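(* Let $(V,l_i)$ and $(W,m_i)$ be Leibniz infinity algebras. There is a 1:1 correspondence between Leibniz infinity algebra morphisms from $(V,l_i)$ to $(W,m_i)$ and morphisms of differential graded Zinbiel coalgebras $\mathrm{Zin}^{\mathrm c}(sV)\to\mathrm{Zin}^{\mathrm c}(sW)$ (resp., in the finite-dimensional case, morphisms of differential graded Zinbiel algebras $\mathrm{Zin}(s^{-1}W^* )\to\mathrm{Zin}(s^{-1}V^* )$), where the quasi-free differential graded Zinbiel coalgebras (resp., algebras) are endowed with the codifferentials (resp., differentials) that encode the structure maps $l_i$ and $m_i$.
   Context: Vector spaces are over a field of characteristic zero; $s$ is the suspension (degree $+1$), $s^{-1}$ the desuspension; the Koszul sign rule is used throughout. $\mathrm{Sh}(k_1,\dots,k_i)$ is the set of permutations $\sigma$ increasing on each of the consecutive blocks of lengths $k_1,\dots,k_i$; $\mathfrak{Sh}(k_1,\dots,k_i)\subset\mathrm{Sh}(k_1,\dots,k_i)$ consists of those with $\sigma(k_1)<\sigma(k_1+k_2)<\dots<\sigma(k_1+\dots+k_i)$. $\varepsilon(\sigma)$ is the Koszul sign and $\mathrm{sign}(\sigma)$ the signature; in exponents, $v$ denotes the degree of a homogeneous element $v$. **Zinbiel (co)algebras.** With $\tau(u\otimes v)=(-1)^{|u||v|}v\otimes u$: a graded Zinbiel algebra is a graded space with degree 0 multiplication $m$ with $m(\mathrm{id}\otimes m)=m(m\otimes\mathrm{id})+m(m\otimes\mathrm{id})(\tau\otimes\mathrm{id})$; a graded Zinbiel coalgebra has a degree 0 comultiplication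 with $(\mathrm{id}\otimes\Delta)\Delta=(\Delta\otimes\mathrm{id})\Delta+(\tau\otimes\mathrm{id})(\Delta\otimes\mathrm{id})\Delta$. Differential graded versions carry a degree $-1$ (homological setting) square-zero derivation $d$, $dm=m(d\otimes\mathrm{id}+\mathrm{id}\otimes d)$ (resp. coderivation $D$, $\Delta D=(D\otimes\mathrm{id}+\mathrm{id}\otimes D)\Delta$); morphisms are degree 0 (co)algebra morphisms commuting with the (co)differentials. On the reduced tensor module $\overline T(U)=\bigoplus_{n\ge1}U^{\otimes n}$, the free graded Zinbiel algebra $\mathrm{Zin}(U)$ has product $$(v_1\dots v_p)\cdot(v_{p+1}\dots v_{p+q})=\sum_{\sigma\in\mathrm{Sh}(p,q-1)}\varepsilon(\sigma^{-1})v_{\sigma^{-1}(1)}\dots v_{\sigma^{-1}(p+q-1)}v_{p+q},$$ and the free graded Zinbiel coalgebra $\mathrm{Zin}^{\mathrm c}(U)$ has coproduct $$\Delta(v_1\dots v_p)=\sum_{k=1}^{p-1}\sum_{\sigma\in\mathrm{Sh}(k,p-k-1)}\varepsilon(\sigma)(v_{\sigma(1)}\dots v_{\sigma(k)})\otimes(v_{\sigma(k+1)}\dots v_{\sigma(p-1)}v_p).$$ A quasi-free differential graded Zinbiel (co)algebra is one whose underlying graded (co)algebra is of this form. **Leibniz infinity algebra.** A graded vector space $V$ with linear maps $l_i:V^{\otimes i}\to V$ of degree $i-2$, $i\ge1$, such that for all $n\ge1$ $$\sum_{i+j=n+1}\sum_{j\le k\le n}\sum_{\sigma\in\mathrm{Sh}(k-j,j-1)}(-1)^{(n-k+1)(j-1)}(-1)^{j(v_{\sigma(1)}+\dots+v_{\sigma(k-j)})}\varepsilon(\sigma)\,\mathrm{sign}(\sigma)\,l_i(v_{\sigma(1)},\dots,v_{\sigma(k-j)},l_j(v_{\sigma(k-j+1)},\dots,v_{\sigma(k-1)},v_k),v_{k+1},\dots,v_n)=0.$$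 Such a structure is encoded by the codifferential $D$ of $\mathrm{Zin}^{\mathrm c}(sV)$ whose corestrictions $D_i:(sV)^{\otimes i}\to sV$ satisfy $l_i=s^{-1}D_is^{\otimes i}$ (in the finite-dimensional case, dually by the differential $d$ of $\mathrm{Zin}(s^{-1}V^* )$ with $D=d^*$). **Leibniz infinity morphism** from $(V,l_i)$ to $(W,m_i)$: linear maps $\varphi_i:V^{\otimes i}\to W$ of degree $i-1$, $i\ge1$, such that for all $n\ge1$ $$\sum_{i=1}^n\sum_{k_1+\dots+k_i=n}\sum_{\sigma\in\mathfrak{Sh}(k_1,\dots,k_i)}(-1)^{\sum_{r=1}^{i-1}(i-r)k_r+\frac{i(i-1)}2}(-1)^{\sum_{r=2}^i(k_r-1)(v_{\sigma(1)}+\dots+v_{\sigma(k_1+\dots+k_{r-1})})}\varepsilon(\sigma)\,\mathrm{sign}(\sigma)$$ $$\cdot\, m_i(\varphi_{k_1}(v_{\sigma(1)},\dots,v_{\sigma(k_1)}),\dots,\varphi_{k_i}(v_{\sigma(k_1+\dots+k_{i-1}+1)},\dots,v_{\sigma(k_1+\dots+k_i)}))$$ $$=\sum_{i+j=n+1}\sum_{j\le k\le n}\sum_{\sigma\in\mathrm{Sh}(k-j,j-1)}(-1)^{k+(n-k+1)j}(-1)^{j(v_{\sigma(1)}+\dots+v_{\sigma(k-j)})}\varepsilon(\sigma)\,\mathrm{sign}(\sigma)$$ $$\cdot\,\varphi_i(v_{\sigma(1)},\dots,v_{\sigma(k-j)},l_j(v_{\sigma(k-j+1)},\dots,v_{\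sigma(k-1)},v_k),v_{k+1},\dots,v_n).$$
   Formalization: In the finite-dimensional case, algebra morphisms correspond to the Leibniz infinity morphisms with finitely many nonzero components, and to all of them if V lies in degrees ≥ 0; unrestricted it fails, e.g. for V, W one-dimensional in degree −1 with zero structure. *)

theory Defs
  imports
    Complex_Main
    "HOL-Library.FuncSet"
    "HOL-Library.Function_Algebras"
    "HOL-Combinatorics.Permutations"
begin

section \<open>Graded vector spaces\<close>

text \<open>A graded vector space is carried by subspaces of an ambient vector space; the space itself is
  the span of its homogeneous components, not the whole ambient type.\<close>

record ('k, 'a) graded_space =
  smult :: "'k \<Rightarrow> 'a \<Rightarrow> 'a"
  hcomp :: "int \<Rightarrow> 'a set"

definition elems :: "('k::field, 'a::ab_group_add) graded_space \<Rightarrow> 'a set" where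
  "elems V = module.span (smult V) (\<Union>n. hcomp V n)"

definition graded_vector_space :: "('k::field, 'a::ab_group_add) graded_space \<Rightarrow> bool" where
  "graded_vector_space V \<longleftrightarrow>
     vector_space (smult V) \<and>
     (\<forall>n. module.subspace (smult V) (hcomp V n)) \<and>
     (\<forall>N x. finite N \<and> (\<forall>n\<in>N. x n \<in> hcomp V n) \<and> (\<Sum>n\<in>N. x n) = 0 \<longrightarrow> (\<forall>n\<in>N. x n = 0))"

definition finite_dimensional :: "('k::field, 'a::ab_group_add) graded_space \<Rightarrow> bool" where
  "finite_dimensional V \<longleftrightarrow> (\<exists>B. finite B \<and> elems V = module.span (smult V) B)"

definition nonneg_graded :: "('k::field, 'a::ab_group_add) graded_space \<Rightarrow> bool" where
  "nonneg_graded V \<longleftrightarrow> (\<forall>n<0. hcomp V n = {0})"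

definition ground :: "('k::field, 'k) graded_space" where
  "ground = \<lparr>smult = (*), hcomp = (\<lambda>n. if n = 0 then UNIV else {0})\<rparr>"

definition linear_map ::
    "('k::field, 'a::ab_group_add) graded_space \<Rightarrow> ('k, 'b::ab_group_add) graded_space \<Rightarrow> ('a \<Rightarrow> 'b) \<Rightarrow> bool" where
  "linear_map A B f \<longleftrightarrow>
     (\<forall>x\<in>elems A. f x \<in> elems B) \<and>
     (\<forall>x\<in>elems A. \<forall>y\<in>elems A. f (x + y) = f x + f y) \<and>
     (\<forall>c. \<forall>x\<in>elems A. f (smult A c x) = smult B c (f x))"

definition graded_map ::
    "('k::field, 'a::ab_group_add) graded_space \<Rightarrow> ('k, 'b::ab_group_add) graded_space \<Rightarrow> int \<Rightarrow> ('a \<Rightarrow> 'b) \<Rightarrow> bool" where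
  "graded_map A B q f \<longleftrightarrow> linear_map A B f \<and> (\<forall>n. \<forall>x\<in>hcomp A n. f x \<in> hcomp B (n + q))"

text \<open>The linear map with prescribed values: \<open>S\<close> is a set of pairs (argument, value) whose
  arguments span \<open>A\<close>.\<close>

definition linear_extension ::
    "('k::field, 'a::ab_group_add) graded_space \<Rightarrow> ('k, 'b::ab_group_add) graded_space \<Rightarrow> ('a \<times> 'b) set \<Rightarrow> 'a \<Rightarrow> 'b" where
  "linear_extension A B S =
     (THE f. f \<in> extensional (elems A) \<and> linear_map A B f \<and> (\<forall>(x, y)\<in>S. f x = y))"

text \<open>The maps \<open>s\<close> and \<open>s\<^sup>-\<^sup>1\<close> are the identity on underlying vectors; only the degree changes.\<close>

definition susp :: "('k, 'a) graded_space \<Rightarrow> ('k, 'a) graded_space" where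
  "susp V = \<lparr>smult = smult V, hcomp = (\<lambda>n. hcomp V (n - 1))\<rparr>"

definition desusp :: "('k, 'a) graded_space \<Rightarrow> ('k, 'a) graded_space" where
  "desusp V = \<lparr>smult = smult V, hcomp = (\<lambda>n. hcomp V (n + 1))\<rparr>"

text \<open>The dual, with $(V^*)_n = (V_{-n})^*$; functionals are normalised to vanish off \<open>elems V\<close>.\<close>

definition dual :: "('k::field, 'a::ab_group_add) graded_space \<Rightarrow> ('k, 'a \<Rightarrow> 'k) graded_space" where
  "dual V = \<lparr>smult = (\<lambda>c f v. c * f v),
     hcomp = (\<lambda>n. {f. linear_map V ground f \<and> (\<forall>v. v \<notin> elems V \<longrightarrow> f v = 0) \<and>
                     (\<forall>p. p \<noteq> - n \<longrightarrow> (\<forall>v\<in>hcomp V p. f v = 0))})\<rparr>"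


section \<open>Tensor products\<close>

text \<open>Over a field, the canonical map from $A \otimes B$ to the space of functionals on the bilinear
  forms on $A \times B$, sending $a \otimes b$ to evaluation at $(a,b)$, is injective.  The tensor
  product is realised as its image.\<close>

definition bilinear_form ::
    "('k::field, 'a::ab_group_add) graded_space \<Rightarrow> ('k, 'b::ab_group_add) graded_space \<Rightarrow> ('a \<Rightarrow> 'b \<Rightarrow> 'k) \<Rightarrow> bool" where
  "bilinear_form A B \<beta> \<longleftrightarrow>
     (\<forall>b\<in>elems B. linear_map A ground (\<lambda>a. \<beta> a b)) \<and>
     (\<forall>a\<in>elems A. linear_map B ground (\<lambda>b. \<beta> a b))"

definition tensor ::
    "('k::field, 'a::ab_group_add) graded_space \<Rightarrow> ('k, 'b::ab_group_add) graded_space \<Rightarrow> 'a \<Rightarrow> 'b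
      \<Rightarrow> ('a \<Rightarrow> 'b \<Rightarrow> 'k) \<Rightarrow> 'k" where
  "tensor A B a b = (\<lambda>\<beta>. if bilinear_form A B \<beta> then \<beta> a b else 0)"

definition tensor_space ::
    "('k::field, 'a::ab_group_add) graded_space \<Rightarrow> ('k, 'b::ab_group_add) graded_space
      \<Rightarrow> ('k, ('a \<Rightarrow> 'b \<Rightarrow> 'k) \<Rightarrow> 'k) graded_space" where
  "tensor_space A B = \<lparr>smult = (\<lambda>c t \<beta>. c * t \<beta>),
     hcomp = (\<lambda>n. module.span (\<lambda>c t \<beta>. c * t \<beta>)
                {tensor A B a b | a b p q. a \<in> hcomp A p \<and> b \<in> hcomp B q \<and> p + q = n})\<rparr>"

text \<open>\<open>tensor_map A B A' B' f q g\<close> is $f \otimes g : A \otimes B \to A' \otimes B'$ for \<open>g\<close> of degree \<open>q\<close>,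
  with the Koszul sign $(f \otimes g)(a \otimes b) = (-1)^{q|a|} f(a) \otimes g(b)$.\<close>

definition tensor_map ::
    "('k::field, 'a::ab_group_add) graded_space \<Rightarrow> ('k, 'b::ab_group_add) graded_space
      \<Rightarrow> ('k, 'c::ab_group_add) graded_space \<Rightarrow> ('k, 'd::ab_group_add) graded_space
      \<Rightarrow> ('a \<Rightarrow> 'c) \<Rightarrow> int \<Rightarrow> ('b \<Rightarrow> 'd)
      \<Rightarrow> (('a \<Rightarrow> 'b \<Rightarrow> 'k) \<Rightarrow> 'k) \<Rightarrow> ('c \<Rightarrow> 'd \<Rightarrow> 'k) \<Rightarrow> 'k" where
  "tensor_map A B A' B' f q g =
     linear_extension (tensor_space A B) (tensor_space A' B')
       {(tensor A B a b, smult (tensor_space A' B') ((-1) powi (q * p)) (tensor A' B' (f a) (g b)))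
         | a b p. a \<in> hcomp A p \<and> b \<in> elems B}"

definition tensor_swap ::
    "('k::field, 'a::ab_group_add) graded_space \<Rightarrow> ('k, 'b::ab_group_add) graded_space
      \<Rightarrow> (('a \<Rightarrow> 'b \<Rightarrow> 'k) \<Rightarrow> 'k) \<Rightarrow> ('b \<Rightarrow> 'a \<Rightarrow> 'k) \<Rightarrow> 'k" where
  "tensor_swap A B =
     linear_extension (tensor_space A B) (tensor_space B A)
       {(tensor A B a b, smult (tensor_space B A) ((-1) powi (p * q)) (tensor B A b a))
         | a b p q. a \<in> hcomp A p \<and> b \<in> hcomp B q}"

definition tensor_assoc ::
    "('k::field, 'a::ab_group_add) graded_space \<Rightarrow> ('k, 'b::ab_group_add) graded_space
      \<Rightarrow> ('k, 'c::ab_group_add) graded_space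
      \<Rightarrow> (((('a \<Rightarrow> 'b \<Rightarrow> 'k) \<Rightarrow> 'k) \<Rightarrow> 'c \<Rightarrow> 'k) \<Rightarrow> 'k)
      \<Rightarrow> ('a \<Rightarrow> (('b \<Rightarrow> 'c \<Rightarrow> 'k) \<Rightarrow> 'k) \<Rightarrow> 'k) \<Rightarrow> 'k" where
  "tensor_assoc A B C =
     linear_extension (tensor_space (tensor_space A B) C) (tensor_space A (tensor_space B C))
       {(tensor (tensor_space A B) C (tensor A B a b) c, tensor A (tensor_space B C) a (tensor B C b c))
         | a b c. a \<in> elems A \<and> b \<in> elems B \<and> c \<in> elems C}"

text \<open>A function on nonempty lists stands for a sequence of maps of \<open>i\<close> arguments, \<open>i \<ge> 1\<close>: its
  restriction to lists of length \<open>i\<close> is the \<open>i\<close>-th map.\<close>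

definition words :: "('k::field, 'a::ab_group_add) graded_space \<Rightarrow> 'a list set" where
  "words V = {vs. vs \<noteq> [] \<and> set vs \<subseteq> elems V}"

definition homogeneous :: "('k::field, 'a::ab_group_add) graded_space \<Rightarrow> int list \<Rightarrow> 'a list \<Rightarrow> bool" where
  "homogeneous V ds vs \<longleftrightarrow> vs \<noteq> [] \<and> list_all2 (\<lambda>d v. v \<in> hcomp V d) ds vs"

definition multilinear ::
    "('k::field, 'a::ab_group_add) graded_space \<Rightarrow> ('k, 'b::ab_group_add) graded_space \<Rightarrow> ('a list \<Rightarrow> 'b) \<Rightarrow> bool" where
  "multilinear V W \<phi> \<longleftrightarrow>
     (\<forall>xs ys. set xs \<subseteq> elems V \<and> set ys \<subseteq> elems V \<longrightarrow> linear_map V W (\<lambda>v. \<phi> (xs @ v # ys)))"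

definition graded_multilinear ::
    "('k::field, 'a::ab_group_add) graded_space \<Rightarrow> ('k, 'b::ab_group_add) graded_space \<Rightarrow> (nat \<Rightarrow> int)
      \<Rightarrow> ('a list \<Rightarrow> 'b) \<Rightarrow> bool" where
  "graded_multilinear V W \<delta> \<phi> \<longleftrightarrow>
     multilinear V W \<phi> \<and>
     (\<forall>ds vs. homogeneous V ds vs \<longrightarrow> \<phi> vs \<in> hcomp W (sum_list ds + \<delta> (length vs)))"

text \<open>The reduced tensor module $\overline T(U)$, realised in the same way: \<open>pure U [v\<^sub>1, \<dots>, v\<^sub>n]\<close> is
  $v_1 \otimes \dots \otimes v_n$.\<close>

definition pure :: "('k::field, 'a::ab_group_add) graded_space \<Rightarrow> 'a list \<Rightarrow> ('a list \<Rightarrow> 'k) \<Rightarrow> 'k" where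
  "pure U vs = (\<lambda>\<beta>. if multilinear U ground \<beta> then \<beta> vs else 0)"

definition tensor_module ::
    "('k::field, 'a::ab_group_add) graded_space \<Rightarrow> ('k, ('a list \<Rightarrow> 'k) \<Rightarrow> 'k) graded_space" where
  "tensor_module U = \<lparr>smult = (\<lambda>c t \<beta>. c * t \<beta>),
     hcomp = (\<lambda>n. module.span (\<lambda>c t \<beta>. c * t \<beta>)
                {pure U vs | vs ds. homogeneous U ds vs \<and> sum_list ds = n})\<rparr>"

definition proj1 :: "('k::field, 'a::ab_group_add) graded_space \<Rightarrow> (('a list \<Rightarrow> 'k) \<Rightarrow> 'k) \<Rightarrow> 'a" where
  "proj1 U = linear_extension (tensor_module U) U
     {(pure U vs, if length vs = 1 then hd vs else 0) | vs. vs \<in> words U}"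

text \<open>The map $\bigoplus_i s^{\otimes i} : \overline T(V) \to \overline T(sV)$; the sign comes from
  moving each \<open>s\<close> past the vectors to the left of its argument.\<close>

definition susp_tensor ::
    "('k::field, 'a::ab_group_add) graded_space \<Rightarrow> (('a list \<Rightarrow> 'k) \<Rightarrow> 'k) \<Rightarrow> ('a list \<Rightarrow> 'k) \<Rightarrow> 'k" where
  "susp_tensor V = linear_extension (tensor_module V) (tensor_module (susp V))
     {(pure V vs, smult (tensor_module (susp V))
         ((-1) powi (\<Sum>r=1..length vs. int (length vs - r) * ds ! (r - 1))) (pure (susp V) vs))
       | vs ds. homogeneous V ds vs}"


section \<open>Shuffles and Koszul signs\<close>

definition psum :: "nat list \<Rightarrow> nat \<Rightarrow> nat" where
  "psum ks r = sum_list (take r ks)"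

definition Sh :: "nat list \<Rightarrow> (nat \<Rightarrow> nat) set" where
  "Sh ks = {\<sigma>. \<sigma> permutes {1..sum_list ks} \<and>
               (\<forall>r<length ks. strict_mono_on {psum ks r + 1..psum ks (r + 1)} \<sigma>)}"

definition half_Sh :: "nat list \<Rightarrow> (nat \<Rightarrow> nat) set" where
  "half_Sh ks = {\<sigma> \<in> Sh ks. strict_mono_on {1..length ks} (\<lambda>r. \<sigma> (psum ks r))}"

text \<open>Permutations act on the positions \<open>1, 2, \<dots>\<close>, list indices start at \<open>0\<close>:
  \<open>slice vs \<sigma> a b\<close> is the word $v_{\sigma(a)} \dots v_{\sigma(b)}$, empty if \<open>b < a\<close>.\<close>

definition slice :: "'a list \<Rightarrow> (nat \<Rightarrow> nat) \<Rightarrow> nat \<Rightarrow> nat \<Rightarrow> 'a list" where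
  "slice vs \<sigma> a b = map (\<lambda>r. vs ! (\<sigma> r - 1)) [a..<Suc b]"

text \<open>$v_1 \dots v_n = \varepsilon(\sigma)\, v_{\sigma(1)} \dots v_{\sigma(n)}$ for vectors of degrees \<open>ds\<close>.\<close>

definition koszul :: "int list \<Rightarrow> (nat \<Rightarrow> nat) \<Rightarrow> 'k::field" where
  "koszul ds \<sigma> = (\<Prod>(a, b)\<in>{(a, b). 1 \<le> a \<and> a < b \<and> b \<le> length ds \<and> \<sigma> b < \<sigma> a}.
                     (-1) powi (ds ! (\<sigma> a - 1) * ds ! (\<sigma> b - 1)))"


section \<open>Differential graded Zinbiel coalgebras and algebras\<close>

definition zinbiel_coalgebra ::
    "('k::field, 'a::ab_group_add) graded_space \<Rightarrow> ('a \<Rightarrow> ('a \<Rightarrow> 'a \<Rightarrow> 'k) \<Rightarrow> 'k) \<Rightarrow> bool" where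
  "zinbiel_coalgebra C \<Delta> \<longleftrightarrow>
     graded_vector_space C \<and> graded_map C (tensor_space C C) 0 \<Delta> \<and>
     (\<forall>x\<in>elems C.
        tensor_map C C C (tensor_space C C) id 0 \<Delta> (\<Delta> x) =
        tensor_assoc C C C (tensor_map C C (tensor_space C C) C \<Delta> 0 id (\<Delta> x)) +
        tensor_assoc C C C
          (tensor_map (tensor_space C C) C (tensor_space C C) C (tensor_swap C C) 0 id
            (tensor_map C C (tensor_space C C) C \<Delta> 0 id (\<Delta> x))))"

definition dg_zinbiel_coalgebra ::
    "('k::field, 'a::ab_group_add) graded_space \<Rightarrow> ('a \<Rightarrow> ('a \<Rightarrow> 'a \<Rightarrow> 'k) \<Rightarrow> 'k) \<Rightarrow> ('a \<Rightarrow> 'a) \<Rightarrow> bool" where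
  "dg_zinbiel_coalgebra C \<Delta> D \<longleftrightarrow>
     zinbiel_coalgebra C \<Delta> \<and> graded_map C C (-1) D \<and> (\<forall>x\<in>elems C. D (D x) = 0) \<and>
     (\<forall>x\<in>elems C. \<Delta> (D x) =
        tensor_map C C C C D 0 id (\<Delta> x) + tensor_map C C C C id (-1) D (\<Delta> x))"

definition dg_coalgebra_morphisms ::
    "('k::field, 'a::ab_group_add) graded_space \<Rightarrow> ('a \<Rightarrow> ('a \<Rightarrow> 'a \<Rightarrow> 'k) \<Rightarrow> 'k) \<Rightarrow> ('a \<Rightarrow> 'a)
      \<Rightarrow> ('k, 'b::ab_group_add) graded_space \<Rightarrow> ('b \<Rightarrow> ('b \<Rightarrow> 'b \<Rightarrow> 'k) \<Rightarrow> 'k) \<Rightarrow> ('b \<Rightarrow> 'b)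
      \<Rightarrow> ('a \<Rightarrow> 'b) set" where
  "dg_coalgebra_morphisms C \<Delta> D C' \<Delta>' D' =
     {F \<in> extensional (elems C). graded_map C C' 0 F \<and>
        (\<forall>x\<in>elems C. \<Delta>' (F x) = tensor_map C C C' C' F 0 F (\<Delta> x)) \<and>
        (\<forall>x\<in>elems C. F (D x) = D' (F x))}"

definition zinbiel_algebra ::
    "('k::field, 'a::ab_group_add) graded_space \<Rightarrow> ((('a \<Rightarrow> 'a \<Rightarrow> 'k) \<Rightarrow> 'k) \<Rightarrow> 'a) \<Rightarrow> bool" where
  "zinbiel_algebra A m \<longleftrightarrow>
     graded_vector_space A \<and> graded_map (tensor_space A A) A 0 m \<and>
     (\<forall>x\<in>elems (tensor_space (tensor_space A A) A).
        m (tensor_map A (tensor_space A A) A A id 0 m (tensor_assoc A A A x)) =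
        m (tensor_map (tensor_space A A) A A A m 0 id x) +
        m (tensor_map (tensor_space A A) A A A m 0 id
            (tensor_map (tensor_space A A) A (tensor_space A A) A (tensor_swap A A) 0 id x)))"

definition dg_zinbiel_algebra ::
    "('k::field, 'a::ab_group_add) graded_space \<Rightarrow> ((('a \<Rightarrow> 'a \<Rightarrow> 'k) \<Rightarrow> 'k) \<Rightarrow> 'a) \<Rightarrow> ('a \<Rightarrow> 'a) \<Rightarrow> bool" where
  "dg_zinbiel_algebra A m d \<longleftrightarrow>
     zinbiel_algebra A m \<and> graded_map A A (-1) d \<and> (\<forall>x\<in>elems A. d (d x) = 0) \<and>
     (\<forall>x\<in>elems (tensor_space A A).
        d (m x) = m (tensor_map A A A A d 0 id x + tensor_map A A A A id (-1) d x))"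

definition dg_algebra_morphisms ::
    "('k::field, 'a::ab_group_add) graded_space \<Rightarrow> ((('a \<Rightarrow> 'a \<Rightarrow> 'k) \<Rightarrow> 'k) \<Rightarrow> 'a) \<Rightarrow> ('a \<Rightarrow> 'a)
      \<Rightarrow> ('k, 'b::ab_group_add) graded_space \<Rightarrow> ((('b \<Rightarrow> 'b \<Rightarrow> 'k) \<Rightarrow> 'k) \<Rightarrow> 'b) \<Rightarrow> ('b \<Rightarrow> 'b)
      \<Rightarrow> ('a \<Rightarrow> 'b) set" where
  "dg_algebra_morphisms A m d A' m' d' =
     {f \<in> extensional (elems A). graded_map A A' 0 f \<and>
        (\<forall>x\<in>elems (tensor_space A A). f (m x) = m' (tensor_map A A A' A' f 0 f x)) \<and>
        (\<forall>x\<in>elems A. f (d x) = d' (f x))}"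


section \<open>Free Zinbiel coalgebras and algebras\<close>

definition zin_coproduct ::
    "('k::field, 'a::ab_group_add) graded_space \<Rightarrow> (('a list \<Rightarrow> 'k) \<Rightarrow> 'k)
      \<Rightarrow> ((('a list \<Rightarrow> 'k) \<Rightarrow> 'k) \<Rightarrow> (('a list \<Rightarrow> 'k) \<Rightarrow> 'k) \<Rightarrow> 'k) \<Rightarrow> 'k" where
  "zin_coproduct U =
     linear_extension (tensor_module U) (tensor_space (tensor_module U) (tensor_module U))
       {(pure U vs,
         let p = length vs in
         \<Sum>k=1..p-1. \<Sum>\<sigma>\<in>Sh [k, p - k - 1].
           smult (tensor_space (tensor_module U) (tensor_module U)) (koszul ds \<sigma>)
             (tensor (tensor_module U) (tensor_module U)
               (pure U (slice vs \<sigma> 1 k)) (pure U (slice vs \<sigma> (k + 1) (p - 1) @ [last vs]))))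
        | vs ds. homogeneous U ds vs}"

definition zin_product ::
    "('k::field, 'a::ab_group_add) graded_space
      \<Rightarrow> (((('a list \<Rightarrow> 'k) \<Rightarrow> 'k) \<Rightarrow> (('a list \<Rightarrow> 'k) \<Rightarrow> 'k) \<Rightarrow> 'k) \<Rightarrow> 'k)
      \<Rightarrow> ('a list \<Rightarrow> 'k) \<Rightarrow> 'k" where
  "zin_product U =
     linear_extension (tensor_space (tensor_module U) (tensor_module U)) (tensor_module U)
       {(tensor (tensor_module U) (tensor_module U) (pure U us) (pure U vs),
         let p = length us; q = length vs in
         \<Sum>\<sigma>\<in>Sh [p, q - 1].
           smult (tensor_module U) (koszul (cs @ ds) (inv \<sigma>))
             (pure U (slice (us @ vs) (inv \<sigma>) 1 (p + q - 1) @ [last vs])))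
        | us cs vs ds. homogeneous U cs us \<and> homogeneous U ds vs}"


section \<open>Leibniz infinity algebras and morphisms\<close>

text \<open>In the double sums below $i = n + 1 - j$ is the length of the outer argument list.\<close>

definition leibniz_inf_algebra ::
    "('k::field, 'v::ab_group_add) graded_space \<Rightarrow> ('v list \<Rightarrow> 'v) \<Rightarrow> bool" where
  "leibniz_inf_algebra V l \<longleftrightarrow>
     graded_vector_space V \<and> graded_multilinear V V (\<lambda>i. int i - 2) l \<and>
     (\<forall>ds vs. homogeneous V ds vs \<longrightarrow>
       (let n = length vs in
        (\<Sum>j=1..n. \<Sum>k=j..n. \<Sum>\<sigma>\<in>Sh [k - j, j - 1].
          smult V
            ((-1) ^ ((n - k + 1) * (j - 1)) *
             (-1) powi (int j * sum_list (slice ds \<sigma> 1 (k - j))) *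
             koszul ds \<sigma> * of_int (sign \<sigma>))
            (l (slice vs \<sigma> 1 (k - j) @ [l (slice vs \<sigma> (k - j + 1) (k - 1) @ [vs ! (k - 1)])] @ drop k vs)))
        = 0))"

definition leibniz_inf_morphisms ::
    "('k::field, 'v::ab_group_add) graded_space \<Rightarrow> ('v list \<Rightarrow> 'v)
      \<Rightarrow> ('k, 'w::ab_group_add) graded_space \<Rightarrow> ('w list \<Rightarrow> 'w) \<Rightarrow> ('v list \<Rightarrow> 'w) set" where
  "leibniz_inf_morphisms V l W m =
     {\<phi> \<in> extensional (words V). graded_multilinear V W (\<lambda>i. int i - 1) \<phi> \<and>
       (\<forall>ds vs. homogeneous V ds vs \<longrightarrow>
         (let n = length vs in
          (\<Sum>ks\<in>{ks. (\<forall>k\<in>set ks. 1 \<le> k) \<and> sum_list ks = n}. \<Sum>\<sigma>\<in>half_Sh ks.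
            let i = length ks in
            smult W
              ((-1) ^ ((\<Sum>r=1..i-1. (i - r) * ks ! (r - 1)) + i * (i - 1) div 2) *
               (-1) powi (\<Sum>r=2..i. (int (ks ! (r - 1)) - 1) * sum_list (slice ds \<sigma> 1 (psum ks (r - 1)))) *
               koszul ds \<sigma> * of_int (sign \<sigma>))
              (m (map (\<lambda>r. \<phi> (slice vs \<sigma> (psum ks (r - 1) + 1) (psum ks r))) [1..<i+1])))
          =
          (\<Sum>j=1..n. \<Sum>k=j..n. \<Sum>\<sigma>\<in>Sh [k - j, j - 1].
            smult W
              ((-1) ^ (k + (n - k + 1) * j) *
               (-1) powi (int j * sum_list (slice ds \<sigma> 1 (k - j))) *
               koszul ds \<sigma> * of_int (sign \<sigma>))
              (\<phi> (slice vs \<sigma> 1 (k - j) @ [l (slice vs \<sigma> (k - j + 1) (k - 1) @ [vs ! (k - 1)])] @ drop k vs)))))}"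

text \<open>$\overline T(s^{-1}V^*)$ is a direct sum, so transposing an algebra morphism can only produce finitely
  many components.  This is no restriction if \<open>V\<close> is nonnegatively graded and \<open>W\<close> is
  finite-dimensional, by the degrees, but it is one for general degrees.\<close>

definition finitely_many_components ::
    "('k::field, 'v::ab_group_add) graded_space \<Rightarrow> ('v list \<Rightarrow> 'w::zero) \<Rightarrow> bool" where
  "finitely_many_components V \<phi> \<longleftrightarrow> (\<exists>N. \<forall>vs\<in>words V. N < length vs \<longrightarrow> \<phi> vs = 0)"


section \<open>Encoding by quasi-free Zinbiel coalgebras and algebras\<close>

text \<open>The sequence $s^{-1} F_i s^{\otimes i}$, $i \ge 1$, for the corestrictions
  $F_i : (sV)^{\otimes i} \to sW$ of \<open>F\<close>.\<close>

definition desusp_corestrictions ::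
    "('k::field, 'v::ab_group_add) graded_space \<Rightarrow> ('k, 'w::ab_group_add) graded_space
      \<Rightarrow> ((('v list \<Rightarrow> 'k) \<Rightarrow> 'k) \<Rightarrow> ('w list \<Rightarrow> 'k) \<Rightarrow> 'k) \<Rightarrow> 'v list \<Rightarrow> 'w" where
  "desusp_corestrictions V W F = (\<lambda>vs\<in>words V. proj1 (susp W) (F (susp_tensor V (pure V vs))))"

definition encoding_codifferential ::
    "('k::field, 'v::ab_group_add) graded_space \<Rightarrow> ('v list \<Rightarrow> 'v)
      \<Rightarrow> ((('v list \<Rightarrow> 'k) \<Rightarrow> 'k) \<Rightarrow> ('v list \<Rightarrow> 'k) \<Rightarrow> 'k) \<Rightarrow> bool" where
  "encoding_codifferential V l D \<longleftrightarrow>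
     dg_zinbiel_coalgebra (tensor_module (susp V)) (zin_coproduct (susp V)) D \<and>
     (\<forall>vs\<in>words V. l vs = desusp_corestrictions V V D vs)"

text \<open>The unsigned pairing of $\overline T(U^*)$ with $\overline T(U)$,
  $\langle f_1 \dots f_p, v_1 \dots v_q \rangle = \delta_{pq} \prod_i f_i(v_i)$.  It is well defined
  without further linear extension because elements of both tensor modules are functionals on
  multilinear forms.  The underlying vectors of $s^{-1}V^*$ are functionals on those of $sV$.\<close>

definition pairing ::
    "((('v \<Rightarrow> 'k) list \<Rightarrow> 'k) \<Rightarrow> 'k) \<Rightarrow> (('v list \<Rightarrow> 'k) \<Rightarrow> 'k) \<Rightarrow> 'k::field" where
  "pairing \<omega> x = \<omega> (\<lambda>fs. x (\<lambda>vs. if length fs = length vs then \<Prod>i<length vs. (fs ! i) (vs ! i) else 0))"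

definition encoding_differential ::
    "('k::field, 'v::ab_group_add) graded_space \<Rightarrow> ('v list \<Rightarrow> 'v)
      \<Rightarrow> (((('v \<Rightarrow> 'k) list \<Rightarrow> 'k) \<Rightarrow> 'k) \<Rightarrow> (('v \<Rightarrow> 'k) list \<Rightarrow> 'k) \<Rightarrow> 'k) \<Rightarrow> bool" where
  "encoding_differential V l d \<longleftrightarrow>
     dg_zinbiel_algebra (tensor_module (desusp (dual V))) (zin_product (desusp (dual V))) d \<and>
     (\<exists>D. encoding_codifferential V l D \<and>
        (\<forall>\<omega>\<in>elems (tensor_module (desusp (dual V))). \<forall>x\<in>elems (tensor_module (susp V)).
           pairing \<omega> (D x) = pairing (d \<omega>) x))"

definition transpose_map ::
    "('k::field, 'v::ab_group_add) graded_space \<Rightarrow> ('k, 'w::ab_group_add) graded_space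
      \<Rightarrow> (((('w \<Rightarrow> 'k) list \<Rightarrow> 'k) \<Rightarrow> 'k) \<Rightarrow> (('v \<Rightarrow> 'k) list \<Rightarrow> 'k) \<Rightarrow> 'k)
      \<Rightarrow> (('v list \<Rightarrow> 'k) \<Rightarrow> 'k) \<Rightarrow> ('w list \<Rightarrow> 'k) \<Rightarrow> 'k" where
  "transpose_map V W f = (\<lambda>x\<in>elems (tensor_module (susp V)).
     THE y. y \<in> elems (tensor_module (susp W)) \<and>
       (\<forall>\<omega>\<in>elems (tensor_module (desusp (dual W))). pairing \<omega> y = pairing (f \<omega>) x))"

end

theory Submission
 imports Defs "HOL-Library.Infinite_Set"
begin

text \<open>
 \<^bold>\<open>Cofreeness.\<close> Write $T = \overline T(U)$, let $\Delta$ be its coproduct and $\pi : T \to U$ the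
 projection onto words of length one.  The last letter of a word never moves in $\Delta$, so
 $(\mathrm{id}\otimes\pi)\Delta$ merely splits off the last letter.  Hence every \<open>x\<close> in \<open>T\<close> can be
 rebuilt from $\pi x$ and $(\mathrm{id}\otimes\pi)\Delta x$ (\<open>reconstruct\<close>), and both tensor factors of
 $\Delta x$ have shorter words.  For a coalgebra morphism \<open>F\<close> this gives the recursion
 $F x = \pi F x + \sum F(x')\,\pi F(x'')$, so \<open>F\<close> is determined by the corestriction $\pi F$
 (\<open>coalgebra_map_unique\<close>).  Conversely the recursion defines an \<open>F\<close> for every degree 0 map
 $f : T \to U'$, and the Zinbiel relation says exactly that this \<open>F\<close> respects coproducts
 (\<open>coalgebra_map_lift\<close>).  The same recursion shows that $FD = EF$ holds as soon as
 $\pi F D = \pi E F$ (\<open>coderivation_commute\<close>).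

 \<^bold>\<open>The equation.\<close> Unrolling the recursions on a word expresses \<open>F\<close> as a sum over half-shuffles, one
 block for each application of $\pi F$, and \<open>D\<close> as a sum over insertions of $\pi D$
 (\<open>coalgebra_map_words\<close>, \<open>coderivation_words\<close>).  So $\pi E F = \pi F D$ on words has the two sides of
 the defining equation of a Leibniz infinity morphism, and only the signs have to be compared.
 Those of $s^{\otimes i}$ change the Koszul sign by the signature of the permutation (\<open>koszul_susp\<close>);
 what remains is parity arithmetic, for one insertion (\<open>insertion_sign\<close>) and for the blocks of a
 half-shuffle (\<open>block_sign\<close>).  Both sides then are the two composites up to one common sign
 (\<open>insertion_sum\<close>, \<open>block_sum\<close>), which gives the coalgebra statement (\<open>coalgebra_correspondence\<close>).

 \<^bold>\<open>Duality.\<close> In finite dimensions words in a homogeneous basis and in its dual basis are dual bases of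
 $\overline T(sV)$ and $\overline T(s^{-1}V^*)$, and the product of the one is adjoint to the coproduct
 of the other (\<open>product_coproduct\<close>).  So if \<open>f\<close> and \<open>F\<close> are adjoint, \<open>f\<close> is a morphism of algebras iff
 \<open>F\<close> is one of coalgebras.  Existence of an adjoint is a finiteness condition, since elements are
 finite sums of words.  For \<open>f\<close> it always holds because \<open>f\<close> cannot shorten words
 (\<open>algebra_map_short\<close>); for \<open>F\<close> it holds iff $\pi F$ kills long words (\<open>coalgebra_map_short\<close>).

 Elements of a tensor product are functionals on bilinear forms, which gives a Sweedler calculus:
 for $t = \sum t'\otimes t''$ the scalar $\sum\beta(t', t'')$ is the application \<open>t (\<lambda>a b. \<beta> a b)\<close>.
\<close>

section \<open>Graded vector spaces and tensor products\<close>

abbreviation fscale :: "'k::field => ('j => 'k) => 'j => 'k" where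
 "fscale \<equiv> (\<lambda>c t b. c * t b)"

abbreviation vecsp :: "('k::field, 'a::ab_group_add) graded_space => bool" where
 "vecsp A \<equiv> vector_space (smult A)"

lemma vector_space_fscale [simp]: "vector_space fscale"
 by unfold_locales (auto simp: fun_eq_iff algebra_simps)

lemma smult_simps [simp]:
 "smult (tensor_space A B) = fscale" "smult (tensor_module U) = fscale"
 "smult (susp V) = smult V" "smult (desusp V) = smult V" "smult ground = (*)"
 "smult (dual V) = fscale"
 by (auto simp: tensor_space_def tensor_module_def susp_def desusp_def ground_def dual_def)

lemma hcomp_simps [simp]:
 "hcomp (susp V) n = hcomp V (n - 1)" "hcomp (desusp V) n = hcomp V (n + 1)"
 by (auto simp: susp_def desusp_def)

lemma elems_susp [simp]: "elems (susp V) = elems V"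
proof -
 have "x \<in> (\<Union>n. hcomp V (n - 1))" if "x \<in> hcomp V n" for x n
  using that by (intro UN_I[of "n + 1"]) auto
 then have "(\<Union>n. hcomp V (n - 1)) = (\<Union>n. hcomp V n)" by blast
 then show ?thesis by (simp add: elems_def)
qed

lemma elems_desusp [simp]: "elems (desusp V) = elems V"
proof -
 have "x \<in> (\<Union>n. hcomp V (n + 1))" if "x \<in> hcomp V n" for x n
  using that by (intro UN_I[of "n - 1"]) auto
 then have "(\<Union>n. hcomp V (n + 1)) = (\<Union>n. hcomp V n)" by blast
 then show ?thesis by (simp add: elems_def)
qed

lemma vs_simps [simp]:
 "vecsp (tensor_space A B)" "vecsp (tensor_module U)"
 "vecsp (ground :: ('k::field, 'k) graded_space)"
 "vecsp (dual V)"
 by (simp_all only: smult_simps vector_space_fscale)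
  (unfold_locales; simp add: algebra_simps)

lemma vector_space_mult [simp]: "vector_space ((*) :: 'k::field => 'k => 'k)"
 by unfold_locales (simp_all add: algebra_simps)

lemma graded_vs: "graded_vector_space A ==> vecsp A"
 by (simp add: graded_vector_space_def)

lemma elems_ground [simp]: "elems (ground :: ('k::field, 'k) graded_space) = UNIV"
proof -
 interpret vector_space "(*) :: 'k => 'k => 'k" using vs_simps(3) by (simp only: smult_simps)
 have "(\<Union>n. hcomp (ground :: ('k, 'k) graded_space) n) = UNIV"
  by (auto simp: ground_def)
 then show ?thesis by (simp add: elems_def)
qed

lemma elems_0 [simp]: "vecsp A ==> 0 \<in> elems A"
proof -
 assume "vecsp A" then interpret vector_space "smult A" .
 show ?thesis by (simp add: elems_def span_zero)
qed

lemma elems_zero_fun [simp]: "vecsp A ==> (\<lambda>_. 0) \<in> elems A"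
 using elems_0[of A] by (simp add: zero_fun_def)

lemma elems_add: "vecsp A ==> x \<in> elems A ==> y \<in> elems A ==> x + y \<in> elems A"
proof -
 assume "vecsp A" "x \<in> elems A" "y \<in> elems A" then interpret vector_space "smult A" by simp
 show ?thesis using \<open>x \<in> elems A\<close> \<open>y \<in> elems A\<close> by (simp add: elems_def span_add)
qed

lemma elems_smult: "vecsp A ==> x \<in> elems A ==> smult A c x \<in> elems A"
proof -
 assume "vecsp A" "x \<in> elems A" then interpret vector_space "smult A" by simp
 show ?thesis using \<open>x \<in> elems A\<close> by (simp add: elems_def span_scale)
qed

lemma elems_sum: "vecsp A ==> (\<And>i. i \<in> I ==> f i \<in> elems A) ==> sum f I \<in> elems A"
 by (induct I rule: infinite_finite_induct) (auto intro: elems_add)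

lemma hcomp_elems: "vecsp A ==> x \<in> hcomp A n ==> x \<in> elems A"
proof -
 assume "vecsp A" "x \<in> hcomp A n" then interpret vector_space "smult A" by simp
 show ?thesis using \<open>x \<in> hcomp A n\<close> by (auto simp: elems_def intro: span_base)
qed

lemma elems_induct [consumes 2, case_names zero step]:
 assumes "vecsp A" "x \<in> elems A" "P 0"
  and "\<And>c n h y. h \<in> hcomp A n ==> y \<in> elems A ==> P y ==> P (smult A c h + y)"
 shows "P x"
proof -
 interpret vector_space "smult A" by fact
 have "x \<in> elems A \<and> P x"
  using assms(2) unfolding elems_def
 proof (induct rule: span_induct_alt)
  case base then show ?case using assms(3) by (simp add: span_zero)
 next
  case (step c h y)
  then obtain n where n: "h \<in> hcomp A n" by auto
  moreover have "h \<in> span (\<Union> (range (hcomp A)))" using n by (auto intro: span_base)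
  moreover have y: "y \<in> elems A" "P y" using step by (auto simp: elems_def)
  ultimately show ?case using assms(4)[OF n y] span_add span_scale by (auto simp: elems_def)
 qed
 then show ?thesis by simp
qed

subsection \<open>Linear maps\<close>

lemma lm_in: "linear_map A B f ==> x \<in> elems A ==> f x \<in> elems B"
 by (simp add: linear_map_def)

lemma lm_add: "linear_map A B f ==> x \<in> elems A ==> y \<in> elems A ==> f (x + y) = f x + f y"
 by (simp add: linear_map_def)

lemma lm_smult: "linear_map A B f ==> x \<in> elems A ==> f (smult A c x) = smult B c (f x)"
 by (simp add: linear_map_def)

lemma lm_0: "vecsp A ==> linear_map A B f ==> f 0 = 0"
 using lm_add[of A B f 0 0] by simp

lemma lm_zero_fun: "vecsp A ==> linear_map A B f ==> f (\<lambda>_. 0) = 0"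
 using lm_0[of A B f] by (simp add: zero_fun_def)

lemma lm_sum:
 assumes "vecsp A" "linear_map A B f" "\<And>i. i \<in> I ==> g i \<in> elems A"
 shows "f (sum g I) = (\<Sum>i\<in>I. f (g i))"
 using assms(3)
proof (induct I rule: infinite_finite_induct)
 case (insert i I)
 then show ?case using lm_add[OF assms(2), of "g i" "sum g I"] elems_sum[OF assms(1), of I g] by simp
qed (use lm_0[OF assms(1,2)] in auto)

lemma lm_comp: "linear_map A B f ==> linear_map B C g ==> linear_map A C (\<lambda>x. g (f x))"
 by (simp add: linear_map_def)

lemma lm_id: "linear_map A A (\<lambda>x. x)" "linear_map A A id"
 by (simp_all add: linear_map_def)

lemma lm_cong: "vecsp A ==> (\<And>x. x \<in> elems A ==> f x = g x) ==> linear_map A B f \<longleftrightarrow> linear_map A B g"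
 by (simp add: linear_map_def elems_add elems_smult)

lemma lm_eq:
 assumes "vecsp A" "linear_map A B f" "linear_map A B g"
  and "\<And>n x. x \<in> hcomp A n ==> f x = g x" and "x \<in> elems A"
 shows "f x = g x"
 using assms(1,5)
proof (induct rule: elems_induct)
 case zero then show ?case using lm_0 assms by metis
next
 case (step c n h y)
 then show ?case using assms hcomp_elems[OF assms(1)] elems_smult[OF assms(1)]
  by (simp add: lm_add lm_smult)
qed

lemma lm_eq_span:
 assumes "vecsp A" "linear_map A B f" "linear_map A B g" "S \<subseteq> elems A" "elems A \<subseteq> module.span (smult A) S"
  and "\<And>x. x \<in> S ==> f x = g x" and "x \<in> elems A"
 shows "f x = g x"
proof -
 interpret vector_space "smult A" by fact
 have "x \<in> span S" using assms by auto
 then have "x \<in> elems A \<and> f x = g x"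
 proof (induct rule: span_induct_alt)
  case base then show ?case using lm_0 assms(1-3) by (metis elems_0)
 next
  case (step c x y)
  then have "x \<in> elems A" using assms by auto
  then show ?case using step assms elems_smult[OF assms(1)]
   by (auto simp: lm_add lm_smult intro!: elems_add elems_smult)
 qed
 then show ?thesis by simp
qed

lemma lm_lincomb:
 assumes "vecsp A" "vecsp B" "linear_map A B f" "linear_map A B g"
 shows lm_plus: "linear_map A B (\<lambda>x. f x + g x)"
  and lm_scaled: "linear_map A B (\<lambda>x. smult B c (f x))"
  and lm_zero: "linear_map A B (\<lambda>x. 0)"
proof -
 interpret B: vector_space "smult B" by fact
 show "linear_map A B (\<lambda>x. f x + g x)" "linear_map A B (\<lambda>x. smult B c (f x))" "linear_map A B (\<lambda>x. 0)"
  using assms unfolding linear_map_def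
  by (auto simp: elems_add elems_smult B.scale_right_distrib ac_simps)
qed

lemma lm_zeroI: "vecsp A ==> vecsp B ==> linear_map A B (\<lambda>x. 0)"
proof -
 assume "vecsp A" "vecsp B"
 then interpret B: vector_space "smult B" by simp
 show ?thesis using \<open>vecsp B\<close> by (auto simp: linear_map_def)
qed

lemma lm_sumI:
 assumes "vecsp A" "vecsp B" "\<And>i. i \<in> I ==> linear_map A B (f i)"
 shows "linear_map A B (\<lambda>x. \<Sum>i\<in>I. f i x)"
 using assms(3)
 by (induct I rule: infinite_finite_induct) (auto simp: lm_zeroI[OF assms(1,2)] intro: lm_plus[OF assms(1,2)])

text \<open>\<open>linear_extension\<close> is a definite description: a linear map with the prescribed values exists by
 exhibition, and is the only one because the arguments span.\<close>

lemma linear_extension_eq: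
 assumes "vecsp A" "linear_map A B g" "\<And>x y. (x, y) \<in> S ==> x \<in> elems A \<and> g x = y"
  and "elems A \<subseteq> module.span (smult A) (fst ` S)"
 shows "linear_extension A B S = restrict g (elems A)"
 unfolding linear_extension_def
proof (rule the_equality)
 show "restrict g (elems A) \<in> extensional (elems A) \<and> linear_map A B (restrict g (elems A)) \<and>
  (\<forall>(x, y)\<in>S. restrict g (elems A) x = y)"
  using assms(3) lm_cong[OF assms(1), of g "restrict g (elems A)" B] assms(2) by auto
next
 fix f assume f: "f \<in> extensional (elems A) \<and> linear_map A B f \<and> (\<forall>(x, y)\<in>S. f x = y)"
 have "f x = g x" if "x \<in> elems A" for x
  using assms(1) _ assms(2) _ assms(4) _ that
  by (rule lm_eq_span) (use f assms(3) in force)+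
 then show "f = restrict g (elems A)" using f by (auto intro!: extensionalityI[of _ "elems A"])
qed

text \<open>Elements of the tensor module are evaluated on scalar-valued forms only; functionals on the target
 reduce vector-valued multilinear maps to these.\<close>

lemma separating_functional:
 fixes s :: "'k::field => 'a::ab_group_add => 'a"
 assumes "vector_space s" "x \<noteq> 0"
 obtains f :: "'a => 'k" where "Vector_Spaces.linear s (*) f" "f x \<noteq> 0"
proof -
 interpret vector_space_pair s "(*) :: 'k => 'k => 'k"
  using assms(1) vs_simps(3) by (simp add: vector_space_pair_def)
 have "vs1.independent {x}" using assms(2) by simp
 from linear_independent_extend[OF this, of "\<lambda>_. 1"] obtain g
  where "Vector_Spaces.linear s (*) g" "g x = 1" by auto
 then show ?thesis using that by (metis zero_neq_one)
qed

lemma linear_imp_lm: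
 "Vector_Spaces.linear (smult A) (smult B) f ==> (\<And>x. x \<in> elems A ==> f x \<in> elems B) ==> linear_map A B f"
 by (simp add: linear_map_def Vector_Spaces.linear_iff)

subsection \<open>Homogeneous bases and parity projections\<close>

text \<open>The last property uses that the sum of the components is direct: the expansion of a homogeneous
 vector has no basis vectors of another degree.\<close>

lemma homogeneous_basis:
 fixes A :: "('k::field, 'a::ab_group_add) graded_space"
 assumes "graded_vector_space A"
 obtains B deg where "\<not> module.dependent (smult A) B" "module.span (smult A) B = elems A"
  "\<And>b. b \<in> B ==> b \<in> hcomp A (deg b)"
  "\<And>p x. x \<in> hcomp A p ==> x \<in> module.span (smult A) {b \<in> B. deg b = p}"
proof -
 have vsA: "vecsp A" using assms by (rule graded_vs)
 interpret vector_space "smult A" by fact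
 obtain B where B: "B \<subseteq> (\<Union>n. hcomp A n)" "independent B" "(\<Union>n. hcomp A n) \<subseteq> span B"
  by (rule basis_exists[of "\<Union>n. hcomp A n"]) (rule that)
 have spB: "span B = elems A" unfolding elems_def
  using span_mono[OF B(1)] span_minimal[OF B(3) subspace_span] by (rule subset_antisym)
 obtain deg where deg: "\<And>b. b \<in> B ==> b \<in> hcomp A (deg b)" using B(1)
  by (metis UN_E subsetD)
 have sub: "subspace (hcomp A n)" for n using assms by (simp add: graded_vector_space_def)
 have direct: "\<forall>n\<in>N. y n = 0" if "finite N" "\<forall>n\<in>N. y n \<in> hcomp A n" "(\<Sum>n\<in>N. y n) = 0" for N y
  using assms that unfolding graded_vector_space_def by blast
 have "x \<in> span {b \<in> B. deg b = p}" if x: "x \<in> hcomp A p" for x p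
 proof -
  have "x \<in> span B" using x B by auto
  then obtain t r where t: "finite t" "t \<subseteq> B" "x = (\<Sum>b\<in>t. smult A (r b) b)"
   by (auto simp: span_explicit)
  define N where "N = insert p (deg ` t)"
  define y where "y n = (\<Sum>b | b \<in> t \<and> deg b = n. smult A (r b) b) - (if n = p then x else 0)" for n
  have N: "finite N" using t by (simp add: N_def)
  have yh: "\<forall>n\<in>N. y n \<in> hcomp A n"
   unfolding y_def using t x deg
   by (auto intro!: subspace_diff[OF sub] subspace_sum[OF sub] subspace_scale[OF sub] subspace_0[OF sub])
  have "(\<Sum>n\<in>N. \<Sum>b | b \<in> t \<and> deg b = n. smult A (r b) b) = x"
   unfolding t(3) using sum.group[OF t(1) N, of deg "\<lambda>b. smult A (r b) b"]
   by (auto simp: N_def)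
  then have "(\<Sum>n\<in>N. y n) = 0" unfolding y_def sum_subtractf using N by (simp add: N_def)
  from direct[OF N yh this] have "y p = 0" by (simp add: N_def)
  then have "x = (\<Sum>b | b \<in> t \<and> deg b = p. smult A (r b) b)" by (simp add: y_def)
  also have "\<dots> \<in> span {b \<in> B. deg b = p}"
   using t by (intro span_sum span_scale span_base) auto
  finally show ?thesis .
 qed
 then show ?thesis using that B spB deg by blast
qed

text \<open>Signs depend on degrees through their parity only.  Projecting onto the even and the odd part
 turns a sign prescribed on homogeneous vectors into an honest linear map.\<close>

definition parity_proj :: "('k::field, 'a::ab_group_add) graded_space => int => 'a => 'a" where
 "parity_proj A = (SOME P. \<forall>i. linear_map A A (P i) \<and>
  (\<forall>p. \<forall>x\<in>hcomp A p. P i x = (if p mod 2 = i then x else 0)))"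

lemma parity_proj:
 assumes "graded_vector_space A"
 shows lm_parity_proj: "linear_map A A (parity_proj A i)"
  and parity_proj_hcomp: "x \<in> hcomp A p ==> parity_proj A i x = (if p mod 2 = i then x else 0)"
proof -
 have vsA: "vecsp A" using assms by (rule graded_vs)
 interpret vector_space_pair "smult A" "smult A" using vsA by (simp add: vector_space_pair_def)
 from assms obtain B deg where B: "vs1.independent B" "vs1.span B = elems A"
  "\<And>b. b \<in> B ==> b \<in> hcomp A (deg b)"
  "\<And>p x. x \<in> hcomp A p ==> x \<in> vs1.span {b \<in> B. deg b = p}"
  by (rule homogeneous_basis) (blast intro: that)
 have "\<exists>g. linear_map A A g \<and> (\<forall>p. \<forall>x\<in>hcomp A p. g x = (if p mod 2 = i then x else 0))" for i
 proof -
  obtain g where g: "Vector_Spaces.linear (smult A) (smult A) g"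
   "\<forall>b\<in>B. g b = (if deg b mod 2 = i then b else 0)"
   using linear_independent_extend[OF B(1), of "\<lambda>b. if deg b mod 2 = i then b else 0"] by blast
  have in_B: "b \<in> elems A" if "b \<in> B" for b using that B(2) vs1.span_base by blast
  have "g x = (if p mod 2 = i then x else 0)" if "x \<in> hcomp A p" for x p
   using B(4)[OF that]
  proof (induct rule: vs1.span_induct_alt)
   case base then show ?case using g(1) linear_0 by auto
  next
   case (step c x y)
   then have "g (smult A c x + y) = smult A c (g x) + g y" "g x = (if deg x mod 2 = i then x else 0)"
    using g by (auto simp: Vector_Spaces.linear_iff)
   then show ?case using step by auto
  qed
  moreover have "linear_map A A g"
  proof (rule linear_imp_lm[OF g(1)])
   fix x assume "x \<in> elems A"
   then have "x \<in> vs1.span B" by (simp add: B)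
   then show "g x \<in> elems A"
   proof (induct rule: vs1.span_induct_alt)
    case base then show ?case by (simp add: linear_0[OF g(1)] elems_0[OF vsA])
   next
    case (step c x y)
    then have "g (smult A c x + y) = smult A c (g x) + g y" using g by (auto simp: Vector_Spaces.linear_iff)
    moreover have "g x \<in> elems A" using g(2) step(1) in_B vsA by auto
    ultimately show ?case using step vsA by (simp add: elems_add elems_smult)
   qed
  qed
  ultimately show ?thesis by blast
 qed
 then have "\<exists>P. \<forall>i. linear_map A A (P i) \<and>
  (\<forall>p. \<forall>x\<in>hcomp A p. P i x = (if p mod 2 = i then x else 0))" by (intro choice allI)
 from someI_ex[OF this, folded parity_proj_def]
 show "linear_map A A (parity_proj A i)"
  and "x \<in> hcomp A p ==> parity_proj A i x = (if p mod 2 = i then x else 0)"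
  by simp_all
qed

text \<open>The involution $x \mapsto (-1)^{|x|}x$, extended linearly; it carries the Koszul sign of an odd map
 that passes \<open>x\<close>.\<close>

definition par :: "('k::field, 'a::ab_group_add) graded_space => 'a => 'a" where
 "par A x = parity_proj A 0 x + smult A (- 1) (parity_proj A 1 x)"

lemma lm_par: "graded_vector_space A ==> linear_map A A (par A)"
 unfolding par_def[abs_def] 
 by (auto intro!: lm_plus lm_scaled[where g="\<lambda>x. x"] lm_parity_proj lm_id dest: graded_vs)

lemma powi_minus_one_parity: "(-1 :: 'k::field) powi p = (if p mod 2 = 0 then 1 else -1)"
 by (simp add: power_int_minus_left even_iff_mod_2_eq_zero)

lemma par_hcomp:
 assumes "graded_vector_space A" "x \<in> hcomp A p"
 shows "par A x = smult A ((-1) powi p) x"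
proof -
 interpret vector_space "smult A" using assms(1) by (rule graded_vs)
 have "p mod 2 = 0 \<or> p mod 2 = 1" by presburger
 then show ?thesis
  using parity_proj_hcomp[OF assms] by (elim disjE) (simp_all add: par_def powi_minus_one_parity)
qed

abbreviation lform :: "('k::field, 'a::ab_group_add) graded_space => ('a => 'k) => bool" where
 "lform A \<equiv> linear_map A ground"

lemma sum_fun_apply: "(\<Sum>i\<in>I. f i) x = (\<Sum>i\<in>I. f i x)"
 by (induct I rule: infinite_finite_induct) auto

lemma vecsp_hcomp:
 assumes "graded_vector_space A"
 shows hcomp_0: "0 \<in> hcomp A n"
  and hcomp_add: "x \<in> hcomp A n ==> y \<in> hcomp A n ==> x + y \<in> hcomp A n"
  and hcomp_smult: "x \<in> hcomp A n ==> smult A c x \<in> hcomp A n"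
  and hcomp_sum: "(\<And>i. i \<in> I ==> f i \<in> hcomp A n) ==> sum f I \<in> hcomp A n"
proof -
 interpret vector_space "smult A" using assms by (rule graded_vs)
 have sub: "subspace (hcomp A n)" using assms by (simp add: graded_vector_space_def)
 show "0 \<in> hcomp A n" "x \<in> hcomp A n ==> y \<in> hcomp A n ==> x + y \<in> hcomp A n"
  "x \<in> hcomp A n ==> smult A c x \<in> hcomp A n"
  "(\<And>i. i \<in> I ==> f i \<in> hcomp A n) ==> sum f I \<in> hcomp A n"
  using subspace_0[OF sub] subspace_add[OF sub] subspace_scale[OF sub] subspace_sum[OF sub, of I f] by simp_all
qed

subsection \<open>Bilinear forms and tensors\<close>

definition bilinear_map where
 "bilinear_map A B C g \<longleftrightarrow> (\<forall>b\<in>elems B. linear_map A C (\<lambda>a. g a b)) \<and> (\<forall>a\<in>elems A. linear_map B C (g a))"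

lemma bmI:
 "(\<And>b. b \<in> elems B ==> linear_map A C (\<lambda>a. g a b)) ==> (\<And>a. a \<in> elems A ==> linear_map B C (\<lambda>b. g a b))
 ==> bilinear_map A B C g"
 by (simp add: bilinear_map_def)

lemma bfI:
 "(\<And>b. b \<in> elems B ==> lform A (\<lambda>a. \<beta> a b)) ==> (\<And>a. a \<in> elems A ==> lform B (\<lambda>b. \<beta> a b))
 ==> bilinear_form A B \<beta>"
 by (simp add: bilinear_form_def)

lemma bf_left: "bilinear_form A B \<beta> ==> b \<in> elems B ==> lform A (\<lambda>a. \<beta> a b)"
 and bf_right: "bilinear_form A B \<beta> ==> a \<in> elems A ==> lform B (\<beta> a)"
 by (simp_all add: bilinear_form_def)

lemma bm_left: "bilinear_map A B C \<beta> ==> b \<in> elems B ==> linear_map A C (\<lambda>a. \<beta> a b)"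
 and bm_right: "bilinear_map A B C \<beta> ==> a \<in> elems A ==> linear_map B C (\<beta> a)"
 by (simp_all add: bilinear_map_def)

lemma bf_cong:
 assumes "vecsp A" "vecsp B" "\<And>a b. a \<in> elems A ==> b \<in> elems B ==> \<beta> a b = \<gamma> a b"
 shows "bilinear_form A B \<beta> \<longleftrightarrow> bilinear_form A B \<gamma>"
proof -
 have "lform A (\<lambda>a. \<beta> a b) = lform A (\<lambda>a. \<gamma> a b)" if "b \<in> elems B" for b
  using that by (intro lm_cong[OF assms(1)] assms(3))
 moreover have "lform B (\<beta> a) = lform B (\<gamma> a)" if "a \<in> elems A" for a
  using that by (intro lm_cong[OF assms(2)] assms(3))
 ultimately show ?thesis by (simp add: bilinear_form_def)
qed

lemma bf_comp: "bilinear_form A' B' \<beta> ==> linear_map A A' f ==> linear_map B B' g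
  ==> bilinear_form A B (\<lambda>a b. \<beta> (f a) (g b))"
 by (intro bfI lm_comp[of A A' f ground "\<lambda>a. \<beta> a _"] lm_comp[of B B' g ground "\<beta> _"])
  (auto intro: bf_left bf_right lm_in)

lemma bm_form: "bilinear_map A B C g ==> lform C L ==> bilinear_form A B (\<lambda>a b. L (g a b))"
 by (rule bfI) (auto intro: lm_comp[of _ C _ ground L] bm_left bm_right)

lemma elems_tensor:
 fixes A :: "('k::field, 'a::ab_group_add) graded_space" and B :: "('k, 'b::ab_group_add) graded_space"
 assumes "vecsp A" "vecsp B"
 shows "elems (tensor_space A B) =
  module.span fscale {tensor A B a b | a b p q. a \<in> hcomp A p \<and> b \<in> hcomp B q}"
proof -
 interpret vector_space "fscale :: _ => (('a => 'b => 'k) => 'k) => _" by (rule vector_space_fscale)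
 let ?S = "\<lambda>n. {tensor A B a b | a b p q. a \<in> hcomp A p \<and> b \<in> hcomp B q \<and> p + q = n}"
 have U: "(\<Union>n. ?S n) = {tensor A B a b | a b p q. a \<in> hcomp A p \<and> b \<in> hcomp B q}" by blast
 have "span (\<Union>n. span (?S n)) = span (\<Union>n. ?S n)"
 proof (rule subset_antisym)
  show "span (\<Union>n. span (?S n)) \<subseteq> span (\<Union>n. ?S n)"
  proof (rule span_minimal[OF UN_least subspace_span])
   fix n show "span (?S n) \<subseteq> span (\<Union>n. ?S n)" by (rule span_mono) blast
  qed
  show "span (\<Union>n. ?S n) \<subseteq> span (\<Union>n. span (?S n))"
   by (intro span_mono UN_mono subset_refl) (rule span_superset)
 qed
 then show ?thesis unfolding U by (simp add: elems_def tensor_space_def)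
qed

lemma tens_induct [consumes 3, case_names zero step]:
 fixes A :: "('k::field, 'a::ab_group_add) graded_space" and B :: "('k, 'b::ab_group_add) graded_space"
 assumes "vecsp A" "vecsp B" "t \<in> elems (tensor_space A B)" "P (\<lambda>\<beta>. 0)"
  and "\<And>c a b p q t. a \<in> hcomp A p ==> b \<in> hcomp B q ==> t \<in> elems (tensor_space A B) ==> P t
   ==> P (\<lambda>\<beta>. c * tensor A B a b \<beta> + t \<beta>)"
 shows "P t"
proof -
 interpret vector_space "fscale :: _ => (('a => 'b => 'k) => 'k) => _" by (rule vector_space_fscale)
 have "t \<in> span {tensor A B a b | a b p q. a \<in> hcomp A p \<and> b \<in> hcomp B q}"
  using assms(3) elems_tensor[OF assms(1,2)] by simp
 then have "t \<in> elems (tensor_space A B) \<and> P t"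
 proof (induct rule: span_induct_alt)
  case base then show ?case using assms(4) by (simp add: zero_fun_def)
 next
  case (step c x y)
  then have "x \<in> elems (tensor_space A B)"
   unfolding elems_tensor[OF assms(1,2)] by (intro span_base)
  then have "fscale c x + y \<in> elems (tensor_space A B)"
   using step elems_smult[of "tensor_space A B" x c] by (intro elems_add) simp_all
  then show ?case using step assms(5) by (auto simp: plus_fun_def)
 qed
 then show ?thesis by simp
qed

lemma tensor_eval [simp]: "bilinear_form A B \<beta> ==> tensor A B a b \<beta> = \<beta> a b"
 and tensor_nonbilinear: "\<not> bilinear_form A B \<beta> ==> tensor A B a b \<beta> = 0"
 by (simp_all add: tensor_def)

lemma hcomp_tensor:
 fixes A :: "('k::field, 'a::ab_group_add) graded_space" and B :: "('k, 'b::ab_group_add) graded_space"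
 shows "a \<in> hcomp A p ==> b \<in> hcomp B q ==> tensor A B a b \<in> hcomp (tensor_space A B) (p + q)"
proof -
 interpret vector_space "fscale :: _ => (('a => 'b => 'k) => 'k) => _" by (rule vector_space_fscale)
 assume "a \<in> hcomp A p" "b \<in> hcomp B q"
 then show ?thesis unfolding tensor_space_def graded_space.simps by (intro span_base) blast
qed

lemma tensor_in:
 assumes A: "vecsp A" and B: "vecsp B" and a: "a \<in> elems A" and b: "b \<in> elems B"
 shows "tensor A B a b \<in> elems (tensor_space A B)"
 using A a
proof (induct rule: elems_induct)
 case zero
 have "tensor A B 0 b = 0" using bf_left[OF _ b] lm_0[OF A] by (auto simp: tensor_def fun_eq_iff)
 then show ?case by simp
next
 case (step c n h y)
 have h: "h \<in> elems A" using A step hcomp_elems by blast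
 have "tensor A B h b \<in> elems (tensor_space A B)" using B b
 proof (induct rule: elems_induct)
  case zero
  have "tensor A B h 0 = 0" using bf_right[OF _ h] lm_0[OF B] by (auto simp: tensor_def fun_eq_iff)
  then show ?case by simp
 next
  case (step c m k y)
  have k: "k \<in> elems B" using B step hcomp_elems by blast
  have "tensor A B h (smult B c k + y) = smult (tensor_space A B) c (tensor A B h k) + tensor A B h y"
   using k step elems_smult[OF B]
   by (auto simp: tensor_def fun_eq_iff lm_add[OF bf_right[OF _ h]] lm_smult[OF bf_right[OF _ h]])
  moreover have "tensor A B h k \<in> elems (tensor_space A B)"
   using hcomp_elems[of "tensor_space A B", OF _ hcomp_tensor[OF \<open>h \<in> hcomp A n\<close> step(1)]] by simp
  ultimately show ?case using step by (simp only: elems_add elems_smult vs_simps)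
 qed
 moreover have "tensor A B (smult A c h + y) b = smult (tensor_space A B) c (tensor A B h b) + tensor A B y b"
  using h step elems_smult[OF A]
  by (auto simp: tensor_def fun_eq_iff lm_add[OF bf_left[OF _ b]] lm_smult[OF bf_left[OF _ b]])
 ultimately show ?case using step by (simp only: elems_add elems_smult vs_simps)
qed

lemma bm_tensor: "vecsp A ==> vecsp B ==> bilinear_map A B (tensor_space A B) (tensor A B)"
 by (rule bmI)
  (simp_all add: linear_map_def[of _ "tensor_space A B"] tensor_in,
  auto simp: tensor_def fun_eq_iff lm_add[OF bf_left] lm_smult[OF bf_left]
   lm_add[OF bf_right] lm_smult[OF bf_right])

lemma tens_nonbilinear:
 assumes "vecsp A" "vecsp B" "t \<in> elems (tensor_space A B)" "\<not> bilinear_form A B \<beta>"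
 shows "t \<beta> = 0"
 using assms(1-3) by (induct rule: tens_induct) (simp_all add: tensor_nonbilinear assms)

lemma tens_eqI:
 assumes "vecsp A" "vecsp B" "t \<in> elems (tensor_space A B)" "t' \<in> elems (tensor_space A B)"
  and "\<And>\<beta>. bilinear_form A B \<beta> ==> t \<beta> = t' \<beta>"
 shows "t = t'"
 using assms tens_nonbilinear by (metis (no_types, lifting) ext)

lemma tens_cong:
 assumes "vecsp A" "vecsp B" "t \<in> elems (tensor_space A B)"
  and "\<And>a b. a \<in> elems A ==> b \<in> elems B ==> \<beta> a b = \<gamma> a b"
 shows "t \<beta> = t \<gamma>"
 using assms(1-3)
proof (induct rule: tens_induct)
 case (step c a b p q t)
 have "a \<in> elems A" "b \<in> elems B" using step hcomp_elems assms(1,2) by blast+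
 moreover have "bilinear_form A B \<beta> \<longleftrightarrow> bilinear_form A B \<gamma>" using assms by (intro bf_cong)
 ultimately show ?case using step assms(4) by (simp add: tensor_def)
qed simp

text \<open>By induction on \<open>t\<close>, as every summand of \<open>t\<close> evaluates the form at one pair of vectors.\<close>

lemma tens_param:
 assumes "vecsp A" "vecsp B" "vecsp Z" "t \<in> elems (tensor_space A B)"
  and "\<And>z. z \<in> elems Z ==> bilinear_form A B (\<beta> z)"
  and "\<And>a b. a \<in> elems A ==> b \<in> elems B ==> lform Z (\<lambda>z. \<beta> z a b)"
 shows "lform Z (\<lambda>z. t (\<beta> z))"
 using assms(1,2,4)
proof (induct rule: tens_induct)
 case zero then show ?case using assms lm_zeroI[of Z ground] by simp
next
 case (step c a b p q t)
 have "lform Z (\<lambda>z. c * \<beta> z a b)"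
  using lm_scaled[OF assms(3) _ assms(6)[of a b] assms(6)[of a b], where c=c]
   hcomp_elems[OF assms(1) step(1)] hcomp_elems[OF assms(2) step(2)] by simp
 then have "lform Z (\<lambda>z. c * \<beta> z a b + t (\<beta> z))" by (rule lm_plus[OF assms(3) vs_simps(3) _ step(4)])
 moreover have "c * tensor A B a b (\<beta> z) + t (\<beta> z) = c * \<beta> z a b + t (\<beta> z)" if "z \<in> elems Z" for z
  by (simp add: assms(5)[OF that])
 ultimately show ?case by (subst lm_cong[OF assms(3)])
qed

lemma lform_eval: "lform (tensor_space A B) (\<lambda>t. t \<beta>)"  "lform (tensor_module U) (\<lambda>t. t \<beta>')"
 by (auto simp: linear_map_def)

lemma tens_lincomb:
 assumes "vecsp A" "vecsp B" "t \<in> elems (tensor_space A B)" "bilinear_form A B \<beta>" "bilinear_form A B \<gamma>"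
 shows tens_plus: "t (\<lambda>a b. \<beta> a b + \<gamma> a b) = t \<beta> + t \<gamma>"
  and tens_scaled: "t (\<lambda>a b. c * \<beta> a b) = c * t \<beta>"
  and bf_plus: "bilinear_form A B (\<lambda>a b. \<beta> a b + \<gamma> a b)"
  and bf_scaled: "bilinear_form A B (\<lambda>a b. c * \<beta> a b)"
proof -
 have "lform A (\<lambda>a. \<beta> a b + \<gamma> a b)" "lform A (\<lambda>a. c * \<beta> a b)" if "b \<in> elems B" for b
  using lm_plus[OF assms(1) _ bf_left[OF assms(4) that] bf_left[OF assms(5) that]]
   lm_scaled[OF assms(1) _ bf_left[OF assms(4) that] bf_left[OF assms(4) that], where c=c] by simp_all
 moreover have "lform B (\<lambda>b. \<beta> a b + \<gamma> a b)" "lform B (\<lambda>b. c * \<beta> a b)" if "a \<in> elems A" for a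
  using lm_plus[OF assms(2) _ bf_right[OF assms(4) that] bf_right[OF assms(5) that]]
   lm_scaled[OF assms(2) _ bf_right[OF assms(4) that] bf_right[OF assms(4) that], where c=c] by simp_all
 ultimately show 1: "bilinear_form A B (\<lambda>a b. \<beta> a b + \<gamma> a b)" "bilinear_form A B (\<lambda>a b. c * \<beta> a b)"
  by (simp_all add: bfI)
 show "t (\<lambda>a b. \<beta> a b + \<gamma> a b) = t \<beta> + t \<gamma>"
  using assms(1-3) by (induct rule: tens_induct) (simp_all add: 1 assms algebra_simps)
 show "t (\<lambda>a b. c * \<beta> a b) = c * t \<beta>"
  using assms(1-3) by (induct rule: tens_induct) (simp_all add: 1 assms algebra_simps)
qed

subsection \<open>Multilinear maps and words\<close>

lemma ml_upd: "multilinear V W h ==> set vs \<subseteq> elems V ==> i < length vs ==> linear_map V W (\<lambda>v. h (vs[i := v]))"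
proof -
 assume h: "multilinear V W h" and vs: "set vs \<subseteq> elems V" "i < length vs"
 have "set (take i vs) \<subseteq> elems V" "set (drop (Suc i) vs) \<subseteq> elems V"
  using vs by (auto dest: in_set_takeD in_set_dropD)
 then have "linear_map V W (\<lambda>v. h (take i vs @ v # drop (Suc i) vs))"
  using h by (simp add: multilinear_def)
 then show ?thesis using vs by (simp add: upd_conv_take_nth_drop)
qed

lemma mlI:
 assumes "vecsp V" "\<And>vs i. set vs \<subseteq> elems V ==> i < length vs ==> linear_map V W (\<lambda>v. h (vs[i := v]))"
 shows "multilinear V W h"
 unfolding multilinear_def
proof (intro allI impI)
 fix xs ys assume "set xs \<subseteq> elems V \<and> set ys \<subseteq> elems V"
 then show "linear_map V W (\<lambda>v. h (xs @ v # ys))"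
  using assms(2)[of "xs @ 0 # ys" "length xs"] assms(1) by simp
qed

lemma words_nth: "set vs \<subseteq> elems U ==> i < length vs ==> vs ! i \<in> elems U"
 by (meson nth_mem subsetD)

lemma homogeneous_words: "vecsp U ==> homogeneous U ds vs ==> vs \<in> words U"
 by (force simp: homogeneous_def words_def list_all2_conv_all_nth in_set_conv_nth intro: hcomp_elems[of U])

lemma ml_in: "multilinear V W h ==> vs \<in> words V ==> h vs \<in> elems W"
 using ml_upd[of V W h vs 0] lm_in[of V W "\<lambda>v. h (vs[0 := v])" "vs ! 0"]
 by (simp add: words_def words_nth)

lemma ml_0:
 assumes "vecsp V" "multilinear V W h" "set vs \<subseteq> elems V" "i < length vs" "vs ! i = 0" shows "h vs = 0"
 using lm_0[OF assms(1) ml_upd[OF assms(2,3,4)]] list_update_id[of vs i] assms(5) by metis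

lemma ml_append:
 assumes "multilinear V W h" "set zs \<subseteq> elems V"
 shows ml_append_right: "multilinear V W (\<lambda>vs. h (vs @ zs))"
  and ml_append_left: "multilinear V W (\<lambda>vs. h (zs @ vs))"
proof -
 have *: "linear_map V W (\<lambda>v. h (xs @ v # ys))" if "set xs \<subseteq> elems V" "set ys \<subseteq> elems V" for xs ys
  using assms that by (simp add: multilinear_def)
 show "multilinear V W (\<lambda>vs. h (vs @ zs))" "multilinear V W (\<lambda>vs. h (zs @ vs))"
  unfolding multilinear_def using *[of _ "_ @ zs"] *[of "zs @ _"] assms(2) by simp_all
qed

lemma ml_comp: "multilinear V W h ==> linear_map W X g ==> multilinear V X (\<lambda>vs. g (h vs))"
 unfolding multilinear_def
proof (intro allI impI)
 fix xs ys assume "\<forall>xs ys. set xs \<subseteq> elems V \<and> set ys \<subseteq> elems V \<longrightarrow> linear_map V W (\<lambda>v. h (xs @ v # ys))"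
  and g: "linear_map W X g" and "set xs \<subseteq> elems V \<and> set ys \<subseteq> elems V"
 then have "linear_map V W (\<lambda>v. h (xs @ v # ys))" by simp
 from lm_comp[OF this g] show "linear_map V X (\<lambda>v. g (h (xs @ v # ys)))" .
qed

lemma ml_zeroI: "vecsp V ==> vecsp W ==> multilinear V W (\<lambda>vs. 0)"
 by (simp add: multilinear_def lm_zeroI)

lemma ml_sumI: "vecsp V ==> vecsp W ==> (\<And>i. i \<in> I ==> multilinear V W (h i)) ==> multilinear V W (\<lambda>vs. \<Sum>i\<in>I. h i vs)"
 by (simp add: multilinear_def lm_sumI)

lemma ml_length:
 "(\<And>n. multilinear V W (h n)) ==> multilinear V W (\<lambda>vs. h (length vs) vs)"
 unfolding multilinear_def by simp

lemma ml_cong: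
 assumes "vecsp V" "\<And>vs. set vs \<subseteq> elems V ==> vs \<noteq> [] ==> h vs = g vs"
 shows "multilinear V W h \<longleftrightarrow> multilinear V W g"
proof -
 have "linear_map V W (\<lambda>v. h (xs @ v # ys)) = linear_map V W (\<lambda>v. g (xs @ v # ys))"
  if "set xs \<subseteq> elems V" "set ys \<subseteq> elems V" for xs ys
  using that assms(2) by (intro lm_cong[OF assms(1)]) auto
 then show ?thesis unfolding multilinear_def by blast
qed

lemma words_induct [consumes 2, case_names homogeneous zero step]:
 assumes "vecsp U" "vs \<in> words U"
  and hom: "\<And>ds vs. homogeneous U ds vs ==> P vs"
  and zero: "\<And>xs ys. set xs \<subseteq> elems U ==> set ys \<subseteq> elems U ==> P (xs @ 0 # ys)"
  and step: "\<And>xs ys c v w. set xs \<subseteq> elems U ==> set ys \<subseteq> elems U ==> v \<in> elems U ==> w \<in> elems U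
   ==> P (xs @ v # ys) ==> P (xs @ w # ys) ==> P (xs @ (smult U c v + w) # ys)"
 shows "P vs"
proof -
 have "P (xs @ ys)" if "list_all2 (\<lambda>d v. v \<in> hcomp U d) ds xs" "set ys \<subseteq> elems U" "xs @ ys \<noteq> []" for ds xs ys
  using that
 proof (induct ys arbitrary: ds xs)
  case Nil then show ?case using hom by (simp add: homogeneous_def)
 next
  case (Cons v ys)
  have xs: "set xs \<subseteq> elems U" using Cons(2) assms(1) hcomp_elems
   by (fastforce simp: list_all2_conv_all_nth in_set_conv_nth)
  have "v \<in> elems U" using Cons by simp
  with assms(1) show ?case
  proof (induct rule: elems_induct)
   case zero then show ?case using assms(4) xs Cons by simp
  next
   case (step c n h y)
   have "list_all2 (\<lambda>d v. v \<in> hcomp U d) (ds @ [n]) (xs @ [h])"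
    using Cons step by (simp add: list_all2_appendI)
   from Cons(1)[OF this] have "P (xs @ h # ys)" using Cons by simp
   then show ?case using assms(5) step xs Cons hcomp_elems[OF assms(1)] by simp
  qed
 qed
 from this[of "[]" "[]" vs] show ?thesis using assms(2) by (simp add: words_def)
qed

lemma ml_eq:
 assumes "vecsp U" "multilinear U W h" "multilinear U W g" "\<And>ds vs. homogeneous U ds vs ==> h vs = g vs"
  and "vs \<in> words U"
 shows "h vs = g vs"
 using assms(1,5)
proof (induct rule: words_induct)
 case (zero xs ys)
 then have "set (xs @ 0 # ys) \<subseteq> elems U" using assms(1) by simp
 from ml_0[OF assms(1,2) this, of "length xs"] ml_0[OF assms(1,3) this, of "length xs"] show ?case by simp
next
 case (step xs ys c v w)
 have "linear_map U W (\<lambda>v. h (xs @ v # ys))" "linear_map U W (\<lambda>v. g (xs @ v # ys))"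
  using assms step by (simp_all add: multilinear_def)
 from lm_add[OF this(1)] lm_add[OF this(2)] lm_smult[OF this(1)] lm_smult[OF this(2)]
 show ?case using step elems_smult[OF assms(1)] by simp
qed (use assms in auto)

subsection \<open>The tensor module\<close>

lemma pure_eval [simp]: "multilinear U ground \<beta> ==> pure U vs \<beta> = \<beta> vs"
 and pure_nonmultilinear: "\<not> multilinear U ground \<beta> ==> pure U vs \<beta> = 0"
 by (simp_all add: pure_def)

lemma elems_tensor_module:
 fixes U :: "('k::field, 'a::ab_group_add) graded_space"
 shows "elems (tensor_module U) = module.span fscale {pure U vs | vs ds. homogeneous U ds vs}"
proof -
 interpret vector_space "fscale :: _ => (('a list => 'k) => 'k) => _" by (rule vector_space_fscale)
 let ?S = "\<lambda>n. {pure U vs | vs ds. homogeneous U ds vs \<and> sum_list ds = n}"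
 have U: "(\<Union>n. ?S n) = {pure U vs | vs ds. homogeneous U ds vs}" by auto
 have "span (\<Union>n. span (?S n)) = span (\<Union>n. ?S n)"
 proof (rule subset_antisym)
  show "span (\<Union>n. span (?S n)) \<subseteq> span (\<Union>n. ?S n)"
  proof (rule span_minimal[OF UN_least subspace_span])
   fix n show "span (?S n) \<subseteq> span (\<Union>n. ?S n)" by (rule span_mono) blast
  qed
  show "span (\<Union>n. ?S n) \<subseteq> span (\<Union>n. span (?S n))"
   by (intro span_mono UN_mono subset_refl) (rule span_superset)
 qed
 then show ?thesis unfolding U by (simp add: elems_def tensor_module_def)
qed

lemma hcomp_pure:
 fixes U :: "('k::field, 'a::ab_group_add) graded_space"
 shows "homogeneous U ds vs ==> pure U vs \<in> hcomp (tensor_module U) (sum_list ds)"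
proof -
 interpret vector_space "fscale :: _ => (('a list => 'k) => 'k) => _" by (rule vector_space_fscale)
 assume "homogeneous U ds vs"
 then show ?thesis unfolding tensor_module_def graded_space.simps by (intro span_base) blast
qed

lemma pure_in:
 assumes "vecsp U" "vs \<in> words U" shows "pure U vs \<in> elems (tensor_module U)"
 using assms
proof (induct rule: words_induct)
 case (homogeneous ds vs) then show ?case by (intro hcomp_elems[of "tensor_module U", OF _ hcomp_pure]) simp_all
next
 case (zero xs ys)
 have "pure U (xs @ 0 # ys) = 0"
  using ml_0[OF assms(1), of ground _ "xs @ 0 # ys" "length xs"] zero assms(1) by (auto simp: pure_def fun_eq_iff)
 then show ?case by simp
next
 case (step xs ys c v w)
 have "pure U (xs @ (smult U c v + w) # ys) = smult (tensor_module U) c (pure U (xs @ v # ys)) + pure U (xs @ w # ys)"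
 proof
  have lf: "lform U (\<lambda>v. \<beta> (xs @ v # ys))" if "multilinear U ground \<beta>" for \<beta>
   using that step by (simp add: multilinear_def)
  show "pure U (xs @ (smult U c v + w) # ys) \<beta> =
    (smult (tensor_module U) c (pure U (xs @ v # ys)) + pure U (xs @ w # ys)) \<beta>" for \<beta>
   using step(3,4) elems_smult[OF assms(1)] by (auto simp: pure_def lm_add[OF lf] lm_smult[OF lf])
 qed
 then show ?case using step by (simp only: elems_add elems_smult vs_simps)
qed

lemma ml_pure: "vecsp U ==> multilinear U (tensor_module U) (pure U)"
 unfolding multilinear_def
proof (intro allI impI)
 fix xs ys assume U: "vecsp U" and *: "set xs \<subseteq> elems U \<and> set ys \<subseteq> elems U"
 show "linear_map U (tensor_module U) (\<lambda>v. pure U (xs @ v # ys))"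
  unfolding linear_map_def
 proof (intro conjI ballI allI)
  fix x assume "x \<in> elems U"
  then show "pure U (xs @ x # ys) \<in> elems (tensor_module U)" using * by (intro pure_in U) (simp add: words_def)
 next
  have lf: "lform U (\<lambda>v. \<beta> (xs @ v # ys))" if "multilinear U ground \<beta>" for \<beta>
   using that * by (simp add: multilinear_def)
  fix x y assume xy: "x \<in> elems U" "y \<in> elems U"
  show "pure U (xs @ (x + y) # ys) = pure U (xs @ x # ys) + pure U (xs @ y # ys)"
   by (simp add: pure_def fun_eq_iff lm_add[OF lf xy])
  show "pure U (xs @ smult U c x # ys) = smult (tensor_module U) c (pure U (xs @ x # ys))" for c
   using lm_smult[OF lf xy(1)] by (simp add: pure_def fun_eq_iff)
 qed
qed

lemma tmod_induct [consumes 2, case_names zero step]: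
 fixes U :: "('k::field, 'a::ab_group_add) graded_space"
 assumes "vecsp U" "x \<in> elems (tensor_module U)" "P (\<lambda>\<beta>. 0)"
  and "\<And>c ds vs x. homogeneous U ds vs ==> x \<in> elems (tensor_module U) ==> P x
   ==> P (\<lambda>\<beta>. c * pure U vs \<beta> + x \<beta>)"
 shows "P x"
proof -
 interpret vector_space "fscale :: _ => (('a list => 'k) => 'k) => _" by (rule vector_space_fscale)
 have "x \<in> span {pure U vs | vs ds. homogeneous U ds vs}"
  using assms(2) elems_tensor_module by blast
 then have "x \<in> elems (tensor_module U) \<and> P x"
 proof (induct rule: span_induct_alt)
  case base then show ?case using assms(3) by (simp add: zero_fun_def)
 next
  case (step c x y)
  then have "x \<in> elems (tensor_module U)"
   unfolding elems_tensor_module by (intro span_base)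
  then have "fscale c x + y \<in> elems (tensor_module U)"
   using step elems_smult[of "tensor_module U" x c] by (intro elems_add) simp_all
  then show ?case using step assms(4) by (auto simp: plus_fun_def)
 qed
 then show ?thesis by simp
qed

lemma tmod_nonmultilinear:
 assumes "vecsp U" "x \<in> elems (tensor_module U)" "\<not> multilinear U ground \<beta>"
 shows "x \<beta> = 0"
 using assms(1-2) by (induct rule: tmod_induct) (simp_all add: pure_nonmultilinear assms)

lemma tmod_eqI:
 assumes "vecsp U" "t \<in> elems (tensor_module U)" "t' \<in> elems (tensor_module U)"
  and "\<And>\<beta>. multilinear U ground \<beta> ==> t \<beta> = t' \<beta>"
 shows "t = t'"
 using assms tmod_nonmultilinear by (metis (no_types, lifting) ext)

lemma tmod_eq:
 assumes "vecsp U" "linear_map (tensor_module U) B f" "linear_map (tensor_module U) B g"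
  and "\<And>ds vs. homogeneous U ds vs ==> f (pure U vs) = g (pure U vs)" and "x \<in> elems (tensor_module U)"
 shows "f x = g x"
 using assms(1,5)
proof (induct rule: tmod_induct)
 case zero then show ?case using lm_zero_fun[OF _ assms(2)] lm_zero_fun[OF _ assms(3)] by simp
next
 case (step c ds vs x)
 have "pure U vs \<in> elems (tensor_module U)" by (intro pure_in homogeneous_words[OF _ step(1)] assms)
 then show ?case
  using step(3) lm_smult[OF assms(2), of "pure U vs" c] lm_add[OF assms(2) _ step(2), of "fscale c (pure U vs)"]
   lm_smult[OF assms(3), of "pure U vs" c] lm_add[OF assms(3) _ step(2), of "fscale c (pure U vs)"]
   elems_smult[of "tensor_module U" "pure U vs" c] assms(4)[OF step(1)] by (simp add: plus_fun_def)
qed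

lemma tmod_push:
 assumes "vecsp U" "x \<in> elems (tensor_module U)" "lform (tensor_module U) L"
 shows "L x = x (\<lambda>vs. L (pure U vs))"
 using assms(1,3) lform_eval(2) _ assms(2)
proof (rule tmod_eq)
 show "L (pure U vs) = pure U vs (\<lambda>vs. L (pure U vs))" for vs
  using ml_comp[OF ml_pure[OF assms(1)] assms(3)] by simp
qed

lemma tmod_param:
 assumes "vecsp U" "vecsp Z" "x \<in> elems (tensor_module U)"
  and "\<And>z. z \<in> elems Z ==> multilinear U ground (\<beta> z)"
  and "\<And>vs. vs \<in> words U ==> lform Z (\<lambda>z. \<beta> z vs)"
 shows "lform Z (\<lambda>z. x (\<beta> z))"
 using assms(1,3)
proof (induct rule: tmod_induct)
 case zero then show ?case using assms lm_zeroI[of Z ground] by simp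
next
 case (step c ds vs x)
 have "lform Z (\<lambda>z. c * \<beta> z vs)"
  using lm_scaled[OF assms(2) _ assms(5)[of vs] assms(5)[of vs], where c=c] homogeneous_words[OF assms(1) step(1)] by simp
 then have "lform Z (\<lambda>z. c * \<beta> z vs + x (\<beta> z))" by (rule lm_plus[OF assms(2) vs_simps(3) _ step(3)])
 moreover have "c * pure U vs (\<beta> z) + x (\<beta> z) = c * \<beta> z vs + x (\<beta> z)" if "z \<in> elems Z" for z
  by (simp add: assms(4)[OF that])
 ultimately show ?case by (subst lm_cong[OF assms(2)])
qed

lemma tmod_cong:
 assumes "vecsp U" "x \<in> elems (tensor_module U)" "\<And>vs. vs \<in> words U ==> \<beta> vs = \<gamma> vs"
 shows "x \<beta> = x \<gamma>"
proof -
 have ml: "multilinear U ground \<beta> = multilinear U ground \<gamma>"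
  using assms(3) by (intro ml_cong[OF assms(1)]) (simp add: words_def)
 show ?thesis using assms(1,2)
  by (induct rule: tmod_induct) (simp_all add: pure_def ml assms homogeneous_words)
qed

text \<open>A basis of the tensor module can be chosen among the words, so prescribing values on it is
 possible; multilinearity then propagates the values to all words.\<close>

lemma lift_multilinear:
 fixes U :: "('k::field, 'a::ab_group_add) graded_space" and B :: "('k, 'b::ab_group_add) graded_space"
 assumes U: "vecsp U" and B: "vecsp B" and \<phi>: "multilinear U B \<phi>"
 obtains g where "linear_map (tensor_module U) B g" "\<And>vs. vs \<in> words U ==> g (pure U vs) = \<phi> vs"
proof -
 let ?T = "tensor_module U"
 interpret vector_space_pair "fscale :: _ => (('a list => 'k) => 'k) => _" "smult B"
  using B by (simp add: vector_space_pair_def vector_space_fscale)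
 let ?S = "{pure U vs | vs ds. homogeneous U ds vs}"
 obtain X where X: "X \<subseteq> ?S" "vs1.independent X" "?S \<subseteq> vs1.span X"
  by (rule vs1.basis_exists[of ?S]) (rule that)
 define w where "w x = (SOME vs. vs \<in> words U \<and> x = pure U vs)" for x
 have w: "w x \<in> words U" "pure U (w x) = x" if x: "x \<in> X" for x
 proof -
  from x X(1) obtain vs ds where "x = pure U vs" "homogeneous U ds vs" by auto
  then have "\<exists>vs. vs \<in> words U \<and> x = pure U vs" using homogeneous_words[OF U] by auto
  from someI_ex[OF this] show "w x \<in> words U" "pure U (w x) = x" by (simp_all add: w_def)
 qed
 obtain g where g: "Vector_Spaces.linear fscale (smult B) g" "\<forall>x\<in>X. g x = \<phi> (w x)"
  using linear_independent_extend[OF X(2), of "\<lambda>x. \<phi> (w x)"] by blast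
 have T: "elems ?T \<subseteq> vs1.span X"
  unfolding elems_tensor_module using vs1.span_minimal[OF X(3)] by simp
 have XT: "X \<subseteq> elems ?T" using w pure_in[OF U] by (metis subsetI)
 have lg: "linear_map ?T B g"
 proof (rule linear_imp_lm)
  fix x assume "x \<in> elems ?T"
  then have "x \<in> vs1.span X" using T by auto
  then show "g x \<in> elems B"
  proof (induct rule: vs1.span_induct_alt)
   case base then show ?case using linear_0[OF g(1)] elems_0[OF B] by (simp add: zero_fun_def)
  next
   case (step c x y)
   then have "g (fscale c x + y) = smult B c (g x) + g y" using g by (simp add: Vector_Spaces.linear_iff)
   moreover have "g x \<in> elems B" using g(2) step(1) w ml_in[OF \<phi>] by simp
   ultimately show ?case using step B by (simp add: elems_add elems_smult plus_fun_def)
  qed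
 qed (use g in simp)
 have "g (pure U vs) = \<phi> vs" if vs: "vs \<in> words U" for vs
 proof (rule ccontr)
  assume "g (pure U vs) \<noteq> \<phi> vs"
  then have "g (pure U vs) - \<phi> vs \<noteq> 0" by simp
  with B obtain L where L: "Vector_Spaces.linear (smult B) (*) L" "L (g (pure U vs) - \<phi> vs) \<noteq> 0"
   by (rule separating_functional)
  have LB: "lform B L" by (rule linear_imp_lm) (use L in simp_all)
  have "L (g x) = x (\<lambda>vs. L (\<phi> vs))" if "x \<in> elems ?T" for x
  proof (rule lm_eq_span[OF _ lm_comp[OF lg LB] lform_eval(2) XT _ _ that])
   fix x assume x: "x \<in> X"
   have "x (\<lambda>vs. L (\<phi> vs)) = L (\<phi> (w x))"
    using pure_eval[OF ml_comp[OF \<phi> LB], of "w x"] w(2)[OF x] by simp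
   then show "L (g x) = x (\<lambda>vs. L (\<phi> vs))" using g(2) x by simp
  qed (use T in simp_all)
  from this[OF pure_in[OF U vs]] have "L (g (pure U vs)) = L (\<phi> vs)" by (simp add: ml_comp[OF \<phi> LB])
  moreover have "L (g (pure U vs) - \<phi> vs + \<phi> vs) = L (g (pure U vs) - \<phi> vs) + L (\<phi> vs)"
   using L(1) unfolding Vector_Spaces.linear_iff by blast
  ultimately have "L (g (pure U vs) - \<phi> vs) = 0" by simp
  then show False using L by simp
 qed
 then show ?thesis using that lg by blast
qed

lemma graded_map_from_words:
 fixes U :: "('k::field, 'a::ab_group_add) graded_space"
 assumes U: "graded_vector_space U" and B: "graded_vector_space B" and g: "linear_map (tensor_module U) B g"
  and pure: "\<And>ds vs. homogeneous U ds vs ==> g (pure U vs) \<in> hcomp B (sum_list ds + q)"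
 shows "graded_map (tensor_module U) B q g"
 unfolding graded_map_def
proof (intro conjI allI ballI)
 have v: "vecsp U" using U by (rule graded_vs)
 show "linear_map (tensor_module U) B g" by (rule g)
 fix n x assume x: "x \<in> hcomp (tensor_module U) n"
 interpret vector_space "fscale :: _ => (('a list => 'k) => 'k) => _" by (rule vector_space_fscale)
 have "x \<in> span {pure U vs | vs ds. homogeneous U ds vs \<and> sum_list ds = n}" using x by (simp add: tensor_module_def)
 then have "x \<in> elems (tensor_module U) \<and> g x \<in> hcomp B (n + q)"
 proof (induct rule: span_induct_alt)
  case base
  have "g 0 = 0" by (rule lm_0[OF vs_simps(2) g])
  then show ?case using hcomp_0[OF B] by (simp add: zero_fun_def)
 next
  case (step c x y)
  then obtain vs ds where x: "x = pure U vs" and h: "homogeneous U ds vs" "sum_list ds = n" by auto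
  have px: "x \<in> elems (tensor_module U)" unfolding x by (rule pure_in[OF v homogeneous_words[OF v h(1)]])
  have "g x \<in> hcomp B (n + q)" using pure[OF h(1)] h(2) x by simp
  moreover have "g (fscale c x + y) = smult B c (g x) + g y"
   using lm_add[OF g elems_smult[OF vs_simps(2) px, of c]] lm_smult[OF g px, of c] step(2) by simp
  moreover have "smult (tensor_module U) c x + y \<in> elems (tensor_module U)"
   using step(2) px by (simp only: elems_add elems_smult vs_simps)
  ultimately show ?case using step(2) by (simp only: smult_simps hcomp_add[OF B] hcomp_smult[OF B] simp_thms)
 qed
 then show "g x \<in> hcomp B (n + q)" by simp
qed

subsection \<open>Twisting by signs\<close>

definition parlists :: "nat => int list set" where
 "parlists n = {ps. set ps \<subseteq> {0, 1} \<and> length ps = n}"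

lemma finite_parlists [simp]: "finite (parlists n)"
 unfolding parlists_def by (rule finite_lists_length_eq) simp

text \<open>Multiplies a multilinear map by a sign that depends on the parities of the arguments, by expanding
 every argument into its even and its odd part.\<close>

definition twist :: "('k::field, 'a::ab_group_add) graded_space => ('k, 'b::ab_group_add) graded_space
  => (int list => 'k) => ('a list => 'b) => 'a list => 'b" where
 "twist U W c h vs = (\<Sum>ps\<in>parlists (length vs). smult W (c ps) (h (map2 (parity_proj U) ps vs)))"

lemma ml_twist:
 assumes U: "graded_vector_space U" and W: "vecsp W" and h: "multilinear U W h"
 shows "multilinear U W (twist U W c h)"
proof (rule mlI)
 show vU: "vecsp U" using U by (rule graded_vs)
 fix vs i assume vs: "set vs \<subseteq> elems U" "i < length vs"
 have *: "map2 (parity_proj U) ps (vs[i := v]) = (map2 (parity_proj U) ps vs)[i := parity_proj U (ps ! i) v]"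
  if "ps \<in> parlists (length vs)" for ps v
  using that vs by (auto simp: parlists_def list_eq_iff_nth_eq nth_list_update)
 have "linear_map U W (\<lambda>v. smult W (c ps) (h ((map2 (parity_proj U) ps vs)[i := parity_proj U (ps ! i) v])))"
  if ps: "ps \<in> parlists (length vs)" for ps
 proof (rule lm_scaled[OF vU W _ lm_zeroI[OF vU W]])
  have "set (map2 (parity_proj U) ps vs) \<subseteq> elems U"
   using vs by (auto dest!: set_zip_rightD intro: lm_in[OF lm_parity_proj[OF U]])
  then show "linear_map U W (\<lambda>v. h ((map2 (parity_proj U) ps vs)[i := parity_proj U (ps ! i) v]))"
   using ps vs by (intro lm_comp[OF lm_parity_proj[OF U] ml_upd[OF h]]) (auto simp: parlists_def)
 qed
 then have "linear_map U W (\<lambda>v. \<Sum>ps\<in>parlists (length vs). smult W (c ps) (h ((map2 (parity_proj U) ps vs)[i := parity_proj U (ps ! i) v])))"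
  by (rule lm_sumI[OF vU W])
 then show "linear_map U W (\<lambda>v. twist U W c h (vs[i := v]))"
  unfolding twist_def using * by (simp cong: sum.cong)
qed

lemma twist_homogeneous:
 assumes U: "graded_vector_space U" and W: "vecsp W" and h: "multilinear U W h" and vs: "homogeneous U ds vs"
 shows "twist U W c h vs = smult W (c (map (\<lambda>d. d mod 2) ds)) (h vs)"
proof -
 interpret W: vector_space "smult W" by fact
 have vU: "vecsp U" using U by (rule graded_vs)
 let ?ps = "map (\<lambda>d. d mod 2) ds"
 have len: "length ds = length vs" using vs by (auto simp: homogeneous_def dest: list_all2_lengthD)
 have nth: "vs ! i \<in> hcomp U (ds ! i)" if "i < length vs" for i
  using vs that by (auto simp: homogeneous_def list_all2_conv_all_nth)
 have "h (map2 (parity_proj U) ps vs) = 0" if "ps \<in> parlists (length vs)" "ps \<noteq> ?ps" for ps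
 proof -
  from that len obtain i where i: "i < length vs" "ps ! i \<noteq> ds ! i mod 2"
   by (auto simp: parlists_def list_eq_iff_nth_eq)
  have el: "set (map2 (parity_proj U) ps vs) \<subseteq> elems U"
   using homogeneous_words[OF vU vs] by (auto simp: words_def dest!: set_zip_rightD intro: lm_in[OF lm_parity_proj[OF U]])
  show ?thesis
   by (rule ml_0[OF vU h el, of i]) (use i that in \<open>auto simp: parlists_def parity_proj_hcomp[OF U nth]\<close>)
 qed
 moreover have "map2 (parity_proj U) ?ps vs = vs"
  using len by (auto simp: list_eq_iff_nth_eq parity_proj_hcomp[OF U nth])
 moreover have "?ps \<in> parlists (length vs)" using len by (auto simp: parlists_def)
 ultimately show ?thesis
  unfolding twist_def by (subst sum.remove[of _ ?ps]) (auto intro!: sum.neutral)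
qed

lemma vector_space_tensor [simp]: "vecsp (tensor_space A B)" "vecsp (tensor_module U)"
 by simp_all

lemma linear_extension:
 assumes "vecsp A" "linear_map A B g" "\<forall>x y. (x, y) \<in> S \<longrightarrow> x \<in> elems A \<and> g x = y"
  and "elems A \<subseteq> module.span (smult A) (fst ` S)"
 shows lm_linear_extension: "linear_map A B (linear_extension A B S)"
  and linear_extension_apply: "x \<in> elems A ==> linear_extension A B S x = g x"
proof -
 have "linear_extension A B S = restrict g (elems A)"
  by (rule linear_extension_eq[OF assms(1,2) _ assms(4)]) (use assms(3) in blast)
 then show "linear_map A B (linear_extension A B S)" "x \<in> elems A ==> linear_extension A B S x = g x"
  using lm_cong[OF assms(1), of g "restrict g (elems A)" B] assms(2) by simp_all
qed

lemma span_generators: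
 assumes "elems A = module.span (smult A) G" "vecsp A" "G \<subseteq> H"
 shows "elems A \<subseteq> module.span (smult A) H"
proof -
 interpret vector_space "smult A" by fact
 show ?thesis using assms(1) span_mono[OF assms(3)] by simp
qed

lemma lm_functional:
 assumes "\<And>t. t \<in> elems A ==> G t \<in> elems B" "smult A = fscale" "smult B = fscale"
  and "\<And>t t' \<beta>. G (t + t') \<beta> = G t \<beta> + G t' \<beta>" "\<And>c t \<beta>. G (\<lambda>\<gamma>. c * t \<gamma>) \<beta> = c * G t \<beta>"
 shows "linear_map A B G"
 unfolding linear_map_def assms(2,3) by (auto simp: assms(1,4,5) fun_eq_iff)

subsection \<open>Tensor products of maps\<close>

text \<open>The witness for the definite description is precomposition of bilinear forms; \<open>e\<close> absorbs the Koszul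
 sign into the first factor.\<close>

lemma tensor_map_general:
 fixes A :: "('k::field, 'a::ab_group_add) graded_space" and B :: "('k, 'b::ab_group_add) graded_space"
  and A' :: "('k, 'c::ab_group_add) graded_space" and B' :: "('k, 'd::ab_group_add) graded_space"
 assumes v: "vecsp A" "vecsp B" "vecsp A'" "vecsp B'" and f: "linear_map A A' f" and g: "linear_map B B' g"
  and e: "linear_map A A e" "\<And>p a. a \<in> hcomp A p ==> e a = smult A ((-1) powi (q * p)) a"
 shows lm_tensor_map_general: "linear_map (tensor_space A B) (tensor_space A' B') (tensor_map A B A' B' f q g)"
  and tensor_map_general_apply: "t \<in> elems (tensor_space A B) ==> bilinear_form A' B' \<beta> ==>
   tensor_map A B A' B' f q g t \<beta> = t (\<lambda>a b. \<beta> (f (e a)) (g b))"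
proof -
 let ?G = "\<lambda>t \<beta>. if bilinear_form A' B' \<beta> then t (\<lambda>a b. \<beta> (f (e a)) (g b)) else 0"
 let ?S = "{(tensor A B a b, smult (tensor_space A' B') ((-1) powi (q * p)) (tensor A' B' (f a) (g b)))
    | a b p. a \<in> hcomp A p \<and> b \<in> elems B}"
 have fe: "linear_map A A' (\<lambda>a. f (e a))" using lm_comp[OF e(1) f] .
 have bil: "bilinear_form A B (\<lambda>a b. \<beta> (f (e a)) (g b))" if "bilinear_form A' B' \<beta>" for \<beta>
  by (rule bf_comp[OF that fe g])
 have G1: "?G (tensor A B a b) = tensor A' B' (f (e a)) (g b)" for a b
  by (auto simp: bil tensor_def fun_eq_iff)
 have in': "?G t \<in> elems (tensor_space A' B')" if "t \<in> elems (tensor_space A B)" for t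
  using v(1,2) that
 proof (induct rule: tens_induct)
  case zero then show ?case by simp
 next
  case (step c a b p q t)
  have "tensor A' B' (f (e a)) (g b) \<in> elems (tensor_space A' B')"
   using hcomp_elems[OF v(1) step(1)] hcomp_elems[OF v(2) step(2)] lm_in[OF fe] lm_in[OF g] v by (intro tensor_in)
  then have "smult (tensor_space A' B') c (tensor A' B' (f (e a)) (g b)) + ?G t \<in> elems (tensor_space A' B')"
   using step by (simp only: elems_add elems_smult vs_simps)
  moreover have "smult (tensor_space A' B') c (tensor A' B' (f (e a)) (g b)) + ?G t = ?G (\<lambda>\<beta>. c * tensor A B a b \<beta> + t \<beta>)"
   by (auto simp: fun_eq_iff bil tensor_def)
  ultimately show ?case by simp
 qed
 have lG: "linear_map (tensor_space A B) (tensor_space A' B') ?G"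
  by (rule lm_functional[OF in']) (auto simp: algebra_simps)
 have S: "\<forall>x y. (x, y) \<in> ?S \<longrightarrow> x \<in> elems (tensor_space A B) \<and> ?G x = y"
 proof (intro allI impI)
  fix x y assume xy: "(x, y) \<in> ?S"
  from xy obtain a b p where x: "x = tensor A B a b" and a: "a \<in> hcomp A p" and b: "b \<in> elems B"
   and y: "y = smult (tensor_space A' B') ((-1) powi (q * p)) (tensor A' B' (f a) (g b))" by auto
  have "a \<in> elems A" using hcomp_elems[OF v(1) a] .
  moreover have "f (e a) = smult A' ((-1) powi (q * p)) (f a)"
   using e(2)[OF a] lm_smult[OF f \<open>a \<in> elems A\<close>] by simp
  then have "tensor A' B' (f (e a)) (g b) = y"
   using lm_smult[OF bm_left[OF bm_tensor[OF v(3,4)] lm_in[OF g b]] lm_in[OF f \<open>a \<in> elems A\<close>]] y by simp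
  ultimately show "x \<in> elems (tensor_space A B) \<and> ?G x = y" unfolding x using G1[of a b] tensor_in[OF v(1,2)] b by simp
 qed
 have sp: "elems (tensor_space A B) \<subseteq> module.span (smult (tensor_space A B)) (fst ` ?S)"
  by (rule span_generators[OF _ vs_simps(1)], simp, rule elems_tensor[OF v(1,2)])
   (force intro: hcomp_elems[OF v(2)] simp: image_iff)
 note L = linear_extension[OF vs_simps(1) lG S sp]
 show "linear_map (tensor_space A B) (tensor_space A' B') (tensor_map A B A' B' f q g)"
  unfolding tensor_map_def by (rule L(1))
 show "t \<in> elems (tensor_space A B) ==> bilinear_form A' B' \<beta> ==>
   tensor_map A B A' B' f q g t \<beta> = t (\<lambda>a b. \<beta> (f (e a)) (g b))"
  unfolding tensor_map_def using L(2)[of t] by simp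
qed

lemma tensor_map_0:
 assumes v: "vecsp A" "vecsp B" "vecsp A'" "vecsp B'" and f: "linear_map A A' f" and g: "linear_map B B' g"
 shows lm_tensor_map_0: "linear_map (tensor_space A B) (tensor_space A' B') (tensor_map A B A' B' f 0 g)"
  and tensor_map_0_apply: "t \<in> elems (tensor_space A B) ==> bilinear_form A' B' \<beta> ==>
   tensor_map A B A' B' f 0 g t \<beta> = t (\<lambda>a b. \<beta> (f a) (g b))"
proof -
 interpret vector_space "smult A" by fact
 show "linear_map (tensor_space A B) (tensor_space A' B') (tensor_map A B A' B' f 0 g)"
  "t \<in> elems (tensor_space A B) ==> bilinear_form A' B' \<beta> ==>
   tensor_map A B A' B' f 0 g t \<beta> = t (\<lambda>a b. \<beta> (f a) (g b))"
  using tensor_map_general[OF v f g lm_id(1), of 0] by simp_all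
qed

text \<open>For an odd second factor the Koszul sign is the parity involution on the first tensor factor.\<close>

lemma tensor_map_odd:
 assumes A: "graded_vector_space A" and v: "vecsp B" "vecsp A'" "vecsp B'"
  and f: "linear_map A A' f" and g: "linear_map B B' g"
 shows lm_tensor_map_odd: "linear_map (tensor_space A B) (tensor_space A' B') (tensor_map A B A' B' f (-1) g)"
  and tensor_map_odd_apply: "t \<in> elems (tensor_space A B) ==> bilinear_form A' B' \<beta> ==>
   tensor_map A B A' B' f (-1) g t \<beta> = t (\<lambda>a b. \<beta> (f (par A a)) (g b))"
proof -
 have "par A a = smult A ((-1) powi (-1 * p)) a" if "a \<in> hcomp A p" for a p
 proof -
  have "(- p) mod 2 = 0 \<longleftrightarrow> p mod 2 = 0" by presburger
  then show ?thesis using par_hcomp[OF A that] by (simp add: powi_minus_one_parity)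
 qed
 note * = tensor_map_general[OF graded_vs[OF A] v f g lm_par[OF A], of "-1", OF this]
 show "linear_map (tensor_space A B) (tensor_space A' B') (tensor_map A B A' B' f (-1) g)" using * by simp
 show "t \<in> elems (tensor_space A B) ==> bilinear_form A' B' \<beta> ==>
   tensor_map A B A' B' f (-1) g t \<beta> = t (\<lambda>a b. \<beta> (f (par A a)) (g b))" using * by simp
qed

text \<open>The symmetry, transposed to bilinear forms: \<open>swap_form A B \<beta> a b\<close> is
 $(-1)^{|a||b|}\beta(b,a)$ on homogeneous vectors.\<close>

definition swap_form where
 "swap_form A B \<beta> a b = \<beta> (parity_proj B 0 b) a + \<beta> (parity_proj B 1 b) (par A a)"

lemma bf_swap_form:
 assumes "graded_vector_space A" "graded_vector_space B" "bilinear_form B A \<beta>"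
 shows "bilinear_form A B (swap_form A B \<beta>)"
proof -
 have v: "vecsp A" "vecsp B" using assms graded_vs by auto
 show ?thesis
 proof (rule bfI)
  fix b assume b: "b \<in> elems B"
  then have "lform A (\<lambda>a. \<beta> (parity_proj B 0 b) a)" "lform A (\<lambda>a. \<beta> (parity_proj B 1 b) (par A a))"
   using lm_in[OF lm_parity_proj[OF assms(2)]] bf_right[OF assms(3)] by (auto intro: lm_comp[OF lm_par[OF assms(1)]])
  then show "lform A (\<lambda>a. swap_form A B \<beta> a b)" unfolding swap_form_def by (intro lm_plus v vs_simps)
 next
  fix a assume a: "a \<in> elems A"
  then have "lform B (\<lambda>b. \<beta> (parity_proj B 0 b) a)" "lform B (\<lambda>b. \<beta> (parity_proj B 1 b) (par A a))"
   using lm_in[OF lm_par[OF assms(1)]] lm_comp[OF lm_parity_proj[OF assms(2)] bf_left[OF assms(3)]] by auto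
  then show "lform B (\<lambda>b. swap_form A B \<beta> a b)" unfolding swap_form_def by (intro lm_plus v vs_simps)
 qed
qed

lemma tensor_swap:
 fixes A :: "('k::field, 'a::ab_group_add) graded_space" and B :: "('k, 'b::ab_group_add) graded_space"
 assumes A: "graded_vector_space A" and B: "graded_vector_space B"
 shows lm_tensor_swap: "linear_map (tensor_space A B) (tensor_space B A) (tensor_swap A B)"
  and tensor_swap_apply: "t \<in> elems (tensor_space A B) ==> bilinear_form B A \<beta> ==>
   tensor_swap A B t \<beta> = t (swap_form A B \<beta>)"
proof -
 have v: "vecsp A" "vecsp B" using assms graded_vs by auto
 let ?G = "\<lambda>t \<beta>. if bilinear_form B A \<beta> then t (swap_form A B \<beta>) else 0"
 let ?S = "{(tensor A B a b, smult (tensor_space B A) ((-1) powi (p * q)) (tensor B A b a))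
    | a b p q. a \<in> hcomp A p \<and> b \<in> hcomp B q}"
 have hom: "swap_form A B \<beta> a b = (-1) powi (p * q) * \<beta> b a"
  if a: "a \<in> hcomp A p" and b: "b \<in> hcomp B q" and \<beta>: "bilinear_form B A \<beta>" for a b p q \<beta>
 proof -
  have el: "a \<in> elems A" "b \<in> elems B" using that hcomp_elems v by blast+
  have 0: "\<beta> 0 x = 0" if "x \<in> elems A" for x using lm_0[OF v(2) bf_left[OF \<beta> that]] .
  have pa: "par A a \<in> elems A" using lm_in[OF lm_par[OF A]] el by simp
  have "q mod 2 = 0 \<or> q mod 2 = 1" by presburger
  then show ?thesis
  proof
   assume q: "q mod 2 = 0"
   then have "even (p * q)" by auto
   then show ?thesis using q 0 el pa by (simp add: swap_form_def parity_proj_hcomp[OF B b] power_int_minus_left)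
  next
   assume q: "q mod 2 = 1"
   then have "odd q" by (simp add: odd_iff_mod_2_eq_one)
   then have "even (p * q) = even p" by simp
   then show ?thesis using q 0 el pa lm_smult[OF bf_right[OF \<beta> el(2)] el(1)]
    by (simp add: swap_form_def parity_proj_hcomp[OF B b] power_int_minus_left par_hcomp[OF A a])
  qed
 qed
 have G1: "?G (tensor A B a b) = smult (tensor_space B A) ((-1) powi (p * q)) (tensor B A b a)"
  if "a \<in> hcomp A p" "b \<in> hcomp B q" for a b p q
  using hom[OF that] by (auto simp: tensor_def fun_eq_iff bf_swap_form[OF A B])
 have in': "?G t \<in> elems (tensor_space B A)" if "t \<in> elems (tensor_space A B)" for t
  using v that
 proof (induct rule: tens_induct)
  case zero then show ?case by simp
 next
  case (step c a b p q t)
  have "tensor B A b a \<in> elems (tensor_space B A)"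
   using hcomp_elems[OF v(1) step(1)] hcomp_elems[OF v(2) step(2)] v by (intro tensor_in)
  then have "smult (tensor_space B A) c (smult (tensor_space B A) ((-1) powi (p * q)) (tensor B A b a)) + ?G t \<in> elems (tensor_space B A)"
   using step by (simp only: elems_add elems_smult vs_simps)
  moreover have "smult (tensor_space B A) c (smult (tensor_space B A) ((-1) powi (p * q)) (tensor B A b a)) + ?G t
    = ?G (\<lambda>\<beta>. c * tensor A B a b \<beta> + t \<beta>)"
   unfolding G1[OF step(1,2), symmetric] by (auto simp: fun_eq_iff)
  ultimately show ?case by simp
 qed
 have lG: "linear_map (tensor_space A B) (tensor_space B A) ?G"
  by (rule lm_functional[OF in']) (auto simp: algebra_simps)
 have S: "\<forall>x y. (x, y) \<in> ?S \<longrightarrow> x \<in> elems (tensor_space A B) \<and> ?G x = y"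
 proof (intro allI impI)
  fix x y assume xy: "(x, y) \<in> ?S"
  from xy obtain a b p q where x: "x = tensor A B a b" and a: "a \<in> hcomp A p" and b: "b \<in> hcomp B q"
   and y: "y = smult (tensor_space B A) ((-1) powi (p * q)) (tensor B A b a)" by auto
  show "x \<in> elems (tensor_space A B) \<and> ?G x = y" unfolding x y
   using G1[OF a b] tensor_in[OF v hcomp_elems[OF v(1) a] hcomp_elems[OF v(2) b]] by simp
 qed
 have sp: "elems (tensor_space A B) \<subseteq> module.span (smult (tensor_space A B)) (fst ` ?S)"
  by (rule span_generators[OF _ vs_simps(1)], simp, rule elems_tensor[OF v])
   (force simp: image_iff)
 note L = linear_extension[OF vs_simps(1) lG S sp]
 show "linear_map (tensor_space A B) (tensor_space B A) (tensor_swap A B)"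
  unfolding tensor_swap_def by (rule L(1))
 show "t \<in> elems (tensor_space A B) ==> bilinear_form B A \<beta> ==>
   tensor_swap A B t \<beta> = t (swap_form A B \<beta>)"
  unfolding tensor_swap_def using L(2)[of t] by simp
qed

lemma bf_assoc:
 assumes v: "vecsp A" "vecsp B" "vecsp C" and \<gamma>: "bilinear_form A (tensor_space B C) \<gamma>"
 shows bf_assoc_inner: "c \<in> elems C ==> bilinear_form A B (\<lambda>a b. \<gamma> a (tensor B C b c))"
  and bf_assoc_outer: "bilinear_form (tensor_space A B) C (\<lambda>s c. s (\<lambda>a b. \<gamma> a (tensor B C b c)))"
proof -
 show inner: "bilinear_form A B (\<lambda>a b. \<gamma> a (tensor B C b c))" if c: "c \<in> elems C" for c
 proof (rule bfI)
  fix b assume "b \<in> elems B"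
  then show "lform A (\<lambda>a. \<gamma> a (tensor B C b c))" using bf_left[OF \<gamma> tensor_in] v c by simp
 next
  fix a assume "a \<in> elems A"
  then show "lform B (\<lambda>b. \<gamma> a (tensor B C b c))"
   using lm_comp[OF bm_left[OF bm_tensor[OF v(2,3)] c] bf_right[OF \<gamma>]] by simp
 qed
 show "bilinear_form (tensor_space A B) C (\<lambda>s c. s (\<lambda>a b. \<gamma> a (tensor B C b c)))"
 proof (rule bfI)
  show "lform (tensor_space A B) (\<lambda>s. s (\<lambda>a b. \<gamma> a (tensor B C b c)))" for c by (rule lform_eval)
  fix s assume s: "s \<in> elems (tensor_space A B)"
  show "lform C (\<lambda>c. s (\<lambda>a b. \<gamma> a (tensor B C b c)))"
  proof (rule tens_param[OF v s])
   fix a b assume "a \<in> elems A" "b \<in> elems B"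
   then show "lform C (\<lambda>c. \<gamma> a (tensor B C b c))"
    using lm_comp[OF bm_right[OF bm_tensor[OF v(2,3)]] bf_right[OF \<gamma>]] by simp
  qed (rule inner)
 qed
qed

lemma tensor_assoc:
 fixes A :: "('k::field, 'a::ab_group_add) graded_space" and B :: "('k, 'b::ab_group_add) graded_space"
  and C :: "('k, 'c::ab_group_add) graded_space"
 assumes v: "vecsp A" "vecsp B" "vecsp C"
 shows lm_tensor_assoc: "linear_map (tensor_space (tensor_space A B) C) (tensor_space A (tensor_space B C)) (tensor_assoc A B C)"
  and tensor_assoc_apply: "t \<in> elems (tensor_space (tensor_space A B) C) ==> bilinear_form A (tensor_space B C) \<gamma> ==>
   tensor_assoc A B C t \<gamma> = t (\<lambda>s c. s (\<lambda>a b. \<gamma> a (tensor B C b c)))"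
proof -
 let ?L = "tensor_space (tensor_space A B) C" and ?R = "tensor_space A (tensor_space B C)"
 let ?G = "\<lambda>t \<gamma>. if bilinear_form A (tensor_space B C) \<gamma> then t (\<lambda>s c. s (\<lambda>a b. \<gamma> a (tensor B C b c))) else 0"
 let ?S = "{(tensor (tensor_space A B) C (tensor A B a b) c, tensor A (tensor_space B C) a (tensor B C b c))
    | a b c. a \<in> elems A \<and> b \<in> elems B \<and> c \<in> elems C}"
 let ?H = "\<lambda>s c \<gamma>. if bilinear_form A (tensor_space B C) \<gamma> then s (\<lambda>a b. \<gamma> a (tensor B C b c)) else 0"
 have H: "?H s c \<in> elems ?R" if "s \<in> elems (tensor_space A B)" and c: "c \<in> elems C" for s c
  using v(1,2) that(1)
 proof (induct rule: tens_induct)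
  case zero then show ?case by simp
 next
  case (step d a b p q t)
  have "tensor A (tensor_space B C) a (tensor B C b c) \<in> elems ?R"
   using hcomp_elems[OF v(1) step(1)] hcomp_elems[OF v(2) step(2)] v c by (intro tensor_in vs_simps)
  then have "smult ?R d (tensor A (tensor_space B C) a (tensor B C b c)) + ?H t c \<in> elems ?R"
   using step by (simp only: elems_add elems_smult vs_simps)
  moreover have "smult ?R d (tensor A (tensor_space B C) a (tensor B C b c)) + ?H t c = ?H (\<lambda>\<beta>. d * tensor A B a b \<beta> + t \<beta>) c"
   using bf_assoc_inner[OF v _ c] by (auto simp: fun_eq_iff tensor_def[of A "tensor_space B C"])
  ultimately show ?case by simp
 qed
 have G1: "?G (tensor (tensor_space A B) C s c) = ?H s c" for s c
  using bf_assoc_outer[OF v] by (auto simp: fun_eq_iff)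
 define G where "G t = ?G t" for t :: "((('a => 'b => 'k) => 'k) => 'c => 'k) => 'k"
 have in': "G t \<in> elems ?R" if "t \<in> elems ?L" for t
  using vs_simps(1) v(3) that
 proof (induct rule: tens_induct)
  case zero then show ?case by (simp add: G_def)
 next
  case (step d s c p q t)
  have "s \<in> elems (tensor_space A B)" "c \<in> elems C" using step(1,2) hcomp_elems v(3) vs_simps(1) by blast+
  then have "smult ?R d (?H s c) + G t \<in> elems ?R"
   using step H by (simp only: elems_add elems_smult vs_simps)
  moreover have "smult ?R d (?H s c) + G t = G (\<lambda>\<beta>. d * tensor (tensor_space A B) C s c \<beta> + t \<beta>)"
   by (auto simp: fun_eq_iff G_def bf_assoc_outer[OF v])
  ultimately show ?case by simp
 qed
 have lG: "linear_map ?L ?R G"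
  by (rule lm_functional[OF in']) (auto simp: G_def algebra_simps)
 have S: "\<forall>x y. (x, y) \<in> ?S \<longrightarrow> x \<in> elems ?L \<and> G x = y"
 proof (intro allI impI)
  fix x y assume xy: "(x, y) \<in> ?S"
  from xy obtain a b c where x: "x = tensor (tensor_space A B) C (tensor A B a b) c"
   and abc: "a \<in> elems A" "b \<in> elems B" "c \<in> elems C"
   and y: "y = tensor A (tensor_space B C) a (tensor B C b c)" by auto
  have "G x = y" unfolding x y G_def G1
   using bf_assoc_inner[OF v _ abc(3)] by (auto simp: fun_eq_iff tensor_def[of A "tensor_space B C"])
  then show "x \<in> elems ?L \<and> G x = y" using tensor_in[OF vs_simps(1) v(3) tensor_in[OF v(1,2)]] abc unfolding x by simp
 qed
 have sp: "elems ?L \<subseteq> module.span (smult ?L) (fst ` ?S)"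
 proof
  interpret vector_space "fscale :: _ => (((('a => 'b => 'k) => 'k) => 'c => 'k) => 'k) => _"
   by (rule vector_space_fscale)
  have inner: "tensor (tensor_space A B) C s c \<in> span (fst ` ?S)"
   if "s \<in> elems (tensor_space A B)" and c: "c \<in> elems C" for s c
   using v(1,2) that(1)
  proof (induct rule: tens_induct)
   case zero
   have "tensor (tensor_space A B) C 0 c = 0"
    using lm_0[OF vs_simps(1) bm_left[OF bm_tensor[OF vs_simps(1) v(3)] c]] .
   then show ?case using span_zero[of "fst ` ?S"] by (simp only: zero_fun_def)
  next
   case (step d a b p q s)
   have el: "a \<in> elems A" "b \<in> elems B" using step(1,2) hcomp_elems v by blast+
   have lm: "linear_map (tensor_space A B) ?L (\<lambda>s. tensor (tensor_space A B) C s c)"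
    using bm_left[OF bm_tensor[OF vs_simps(1) v(3)] c] .
   have ab: "tensor A B a b \<in> elems (tensor_space A B)" using tensor_in[OF v(1,2) el] .
   have "tensor (tensor_space A B) C (\<lambda>\<beta>. d * tensor A B a b \<beta> + s \<beta>) c
    = fscale d (tensor (tensor_space A B) C (tensor A B a b) c) + tensor (tensor_space A B) C s c"
    using lm_add[OF lm elems_smult[OF vs_simps(1) ab] step(3)] lm_smult[OF lm ab] by (simp add: plus_fun_def)
   moreover have "tensor (tensor_space A B) C (tensor A B a b) c \<in> fst ` ?S"
    using el c by (force simp: image_iff)
   ultimately show ?case using step(4) by (simp only: span_add span_scale span_base)
  qed
  fix t assume "t \<in> elems ?L"
  with vs_simps(1)[of A B] v(3) have "t \<in> span (fst ` ?S)"
  proof (induct rule: tens_induct)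
   case zero then show ?case using span_zero[of "fst ` ?S"] by (simp only: zero_fun_def)
  next
   case (step d s c p q t)
   have "s \<in> elems (tensor_space A B)" "c \<in> elems C" using step(1,2) hcomp_elems v(3) vs_simps(1) by blast+
   from span_add[OF span_scale[OF inner[OF this]] step(4), of d] show ?case by (simp only: plus_fun_def)
  qed
  then show "t \<in> module.span (smult ?L) (fst ` ?S)" by simp
 qed
 note L = linear_extension[OF vs_simps(1) lG S sp]
 show "linear_map ?L ?R (tensor_assoc A B C)"
  unfolding tensor_assoc_def by (rule L(1))
 show "t \<in> elems ?L ==> bilinear_form A (tensor_space B C) \<gamma> ==>
   tensor_assoc A B C t \<gamma> = t (\<lambda>s c. s (\<lambda>a b. \<gamma> a (tensor B C b c)))"
  unfolding tensor_assoc_def using L(2)[of t] by (simp add: G_def)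
qed

section \<open>Zinbiel structures on words\<close>

subsection \<open>Permuting the letters of a word\<close>

text \<open>\<open>pm vs \<sigma>\<close> is the word $v_{\sigma(1)} \dots v_{\sigma(n)}$.\<close>

definition pm :: "'a list => (nat => nat) => 'a list" where
 "pm vs \<sigma> = slice vs \<sigma> 1 (length vs)"

lemma length_slice [simp]: "length (slice vs \<sigma> a b) = Suc b - a"
 by (simp add: slice_def del: upt_Suc)

lemma nth_slice: "i < Suc b - a ==> slice vs \<sigma> a b ! i = vs ! (\<sigma> (a + i) - 1)"
 by (simp add: slice_def del: upt_Suc)

lemma length_pm [simp]: "length (pm vs \<sigma>) = length vs"
 by (simp add: pm_def)

lemma nth_pm: "i < length vs ==> pm vs \<sigma> ! i = vs ! (\<sigma> (Suc i) - 1)"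
 by (simp add: pm_def nth_slice)

lemma slice_eq_take: "k \<le> length vs ==> slice vs \<sigma> 1 k = take k (pm vs \<sigma>)"
 by (rule nth_equalityI) (auto simp: nth_slice nth_pm)

lemma slice_eq_drop: "slice vs \<sigma> (Suc k) (length vs) = drop k (pm vs \<sigma>)"
 by (rule nth_equalityI) (auto simp: nth_slice nth_pm)

lemma slice_snoc:
 assumes "\<sigma> (length vs) = length vs" "k < length vs"
 shows "slice vs \<sigma> (Suc k) (length vs - 1) @ [last vs] = drop k (pm vs \<sigma>)"
proof -
 have "last vs = vs ! (length vs - 1)" using assms(2) by (intro last_conv_nth) auto
 moreover have "Suc (k + i) = length vs" if "i < Suc (length vs - Suc k)" "\<not> i < length vs - Suc k" for i
  using that assms(2) by simp
 ultimately show ?thesis using assms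
  by (intro nth_equalityI) (auto simp: nth_slice nth_pm nth_append)
qed

lemma permutes_range: "\<sigma> permutes {1..n} ==> i < n ==> \<sigma> (Suc i) - 1 < n"
 using permutes_in_image[of \<sigma> "{1..n}" "Suc i"] by auto

lemma set_pm: "\<sigma> permutes {1..length vs} ==> set (pm vs \<sigma>) \<subseteq> set vs"
proof
 fix x assume "\<sigma> permutes {1..length vs}" "x \<in> set (pm vs \<sigma>)"
 then obtain i where "i < length vs" "x = vs ! (\<sigma> (Suc i) - 1)" by (auto simp: in_set_conv_nth nth_pm)
 then show "x \<in> set vs" using permutes_range[OF \<open>\<sigma> permutes {1..length vs}\<close>] by simp
qed

lemma pm_update:
 assumes \<sigma>: "\<sigma> permutes {1..length vs}" and i: "i < length vs"
 shows "pm (vs[i := v]) \<sigma> = (pm vs \<sigma>)[inv \<sigma> (Suc i) - 1 := v]" and "inv \<sigma> (Suc i) - 1 < length vs"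
proof -
 show *: "inv \<sigma> (Suc i) - 1 < length vs" using permutes_range[OF permutes_inv[OF \<sigma>] i] .
 have inv: "inv \<sigma> (Suc i) \<in> {1..length vs}"
  using permutes_in_image[OF permutes_inv[OF \<sigma>], of "Suc i"] i by simp
 have eq: "(\<sigma> (Suc j) - 1 = i) = (j = inv \<sigma> (Suc i) - 1)" if "j < length vs" for j
 proof -
  have "\<sigma> (Suc j) \<ge> 1" using permutes_in_image[OF \<sigma>, of "Suc j"] that by simp
  then have "(\<sigma> (Suc j) - 1 = i) = (\<sigma> (Suc j) = Suc i)" by auto
  also have "\<dots> = (Suc j = inv \<sigma> (Suc i))" using permutes_inverses[OF \<sigma>] by metis
  also have "\<dots> = (j = inv \<sigma> (Suc i) - 1)" using inv by auto
  finally show ?thesis .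
 qed
 show "pm (vs[i := v]) \<sigma> = (pm vs \<sigma>)[inv \<sigma> (Suc i) - 1 := v]"
 proof (rule nth_equalityI)
  fix j assume "j < length (pm (vs[i := v]) \<sigma>)"
  then have j: "j < length vs" by simp
  have "pm (vs[i := v]) \<sigma> ! j = (if i = \<sigma> (Suc j) - 1 then v else vs ! (\<sigma> (Suc j) - 1))"
   using j permutes_range[OF \<sigma> j] by (simp only: nth_pm length_list_update nth_list_update[OF i])
  also have "\<dots> = (if inv \<sigma> (Suc i) - 1 = j then v else pm vs \<sigma> ! j)"
   using eq[OF j] j by (simp only: nth_pm eq_commute)
  also have "\<dots> = (pm vs \<sigma>)[inv \<sigma> (Suc i) - 1 := v] ! j"
   using * by (simp only: nth_list_update length_pm)
  finally show "pm (vs[i := v]) \<sigma> ! j = (pm vs \<sigma>)[inv \<sigma> (Suc i) - 1 := v] ! j" .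
 qed simp
qed

lemma ml_pm:
 assumes "vecsp U" "vecsp W" "\<sigma> permutes {1..n}" "multilinear U W B"
 shows "multilinear U W (\<lambda>vs. if length vs = n then B (pm vs \<sigma>) else 0)"
proof (rule mlI[OF assms(1)])
 fix vs i assume vs: "set vs \<subseteq> elems U" "i < length vs"
 show "linear_map U W (\<lambda>v. if length (vs[i := v]) = n then B (pm (vs[i := v]) \<sigma>) else 0)"
 proof (cases "length vs = n")
  case True
  then have \<sigma>: "\<sigma> permutes {1..length vs}" using assms by simp
  have "set (pm vs \<sigma>) \<subseteq> elems U" using set_pm[OF \<sigma>] vs by auto
  then show ?thesis using True pm_update[OF \<sigma> vs(2)] ml_upd[OF assms(4), of "pm vs \<sigma>"] by simp
 qed (simp add: lm_zeroI assms)
qed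

lemma Sh_permutes: "\<sigma> \<in> Sh ks ==> \<sigma> permutes {1..sum_list ks}"
 by (simp add: Sh_def)

lemma finite_Sh [simp]: "finite (Sh ks)"
 by (rule finite_subset[OF _ finite_permutations[of "{1..sum_list ks}"]]) (auto simp: Sh_def)

lemma Sh_two:
 assumes "\<sigma> \<in> Sh [k, n - k - 1]" "k < n"
 shows Sh_two_permutes: "\<sigma> permutes {1..n - 1}" "\<sigma> permutes {1..n}" and Sh_two_last: "\<sigma> n = n"
proof -
 show 1: "\<sigma> permutes {1..n - 1}" using Sh_permutes[OF assms(1)] assms(2) by simp
 show "\<sigma> permutes {1..n}" by (rule permutes_subset[OF 1]) auto
 show "\<sigma> n = n" by (rule permutes_not_in[OF 1]) (use assms in auto)
qed

lemma sign_parity_cong: "a mod 2 = b mod 2 ==> (-1 :: 'k::field) powi a = (-1) powi b"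
 by (simp add: powi_minus_one_parity)

lemma koszul_parity:
 assumes "\<sigma> permutes {1..length ds}"
 shows "koszul (map (\<lambda>d. d mod 2) ds) \<sigma> = (koszul ds \<sigma> :: 'k::field)"
 unfolding koszul_def
proof (rule prod.cong)
 fix x assume "x \<in> {(a, b). 1 \<le> a \<and> a < b \<and> b \<le> length ds \<and> \<sigma> b < \<sigma> a}"
 then obtain a b where x: "x = (a, b)" "1 \<le> a" "a < b" "b \<le> length ds" by auto
 have "\<sigma> a - 1 < length ds" "\<sigma> b - 1 < length ds"
  using permutes_range[OF assms, of "a - 1"] permutes_range[OF assms, of "b - 1"] x by auto
 then show "(case x of (a, b) => (-1 :: 'k) powi (map (\<lambda>d. d mod 2) ds ! (\<sigma> a - 1) * map (\<lambda>d. d mod 2) ds ! (\<sigma> b - 1)))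
  = (case x of (a, b) => (-1) powi (ds ! (\<sigma> a - 1) * ds ! (\<sigma> b - 1)))"
  unfolding x prod.case by (intro sign_parity_cong) (simp only: nth_map mod_mult_eq)
qed simp

lemma homogeneous_nth: "homogeneous U ds vs \<longleftrightarrow> vs \<noteq> [] \<and> length ds = length vs \<and> (\<forall>i<length vs. vs ! i \<in> hcomp U (ds ! i))"
 by (auto simp: homogeneous_def list_all2_conv_all_nth)

lemma homogeneous_length: "homogeneous U ds vs ==> length ds = length vs"
 by (simp add: homogeneous_nth)

lemma homogeneous_pm:
 assumes "homogeneous U ds vs" "\<sigma> permutes {1..length vs}"
 shows "homogeneous U (pm ds \<sigma>) (pm vs \<sigma>)"
proof -
 have "pm vs \<sigma> \<noteq> []" using assms(1) length_pm[of vs \<sigma>] unfolding homogeneous_nth by (metis length_0_conv)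
 moreover have "pm vs \<sigma> ! i \<in> hcomp U (pm ds \<sigma> ! i)" if "i < length vs" for i
  using assms(1) permutes_range[OF assms(2) that] that by (simp only: nth_pm homogeneous_nth)
 ultimately show ?thesis using assms(1) by (simp add: homogeneous_nth)
qed

lemma homogeneous_take: "homogeneous U ds vs ==> 0 < k ==> homogeneous U (take k ds) (take k vs)"
 by (auto simp: homogeneous_nth)

lemma homogeneous_drop: "homogeneous U ds vs ==> k < length vs ==> homogeneous U (drop k ds) (drop k vs)"
 by (auto simp: homogeneous_nth)

lemma homogeneous_append:
 "homogeneous U ds vs ==> homogeneous U ds' vs' ==> homogeneous U (ds @ ds') (vs @ vs')"
 by (auto simp: homogeneous_def intro: list_all2_appendI)

lemma homogeneous_singleton: "u \<in> hcomp U d ==> homogeneous U [d] [u]"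
 by (simp add: homogeneous_def)

lemma words_append: "vs \<in> words U ==> set ws \<subseteq> elems U ==> vs @ ws \<in> words U"
 by (simp add: words_def)

subsection \<open>The coproduct\<close>

definition unshuffle_form where
 "unshuffle_form U n k \<sigma> \<beta> =
  twist U ground (\<lambda>ps. koszul ps \<sigma>)
   (\<lambda>vs. if length vs = n then \<beta> (pure U (take k (pm vs \<sigma>))) (pure U (drop k (pm vs \<sigma>))) else 0)"

text \<open>Cutting a permuted word in two and tensoring the parts is multilinear in the word, so the
 summands of the coproduct may be prescribed on homogeneous words.\<close>

lemma ml_split:
 assumes U: "vecsp U" and \<beta>: "bilinear_form (tensor_module U) (tensor_module U) \<beta>" and k: "0 < k"
 shows "multilinear U ground (\<lambda>vs. if k < length vs then \<beta> (pure U (take k vs)) (pure U (drop k vs)) else 0)"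
proof (rule mlI[OF U])
 fix vs i assume vs: "set vs \<subseteq> elems U" "i < length vs"
 have tk: "set (take k vs) \<subseteq> elems U" "set (drop k vs) \<subseteq> elems U"
  using vs by (auto dest: in_set_takeD in_set_dropD)
 show "lform U (\<lambda>v. if k < length (vs[i := v]) then \<beta> (pure U (take k (vs[i := v]))) (pure U (drop k (vs[i := v]))) else 0)"
 proof (cases "k < length vs")
  case True
  then have "take k vs \<in> words U" "drop k vs \<in> words U" using tk k by (auto simp: words_def)
  then have p: "pure U (take k vs) \<in> elems (tensor_module U)" "pure U (drop k vs) \<in> elems (tensor_module U)"
   by (auto intro: pure_in[OF U])
  show ?thesis
  proof (cases "i < k")
   case i: True
   have "linear_map U (tensor_module U) (\<lambda>v. pure U ((take k vs)[i := v]))"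
    using ml_upd[OF ml_pure[OF U] tk(1), of i] vs i by simp
   from lm_comp[OF this bf_left[OF \<beta> p(2)]] show ?thesis using True i by (simp add: take_update_swap)
  next
   case i: False
   have "linear_map U (tensor_module U) (\<lambda>v. pure U ((drop k vs)[i - k := v]))"
    using ml_upd[OF ml_pure[OF U] tk(2), of "i - k"] vs i by simp
   from lm_comp[OF this bf_right[OF \<beta> p(1)]] show ?thesis using True i by (simp add: drop_update_swap)
  qed
 qed (simp add: lm_zeroI U)
qed

lemma
 assumes U: "graded_vector_space U" and \<beta>: "bilinear_form (tensor_module U) (tensor_module U) \<beta>"
  and k: "0 < k" "k < n" and \<sigma>: "\<sigma> permutes {1..n}"
 shows ml_unshuffle_form: "multilinear U ground (unshuffle_form U n k \<sigma> \<beta>)"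
  and unshuffle_form_homogeneous: "homogeneous U ds vs ==> length vs = n ==>
   unshuffle_form U n k \<sigma> \<beta> vs = koszul ds \<sigma> * \<beta> (pure U (take k (pm vs \<sigma>))) (pure U (drop k (pm vs \<sigma>)))"
proof -
 have v: "vecsp U" using U by (rule graded_vs)
 have eq: "(\<lambda>vs. if length vs = n then \<beta> (pure U (take k (pm vs \<sigma>))) (pure U (drop k (pm vs \<sigma>))) else 0) =
  (\<lambda>vs. if length vs = n then (\<lambda>vs. if k < length vs then \<beta> (pure U (take k vs)) (pure U (drop k vs)) else 0) (pm vs \<sigma>) else 0)"
  using k by auto
 have ml: "multilinear U ground (\<lambda>vs. if length vs = n then \<beta> (pure U (take k (pm vs \<sigma>))) (pure U (drop k (pm vs \<sigma>))) else 0)"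
  unfolding eq by (rule ml_pm[OF v _ \<sigma> ml_split[OF v \<beta> k(1)]]) simp
 show "multilinear U ground (unshuffle_form U n k \<sigma> \<beta>)"
  unfolding unshuffle_form_def by (rule ml_twist[OF U _ ml]) simp
 assume vs: "homogeneous U ds vs" "length vs = n"
 then have "koszul (map (\<lambda>d. d mod 2) ds) \<sigma> = (koszul ds \<sigma> :: 'a)"
  using \<sigma> by (intro koszul_parity) (simp add: homogeneous_length)
 then show "unshuffle_form U n k \<sigma> \<beta> vs = koszul ds \<sigma> * \<beta> (pure U (take k (pm vs \<sigma>))) (pure U (drop k (pm vs \<sigma>)))"
  unfolding unshuffle_form_def using twist_homogeneous[OF U _ ml vs(1), of "\<lambda>ps. koszul ps \<sigma>"] vs(2) by simp
qed

lemma zin_coproduct: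
 fixes U :: "('k::field, 'a::ab_group_add) graded_space"
 assumes U: "graded_vector_space U"
 shows lm_zin_coproduct: "linear_map (tensor_module U) (tensor_space (tensor_module U) (tensor_module U)) (zin_coproduct U)"
  and zin_coproduct_pure: "homogeneous U ds vs ==> bilinear_form (tensor_module U) (tensor_module U) \<beta> ==>
   zin_coproduct U (pure U vs) \<beta> =
    (\<Sum>k=1..length vs - 1. \<Sum>\<sigma>\<in>Sh [k, length vs - k - 1].
     koszul ds \<sigma> * \<beta> (pure U (take k (pm vs \<sigma>))) (pure U (drop k (pm vs \<sigma>))))"
proof -
 have v: "vecsp U" using U by (rule graded_vs)
 let ?T = "tensor_module U"
 let ?TT = "tensor_space ?T ?T"
 define cf where "cf \<beta> n vs = (\<Sum>k=1..n - 1. \<Sum>\<sigma>\<in>Sh [k, n - k - 1]. unshuffle_form U n k \<sigma> \<beta> vs)" for \<beta> n vs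
 define G where "G x = (\<lambda>\<beta>. if bilinear_form ?T ?T \<beta> then x (\<lambda>vs. cf \<beta> (length vs) vs) else 0)"
  for x :: "('a list => 'k) => 'k"
 have per: "0 < k \<and> k < n \<and> \<sigma> permutes {1..n}" if "k \<in> {1..n - 1}" "\<sigma> \<in> Sh [k, n - k - 1]" for k n \<sigma>
 proof -
  have "0 < k" "k < n" using that by auto
  then show ?thesis using Sh_two_permutes(2)[OF that(2)] by blast
 qed
 have ml: "multilinear U ground (\<lambda>vs. cf \<beta> (length vs) vs)" if "bilinear_form ?T ?T \<beta>" for \<beta>
  unfolding cf_def by (rule ml_length, (rule ml_sumI[OF v], simp)+, rule ml_unshuffle_form[OF U that])
   (use per in blast)+
 have cf: "cf \<beta> (length vs) vs = (\<Sum>k=1..length vs - 1. \<Sum>\<sigma>\<in>Sh [k, length vs - k - 1].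
     koszul ds \<sigma> * \<beta> (pure U (take k (pm vs \<sigma>))) (pure U (drop k (pm vs \<sigma>))))"
  if "homogeneous U ds vs" "bilinear_form ?T ?T \<beta>" for ds vs \<beta>
  unfolding cf_def by (intro sum.cong refl unshuffle_form_homogeneous[OF U that(2) _ _ _ that(1)])
   (use per in blast)+
 define R where "R ds vs = (\<Sum>k=1..length vs - 1. \<Sum>\<sigma>\<in>Sh [k, length vs - k - 1].
     smult ?TT (koszul ds \<sigma>) (tensor ?T ?T (pure U (slice vs \<sigma> 1 k)) (pure U (slice vs \<sigma> (k + 1) (length vs - 1) @ [last vs]))))"
  for ds vs
 have sl: "slice vs \<sigma> 1 k = take k (pm vs \<sigma>)" "slice vs \<sigma> (k + 1) (length vs - 1) @ [last vs] = drop k (pm vs \<sigma>)"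
  if "k \<in> {1..length vs - 1}" "\<sigma> \<in> Sh [k, length vs - k - 1]" for vs :: "'a list" and k \<sigma>
 proof -
  have k: "k < length vs" using that(1) by auto
  show "slice vs \<sigma> 1 k = take k (pm vs \<sigma>)" using k by (intro slice_eq_take) simp
  show "slice vs \<sigma> (k + 1) (length vs - 1) @ [last vs] = drop k (pm vs \<sigma>)"
   using slice_snoc[of \<sigma> vs k] Sh_two_last[OF that(2) k] k by simp
 qed
 have R: "R ds vs = (\<Sum>k=1..length vs - 1. \<Sum>\<sigma>\<in>Sh [k, length vs - k - 1].
     smult ?TT (koszul ds \<sigma>) (tensor ?T ?T (pure U (take k (pm vs \<sigma>))) (pure U (drop k (pm vs \<sigma>)))))" for ds vs
  unfolding R_def by (intro sum.cong refl) (simp only: sl)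
 have GR: "G (pure U vs) = R ds vs" if "homogeneous U ds vs" for ds vs
 proof
  fix \<beta> show "G (pure U vs) \<beta> = R ds vs \<beta>"
   by (cases "bilinear_form ?T ?T \<beta>") (simp_all add: G_def R ml cf[OF that] sum_fun_apply tensor_nonbilinear)
 qed
 have Rin: "R ds vs \<in> elems ?TT" if "homogeneous U ds vs" for ds vs
  unfolding R
 proof (intro elems_sum elems_smult tensor_in pure_in v vs_simps)
  fix k \<sigma> assume k: "k \<in> {1..length vs - 1}" "\<sigma> \<in> Sh [k, length vs - k - 1]"
  have p: "0 < k \<and> k < length vs \<and> \<sigma> permutes {1..length vs}" by (rule per[OF k])
  then have h: "homogeneous U (pm ds \<sigma>) (pm vs \<sigma>)" by (intro homogeneous_pm[OF that]) blast
  show "take k (pm vs \<sigma>) \<in> words U" "drop k (pm vs \<sigma>) \<in> words U"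
   using homogeneous_words[OF v homogeneous_take[OF h, of k]] homogeneous_words[OF v homogeneous_drop[OF h, of k]] p by simp_all
 qed
 have in': "G x \<in> elems ?TT" if "x \<in> elems ?T" for x
  using v that
 proof (induct rule: tmod_induct)
  case zero then show ?case by (simp add: G_def)
 next
  case (step c ds vs x)
  have "G (\<lambda>\<beta>. c * pure U vs \<beta> + x \<beta>) = smult ?TT c (G (pure U vs)) + G x"
   by (auto simp: G_def fun_eq_iff)
  then show ?case using step Rin[OF step(1)] GR[OF step(1)] by (simp only: elems_add elems_smult vs_simps)
 qed
 have lG: "linear_map ?T ?TT G"
  by (rule lm_functional[OF in']) (auto simp: G_def algebra_simps)
 let ?S = "{(pure U vs,
    let p = length vs in
    \<Sum>k=1..p-1. \<Sum>\<sigma>\<in>Sh [k, p - k - 1].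
     smult (tensor_space (tensor_module U) (tensor_module U)) (koszul ds \<sigma>)
      (tensor (tensor_module U) (tensor_module U)
       (pure U (slice vs \<sigma> 1 k)) (pure U (slice vs \<sigma> (k + 1) (p - 1) @ [last vs]))))
    | vs ds. homogeneous U ds vs}"
 have S: "\<forall>x y. (x, y) \<in> ?S \<longrightarrow> x \<in> elems ?T \<and> G x = y"
 proof (intro allI impI)
  fix x y assume "(x, y) \<in> ?S"
  then obtain ds vs where "x = pure U vs" "homogeneous U ds vs" "y = R ds vs" by (auto simp: R_def Let_def)
  then show "x \<in> elems ?T \<and> G x = y" using GR pure_in[OF v] homogeneous_words[OF v] by auto
 qed
 have sp: "elems ?T \<subseteq> module.span (smult ?T) (fst ` ?S)"
  by (rule span_generators[OF _ vs_simps(2)], simp, rule elems_tensor_module) (force simp: image_iff)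
 note L = linear_extension[OF vs_simps(2) lG S sp]
 show "linear_map ?T ?TT (zin_coproduct U)" unfolding zin_coproduct_def by (rule L(1))
 assume vs: "homogeneous U ds vs" "bilinear_form ?T ?T \<beta>"
 have "zin_coproduct U (pure U vs) = G (pure U vs)"
  unfolding zin_coproduct_def by (rule L(2)) (use vs pure_in[OF v] homogeneous_words[OF v] in auto)
 then show "zin_coproduct U (pure U vs) \<beta> =
    (\<Sum>k=1..length vs - 1. \<Sum>\<sigma>\<in>Sh [k, length vs - k - 1].
     koszul ds \<sigma> * \<beta> (pure U (take k (pm vs \<sigma>))) (pure U (drop k (pm vs \<sigma>))))"
  by (simp add: G_def ml[OF vs(2)] cf[OF vs] vs(2))
qed

subsection \<open>The product\<close>

lemma zin_product:
 fixes U :: "('k::field, 'a::ab_group_add) graded_space"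
 assumes U: "graded_vector_space U"
 shows lm_zin_product: "linear_map (tensor_space (tensor_module U) (tensor_module U)) (tensor_module U) (zin_product U)"
  and zin_product_pure: "homogeneous U cs us ==> homogeneous U ds vs ==> multilinear U ground \<beta> ==>
   zin_product U (tensor (tensor_module U) (tensor_module U) (pure U us) (pure U vs)) \<beta> =
    (\<Sum>\<sigma>\<in>Sh [length us, length vs - 1]. koszul (cs @ ds) (inv \<sigma>) * \<beta> (pm (us @ vs) (inv \<sigma>)))"
proof -
 have v: "vecsp U" using U by (rule graded_vs)
 let ?T = "tensor_module U"
 let ?TT = "tensor_space ?T ?T"
 define pr where "pr \<beta> p q = (\<lambda>zs. \<Sum>\<sigma>\<in>Sh [p, q - 1]. twist U ground (\<lambda>ps. koszul ps (inv \<sigma>))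
   (\<lambda>zs. if length zs = p + q then \<beta> (pm zs (inv \<sigma>)) else 0) zs)" for \<beta> p q
 have perm: "inv \<sigma> permutes {1..p + q}" if "\<sigma> \<in> Sh [p, q - 1]" for \<sigma> p q
  using permutes_subset[OF permutes_inv[OF Sh_permutes[OF that]], of "{1..p + q}"] by auto
 have ml: "multilinear U ground (\<lambda>zs. if length zs = p + q then \<beta> (pm zs (inv \<sigma>)) else 0)"
  if "multilinear U ground \<beta>" "\<sigma> \<in> Sh [p, q - 1]" for \<beta> p q \<sigma>
  by (rule ml_pm[OF v _ perm[OF that(2)] that(1)]) simp
 have mlpr: "multilinear U ground (pr \<beta> p q)" if "multilinear U ground \<beta>" for \<beta> p q
  unfolding pr_def by (rule ml_sumI[OF v], simp, rule ml_twist[OF U _ ml[OF that]]) simp_all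
 define P where "P \<beta> us vs = pr \<beta> (length us) (length vs) (us @ vs)" for \<beta> us vs
 have mlP: "multilinear U ground (P \<beta> us)" "\<And>vs. set vs \<subseteq> elems U ==> multilinear U ground (\<lambda>us. P \<beta> us vs)"
  if \<beta>: "multilinear U ground \<beta>" and us: "set us \<subseteq> elems U" for \<beta> us
 proof -
  show "multilinear U ground (P \<beta> us)"
   unfolding P_def[abs_def] by (rule ml_length, rule ml_append_left[OF mlpr[OF \<beta>] us])
  show "multilinear U ground (\<lambda>us. P \<beta> us vs)" if vs: "set vs \<subseteq> elems U" for vs
   unfolding P_def by (rule ml_length, rule ml_append_right[OF mlpr[OF \<beta>] vs])
 qed
 define G where "G t = (\<lambda>\<beta>. if multilinear U ground \<beta> then t (\<lambda>x y. x (\<lambda>us. y (P \<beta> us))) else 0)"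
  for t :: "((('a list => 'k) => 'k) => (('a list => 'k) => 'k) => 'k) => 'k"
 have mlin: "multilinear U ground (\<lambda>us. y (P \<beta> us))" if \<beta>: "multilinear U ground \<beta>" and y: "y \<in> elems ?T" for \<beta> y
  unfolding multilinear_def
 proof (intro allI impI)
  fix xs ys assume *: "set xs \<subseteq> elems U \<and> set ys \<subseteq> elems U"
  show "lform U (\<lambda>v. y (P \<beta> (xs @ v # ys)))"
  proof (rule tmod_param[OF v v y])
   show "multilinear U ground (P \<beta> (xs @ z # ys))" if "z \<in> elems U" for z
    using mlP(1)[OF \<beta>] * that by simp
   show "lform U (\<lambda>z. P \<beta> (xs @ z # ys) vs)" if "vs \<in> words U" for vs
    using mlP(2)[OF \<beta>, of "[]" vs] * that by (simp add: multilinear_def words_def)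
  qed
 qed
 have bil: "bilinear_form ?T ?T (\<lambda>x y. x (\<lambda>us. y (P \<beta> us)))" if \<beta>: "multilinear U ground \<beta>" for \<beta>
 proof (rule bfI)
  show "lform ?T (\<lambda>x. x (\<lambda>us. y (P \<beta> us)))" for y by (rule lform_eval)
  show "lform ?T (\<lambda>y. x (\<lambda>us. y (P \<beta> us)))" if x: "x \<in> elems ?T" for x
   by (rule tmod_param[OF v vs_simps(2) x mlin[OF \<beta>]]) (auto intro: lform_eval)
 qed
 define R where "R cs us ds vs = (\<Sum>\<sigma>\<in>Sh [length us, length vs - 1].
     smult ?T (koszul (cs @ ds) (inv \<sigma>))
      (pure U (slice (us @ vs) (inv \<sigma>) 1 (length us + length vs - 1) @ [last vs])))"
  for cs ds us vs
 have R: "R cs us ds vs = (\<Sum>\<sigma>\<in>Sh [length us, length vs - 1].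
     smult ?T (koszul (cs @ ds) (inv \<sigma>)) (pure U (pm (us @ vs) (inv \<sigma>))))"
  if "homogeneous U ds vs" for cs ds us vs
  unfolding R_def
 proof (intro sum.cong refl)
  fix \<sigma> assume \<sigma>: "\<sigma> \<in> Sh [length us, length vs - 1]"
  have "vs \<noteq> []" using that by (simp add: homogeneous_nth)
  then have "inv \<sigma> (length (us @ vs)) = length (us @ vs)"
   using permutes_not_in[OF permutes_inv[OF Sh_permutes[OF \<sigma>]], of "length (us @ vs)"] by (cases vs) auto
  from slice_snoc[of "inv \<sigma>" "us @ vs" 0] this \<open>vs \<noteq> []\<close>
  show "smult ?T (koszul (cs @ ds) (inv \<sigma>)) (pure U (slice (us @ vs) (inv \<sigma>) 1 (length us + length vs - 1) @ [last vs]))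
   = smult ?T (koszul (cs @ ds) (inv \<sigma>)) (pure U (pm (us @ vs) (inv \<sigma>)))" by simp
 qed
 have prh: "P \<beta> us vs = (\<Sum>\<sigma>\<in>Sh [length us, length vs - 1]. koszul (cs @ ds) (inv \<sigma>) * \<beta> (pm (us @ vs) (inv \<sigma>)))"
  if us: "homogeneous U cs us" and vs: "homogeneous U ds vs" and \<beta>: "multilinear U ground \<beta>" for \<beta> cs us ds vs
  unfolding P_def pr_def
 proof (intro sum.cong refl)
  fix \<sigma> assume \<sigma>: "\<sigma> \<in> Sh [length us, length vs - 1]"
  have "inv \<sigma> permutes {1..length (cs @ ds)}" using perm[OF \<sigma>] us vs by (simp add: homogeneous_length)
  then have "koszul (map (\<lambda>d. d mod 2) (cs @ ds)) (inv \<sigma>) = (koszul (cs @ ds) (inv \<sigma>) :: 'k)"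
   by (rule koszul_parity)
  then show "twist U ground (\<lambda>ps. koszul ps (inv \<sigma>))
    (\<lambda>zs. if length zs = length us + length vs then \<beta> (pm zs (inv \<sigma>)) else 0) (us @ vs)
    = koszul (cs @ ds) (inv \<sigma>) * \<beta> (pm (us @ vs) (inv \<sigma>))"
   using twist_homogeneous[OF U _ ml[OF \<beta> \<sigma>] homogeneous_append[OF us vs], of "\<lambda>ps. koszul ps (inv \<sigma>)"]
   by simp
 qed
 have GR: "G (tensor ?T ?T (pure U us) (pure U vs)) = R cs us ds vs"
  if us: "homogeneous U cs us" and vs: "homogeneous U ds vs" for cs us ds vs
 proof
  fix \<beta> show "G (tensor ?T ?T (pure U us) (pure U vs)) \<beta> = R cs us ds vs \<beta>"
   using mlP(1)[of \<beta> us] mlin[of \<beta> "pure U vs"] pure_in[OF v homogeneous_words[OF v vs]] homogeneous_words[OF v us]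
   by (cases "multilinear U ground \<beta>")
    (simp_all add: G_def R[OF vs] bil sum_fun_apply pure_nonmultilinear prh[OF us vs] words_def)
 qed
 have Rin: "R cs us ds vs \<in> elems ?T" if us: "homogeneous U cs us" and vs: "homogeneous U ds vs" for cs us ds vs
  unfolding R[OF vs]
 proof (intro elems_sum elems_smult pure_in v vs_simps)
  fix \<sigma> assume \<sigma>: "\<sigma> \<in> Sh [length us, length vs - 1]"
  show "pm (us @ vs) (inv \<sigma>) \<in> words U"
   by (rule homogeneous_words[OF v homogeneous_pm[OF homogeneous_append[OF us vs]]]) (use perm[OF \<sigma>] in simp)
 qed
 have Gadd: "G (\<lambda>\<beta>. c * s \<beta> + t \<beta>) = smult ?T c (G s) + G t" for c s t
  by (auto simp: G_def fun_eq_iff)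
 have bmT: "bilinear_map ?T ?T ?TT (tensor ?T ?T)" by (rule bm_tensor) simp_all
 have gen: "\<And>Q. Q (\<lambda>_. 0) ==> (\<And>c s t. Q s ==> Q t ==> Q (\<lambda>\<beta>. c * s \<beta> + t \<beta>)) ==>
   (\<And>cs us ds vs. homogeneous U cs us ==> homogeneous U ds vs ==> Q (tensor ?T ?T (pure U us) (pure U vs))) ==>
   x \<in> elems ?T ==> y \<in> elems ?T ==> Q (tensor ?T ?T x y)" for x y
 proof -
  fix Q assume Q: "Q (\<lambda>_. 0)" "\<And>c s t. Q s ==> Q t ==> Q (\<lambda>\<beta>. c * s \<beta> + t \<beta>)"
   "\<And>cs us ds vs. homogeneous U cs us ==> homogeneous U ds vs ==> Q (tensor ?T ?T (pure U us) (pure U vs))"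
  assume y: "y \<in> elems ?T"
  have expand: "tensor ?T ?T (\<lambda>\<beta>. c * a \<beta> + b \<beta>) y = (\<lambda>\<beta>. c * tensor ?T ?T a y \<beta> + tensor ?T ?T b y \<beta>)"
   if "a \<in> elems ?T" "b \<in> elems ?T" "y \<in> elems ?T" for a b c y
   using lm_add[OF bm_left[OF bmT that(3)], of "fscale c a" b] lm_smult[OF bm_left[OF bmT that(3)], of a c]
    that elems_smult[of ?T a c] by (simp add: plus_fun_def)
  have expand': "tensor ?T ?T y (\<lambda>\<beta>. c * a \<beta> + b \<beta>) = (\<lambda>\<beta>. c * tensor ?T ?T y a \<beta> + tensor ?T ?T y b \<beta>)"
   if "a \<in> elems ?T" "b \<in> elems ?T" "y \<in> elems ?T" for a b c y
   using lm_add[OF bm_right[OF bmT that(3)], of "fscale c a" b] lm_smult[OF bm_right[OF bmT that(3)], of a c]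
    that elems_smult[of ?T a c] by (simp add: plus_fun_def)
  have z: "tensor ?T ?T (\<lambda>_. 0) y = (\<lambda>_. 0)" if "y \<in> elems ?T" for y
   using lm_0[OF vs_simps(2) bm_left[OF bmT that]] by (simp add: zero_fun_def)
  have z': "tensor ?T ?T y (\<lambda>_. 0) = (\<lambda>_. 0)" if "y \<in> elems ?T" for y
   using lm_0[OF vs_simps(2) bm_right[OF bmT that]] by (simp add: zero_fun_def)
  note pin = pure_in[OF v homogeneous_words[OF v]]
  have 1: "Q (tensor ?T ?T (pure U us) y)" if us: "homogeneous U cs us" for cs us
   using v y
  proof (induct rule: tmod_induct)
   case zero show ?case unfolding z'[OF pin[OF us]] by (rule Q(1))
  next
   case (step c ds vs x)
   show ?case unfolding expand'[OF pin[OF step(1)] step(2) pin[OF us]]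
    by (rule Q(2)[OF Q(3)[OF us step(1)] step(3)])
  qed
  assume "x \<in> elems ?T"
  with v show "Q (tensor ?T ?T x y)"
  proof (induct rule: tmod_induct)
   case zero show ?case unfolding z[OF y] by (rule Q(1))
  next
   case (step c ds vs x)
   show ?case unfolding expand[OF pin[OF step(1)] step(2) y]
    by (rule Q(2)[OF 1[OF step(1)] step(3)])
  qed
 qed
 have in': "G t \<in> elems ?T" if "t \<in> elems ?TT" for t
  using vs_simps(2) vs_simps(2) that
 proof (induct rule: tens_induct)
  case zero then show ?case by (simp add: G_def)
 next
  case (step c x y p q t)
  have el: "x \<in> elems ?T" "y \<in> elems ?T" using step(1,2) hcomp_elems vs_simps(2) by blast+
  have "G (tensor ?T ?T x y) \<in> elems ?T"
  proof (rule gen[OF _ _ _ el])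
   show "G (\<lambda>_. 0) \<in> elems ?T" by (simp add: G_def)
   show "G (\<lambda>\<beta>. c * s \<beta> + t \<beta>) \<in> elems ?T" if "G s \<in> elems ?T" "G t \<in> elems ?T" for c s t
    unfolding Gadd using that by (simp only: elems_add elems_smult vs_simps)
   show "G (tensor ?T ?T (pure U us) (pure U vs)) \<in> elems ?T" if "homogeneous U cs us" "homogeneous U ds vs" for cs us ds vs
    using GR[OF that] Rin[OF that] by simp
  qed
  then show ?case unfolding Gadd using step by (simp only: elems_add elems_smult vs_simps)
 qed
 have lG: "linear_map ?TT ?T G"
  by (rule lm_functional[OF in']) (auto simp: G_def)
 let ?S = "{(tensor (tensor_module U) (tensor_module U) (pure U us) (pure U vs),
    let p = length us; q = length vs in
    \<Sum>\<sigma>\<in>Sh [p, q - 1].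
     smult (tensor_module U) (koszul (cs @ ds) (inv \<sigma>))
      (pure U (slice (us @ vs) (inv \<sigma>) 1 (p + q - 1) @ [last vs])))
    | us cs vs ds. homogeneous U cs us \<and> homogeneous U ds vs}"
 have S: "\<forall>x y. (x, y) \<in> ?S \<longrightarrow> x \<in> elems ?TT \<and> G x = y"
 proof (intro allI impI)
  fix x y assume "(x, y) \<in> ?S"
  then obtain cs us ds vs where x: "x = tensor ?T ?T (pure U us) (pure U vs)" and
   h: "homogeneous U cs us" "homogeneous U ds vs" and y: "y = R cs us ds vs" by (auto simp: R_def Let_def)
  show "x \<in> elems ?TT \<and> G x = y" unfolding x y
   using GR[OF h] tensor_in[OF vs_simps(2,2) pure_in[OF v homogeneous_words[OF v h(1)]] pure_in[OF v homogeneous_words[OF v h(2)]]] by simp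
 qed
 have sp: "elems ?TT \<subseteq> module.span (smult ?TT) (fst ` ?S)"
 proof
  interpret vector_space "fscale :: _ => (((('a list => 'k) => 'k) => (('a list => 'k) => 'k) => 'k) => 'k) => _"
   by (rule vector_space_fscale)
  have z: "(\<lambda>_. 0) \<in> span (fst ` ?S)" using span_zero[of "fst ` ?S"] by (simp only: zero_fun_def)
  have a: "(\<lambda>\<beta>. c * s \<beta> + t \<beta>) \<in> span (fst ` ?S)" if "s \<in> span (fst ` ?S)" "t \<in> span (fst ` ?S)" for c s t
   using span_add[OF span_scale[OF that(1)] that(2), of c] by (simp only: plus_fun_def)
  fix t assume "t \<in> elems ?TT"
  with vs_simps(2) vs_simps(2) have "t \<in> span (fst ` ?S)"
  proof (induct rule: tens_induct)
   case zero show ?case by (rule z)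
  next
   case (step c x y p q t)
   have el: "x \<in> elems ?T" "y \<in> elems ?T" using step(1,2) hcomp_elems vs_simps(2) by blast+
   have "tensor ?T ?T x y \<in> span (fst ` ?S)"
   proof (rule gen[OF z a _ el])
    show "tensor ?T ?T (pure U us) (pure U vs) \<in> span (fst ` ?S)"
     if "homogeneous U cs us" "homogeneous U ds vs" for cs us ds vs
     using that by (intro span_base) (force simp: image_iff)
   qed
   then show ?case using step(4) by (rule a)
  qed
  then show "t \<in> module.span (smult ?TT) (fst ` ?S)" by simp
 qed
 note L = linear_extension[OF vs_simps(1) lG S sp]
 show "linear_map ?TT ?T (zin_product U)" unfolding zin_product_def by (rule L(1))
 assume h: "homogeneous U cs us" "homogeneous U ds vs" and \<beta>: "multilinear U ground \<beta>"
 have "zin_product U (tensor ?T ?T (pure U us) (pure U vs)) = G (tensor ?T ?T (pure U us) (pure U vs))"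
  unfolding zin_product_def by (rule L(2))
   (use tensor_in[OF vs_simps(2,2) pure_in[OF v homogeneous_words[OF v h(1)]] pure_in[OF v homogeneous_words[OF v h(2)]]] in simp)
 then show "zin_product U (tensor ?T ?T (pure U us) (pure U vs)) \<beta> =
    (\<Sum>\<sigma>\<in>Sh [length us, length vs - 1]. koszul (cs @ ds) (inv \<sigma>) * \<beta> (pm (us @ vs) (inv \<sigma>)))"
  unfolding GR[OF h] by (simp add: R[OF h(2)] sum_fun_apply \<beta>)
qed

subsection \<open>The projection onto words of length one, and suspension\<close>

lemma proj1:
 assumes v: "vecsp U"
 shows lm_proj1: "linear_map (tensor_module U) U (proj1 U)"
  and proj1_pure: "vs \<in> words U ==> proj1 U (pure U vs) = (if length vs = 1 then hd vs else 0)"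
proof -
 have "multilinear U U (\<lambda>vs. if length vs = 1 then hd vs else 0)"
 proof (rule mlI[OF v])
  fix vs i assume "i < length (vs :: 'b list)"
  then show "linear_map U U (\<lambda>x. if length (vs[i := x]) = 1 then hd (vs[i := x]) else 0)"
   by (cases "length vs = 1") (auto simp: length_Suc_conv lm_id lm_zeroI v)
 qed
 from lift_multilinear[OF v v this] obtain g where g: "linear_map (tensor_module U) U g"
  "\<And>vs. vs \<in> words U ==> g (pure U vs) = (if length vs = 1 then hd vs else 0)" by blast
 let ?S = "{(pure U vs, if length vs = 1 then hd vs else 0) | vs. vs \<in> words U}"
 have S: "\<forall>x y. (x, y) \<in> ?S \<longrightarrow> x \<in> elems (tensor_module U) \<and> g x = y"
  using g(2) pure_in[OF v] by auto
 have sp: "elems (tensor_module U) \<subseteq> module.span (smult (tensor_module U)) (fst ` ?S)"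
  by (rule span_generators[OF _ vs_simps(2)], simp, rule elems_tensor_module)
   (use homogeneous_words[OF v] in \<open>force simp: image_iff\<close>)
 note L = linear_extension[OF vs_simps(2) g(1) S sp]
 show "linear_map (tensor_module U) U (proj1 U)" unfolding proj1_def by (rule L(1))
 show "vs \<in> words U ==> proj1 U (pure U vs) = (if length vs = 1 then hd vs else 0)"
  unfolding proj1_def using L(2)[OF pure_in[OF v], of vs] g(2) by simp
qed

definition susp_sign :: "int list => 'k::field" where
 "susp_sign ds = (-1) powi (\<Sum>r=1..length ds. int (length ds - r) * ds ! (r - 1))"

lemma susp_sign_parity: "susp_sign (map (\<lambda>d. d mod 2) ds) = (susp_sign ds :: 'k::field)"
proof -
 have "(\<Sum>r=1..length ds. int (length ds - r) * map (\<lambda>d. d mod 2) ds ! (r - 1)) mod 2 =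
  (\<Sum>r=1..length ds. (int (length ds - r) * map (\<lambda>d. d mod 2) ds ! (r - 1)) mod 2) mod 2"
  by (rule mod_sum_eq[symmetric])
 also have "\<dots> = (\<Sum>r=1..length ds. (int (length ds - r) * ds ! (r - 1)) mod 2) mod 2"
 proof (rule arg_cong[of _ _ "\<lambda>x. x mod 2"], rule sum.cong[OF refl])
  fix r assume "r \<in> {1..length ds}"
  then have "r - 1 < length ds" by auto
  then show "int (length ds - r) * map (\<lambda>d. d mod 2) ds ! (r - 1) mod 2 = int (length ds - r) * ds ! (r - 1) mod 2"
   by (simp only: nth_map mod_mult_right_eq)
 qed
 also have "\<dots> = (\<Sum>r=1..length ds. int (length ds - r) * ds ! (r - 1)) mod 2" by (rule mod_sum_eq)
 finally show ?thesis unfolding susp_sign_def by (intro sign_parity_cong) simp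
qed

lemma multilinear_susp [simp]:
 "multilinear (susp V) W h \<longleftrightarrow> multilinear V W h" "words (susp V) = words V"
 "multilinear V (susp W) h \<longleftrightarrow> multilinear V W h"
 by (simp_all add: multilinear_def linear_map_def words_def)

lemma homogeneous_susp: "homogeneous (susp V) (map (\<lambda>d. d + 1) ds) vs \<longleftrightarrow> homogeneous V ds vs"
 by (auto simp: homogeneous_nth)

lemma susp_tensor:
 assumes V: "graded_vector_space V"
 shows lm_susp_tensor: "linear_map (tensor_module V) (tensor_module (susp V)) (susp_tensor V)"
  and susp_tensor_pure: "homogeneous V ds vs ==>
   susp_tensor V (pure V vs) = smult (tensor_module (susp V)) (susp_sign ds) (pure (susp V) vs)"
proof -
 have v: "vecsp V" using V by (rule graded_vs)
 have ml: "multilinear V (tensor_module (susp V)) (pure (susp V))" using ml_pure[of "susp V"] v by simp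
 from lift_multilinear[OF v vs_simps(2) ml_twist[OF V vs_simps(2) ml, of susp_sign]] obtain g where
  g: "linear_map (tensor_module V) (tensor_module (susp V)) g"
  "\<And>vs. vs \<in> words V ==> g (pure V vs) = twist V (tensor_module (susp V)) susp_sign (pure (susp V)) vs" by blast
 let ?S = "{(pure V vs, smult (tensor_module (susp V))
    ((-1) powi (\<Sum>r=1..length vs. int (length vs - r) * ds ! (r - 1))) (pure (susp V) vs))
   | vs ds. homogeneous V ds vs}"
 have g': "g (pure V vs) = smult (tensor_module (susp V)) (susp_sign ds) (pure (susp V) vs)" if "homogeneous V ds vs" for ds vs
  using g(2)[OF homogeneous_words[OF v that]] twist_homogeneous[OF V vs_simps(2) ml that, of susp_sign]
  by (simp only: susp_sign_parity)
 have S: "\<forall>x y. (x, y) \<in> ?S \<longrightarrow> x \<in> elems (tensor_module V) \<and> g x = y"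
 proof (intro allI impI)
  fix x y assume "(x, y) \<in> ?S"
  then obtain vs ds where x: "x = pure V vs" and h: "homogeneous V ds vs"
   and y: "y = smult (tensor_module (susp V)) ((-1) powi (\<Sum>r=1..length vs. int (length vs - r) * ds ! (r - 1))) (pure (susp V) vs)"
   by blast
  show "x \<in> elems (tensor_module V) \<and> g x = y" unfolding x y
   using g'[OF h] pure_in[OF v homogeneous_words[OF v h]] by (simp only: susp_sign_def homogeneous_length[OF h])
 qed
 have sp: "elems (tensor_module V) \<subseteq> module.span (smult (tensor_module V)) (fst ` ?S)"
  by (rule span_generators[OF _ vs_simps(2)], simp, rule elems_tensor_module) (force simp: image_iff)
 note L = linear_extension[OF vs_simps(2) g(1) S sp]
 show "linear_map (tensor_module V) (tensor_module (susp V)) (susp_tensor V)" unfolding susp_tensor_def by (rule L(1))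
 assume h: "homogeneous V ds vs"
 show "susp_tensor V (pure V vs) = smult (tensor_module (susp V)) (susp_sign ds) (pure (susp V) vs)"
  unfolding susp_tensor_def L(2)[OF pure_in[OF v homogeneous_words[OF v h]]] by (rule g'[OF h])
qed

section \<open>Cofreeness\<close>

subsection \<open>Trilinear forms and integration\<close>

text \<open>Forms on $A \otimes B \otimes C$, in a shape that does not depend on the bracketing.\<close>

definition trilinear where
 "trilinear A B C \<gamma> \<longleftrightarrow> (\<forall>a\<in>elems A. \<forall>b\<in>elems B. lform C (\<lambda>c. \<gamma> a b c)) \<and>
  (\<forall>a\<in>elems A. \<forall>c\<in>elems C. lform B (\<lambda>b. \<gamma> a b c)) \<and>
  (\<forall>b\<in>elems B. \<forall>c\<in>elems C. lform A (\<lambda>a. \<gamma> a b c))"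

lemma trilinearI:
 assumes "\<And>a b. a \<in> elems A ==> b \<in> elems B ==> lform C (\<lambda>c. \<gamma> a b c)"
  and "\<And>a c. a \<in> elems A ==> c \<in> elems C ==> lform B (\<lambda>b. \<gamma> a b c)"
  and "\<And>b c. b \<in> elems B ==> c \<in> elems C ==> lform A (\<lambda>a. \<gamma> a b c)"
 shows "trilinear A B C \<gamma>"
 using assms by (simp add: trilinear_def)

lemma trilinearD:
 assumes "trilinear A B C \<gamma>"
 shows "a \<in> elems A ==> b \<in> elems B ==> lform C (\<lambda>c. \<gamma> a b c)"
  and "a \<in> elems A ==> c \<in> elems C ==> lform B (\<lambda>b. \<gamma> a b c)"
  and "b \<in> elems B ==> c \<in> elems C ==> lform A (\<lambda>a. \<gamma> a b c)"
 using assms by (simp_all add: trilinear_def)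

lemma trilinear_bf:
 assumes "trilinear A B C \<gamma>"
 shows "a \<in> elems A ==> bilinear_form B C (\<gamma> a)" "c \<in> elems C ==> bilinear_form A B (\<lambda>a b. \<gamma> a b c)"
 using trilinearD[OF assms] by (auto intro!: bfI)

lemma trilinear_comp:
 assumes "trilinear A' B' C' \<gamma>" "linear_map A A' f" "linear_map B B' g" "linear_map C C' h"
 shows "trilinear A B C (\<lambda>a b c. \<gamma> (f a) (g b) (h c))"
 by (rule trilinearI)
  (auto intro: lm_comp[OF assms(4) trilinearD(1)[OF assms(1)]] lm_comp[OF assms(3) trilinearD(2)[OF assms(1)]]
   lm_comp[OF assms(2) trilinearD(3)[OF assms(1)]] lm_in[OF assms(2)] lm_in[OF assms(3)] lm_in[OF assms(4)])

lemma trilinear_swap_form: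
 assumes A: "graded_vector_space A" and B: "graded_vector_space B" and C: "vecsp C" and \<gamma>: "trilinear B A C \<gamma>"
 shows "trilinear A B C (\<lambda>a b c. swap_form A B (\<lambda>p q. \<gamma> p q c) a b)"
proof (rule trilinearI)
 fix a b assume a: "a \<in> elems A" and b: "b \<in> elems B"
 show "lform C (\<lambda>c. swap_form A B (\<lambda>p q. \<gamma> p q c) a b)"
  unfolding swap_form_def using lm_in[OF lm_parity_proj[OF B] b] lm_in[OF lm_par[OF A] a] a
  by (intro lm_plus C vs_simps trilinearD(1)[OF \<gamma>])
next
 fix a c assume "a \<in> elems A" "c \<in> elems C"
 then show "lform B (\<lambda>b. swap_form A B (\<lambda>p q. \<gamma> p q c) a b)"
  using bf_right[OF bf_swap_form[OF A B trilinear_bf(2)[OF \<gamma>]]] by simp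
next
 fix b c assume "b \<in> elems B" "c \<in> elems C"
 then show "lform A (\<lambda>a. swap_form A B (\<lambda>p q. \<gamma> p q c) a b)"
  using bf_left[OF bf_swap_form[OF A B trilinear_bf(2)[OF \<gamma>]]] by simp
qed

text \<open>\<open>integrate t g\<close> is $\sum g(t', t'')$ for a bilinear \<open>g\<close> with values in a tensor module; as these values
 are functionals, it is computed pointwise.\<close>

definition integrate :: "(('a => 'b => 'k) => 'k) => ('a => 'b => 'j => 'k) => 'j => 'k::field" where
 "integrate t g = (\<lambda>\<beta>. t (\<lambda>a b. g a b \<beta>))"

lemma integrate:
 fixes U :: "('k::field, 'u::ab_group_add) graded_space"
 fixes W :: "('k, 'w::ab_group_add) graded_space"
 assumes v: "vecsp A" "vecsp B" and t: "t \<in> elems (tensor_space A B)" and g: "bilinear_map A B (tensor_module U) g"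
 shows integrate_in: "integrate t g \<in> elems (tensor_module U)"
  and integrate_push: "lform (tensor_module U) L ==> L (integrate t g) = t (\<lambda>a b. L (g a b))"
  and integrate_zero: "vecsp W ==> linear_map (tensor_module U) W h ==> (\<And>a b. a \<in> elems A ==> b \<in> elems B ==> h (g a b) = 0)
   ==> h (integrate t g) = 0"
proof -
 let ?T = "tensor_module U"
 have bil: "bilinear_form A B (\<lambda>a b. L (g a b))" if "lform ?T L" for L by (rule bm_form[OF g that])
 have step: "integrate (\<lambda>\<beta>. c * tensor A B a b \<beta> + s \<beta>) g = smult ?T c (g a b) + integrate s g" for c a b s
  by (auto simp: integrate_def fun_eq_iff bil[OF lform_eval(2)])
 have gin: "g a b \<in> elems ?T" if "a \<in> hcomp A p" "b \<in> hcomp B q" for a b p q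
  using lm_in[OF bm_right[OF g]] that hcomp_elems v by metis
 have *: "integrate t g \<in> elems ?T \<and> (lform ?T L \<longrightarrow> L (integrate t g) = t (\<lambda>a b. L (g a b))) \<and>
  (vecsp W \<and> linear_map ?T W h \<and> (\<forall>a\<in>elems A. \<forall>b\<in>elems B. h (g a b) = 0) \<longrightarrow> h (integrate t g) = 0)" for L and W :: "('k, 'w::ab_group_add) graded_space" and h
  using v t
 proof (induct rule: tens_induct)
  case zero
  have "h (\<lambda>_. 0) = 0" if "linear_map ?T W h" for h :: "(('u list => 'k) => 'k) => 'w" and W
   by (rule lm_zero_fun[OF vs_simps(2) that])
  then show ?case using lm_zero_fun[OF vs_simps(2), of U ground L] by (auto simp: integrate_def)
 next
  case (step c a b p q t)
  note gi = gin[OF step(1,2)]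
  have el: "a \<in> elems A" "b \<in> elems B" using step(1,2) hcomp_elems v by blast+
  show ?case unfolding \<open>\<And>c a b s. integrate (\<lambda>\<beta>. c * tensor A B a b \<beta> + s \<beta>) g = _\<close>
  proof (intro conjI impI)
   show "smult ?T c (g a b) + integrate t g \<in> elems ?T" using gi step(4) by (simp only: elems_add elems_smult vs_simps)
   assume L: "lform ?T L"
   show "L (smult ?T c (g a b) + integrate t g) = c * tensor A B a b (\<lambda>a b. L (g a b)) + t (\<lambda>a b. L (g a b))"
    using lm_add[OF L elems_smult[OF _ gi]] lm_smult[OF L gi] step(4) L by (simp add: bil)
  next
   assume h: "vecsp W \<and> linear_map ?T W h \<and> (\<forall>a\<in>elems A. \<forall>b\<in>elems B. h (g a b) = 0)"
   then interpret vector_space "smult W" by simp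
   from h have h': "linear_map ?T W h" "h (g a b) = 0" using el by auto
   show "h (smult ?T c (g a b) + integrate t g) = 0"
    using lm_add[OF h'(1) elems_smult[OF _ gi]] lm_smult[OF h'(1) gi] step(4) h h' by simp
  qed
 qed
 show "integrate t g \<in> elems ?T" using * by blast
 show "lform ?T L ==> L (integrate t g) = t (\<lambda>a b. L (g a b))" using * by blast
 show "vecsp W ==> linear_map ?T W h ==> (\<And>a b. a \<in> elems A ==> b \<in> elems B ==> h (g a b) = 0) ==> h (integrate t g) = 0"
  using *[of _ W h] by blast
qed

subsection \<open>Appending a letter\<close>

definition snoc_word :: "('k::field, 'a::ab_group_add) graded_space => (('a list => 'k) => 'k) => 'a => ('a list => 'k) => 'k" where
 "snoc_word U y u = (\<lambda>\<beta>. if multilinear U ground \<beta> then y (\<lambda>ws. \<beta> (ws @ [u])) else 0)"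

lemma snoc_word_pure: "u \<in> elems U ==> snoc_word U (pure U ws) u = pure U (ws @ [u])"
 by (auto simp: snoc_word_def pure_def fun_eq_iff dest: ml_append_right[of U ground _ "[u]"])

lemma snoc_word_apply: "multilinear U ground \<beta> ==> snoc_word U y u \<beta> = y (\<lambda>ws. \<beta> (ws @ [u]))"
 by (simp add: snoc_word_def)

lemma snoc_word_in:
 assumes U: "vecsp U" and u: "u \<in> elems U" and y: "y \<in> elems (tensor_module U)"
 shows "snoc_word U y u \<in> elems (tensor_module U)"
 using U y
proof (induct rule: tmod_induct)
 case zero
 have "snoc_word U (\<lambda>\<beta>. 0) u = (\<lambda>\<beta>. 0)" by (simp add: snoc_word_def fun_eq_iff)
 then show ?case by simp
next
 case (step c ds vs x)
 have "pure U (vs @ [u]) \<in> elems (tensor_module U)"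
  using homogeneous_words[OF U step(1)] u by (intro pure_in U words_append) auto
 moreover have "snoc_word U (\<lambda>\<beta>. c * pure U vs \<beta> + x \<beta>) u = smult (tensor_module U) c (snoc_word U (pure U vs) u) + snoc_word U x u"
  by (auto simp: snoc_word_def fun_eq_iff)
 ultimately show ?case using step(3) by (simp only: snoc_word_pure[OF u] elems_add elems_smult vs_simps)
qed

lemma bm_snoc_word:
 assumes U: "vecsp U" shows "bilinear_map (tensor_module U) U (tensor_module U) (snoc_word U)"
proof (rule bmI)
 fix u assume u: "u \<in> elems U"
 show "linear_map (tensor_module U) (tensor_module U) (\<lambda>y. snoc_word U y u)"
  by (rule lm_functional[OF snoc_word_in[OF U u]]) (auto simp: snoc_word_def)
next
 fix y assume y: "y \<in> elems (tensor_module U)"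
 have lf: "lform U (\<lambda>u. y (\<lambda>ws. \<beta> (ws @ [u])))" if \<beta>: "multilinear U ground \<beta>" for \<beta>
 proof (rule tmod_param[OF U U y])
  show "multilinear U ground (\<lambda>ws. \<beta> (ws @ [u]))" if "u \<in> elems U" for u
   using ml_append_right[OF \<beta>] that by simp
  show "lform U (\<lambda>u. \<beta> (vs @ [u]))" if "vs \<in> words U" for vs
   using \<beta> that by (simp add: multilinear_def words_def)
 qed
 show "linear_map U (tensor_module U) (snoc_word U y)"
  unfolding linear_map_def
 proof (intro conjI ballI allI ext)
  show "snoc_word U y u \<in> elems (tensor_module U)" if "u \<in> elems U" for u by (rule snoc_word_in[OF U that y])
  show "snoc_word U y (u + u') \<beta> = (snoc_word U y u + snoc_word U y u') \<beta>" if "u \<in> elems U" "u' \<in> elems U" for u u' \<beta>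
   using lm_add[OF lf that] by (simp add: snoc_word_def)
  show "snoc_word U y (smult U c u) \<beta> = smult (tensor_module U) c (snoc_word U y u) \<beta>" if "u \<in> elems U" for u c \<beta>
   using lm_smult[OF lf that] by (simp add: snoc_word_def)
 qed
qed

lemma hcomp_snoc_word:
 assumes gT: "graded_vector_space (tensor_module U)" and U: "vecsp U"
  and y: "y \<in> hcomp (tensor_module U) p" and u: "u \<in> hcomp U q"
 shows "snoc_word U y u \<in> hcomp (tensor_module U) (p + q)"
proof -
 let ?T = "tensor_module U"
 interpret vector_space "fscale :: _ => (('b list => 'a) => 'a) => _" by (rule vector_space_fscale)
 have u': "u \<in> elems U" by (rule hcomp_elems[OF U u])
 have "y \<in> span {pure U vs | vs ds. homogeneous U ds vs \<and> sum_list ds = p}" using y by (simp add: tensor_module_def)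
 then show ?thesis
 proof (induct rule: span_induct_alt)
  case base
  have "snoc_word U 0 u = 0" by (auto simp: snoc_word_def fun_eq_iff)
  then show ?case using hcomp_0[OF gT] by (simp add: zero_fun_def)
 next
  case (step c x y)
  then obtain vs ds where x: "x = pure U vs" and h: "homogeneous U ds vs" "sum_list ds = p" by auto
  have "pure U (vs @ [u]) \<in> hcomp ?T (p + q)"
   using hcomp_pure[OF homogeneous_append[OF h(1) homogeneous_singleton[OF u]]] h(2) by simp
  moreover have "snoc_word U (fscale c x + y) u = smult ?T c (snoc_word U x u) + snoc_word U y u"
   by (auto simp: snoc_word_def fun_eq_iff)
  ultimately show ?case using step(2) unfolding x by (simp only: snoc_word_pure[OF u'] hcomp_add[OF gT] hcomp_smult[OF gT])
 qed
qed

lemma ml_letter: "multilinear U W h ==> linear_map U W (\<lambda>u. h [u])"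
 unfolding multilinear_def by (drule spec[of _ "[]"], drule spec[of _ "[]"]) simp

lemma lm_letter: "vecsp U ==> linear_map U (tensor_module U) (\<lambda>u. pure U [u])"
 by (rule ml_letter[OF ml_pure])

lemma proj1_snoc_word:
 assumes U: "vecsp U" and y: "y \<in> elems (tensor_module U)" and u: "u \<in> elems U"
 shows "proj1 U (snoc_word U y u) = 0"
proof (rule tmod_eq[OF U _ _ _ y])
 show "linear_map (tensor_module U) U (\<lambda>y. proj1 U (snoc_word U y u))"
  by (rule lm_comp[OF bm_left[OF bm_snoc_word[OF U] u] lm_proj1[OF U]])
 show "linear_map (tensor_module U) U (\<lambda>y. 0)" by (rule lm_zeroI) (simp_all add: U)
 show "proj1 U (snoc_word U (pure U vs) u) = 0" if "homogeneous U ds vs" for ds vs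
  using homogeneous_words[OF U that] u by (simp add: snoc_word_pure proj1_pure[OF U] words_append) (auto simp: words_def)
qed

subsection \<open>Shuffles with an empty block\<close>

lemma strict_mono_permutes_id:
 assumes \<sigma>: "\<sigma> permutes {1..n::nat}" and mono: "strict_mono_on {1..n} \<sigma>" shows "\<sigma> = id"
proof -
 have ge: "i \<le> \<tau> i" if \<tau>: "\<tau> permutes {1..n}" "strict_mono_on {1..n} \<tau>" and i: "i \<in> {1..n}" for \<tau> :: "nat => nat" and i
  using i
 proof (induct i)
  case (Suc i)
  show ?case
  proof (cases "i = 0")
   case True then show ?thesis using permutes_in_image[OF \<tau>(1), of "Suc i"] Suc(2) by simp
  next
   case False
   then have "\<tau> i < \<tau> (Suc i)" using Suc(2) by (intro strict_mono_onD[OF \<tau>(2)]) auto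
   then show ?thesis using Suc False by simp
  qed
 qed simp
 have inv_mono: "strict_mono_on {1..n} (inv \<sigma>)"
 proof (rule strict_mono_onI)
  fix r s assume rs: "r \<in> {1..n}" "s \<in> {1..n}" "r < s"
  have "inv \<sigma> r \<in> {1..n}" "inv \<sigma> s \<in> {1..n}" using permutes_in_image[OF permutes_inv[OF \<sigma>]] rs by blast+
  then have "\<sigma> (inv \<sigma> s) < \<sigma> (inv \<sigma> r)" if "inv \<sigma> s < inv \<sigma> r"
   using that by (intro strict_mono_onD[OF mono])
  then show "inv \<sigma> r < inv \<sigma> s" using rs permutes_inverses[OF \<sigma>]
   by (metis linorder_neqE_nat order_less_asym)
 qed
 have "\<sigma> i = i" for i
 proof (cases "i \<in> {1..n}")
  case True
  then have "\<sigma> i \<in> {1..n}" using permutes_in_image[OF \<sigma>] by blast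
  from ge[OF permutes_inv[OF \<sigma>] inv_mono this] have "\<sigma> i \<le> i" using permutes_inverses[OF \<sigma>] by simp
  then show ?thesis using ge[OF \<sigma> mono True] by simp
 qed (rule permutes_not_in[OF \<sigma>])
 then show ?thesis by auto
qed

lemma Sh_trivial: "Sh [n, 0] = {id}" "Sh [0, n] = {id}" "Sh [n] = {id}"
proof -
 have id: "id permutes {1..n}" "strict_mono_on {1..n} (id :: nat => nat)" by (auto simp: permutes_id strict_mono_on_def)
 have "strict_mono_on {Suc n..n} \<sigma>" for \<sigma> :: "nat => nat" by (auto simp: strict_mono_on_def)
 moreover have "strict_mono_on {Suc 0..0} \<sigma>" for \<sigma> :: "nat => nat" by (auto simp: strict_mono_on_def)
 ultimately show "Sh [n, 0] = {id}" "Sh [0, n] = {id}" "Sh [n] = {id}"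
  using strict_mono_permutes_id id by (auto simp: Sh_def psum_def All_less_Suc numeral_2_eq_2)
qed

lemma koszul_id [simp]: "koszul ds id = 1"
proof -
 have "{(a, b). 1 \<le> a \<and> a < b \<and> b \<le> length ds \<and> id b < id a} = {}" by auto
 then show ?thesis unfolding koszul_def by (simp only: prod.empty)
qed

lemma pm_id [simp]: "pm vs id = vs"
 by (rule nth_equalityI) (simp_all add: nth_pm)

lemma sum_list_pm: "\<sigma> permutes {1..length ds} ==> sum_list (pm ds \<sigma>) = (sum_list ds :: int)"
proof -
 assume \<sigma>: "\<sigma> permutes {1..length ds}"
 have *: "sum_list xs = (\<Sum>i\<in>{1..length xs}. xs ! (i - 1))" for xs :: "int list"
  unfolding sum_list_sum_nth by (rule sum.reindex_bij_witness[of _ "\<lambda>i. i - 1" Suc]) auto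
 have "sum_list (pm ds \<sigma>) = (\<Sum>i\<in>{1..length ds}. ds ! (\<sigma> i - 1))"
  unfolding * by (auto intro!: sum.cong simp: nth_pm)
 also have "\<dots> = (\<Sum>i\<in>{1..length ds}. ds ! (i - 1))"
  using sum.permute[OF \<sigma>, of "\<lambda>i. ds ! (i - 1)"] by (simp add: o_def)
 finally show ?thesis using * by simp
qed

subsection \<open>The cofree Zinbiel coalgebra\<close>

text \<open>The Zinbiel relation for the concrete coproduct is part of the structure of a differential graded
 coalgebra, and is taken from there.\<close>

locale cofree_zinbiel =
 fixes U :: "('k::field, 'a::ab_group_add) graded_space"
 assumes graded: "graded_vector_space U"
  and zinbiel: "zinbiel_coalgebra (tensor_module U) (zin_coproduct U)"
begin

abbreviation "T \<equiv> tensor_module U"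
abbreviation "\<Delta> \<equiv> zin_coproduct U"
abbreviation "\<pi> \<equiv> proj1 U"

lemma vU: "vecsp U" using graded by (rule graded_vs)
lemma gT: "graded_vector_space T" using zinbiel by (simp add: zinbiel_coalgebra_def)
lemma lm_\<Delta>: "linear_map T (tensor_space T T) \<Delta>" by (rule lm_zin_coproduct[OF graded])
lemma \<Delta>_in: "x \<in> elems T ==> \<Delta> x \<in> elems (tensor_space T T)" by (rule lm_in[OF lm_\<Delta>])
lemma lm_\<pi>: "linear_map T U \<pi>" by (rule lm_proj1[OF vU])
lemma pure_T: "homogeneous U ds vs ==> pure U vs \<in> elems T" by (rule pure_in[OF vU homogeneous_words[OF vU]])

lemma lm_\<Delta>_eval: "lform T (\<lambda>x. \<Delta> x \<beta>)"
 by (rule lm_comp[OF lm_\<Delta> lform_eval(1)])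

text \<open>Both tensor factors of $\Delta(v_1\dots v_n)$ consist of shorter words.\<close>

lemma coproduct_cong:
 assumes h: "homogeneous U ds vs" and "bilinear_form T T \<beta>" "bilinear_form T T \<gamma>"
  and eq: "\<And>cs us es ws. homogeneous U cs us ==> homogeneous U es ws ==> length us + length ws = length vs ==>
   \<beta> (pure U us) (pure U ws) = \<gamma> (pure U us) (pure U ws)"
 shows "\<Delta> (pure U vs) \<beta> = \<Delta> (pure U vs) \<gamma>"
 unfolding zin_coproduct_pure[OF graded h assms(2)] zin_coproduct_pure[OF graded h assms(3)]
proof (intro sum.cong refl)
 fix k \<sigma> assume k: "k \<in> {1..length vs - 1}" and \<sigma>: "\<sigma> \<in> Sh [k, length vs - k - 1]"
 have k': "0 < k" "k < length vs" using k by auto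
 have h': "homogeneous U (pm ds \<sigma>) (pm vs \<sigma>)" by (rule homogeneous_pm[OF h Sh_two_permutes(2)[OF \<sigma> k'(2)]])
 have "\<beta> (pure U (take k (pm vs \<sigma>))) (pure U (drop k (pm vs \<sigma>))) = \<gamma> (pure U (take k (pm vs \<sigma>))) (pure U (drop k (pm vs \<sigma>)))"
  by (rule eq[OF homogeneous_take[OF h' k'(1)] homogeneous_drop[OF h']]) (use k' in simp_all)
 then show "koszul ds \<sigma> * \<beta> (pure U (take k (pm vs \<sigma>))) (pure U (drop k (pm vs \<sigma>))) =
  koszul ds \<sigma> * \<gamma> (pure U (take k (pm vs \<sigma>))) (pure U (drop k (pm vs \<sigma>)))" by simp
qed

text \<open>Applying $\pi$ to the second factor leaves the summand with $k = n - 1$ only, whose sole shuffle is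
 the identity.\<close>

lemma coproduct_proj1:
 assumes h: "homogeneous U ds vs" and \<gamma>: "bilinear_form T U \<gamma>"
 shows "\<Delta> (pure U vs) (\<lambda>a b. \<gamma> a (\<pi> b)) = (if length vs = 1 then 0 else \<gamma> (pure U (butlast vs)) (last vs))"
proof -
 let ?n = "length vs"
 have n: "vs \<noteq> []" using h by (simp add: homogeneous_nth)
 have bil: "bilinear_form T T (\<lambda>a b. \<gamma> a (\<pi> b))" by (rule bf_comp[OF \<gamma> lm_id(1) lm_\<pi>])
 let ?t = "\<lambda>k \<sigma>. koszul ds \<sigma> * \<gamma> (pure U (take k (pm vs \<sigma>))) (\<pi> (pure U (drop k (pm vs \<sigma>))))"
 have "?t k \<sigma> = 0" if k: "k \<in> {1..?n - 1}" and \<sigma>: "\<sigma> \<in> Sh [k, ?n - k - 1]" and "k \<noteq> ?n - 1" for k \<sigma>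
 proof -
  have k': "0 < k" "k < ?n" using k by auto
  have h': "homogeneous U (pm ds \<sigma>) (pm vs \<sigma>)" by (rule homogeneous_pm[OF h Sh_two_permutes(2)[OF \<sigma> k'(2)]])
  have "drop k (pm vs \<sigma>) \<in> words U" using homogeneous_words[OF vU homogeneous_drop[OF h']] k' by simp
  then have "\<pi> (pure U (drop k (pm vs \<sigma>))) = 0" using proj1_pure[OF vU] that by auto
  then show ?thesis using lm_0[OF vU bf_right[OF \<gamma> pure_T[OF homogeneous_take[OF h' k'(1)]]]] by simp
 qed
 then have z: "(\<Sum>\<sigma>\<in>Sh [k, ?n - k - 1]. ?t k \<sigma>) = 0" if "k \<in> {1..?n - 1}" "k \<noteq> ?n - 1" for k
  using that by (intro sum.neutral) blast
 show ?thesis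
 proof (cases "?n = 1")
  case True then show ?thesis unfolding zin_coproduct_pure[OF graded h bil] by simp
 next
  case False
  with n have n2: "?n - 1 \<in> {1..?n - 1}" "?n - (?n - 1) - 1 = 0" by (auto simp: Suc_le_eq neq_Nil_conv)
  have "drop (?n - 1) vs = [last vs]" using n
   by (metis append_butlast_last_id append_eq_conv_conj length_butlast)
  moreover have "[last vs] \<in> words U" using homogeneous_words[OF vU h] n by (auto simp: words_def)
  ultimately have "\<pi> (pure U (drop (?n - 1) vs)) = last vs" using proj1_pure[OF vU] by simp
  moreover have "(\<Sum>k\<in>{1..?n - 1}. \<Sum>\<sigma>\<in>Sh [k, ?n - k - 1]. ?t k \<sigma>) = (\<Sum>\<sigma>\<in>Sh [?n - 1, ?n - (?n - 1) - 1]. ?t (?n - 1) \<sigma>)"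
   using z n2(1) by (subst sum.remove[of _ "?n - 1"]) (auto intro!: sum.neutral)
  ultimately show ?thesis
   unfolding zin_coproduct_pure[OF graded h bil] n2(2) Sh_trivial using False by (simp add: butlast_conv_take)
 qed
qed

lemma coproduct_snoc_proj1:
 assumes y: "y \<in> elems T" and u: "u \<in> elems U" and \<gamma>: "bilinear_form T U \<gamma>"
 shows "\<Delta> (snoc_word U y u) (\<lambda>a b. \<gamma> a (\<pi> b)) = \<gamma> y u"
proof (rule tmod_eq[OF vU _ bf_left[OF \<gamma> u] _ y])
 show "lform T (\<lambda>y. \<Delta> (snoc_word U y u) (\<lambda>a b. \<gamma> a (\<pi> b)))"
  by (rule lm_comp[OF bm_left[OF bm_snoc_word[OF vU] u] lm_\<Delta>_eval])
 fix ds vs assume h: "homogeneous U ds vs"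
 note y = pure_T[OF h]
 show "\<Delta> (snoc_word U (pure U vs) u) (\<lambda>a b. \<gamma> a (\<pi> b)) = \<gamma> (pure U vs) u"
 proof (rule lm_eq[OF vU _ bf_right[OF \<gamma> y] _ u])
  show "lform U (\<lambda>u. \<Delta> (snoc_word U (pure U vs) u) (\<lambda>a b. \<gamma> a (\<pi> b)))"
   by (rule lm_comp[OF bm_right[OF bm_snoc_word[OF vU] y] lm_\<Delta>_eval])
  fix n u assume u: "u \<in> hcomp U n"
  have "vs \<noteq> []" using h by (simp add: homogeneous_nth)
  then show "\<Delta> (snoc_word U (pure U vs) u) (\<lambda>a b. \<gamma> a (\<pi> b)) = \<gamma> (pure U vs) u"
   using coproduct_proj1[OF homogeneous_append[OF h homogeneous_singleton[OF u]] \<gamma>]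
   by (simp add: snoc_word_pure[OF hcomp_elems[OF vU u]])
 qed
qed

lemma bf_conc: "multilinear U ground \<beta> ==> bilinear_form T U (\<lambda>a u. a (\<lambda>ws. \<beta> (ws @ [u])))"
 using bm_form[OF bm_snoc_word[OF vU] lform_eval(2), of \<beta>] by (simp only: snoc_word_apply)

text \<open>Every element is recovered from its letter part and from $(\mathrm{id}\otimes\pi)\Delta$, which
 splits off the last letter of a word.\<close>

lemma reconstruct:
 assumes x: "x \<in> elems T" and \<beta>: "multilinear U ground \<beta>"
 shows "x \<beta> = \<beta> [\<pi> x] + \<Delta> x (\<lambda>a b. a (\<lambda>ws. \<beta> (ws @ [\<pi> b])))"
proof (rule tmod_eq[OF vU lform_eval(2) _ _ x])
 have "lform U (\<lambda>u. \<beta> [u])" by (rule ml_letter[OF \<beta>])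
 from lm_comp[OF lm_\<pi> this]
 show "lform T (\<lambda>x. \<beta> [\<pi> x] + \<Delta> x (\<lambda>a b. a (\<lambda>ws. \<beta> (ws @ [\<pi> b]))))"
  by (intro lm_plus vs_simps lm_\<Delta>_eval)
 fix ds vs assume h: "homogeneous U ds vs"
 have bl: "bilinear_form T U (\<lambda>a u. a (\<lambda>ws. \<beta> (ws @ [u])))" by (rule bf_conc[OF \<beta>])
 have w: "vs \<in> words U" "vs \<noteq> []" using homogeneous_words[OF vU h] by (auto simp: words_def)
 show "pure U vs \<beta> = \<beta> [\<pi> (pure U vs)] + \<Delta> (pure U vs) (\<lambda>a b. a (\<lambda>ws. \<beta> (ws @ [\<pi> b])))"
 proof (cases "length vs = 1")
  case True
  then obtain v where "vs = [v]" by (auto simp: length_Suc_conv)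
  then show ?thesis using coproduct_proj1[OF h bl] proj1_pure[OF vU w(1)] \<beta> by simp
 next
  case False
  have "\<beta> [0] = 0" using ml_0[OF vU \<beta>, of "[0]" 0] vU by simp
  moreover have "last vs \<in> elems U" using w by (auto simp: words_def)
  then have "multilinear U ground (\<lambda>ws. \<beta> (ws @ [last vs]))" using ml_append_right[OF \<beta>] by simp
  ultimately show ?thesis using False coproduct_proj1[OF h bl] proj1_pure[OF vU w(1)] \<beta> w by simp
 qed
qed

lemma reconstruct_form:
 assumes x: "x \<in> elems T" and L: "lform T L"
 shows "L x = L (pure U [\<pi> x]) + \<Delta> x (\<lambda>a b. L (snoc_word U a (\<pi> b)))"
proof -
 have ml: "multilinear U ground (\<lambda>vs. L (pure U vs))" by (rule ml_comp[OF ml_pure[OF vU] L])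
 have "a (\<lambda>ws. L (pure U (ws @ [u]))) = L (snoc_word U a u)" if "a \<in> elems T" "u \<in> elems U" for a u
  using tmod_push[OF vU snoc_word_in[OF vU that(2,1)] L] by (simp add: snoc_word_apply[OF ml])
 then have "\<Delta> x (\<lambda>a b. a (\<lambda>ws. L (pure U (ws @ [\<pi> b])))) = \<Delta> x (\<lambda>a b. L (snoc_word U a (\<pi> b)))"
  by (intro tens_cong[OF vs_simps(2,2) \<Delta>_in[OF x]]) (simp add: lm_in[OF lm_\<pi>])
 then show ?thesis using tmod_push[OF vU x L] reconstruct[OF x ml] by simp
qed

subsection \<open>The Zinbiel relation on trilinear forms\<close>

lemma bf_int12: assumes \<gamma>: "trilinear T T C \<gamma>" and C: "vecsp C"
 shows "bilinear_form T C (\<lambda>y c. \<Delta> y (\<lambda>a b. \<gamma> a b c))"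
proof (rule bfI)
 show "lform T (\<lambda>y. \<Delta> y (\<lambda>a b. \<gamma> a b c))" for c by (rule lm_\<Delta>_eval)
 show "lform C (\<lambda>c. \<Delta> y (\<lambda>a b. \<gamma> a b c))" if "y \<in> elems T" for y
  by (rule tens_param[OF vs_simps(2,2) C \<Delta>_in[OF that] trilinear_bf(2)[OF \<gamma>] trilinearD(1)[OF \<gamma>]])
qed

lemma bf_int23: assumes \<gamma>: "trilinear C T T \<gamma>" and C: "vecsp C"
 shows "bilinear_form C T (\<lambda>a y. \<Delta> y (\<gamma> a))"
proof (rule bfI)
 show "lform T (\<lambda>y. \<Delta> y (\<gamma> a))" for a by (rule lm_\<Delta>_eval)
 show "lform C (\<lambda>a. \<Delta> y (\<gamma> a))" if "y \<in> elems T" for y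
  by (rule tens_param[OF vs_simps(2,2) C \<Delta>_in[OF that] trilinear_bf(1)[OF \<gamma>] trilinearD(3)[OF \<gamma>]])
qed

text \<open>The coassociativity axiom, evaluated on a trilinear form.\<close>

lemma zinbiel_form:
 assumes x: "x \<in> elems T" and \<gamma>: "trilinear T T T \<gamma>"
 shows "\<Delta> x (\<lambda>a y. \<Delta> y (\<gamma> a)) = \<Delta> x (\<lambda>y c. \<Delta> y (\<lambda>a b. \<gamma> a b c)) +
  \<Delta> x (\<lambda>y c. \<Delta> y (swap_form T T (\<lambda>a b. \<gamma> a b c)))"
proof -
 let ?TT = "tensor_space T T"
 let ?G = "\<lambda>a u. u (\<gamma> a)"
 let ?H = "\<lambda>s c. s (\<lambda>a b. tensor T T b c (\<gamma> a))"
 let ?t1 = "tensor_map T T ?TT T \<Delta> 0 id (\<Delta> x)"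
 let ?t2 = "tensor_map ?TT T ?TT T (tensor_swap T T) 0 id ?t1"
 have G: "bilinear_form T ?TT ?G"
 proof (rule bfI)
  show "lform ?TT (\<lambda>u. u (\<gamma> a))" for a by (rule lform_eval)
  show "lform T (\<lambda>a. u (\<gamma> a))" if "u \<in> elems ?TT" for u
   by (rule tens_param[OF vs_simps(2,2,2) that trilinear_bf(1)[OF \<gamma>] trilinearD(3)[OF \<gamma>]])
 qed
 have H: "bilinear_form ?TT T ?H" by (rule bf_assoc_outer[OF vs_simps(2,2,2) G])
 have Heq: "s (\<lambda>a b. tensor T T b c (\<gamma> a)) = s (\<lambda>a b. \<gamma> a b c)" if "s \<in> elems ?TT" "c \<in> elems T" for s c
  by (rule tens_cong[OF vs_simps(2,2) that(1)]) (simp add: trilinear_bf[OF \<gamma>])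
 have t1: "?t1 \<in> elems (tensor_space ?TT T)"
  by (rule lm_in[OF lm_tensor_map_0 \<Delta>_in[OF x]]) (simp_all add: lm_\<Delta> lm_id)
 have t2: "?t2 \<in> elems (tensor_space ?TT T)"
  by (rule lm_in[OF lm_tensor_map_0 t1]) (simp_all add: lm_tensor_swap[OF gT gT] lm_id)
 have Hs: "bilinear_form ?TT T (\<lambda>s c. ?H (tensor_swap T T s) c)"
  using bf_comp[OF H lm_tensor_swap[OF gT gT] lm_id(1)] by simp
 have "tensor_map T T T ?TT id 0 \<Delta> (\<Delta> x) = tensor_assoc T T T ?t1 + tensor_assoc T T T ?t2"
  using zinbiel x unfolding zinbiel_coalgebra_def by blast
 then have "tensor_map T T T ?TT id 0 \<Delta> (\<Delta> x) ?G = tensor_assoc T T T ?t1 ?G + tensor_assoc T T T ?t2 ?G"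
  by simp
 moreover have "tensor_map T T T ?TT id 0 \<Delta> (\<Delta> x) ?G = \<Delta> x (\<lambda>a y. \<Delta> y (\<gamma> a))"
  using tensor_map_0_apply[OF vs_simps(2,2,2,1) lm_id(2) lm_\<Delta> \<Delta>_in[OF x] G] by simp
 moreover have "tensor_assoc T T T ?t1 ?G = \<Delta> x (\<lambda>y c. \<Delta> y (\<lambda>a b. \<gamma> a b c))"
 proof -
  have "tensor_assoc T T T ?t1 ?G = ?t1 ?H" by (rule tensor_assoc_apply[OF vs_simps(2,2,2) t1 G])
  also have "\<dots> = \<Delta> x (\<lambda>y c. ?H (\<Delta> y) c)"
   using tensor_map_0_apply[OF vs_simps(2,2,1,2) lm_\<Delta> lm_id(2) \<Delta>_in[OF x] H] by simp
  also have "\<dots> = \<Delta> x (\<lambda>y c. \<Delta> y (\<lambda>a b. \<gamma> a b c))"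
   by (rule tens_cong[OF vs_simps(2,2) \<Delta>_in[OF x]]) (rule Heq[OF \<Delta>_in])
  finally show ?thesis .
 qed
 moreover have "tensor_assoc T T T ?t2 ?G = \<Delta> x (\<lambda>y c. \<Delta> y (swap_form T T (\<lambda>a b. \<gamma> a b c)))"
 proof -
  have "tensor_assoc T T T ?t2 ?G = ?t2 ?H" by (rule tensor_assoc_apply[OF vs_simps(2,2,2) t2 G])
  also have "\<dots> = ?t1 (\<lambda>s c. ?H (tensor_swap T T s) c)"
   using tensor_map_0_apply[OF vs_simps(1,2,1,2) lm_tensor_swap[OF gT gT] lm_id(2) t1 H] by simp
  also have "\<dots> = \<Delta> x (\<lambda>y c. ?H (tensor_swap T T (\<Delta> y)) c)"
   using tensor_map_0_apply[OF vs_simps(2,2,1,2) lm_\<Delta> lm_id(2) \<Delta>_in[OF x] Hs] by simp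
  also have "\<dots> = \<Delta> x (\<lambda>y c. \<Delta> y (swap_form T T (\<lambda>a b. \<gamma> a b c)))"
  proof (rule tens_cong[OF vs_simps(2,2) \<Delta>_in[OF x]])
   fix y c assume yc: "y \<in> elems T" "c \<in> elems T"
   have "?H (tensor_swap T T (\<Delta> y)) c = tensor_swap T T (\<Delta> y) (\<lambda>a b. \<gamma> a b c)"
    by (rule Heq[OF lm_in[OF lm_tensor_swap[OF gT gT] \<Delta>_in[OF yc(1)]] yc(2)])
   then show "?H (tensor_swap T T (\<Delta> y)) c = \<Delta> y (swap_form T T (\<lambda>a b. \<gamma> a b c))"
    using tensor_swap_apply[OF gT gT \<Delta>_in[OF yc(1)] trilinear_bf(2)[OF \<gamma> yc(2)]] by simp
  qed
  finally show ?thesis .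
 qed
 ultimately show ?thesis by simp
qed

text \<open>The coproduct of a word with one more letter; this follows from the Zinbiel relation because
 the last letter is split off by $(\mathrm{id}\otimes\pi)\Delta$.\<close>

lemma coproduct_snoc:
 assumes y: "y \<in> elems T" and u: "u \<in> elems U" and \<beta>: "bilinear_form T T \<beta>"
 shows "\<Delta> (snoc_word U y u) \<beta> = \<beta> y (pure U [u]) + \<Delta> y (\<lambda>p q. \<beta> p (snoc_word U q u))
  + \<Delta> y (swap_form T T (\<lambda>p q. \<beta> p (snoc_word U q u)))"
proof -
 let ?z = "snoc_word U y u"
 have z: "?z \<in> elems T" by (rule snoc_word_in[OF vU u y])
 define \<gamma> where "\<gamma> p q v = \<beta> p (snoc_word U q v)" for p q v
 have \<gamma>: "trilinear T T U \<gamma>" unfolding \<gamma>_def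
 proof (rule trilinearI)
  show "lform U (\<lambda>v. \<beta> p (snoc_word U q v))" if "p \<in> elems T" "q \<in> elems T" for p q
   by (rule lm_comp[OF bm_right[OF bm_snoc_word[OF vU] that(2)] bf_right[OF \<beta> that(1)]])
  show "lform T (\<lambda>q. \<beta> p (snoc_word U q v))" if "p \<in> elems T" "v \<in> elems U" for p v
   by (rule lm_comp[OF bm_left[OF bm_snoc_word[OF vU] that(2)] bf_right[OF \<beta> that(1)]])
  show "lform T (\<lambda>p. \<beta> p (snoc_word U q v))" if "q \<in> elems T" "v \<in> elems U" for q v
   by (rule bf_left[OF \<beta> snoc_word_in[OF vU that(2,1)]])
 qed
 have \<gamma>\<pi>: "trilinear T T T (\<lambda>p q r. \<gamma> p q (\<pi> r))" by (rule trilinear_comp[OF \<gamma> lm_id(1) lm_id(1) lm_\<pi>])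
 have letter: "bilinear_form T U (\<lambda>a v. \<beta> a (pure U [v]))" by (rule bf_comp[OF \<beta> lm_id(1) lm_letter[OF vU]])
 have 1: "bilinear_form T T (\<lambda>a b. \<beta> a (pure U [\<pi> b]))" using bf_comp[OF letter lm_id(1) lm_\<pi>] .
 have 2: "bilinear_form T T (\<lambda>a b. \<Delta> b (\<lambda>q r. \<gamma> a q (\<pi> r)))" by (rule bf_int23[OF \<gamma>\<pi> vs_simps(2)])
 have "\<Delta> ?z \<beta> = \<Delta> ?z (\<lambda>a b. \<beta> a (pure U [\<pi> b]) + \<Delta> b (\<lambda>q r. \<gamma> a q (\<pi> r)))"
  unfolding \<gamma>_def by (rule tens_cong[OF vs_simps(2,2) \<Delta>_in[OF z]]) (rule reconstruct_form[OF _ bf_right[OF \<beta>]])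
 also have "\<dots> = \<Delta> ?z (\<lambda>a b. \<beta> a (pure U [\<pi> b])) + \<Delta> ?z (\<lambda>a b. \<Delta> b (\<lambda>q r. \<gamma> a q (\<pi> r)))"
  by (rule tens_plus[OF vs_simps(2,2) \<Delta>_in[OF z] 1 2])
 also have "\<Delta> ?z (\<lambda>a b. \<beta> a (pure U [\<pi> b])) = \<beta> y (pure U [u])"
  by (rule coproduct_snoc_proj1[OF y u letter])
 also have "\<Delta> ?z (\<lambda>a b. \<Delta> b (\<lambda>q r. \<gamma> a q (\<pi> r))) =
   \<Delta> ?z (\<lambda>y' c. \<Delta> y' (\<lambda>a b. \<gamma> a b (\<pi> c))) + \<Delta> ?z (\<lambda>y' c. \<Delta> y' (swap_form T T (\<lambda>a b. \<gamma> a b (\<pi> c))))"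
  by (rule zinbiel_form[OF z \<gamma>\<pi>])
 also have "\<Delta> ?z (\<lambda>y' c. \<Delta> y' (\<lambda>a b. \<gamma> a b (\<pi> c))) = \<Delta> y (\<lambda>a b. \<gamma> a b u)"
  by (rule coproduct_snoc_proj1[OF y u bf_int12[OF \<gamma> vU]])
 also have "\<Delta> ?z (\<lambda>y' c. \<Delta> y' (swap_form T T (\<lambda>a b. \<gamma> a b (\<pi> c)))) = \<Delta> y (swap_form T T (\<lambda>a b. \<gamma> a b u))"
  by (rule coproduct_snoc_proj1[OF y u bf_int12[OF trilinear_swap_form[OF gT gT vU \<gamma>] vU]])
 finally show ?thesis by (simp add: \<gamma>_def add.assoc)
qed

lemma coproduct_letter: "u \<in> elems U ==> bilinear_form T T \<beta> ==> \<Delta> (pure U [u]) \<beta> = 0"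
proof -
 assume u: "u \<in> elems U" and \<beta>: "bilinear_form T T \<beta>"
 show ?thesis
 proof (rule lm_eq[OF vU _ _ _ u])
  show "lform U (\<lambda>u. \<Delta> (pure U [u]) \<beta>)" by (rule lm_comp[OF lm_letter[OF vU] lm_\<Delta>_eval])
  show "lform U (\<lambda>u. 0)" by (rule lm_zeroI[OF vU]) simp
  show "\<Delta> (pure U [x]) \<beta> = 0" if "x \<in> hcomp U n" for n x
   using zin_coproduct_pure[OF graded homogeneous_singleton[OF that] \<beta>] by simp
 qed
qed

end

subsection \<open>Coderivations\<close>

lemma shorter_factor: "homogeneous U es ws ==> m + length ws = n ==> m < n"
 by (cases ws) (simp_all add: homogeneous_nth)

lemma graded_map_parity:
 assumes A: "graded_vector_space A" and B: "graded_vector_space B" and F: "graded_map A B 0 F" and a: "a \<in> elems A"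
 shows "F (parity_proj A i a) = parity_proj B i (F a)" and "F (par A a) = par B (F a)"
proof -
 have l: "linear_map A B F" and h: "\<And>n x. x \<in> hcomp A n ==> F x \<in> hcomp B n" using F by (auto simp: graded_map_def)
 have F0: "F 0 = 0" by (rule lm_0[OF graded_vs[OF A] l])
 have *: "F (parity_proj A i a) = parity_proj B i (F a)" for i
  by (rule lm_eq[OF graded_vs[OF A] lm_comp[OF lm_parity_proj[OF A] l] lm_comp[OF l lm_parity_proj[OF B]] _ a])
   (simp add: parity_proj_hcomp[OF A] parity_proj_hcomp[OF B h] F0)
 show "F (parity_proj A i a) = parity_proj B i (F a)" by (rule *)
 have "parity_proj A i a \<in> elems A" for i by (rule lm_in[OF lm_parity_proj[OF A] a])
 then show "F (par A a) = par B (F a)"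
  unfolding par_def by (simp add: lm_add[OF l] lm_smult[OF l] elems_smult[OF graded_vs[OF A]] *)
qed

lemma swap_form_hom:
 assumes "graded_vector_space A" "graded_vector_space B" "graded_map A B 0 F" "a \<in> elems A" "b \<in> elems A"
 shows "swap_form B B \<beta> (F a) (F b) = swap_form A A (\<lambda>p q. \<beta> (F p) (F q)) a b"
 using graded_map_parity[OF assms(1,2,3)] assms(4,5) by (simp add: swap_form_def)

lemma lm_integrate:
 assumes "vecsp A" "vecsp B" "bilinear_map A B (tensor_module U) g"
 shows "linear_map (tensor_space A B) (tensor_module U) (\<lambda>t. integrate t g)"
 by (rule lm_functional[OF integrate_in[OF assms(1,2) _ assms(3)]]) (auto simp: integrate_def)

context cofree_zinbiel
begin

definition coderivation :: "((('a list => 'k) => 'k) => ('a list => 'k) => 'k) => bool" where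
 "coderivation D \<longleftrightarrow> linear_map T T D \<and> (\<forall>x\<in>elems T. \<forall>\<beta>. bilinear_form T T \<beta> \<longrightarrow>
  \<Delta> (D x) \<beta> = \<Delta> x (\<lambda>a b. \<beta> (D a) b) + \<Delta> x (\<lambda>a b. \<beta> (par T a) (D b)))"

lemma coderivation_lm: "coderivation D ==> linear_map T T D"
 by (simp add: coderivation_def)

lemma coderivationD: "coderivation D ==> x \<in> elems T ==> bilinear_form T T \<beta> ==>
  \<Delta> (D x) \<beta> = \<Delta> x (\<lambda>a b. \<beta> (D a) b) + \<Delta> x (\<lambda>a b. \<beta> (par T a) (D b))"
 by (simp add: coderivation_def)

lemma dg_coderivation:
 assumes "dg_zinbiel_coalgebra T \<Delta> D" shows "coderivation D"
proof -
 have D: "linear_map T T D" and eq: "\<And>x. x \<in> elems T ==> \<Delta> (D x) =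
   tensor_map T T T T D 0 id (\<Delta> x) + tensor_map T T T T id (-1) D (\<Delta> x)"
  using assms by (auto simp: dg_zinbiel_coalgebra_def graded_map_def)
 show ?thesis
  unfolding coderivation_def using D
  by (auto simp: eq tensor_map_0_apply[OF vs_simps(2,2,2,2) D lm_id(2) \<Delta>_in]
    tensor_map_odd_apply[OF gT vs_simps(2,2,2) lm_id(2) D \<Delta>_in])
qed

text \<open>Apply \<open>reconstruct\<close> to \<open>D x\<close>; the sign of the second summand is carried by the parity involution.\<close>

lemma coderivation_rec:
 assumes D: "coderivation D" and x: "x \<in> elems T" and \<beta>: "multilinear U ground \<beta>"
 shows "D x \<beta> = \<beta> [\<pi> (D x)] + \<Delta> x (\<lambda>a b. D a (\<lambda>ws. \<beta> (ws @ [\<pi> b])))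
  + \<Delta> x (\<lambda>a b. par T a (\<lambda>ws. \<beta> (ws @ [\<pi> (D b)])))"
 using reconstruct[OF lm_in[OF coderivation_lm[OF D] x] \<beta>]
  coderivationD[OF D x bf_comp[OF bf_conc[OF \<beta>] lm_id(1) lm_\<pi>]] by simp

text \<open>A map into a tensor module built from words of shorter length.\<close>

lemma integrate_coproduct:
 assumes h: "homogeneous U ds vs" and g: "bilinear_map T T (tensor_module U') g"
 shows "integrate (\<Delta> (pure U vs)) g = (\<Sum>k=1..length vs - 1. \<Sum>\<sigma>\<in>Sh [k, length vs - k - 1].
     smult (tensor_module U') (koszul ds \<sigma>) (g (pure U (take k (pm vs \<sigma>))) (pure U (drop k (pm vs \<sigma>)))))"
proof
 fix \<beta>
 have "bilinear_form T T (\<lambda>a b. g a b \<beta>)" by (rule bm_form[OF g lform_eval(2)])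
 then show "integrate (\<Delta> (pure U vs)) g \<beta> = (\<Sum>k=1..length vs - 1. \<Sum>\<sigma>\<in>Sh [k, length vs - k - 1].
   smult (tensor_module U') (koszul ds \<sigma>) (g (pure U (take k (pm vs \<sigma>))) (pure U (drop k (pm vs \<sigma>))))) \<beta>"
  unfolding integrate_def by (simp add: zin_coproduct_pure[OF graded h] sum_fun_apply)
qed

lemma integrate_coproduct_cong:
 assumes h: "homogeneous U ds vs" and "bilinear_map T T (tensor_module U') g" "bilinear_map T T (tensor_module U') g'"
  and "\<And>cs us es ws. homogeneous U cs us ==> homogeneous U es ws ==> length us + length ws = length vs ==>
   g (pure U us) (pure U ws) = g' (pure U us) (pure U ws)"
 shows "integrate (\<Delta> (pure U vs)) g = integrate (\<Delta> (pure U vs)) g'"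
 unfolding integrate_def
 by (rule ext, rule coproduct_cong[OF h bm_form[OF assms(2) lform_eval(2)] bm_form[OF assms(3) lform_eval(2)]])
  (simp add: assms(4))

end

subsection \<open>Coalgebra morphisms\<close>

text \<open>The coalgebra morphism with corestriction \<open>f\<close>, built by recursion on the length of words.\<close>

primrec cofree_approx :: "('k::field, 'a::ab_group_add) graded_space => ('k, 'b::ab_group_add) graded_space
  => ((('a list => 'k) => 'k) => 'b) => nat => (('a list => 'k) => 'k) => ('b list => 'k) => 'k" where
 "cofree_approx U U' f 0 = (\<lambda>x. 0)"
| "cofree_approx U U' f (Suc n) = (\<lambda>x. pure U' [f x] +
  integrate (zin_coproduct U x) (\<lambda>a b. snoc_word U' (cofree_approx U U' f n a) (f b)))"

definition cofree_lift :: "('k::field, 'a::ab_group_add) graded_space => ('k, 'b::ab_group_add) graded_space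
  => ((('a list => 'k) => 'k) => 'b) => (('a list => 'k) => 'k) => ('b list => 'k) => 'k" where
 "cofree_lift U U' f x = (\<lambda>\<beta>. x (\<lambda>vs. cofree_approx U U' f (length vs) (pure U vs) \<beta>))"

locale cofree_pair = S: cofree_zinbiel U + R: cofree_zinbiel U'
 for U :: "('k::field, 'a::ab_group_add) graded_space" and U' :: "('k, 'b::ab_group_add) graded_space"
begin

definition coalgebra_map :: "((('a list => 'k) => 'k) => ('b list => 'k) => 'k) => bool" where
 "coalgebra_map F \<longleftrightarrow> linear_map S.T R.T F \<and> (\<forall>x\<in>elems S.T. \<forall>\<beta>. bilinear_form R.T R.T \<beta> \<longrightarrow>
  R.\<Delta> (F x) \<beta> = S.\<Delta> x (\<lambda>a b. \<beta> (F a) (F b)))"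

lemma coalgebra_map_iff:
 assumes F: "linear_map S.T R.T F"
 shows "coalgebra_map F \<longleftrightarrow> (\<forall>x\<in>elems S.T. R.\<Delta> (F x) = tensor_map S.T S.T R.T R.T F 0 F (S.\<Delta> x))"
proof -
 have *: "tensor_map S.T S.T R.T R.T F 0 F (S.\<Delta> x) \<beta> = S.\<Delta> x (\<lambda>a b. \<beta> (F a) (F b))"
  if "x \<in> elems S.T" "bilinear_form R.T R.T \<beta>" for x \<beta>
  by (rule tensor_map_0_apply[OF vs_simps(2,2,2,2) F F S.\<Delta>_in[OF that(1)] that(2)])
 have in': "R.\<Delta> (F x) \<in> elems (tensor_space R.T R.T)"
  "tensor_map S.T S.T R.T R.T F 0 F (S.\<Delta> x) \<in> elems (tensor_space R.T R.T)" if "x \<in> elems S.T" for x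
  using R.\<Delta>_in[OF lm_in[OF F that]] lm_in[OF lm_tensor_map_0[OF vs_simps(2,2,2,2) F F] S.\<Delta>_in[OF that]] by simp_all
 show ?thesis
 proof
  assume "coalgebra_map F"
  then show "\<forall>x\<in>elems S.T. R.\<Delta> (F x) = tensor_map S.T S.T R.T R.T F 0 F (S.\<Delta> x)"
   using * in' unfolding coalgebra_map_def by (intro ballI tens_eqI[OF vs_simps(2,2)]) auto
 qed (use * F in \<open>auto simp: coalgebra_map_def\<close>)
qed

lemma coalgebra_map_lm: "coalgebra_map F ==> linear_map S.T R.T F"
 by (simp add: coalgebra_map_def)

lemma coalgebra_mapD: "coalgebra_map F ==> x \<in> elems S.T ==> bilinear_form R.T R.T \<beta> ==>
  R.\<Delta> (F x) \<beta> = S.\<Delta> x (\<lambda>a b. \<beta> (F a) (F b))"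
 by (simp add: coalgebra_map_def)

text \<open>Apply \<open>reconstruct\<close> to \<open>F x\<close> and move $\Delta$ past \<open>F\<close>.\<close>

lemma coalgebra_map_rec:
 assumes F: "coalgebra_map F" and x: "x \<in> elems S.T" and \<beta>: "multilinear U' ground \<beta>"
 shows "F x \<beta> = \<beta> [R.\<pi> (F x)] + S.\<Delta> x (\<lambda>a b. F a (\<lambda>ws. \<beta> (ws @ [R.\<pi> (F b)])))"
 using R.reconstruct[OF lm_in[OF coalgebra_map_lm[OF F] x] \<beta>]
  coalgebra_mapD[OF F x bf_comp[OF R.bf_conc[OF \<beta>] lm_id(1) R.lm_\<pi>]] by simp

text \<open>Two linear maps satisfying the same recursion over $\Delta$ agree by induction on the length of words,
 because both tensor factors of $\Delta$ have shorter words.\<close>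

lemma eq_by_recursion:
 assumes G: "linear_map S.T R.T G" and H: "linear_map S.T R.T H"
  and step: "\<And>ds vs \<beta>. homogeneous U ds vs ==> multilinear U' ground \<beta> ==>
   (\<And>cs us. homogeneous U cs us ==> length us < length vs ==> G (pure U us) = H (pure U us)) ==>
   G (pure U vs) \<beta> = H (pure U vs) \<beta>"
  and x: "x \<in> elems S.T"
 shows "G x = H x"
proof (rule tmod_eq[OF S.vU G H _ x])
 fix ds vs show "homogeneous U ds vs ==> G (pure U vs) = H (pure U vs)"
 proof (induct "length vs" arbitrary: ds vs rule: less_induct)
  case less
  show ?case
   by (rule tmod_eqI[OF R.vU lm_in[OF G S.pure_T[OF less(2)]] lm_in[OF H S.pure_T[OF less(2)]] step[OF less(2)]])
    (use less(1) in blast)+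
 qed
qed

lemma coalgebra_map_unique:
 assumes F: "coalgebra_map F" and G: "coalgebra_map G" and eq: "\<And>x. x \<in> elems S.T ==> R.\<pi> (F x) = R.\<pi> (G x)"
  and x: "x \<in> elems S.T"
 shows "F x = G x"
proof (rule eq_by_recursion[OF coalgebra_map_lm[OF F] coalgebra_map_lm[OF G] _ x])
 fix ds vs \<beta> assume h: "homogeneous U ds vs" and \<beta>: "multilinear U' ground \<beta>"
  and IH: "\<And>cs us. homogeneous U cs us ==> length us < length vs ==> F (pure U us) = G (pure U us)"
 note p = S.pure_T[OF h]
 have bil: "bilinear_form S.T S.T (\<lambda>a b. F a (\<lambda>ws. \<beta> (ws @ [R.\<pi> (F b)])))" if F: "coalgebra_map F" for F
  by (rule bf_comp[OF R.bf_conc[OF \<beta>] coalgebra_map_lm[OF F] lm_comp[OF coalgebra_map_lm[OF F] R.lm_\<pi>]])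
 have "S.\<Delta> (pure U vs) (\<lambda>a b. F a (\<lambda>ws. \<beta> (ws @ [R.\<pi> (F b)]))) = S.\<Delta> (pure U vs) (\<lambda>a b. G a (\<lambda>ws. \<beta> (ws @ [R.\<pi> (G b)])))"
 proof (rule S.coproduct_cong[OF h bil[OF F] bil[OF G]])
  fix cs us es ws assume "homogeneous U cs us" "homogeneous U es ws" "length us + length ws = length vs"
  then show "F (pure U us) (\<lambda>zs. \<beta> (zs @ [R.\<pi> (F (pure U ws))])) = G (pure U us) (\<lambda>zs. \<beta> (zs @ [R.\<pi> (G (pure U ws))]))"
   using IH[of cs us] eq[OF S.pure_T[of es ws]] shorter_factor[of U es ws "length us" "length vs"] by simp
 qed
 then show "F (pure U vs) \<beta> = G (pure U vs) \<beta>"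
  by (simp add: coalgebra_map_rec[OF F p \<beta>] coalgebra_map_rec[OF G p \<beta>] eq[OF p])
qed

text \<open>Both composites of a coalgebra morphism with coderivations are determined by their corestrictions.\<close>

lemma coderivation_commute:
 assumes F: "coalgebra_map F" and par: "\<And>x. x \<in> elems S.T ==> F (par S.T x) = par R.T (F x)"
  and D: "S.coderivation D" and E: "R.coderivation E"
  and eq: "\<And>x. x \<in> elems S.T ==> R.\<pi> (F (D x)) = R.\<pi> (E (F x))" and x: "x \<in> elems S.T"
 shows "F (D x) = E (F x)"
proof (rule eq_by_recursion[OF _ _ _ x])
 note lF = coalgebra_map_lm[OF F] and lD = S.coderivation_lm[OF D] and lE = R.coderivation_lm[OF E]
 show lFD: "linear_map S.T R.T (\<lambda>x. F (D x))" and lEF: "linear_map S.T R.T (\<lambda>x. E (F x))"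
  by (rule lm_comp[OF lD lF], rule lm_comp[OF lF lE])
 fix ds vs \<beta> assume h: "homogeneous U ds vs" and \<beta>: "multilinear U' ground \<beta>"
  and IH: "\<And>cs us. homogeneous U cs us ==> length us < length vs ==> F (D (pure U us)) = E (F (pure U us))"
 note p = S.pure_T[OF h]
 let ?\<gamma> = "\<lambda>a b. a (\<lambda>ws. \<beta> (ws @ [R.\<pi> b]))"
 have \<gamma>: "bilinear_form R.T R.T ?\<gamma>" by (rule bf_comp[OF R.bf_conc[OF \<beta>] lm_id(1) R.lm_\<pi>])
 have lp: "linear_map R.T R.T (par R.T)" by (rule lm_par[OF R.gT])
 have "F (D (pure U vs)) \<beta> = \<beta> [R.\<pi> (F (D (pure U vs)))] + R.\<Delta> (F (D (pure U vs))) ?\<gamma>"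
  by (rule R.reconstruct[OF lm_in[OF lFD p] \<beta>])
 also have "R.\<Delta> (F (D (pure U vs))) ?\<gamma> = S.\<Delta> (D (pure U vs)) (\<lambda>a b. ?\<gamma> (F a) (F b))"
  by (rule coalgebra_mapD[OF F lm_in[OF lD p] \<gamma>])
 also have "\<dots> = S.\<Delta> (pure U vs) (\<lambda>a b. ?\<gamma> (F (D a)) (F b)) + S.\<Delta> (pure U vs) (\<lambda>a b. ?\<gamma> (F (par S.T a)) (F (D b)))"
  by (rule S.coderivationD[OF D p bf_comp[OF \<gamma> lF lF]])
 also have "S.\<Delta> (pure U vs) (\<lambda>a b. ?\<gamma> (F (D a)) (F b)) = S.\<Delta> (pure U vs) (\<lambda>a b. ?\<gamma> (E (F a)) (F b))"
 proof (rule S.coproduct_cong[OF h bf_comp[OF \<gamma> lFD lF] bf_comp[OF \<gamma> lEF lF]])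
  fix cs us es ws assume "homogeneous U cs us" "homogeneous U es ws" "length us + length ws = length vs"
  then show "?\<gamma> (F (D (pure U us))) (F (pure U ws)) = ?\<gamma> (E (F (pure U us))) (F (pure U ws))"
   using IH[of cs us] shorter_factor[of U es ws "length us" "length vs"] by simp
 qed
 also have "S.\<Delta> (pure U vs) (\<lambda>a b. ?\<gamma> (F (par S.T a)) (F (D b))) = S.\<Delta> (pure U vs) (\<lambda>a b. ?\<gamma> (par R.T (F a)) (E (F b)))"
  by (rule tens_cong[OF vs_simps(2,2) S.\<Delta>_in[OF p]]) (simp add: par eq)
 also have "S.\<Delta> (pure U vs) (\<lambda>a b. ?\<gamma> (E (F a)) (F b)) = R.\<Delta> (F (pure U vs)) (\<lambda>a b. ?\<gamma> (E a) b)"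
  by (rule coalgebra_mapD[OF F p bf_comp[OF \<gamma> lE lm_id(1)], symmetric])
 also have "S.\<Delta> (pure U vs) (\<lambda>a b. ?\<gamma> (par R.T (F a)) (E (F b))) = R.\<Delta> (F (pure U vs)) (\<lambda>a b. ?\<gamma> (par R.T a) (E b))"
  by (rule coalgebra_mapD[OF F p bf_comp[OF \<gamma> lp lE], symmetric])
 also have "R.\<Delta> (F (pure U vs)) (\<lambda>a b. ?\<gamma> (E a) b) + R.\<Delta> (F (pure U vs)) (\<lambda>a b. ?\<gamma> (par R.T a) (E b))
   = R.\<Delta> (E (F (pure U vs))) ?\<gamma>"
  by (rule R.coderivationD[OF E lm_in[OF lF p] \<gamma>, symmetric])
 also have "\<beta> [R.\<pi> (F (D (pure U vs)))] + R.\<Delta> (E (F (pure U vs))) ?\<gamma> = E (F (pure U vs)) \<beta>"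
  using R.reconstruct[OF lm_in[OF lEF p] \<beta>] eq[OF p] by simp
 finally show "F (D (pure U vs)) \<beta> = E (F (pure U vs)) \<beta>" .
qed

subsection \<open>Existence\<close>

context
 fixes f assumes f: "graded_map S.T U' 0 f"
begin

abbreviation "approx \<equiv> cofree_approx U U' f"
abbreviation "lift \<equiv> cofree_lift U U' f"

lemma lm_f: "linear_map S.T U' f" using f by (simp add: graded_map_def)

lemma bm_snoc_comp: "linear_map S.T R.T F ==> bilinear_map S.T S.T R.T (\<lambda>a b. snoc_word U' (F a) (f b))"
proof (rule bmI)
 assume F: "linear_map S.T R.T F"
 show "linear_map S.T R.T (\<lambda>a. snoc_word U' (F a) (f b))" if "b \<in> elems S.T" for b
  by (rule lm_comp[OF F bm_left[OF bm_snoc_word[OF R.vU] lm_in[OF lm_f that]]])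
 show "linear_map S.T R.T (\<lambda>b. snoc_word U' (F a) (f b))" if "a \<in> elems S.T" for a
  by (rule lm_comp[OF lm_f bm_right[OF bm_snoc_word[OF R.vU] lm_in[OF F that]]])
qed

lemma lm_approx: "linear_map S.T R.T (approx n)"
proof (induct n)
 case 0
 have "linear_map S.T R.T (\<lambda>x. 0)" by (rule lm_zeroI) simp_all
 then show ?case by (simp add: zero_fun_def)
next
 case (Suc n)
 show ?case unfolding cofree_approx.simps
  by (rule lm_plus[OF vs_simps(2,2) lm_comp[OF lm_f lm_letter[OF R.vU]]
     lm_comp[OF S.lm_\<Delta> lm_integrate[OF vs_simps(2,2) bm_snoc_comp[OF Suc]]]])
qed

text \<open>The recursion for the lift runs over elements, not over a datatype, hence is approximated: after \<open>n\<close>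
 steps it is correct on words of length at most \<open>n\<close>.\<close>

lemma approx_stable:
 assumes "homogeneous U ds vs" "length vs \<le> n" "length vs \<le> m"
 shows "approx n (pure U vs) = approx m (pure U vs)"
 using assms
proof (induct n arbitrary: m ds vs)
 case 0 then show ?case by (simp add: homogeneous_nth)
next
 case (Suc n)
 then obtain m' where m: "m = Suc m'" by (cases m) (auto simp: homogeneous_nth)
 have "integrate (S.\<Delta> (pure U vs)) (\<lambda>a b. snoc_word U' (approx n a) (f b)) =
  integrate (S.\<Delta> (pure U vs)) (\<lambda>a b. snoc_word U' (approx m' a) (f b))"
 proof (rule S.integrate_coproduct_cong[OF Suc(2) bm_snoc_comp[OF lm_approx] bm_snoc_comp[OF lm_approx]])
  fix cs us es ws assume us: "homogeneous U cs us" and ws: "homogeneous U es ws" "length us + length ws = length vs"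
  then have "length us < length vs" using shorter_factor[OF ws] by simp
  then show "snoc_word U' (approx n (pure U us)) (f (pure U ws)) = snoc_word U' (approx m' (pure U us)) (f (pure U ws))"
   using Suc(1)[OF us, of m'] Suc(3,4) m by simp
 qed
 then show ?case by (simp add: m)
qed

lemma ml_approx: "multilinear U ground (\<lambda>vs. approx (length vs) (pure U vs) \<beta>)"
proof (rule ml_length)
 show "multilinear U ground (\<lambda>vs. approx n (pure U vs) \<beta>)" for n
  by (rule ml_comp[OF ml_pure[OF S.vU] lm_comp[OF lm_approx lform_eval(2)]])
qed

lemma lift_pure: "lift (pure U vs) = approx (length vs) (pure U vs)"
 by (simp add: cofree_lift_def ml_approx)

lemma lm_lift: "linear_map S.T R.T lift"
proof (rule lm_functional)
 show "lift x \<in> elems R.T" if "x \<in> elems S.T" for x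
  using S.vU that
 proof (induct rule: tmod_induct)
  case zero
  have "lift (\<lambda>\<beta>. 0) = (\<lambda>\<beta>. 0)" by (simp add: cofree_lift_def)
  then show ?case by simp
 next
  case (step c ds vs x)
  have "lift (\<lambda>\<beta>. c * pure U vs \<beta> + x \<beta>) = smult R.T c (lift (pure U vs)) + lift x"
   by (simp add: cofree_lift_def fun_eq_iff)
  moreover have "lift (pure U vs) \<in> elems R.T" unfolding lift_pure by (rule lm_in[OF lm_approx S.pure_T[OF step(1)]])
  ultimately show ?case using step(3) by (simp only: elems_add elems_smult vs_simps)
 qed
qed (auto simp: cofree_lift_def)

lemma lift_rec:
 assumes x: "x \<in> elems S.T"
 shows "lift x = pure U' [f x] + integrate (S.\<Delta> x) (\<lambda>a b. snoc_word U' (lift a) (f b))"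
proof (rule tmod_eq[OF S.vU lm_lift _ _ x])
 show "linear_map S.T R.T (\<lambda>x. pure U' [f x] + integrate (S.\<Delta> x) (\<lambda>a b. snoc_word U' (lift a) (f b)))"
  by (rule lm_plus[OF vs_simps(2,2) lm_comp[OF lm_f lm_letter[OF R.vU]]
     lm_comp[OF S.lm_\<Delta> lm_integrate[OF vs_simps(2,2) bm_snoc_comp[OF lm_lift]]]])
 fix ds vs assume h: "homogeneous U ds vs"
 then obtain n where n: "length vs = Suc n" by (cases vs) (auto simp: homogeneous_nth)
 have "integrate (S.\<Delta> (pure U vs)) (\<lambda>a b. snoc_word U' (approx n a) (f b)) =
  integrate (S.\<Delta> (pure U vs)) (\<lambda>a b. snoc_word U' (lift a) (f b))"
 proof (rule S.integrate_coproduct_cong[OF h bm_snoc_comp[OF lm_approx] bm_snoc_comp[OF lm_lift]])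
  fix cs us es ws assume us: "homogeneous U cs us" and ws: "homogeneous U es ws" "length us + length ws = length vs"
  then have "length us \<le> n" using n by (cases ws) (auto simp: homogeneous_nth)
  then show "snoc_word U' (approx n (pure U us)) (f (pure U ws)) = snoc_word U' (lift (pure U us)) (f (pure U ws))"
   using approx_stable[OF us, of n "length us"] by (simp add: lift_pure)
 qed
 then show "lift (pure U vs) = pure U' [f (pure U vs)] + integrate (S.\<Delta> (pure U vs)) (\<lambda>a b. snoc_word U' (lift a) (f b))"
  by (simp add: lift_pure n)
qed

lemma proj1_lift: "x \<in> elems S.T ==> R.\<pi> (lift x) = f x"
proof -
 assume x: "x \<in> elems S.T"
 let ?I = "integrate (S.\<Delta> x) (\<lambda>a b. snoc_word U' (lift a) (f b))"
 have fx: "f x \<in> elems U'" by (rule lm_in[OF lm_f x])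
 have w: "[f x] \<in> words U'" using fx by (simp add: words_def)
 have "R.\<pi> ?I = 0"
  by (rule integrate_zero[OF vs_simps(2,2) S.\<Delta>_in[OF x] bm_snoc_comp[OF lm_lift] R.vU R.lm_\<pi>])
   (rule proj1_snoc_word[OF R.vU lm_in[OF lm_lift] lm_in[OF lm_f]])
 moreover have "R.\<pi> (pure U' [f x]) = f x" using proj1_pure[OF R.vU w] by simp
 ultimately show ?thesis
  unfolding lift_rec[OF x]
  using lm_add[OF R.lm_\<pi> pure_in[OF R.vU w] integrate_in[OF vs_simps(2,2) S.\<Delta>_in[OF x] bm_snoc_comp[OF lm_lift]]] by simp
qed

lemma graded_lift: "graded_map S.T R.T 0 lift"
proof -
 have pure: "lift (pure U vs) \<in> hcomp R.T (sum_list ds)" if "homogeneous U ds vs" for ds vs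
  using that
 proof (induct "length vs" arbitrary: ds vs rule: less_induct)
  case less
  note h = less(2)
  have "f (pure U vs) \<in> hcomp U' (sum_list ds)" using f hcomp_pure[OF h] by (auto simp: graded_map_def)
  from hcomp_pure[OF homogeneous_singleton[OF this]] have 1: "pure U' [f (pure U vs)] \<in> hcomp R.T (sum_list ds)" by simp
  have 2: "snoc_word U' (lift (pure U (take k (pm vs \<sigma>)))) (f (pure U (drop k (pm vs \<sigma>)))) \<in> hcomp R.T (sum_list ds)"
   if k: "k \<in> {1..length vs - 1}" and \<sigma>: "\<sigma> \<in> Sh [k, length vs - k - 1]" for k \<sigma>
  proof -
   have k': "0 < k" "k < length vs" using k by auto
   note p = Sh_two_permutes(2)[OF \<sigma> k'(2)]
   have h': "homogeneous U (pm ds \<sigma>) (pm vs \<sigma>)" by (rule homogeneous_pm[OF h p])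
   have "lift (pure U (take k (pm vs \<sigma>))) \<in> hcomp R.T (sum_list (take k (pm ds \<sigma>)))"
    by (rule less(1)[OF _ homogeneous_take[OF h' k'(1)]]) (use k' in simp)
   moreover have "f (pure U (drop k (pm vs \<sigma>))) \<in> hcomp U' (sum_list (drop k (pm ds \<sigma>)))"
    using f hcomp_pure[OF homogeneous_drop[OF h', of k]] k' by (auto simp: graded_map_def)
   moreover have "sum_list (take k (pm ds \<sigma>)) + sum_list (drop k (pm ds \<sigma>)) = sum_list ds"
    using sum_list_pm[of \<sigma> ds] p h by (simp add: homogeneous_length flip: sum_list_append)
   ultimately show ?thesis using hcomp_snoc_word[OF R.gT R.vU] by metis
  qed
  have "(\<Sum>k=1..length vs - 1. \<Sum>\<sigma>\<in>Sh [k, length vs - k - 1]. smult R.T (koszul ds \<sigma>)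
    (snoc_word U' (lift (pure U (take k (pm vs \<sigma>)))) (f (pure U (drop k (pm vs \<sigma>)))))) \<in> hcomp R.T (sum_list ds)"
   by (intro hcomp_sum[OF R.gT] hcomp_smult[OF R.gT] 2)
  then show ?case
   unfolding lift_rec[OF S.pure_T[OF h]] S.integrate_coproduct[OF h bm_snoc_comp[OF lm_lift]]
   by (rule hcomp_add[OF R.gT 1])
 qed
 show ?thesis by (rule graded_map_from_words[OF S.graded R.gT lm_lift]) (simp add: pure)
qed

text \<open>By induction on the length of words.  Expanding the left side with the recursion and
 \<open>coproduct_snoc\<close>, and the right side with the recursion in the second factor, the terms match up by
 the Zinbiel relation for $\Delta$ of the word.\<close>

lemma coalgebra_map_lift: "coalgebra_map lift"
proof -
 let ?F = lift
 have word: "R.\<Delta> (?F (pure U vs)) \<beta> = S.\<Delta> (pure U vs) (\<lambda>a b. \<beta> (?F a) (?F b))"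
  if "homogeneous U ds vs" "bilinear_form R.T R.T \<beta>" for ds vs \<beta>
  using that
 proof (induct "length vs" arbitrary: ds vs \<beta> rule: less_induct)
  case less
  note h = less(2) and \<beta> = less(3)
  let ?x = "pure U vs"
  have x: "?x \<in> elems S.T" by (rule S.pure_T[OF h])
  define g where "g a b = snoc_word U' (?F a) (f b)" for a b
  have g: "bilinear_map S.T S.T R.T g" unfolding g_def by (rule bm_snoc_comp[OF lm_lift])
  define \<mu> where "\<mu> p q b = \<beta> (?F p) (g q b)" for p q b
  have \<mu>: "trilinear S.T S.T S.T \<mu>" unfolding \<mu>_def
  proof (rule trilinearI)
   show "lform S.T (\<lambda>b. \<beta> (?F p) (g q b))" if "p \<in> elems S.T" "q \<in> elems S.T" for p q
    by (rule lm_comp[OF bm_right[OF g that(2)] bf_right[OF \<beta> lm_in[OF lm_lift that(1)]]])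
   show "lform S.T (\<lambda>q. \<beta> (?F p) (g q b))" if "p \<in> elems S.T" "b \<in> elems S.T" for p b
    by (rule lm_comp[OF bm_left[OF g that(2)] bf_right[OF \<beta> lm_in[OF lm_lift that(1)]]])
   show "lform S.T (\<lambda>p. \<beta> (?F p) (g q b))" if "q \<in> elems S.T" "b \<in> elems S.T" for q b
    by (rule lm_comp[OF lm_lift bf_left[OF \<beta> lm_in[OF bm_left[OF g that(2)] that(1)]]])
  qed
  let ?b1 = "\<lambda>a b. \<beta> (?F a) (pure U' [f b])"
  let ?b2 = "\<lambda>a b. S.\<Delta> a (\<lambda>p q. \<mu> p q b)"
  let ?b3 = "\<lambda>a b. S.\<Delta> a (swap_form S.T S.T (\<lambda>p q. \<mu> p q b))"
  have b1: "bilinear_form S.T S.T ?b1" by (rule bf_comp[OF \<beta> lm_lift lm_comp[OF lm_f lm_letter[OF R.vU]]])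
  have b2: "bilinear_form S.T S.T ?b2" by (rule S.bf_int12[OF \<mu> vs_simps(2)])
  have b3: "bilinear_form S.T S.T ?b3"
   by (rule S.bf_int12[OF trilinear_swap_form[OF S.gT S.gT vs_simps(2) \<mu>] vs_simps(2)])
  have b4: "bilinear_form S.T S.T (\<lambda>a b. S.\<Delta> b (\<mu> a))" by (rule S.bf_int23[OF \<mu> vs_simps(2)])
  note b12 = bf_plus[OF vs_simps(2,2) S.\<Delta>_in[OF x] b1 b2]
  have fx: "f ?x \<in> elems U'" by (rule lm_in[OF lm_f x])
  have fx': "pure U' [f ?x] \<in> elems R.T" by (rule lm_in[OF lm_letter[OF R.vU] fx])
  have "R.\<Delta> (?F ?x) \<beta> = R.\<Delta> (pure U' [f ?x]) \<beta> + R.\<Delta> (integrate (S.\<Delta> ?x) g) \<beta>"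
   unfolding lift_rec[OF x] g_def[symmetric]
   by (rule lm_add[OF R.lm_\<Delta>_eval fx' integrate_in[OF vs_simps(2,2) S.\<Delta>_in[OF x] g]])
  also have "\<dots> = S.\<Delta> ?x (\<lambda>a b. R.\<Delta> (g a b) \<beta>)"
   using R.coproduct_letter[OF fx \<beta>] integrate_push[OF vs_simps(2,2) S.\<Delta>_in[OF x] g R.lm_\<Delta>_eval] by simp
  also have "\<dots> = S.\<Delta> ?x (\<lambda>a b. (?b1 a b + ?b2 a b) + ?b3 a b)"
  proof (rule S.coproduct_cong[OF h bm_form[OF g R.lm_\<Delta>_eval] bf_plus[OF vs_simps(2,2) S.\<Delta>_in[OF x] b12 b3]])
   fix cs us es ws assume us: "homogeneous U cs us" and ws: "homogeneous U es ws" and len: "length us + length ws = length vs"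
   let ?a = "pure U us" and ?b = "pure U ws"
   have a: "?a \<in> elems S.T" and b: "?b \<in> elems S.T" using S.pure_T us ws by auto
   have l: "length us < length vs" by (rule shorter_factor[OF ws len])
   let ?\<nu> = "\<lambda>p q. \<beta> p (snoc_word U' q (f ?b))"
   have fb: "f ?b \<in> elems U'" by (rule lm_in[OF lm_f b])
   have \<nu>: "bilinear_form R.T R.T ?\<nu>"
    by (rule bf_comp[OF \<beta> lm_id(1) bm_left[OF bm_snoc_word[OF R.vU] fb]])
   have "R.\<Delta> (g ?a ?b) \<beta> = \<beta> (?F ?a) (pure U' [f ?b]) + R.\<Delta> (?F ?a) ?\<nu> + R.\<Delta> (?F ?a) (swap_form R.T R.T ?\<nu>)"
    unfolding g_def by (rule R.coproduct_snoc[OF lm_in[OF lm_lift a] fb \<beta>])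
   also have "R.\<Delta> (?F ?a) ?\<nu> = ?b2 ?a ?b"
    unfolding less(1)[OF l us \<nu>] \<mu>_def g_def ..
   also have "R.\<Delta> (?F ?a) (swap_form R.T R.T ?\<nu>) = S.\<Delta> ?a (\<lambda>p q. swap_form R.T R.T ?\<nu> (?F p) (?F q))"
    by (rule less(1)[OF l us bf_swap_form[OF R.gT R.gT \<nu>]])
   also have "\<dots> = ?b3 ?a ?b" unfolding \<mu>_def g_def
    by (rule tens_cong[OF vs_simps(2,2) S.\<Delta>_in[OF a]]) (rule swap_form_hom[OF S.gT R.gT graded_lift])
   finally show "R.\<Delta> (g ?a ?b) \<beta> = (?b1 ?a ?b + ?b2 ?a ?b) + ?b3 ?a ?b" .
  qed
  also have "\<dots> = S.\<Delta> ?x ?b1 + (S.\<Delta> ?x ?b2 + S.\<Delta> ?x ?b3)"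
   unfolding tens_plus[OF vs_simps(2,2) S.\<Delta>_in[OF x] b12 b3] tens_plus[OF vs_simps(2,2) S.\<Delta>_in[OF x] b1 b2]
   by (rule add.assoc)
  also have "S.\<Delta> ?x ?b2 + S.\<Delta> ?x ?b3 = S.\<Delta> ?x (\<lambda>a b. S.\<Delta> b (\<mu> a))"
   by (rule S.zinbiel_form[OF x \<mu>, symmetric])
  also have "S.\<Delta> ?x ?b1 + S.\<Delta> ?x (\<lambda>a b. S.\<Delta> b (\<mu> a)) = S.\<Delta> ?x (\<lambda>a b. ?b1 a b + S.\<Delta> b (\<mu> a))"
   by (rule tens_plus[OF vs_simps(2,2) S.\<Delta>_in[OF x] b1 b4, symmetric])
  also have "\<dots> = S.\<Delta> ?x (\<lambda>a b. \<beta> (?F a) (?F b))"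
  proof (rule tens_cong[OF vs_simps(2,2) S.\<Delta>_in[OF x]])
   fix a b assume a: "a \<in> elems S.T" and b: "b \<in> elems S.T"
   note L = bf_right[OF \<beta> lm_in[OF lm_lift a]]
   have "\<beta> (?F a) (integrate (S.\<Delta> b) g) = S.\<Delta> b (\<mu> a)"
    unfolding \<mu>_def by (rule integrate_push[OF vs_simps(2,2) S.\<Delta>_in[OF b] g L])
   then show "?b1 a b + S.\<Delta> b (\<mu> a) = \<beta> (?F a) (?F b)"
    unfolding lift_rec[OF b] g_def[symmetric]
    using lm_add[OF L lm_in[OF lm_letter[OF R.vU] lm_in[OF lm_f b]] integrate_in[OF vs_simps(2,2) S.\<Delta>_in[OF b] g]] by simp
  qed
  finally show ?case .
 qed
 show ?thesis
  unfolding coalgebra_map_def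
 proof (intro conjI ballI allI impI lm_lift)
  fix x \<beta> assume x: "x \<in> elems S.T" and \<beta>: "bilinear_form R.T R.T \<beta>"
  show "R.\<Delta> (?F x) \<beta> = S.\<Delta> x (\<lambda>a b. \<beta> (?F a) (?F b))"
   by (rule tmod_eq[OF S.vU lm_comp[OF lm_lift R.lm_\<Delta>_eval] S.lm_\<Delta>_eval _ x]) (rule word[OF _ \<beta>])
 qed
qed

end

end

section \<open>Shuffles and signs\<close>

subsection \<open>The Koszul sign is a cocycle\<close>

definition pairs :: "nat => (nat \<times> nat) set" where
 "pairs n = {(a, b). 1 \<le> a \<and> a < b \<and> b \<le> n}"

lemma finite_pairs [simp]: "finite (pairs n)"
 by (rule finite_subset[of _ "{1..n} \<times> {1..n}"]) (auto simp: pairs_def)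

lemma koszul_pairs:
 "koszul ds \<sigma> = (\<Prod>(a, b)\<in>pairs (length ds). if \<sigma> b < \<sigma> a then (-1 :: 'k::field) powi (ds ! (\<sigma> a - 1) * ds ! (\<sigma> b - 1)) else 1)"
proof -
 have "{(a, b). 1 \<le> a \<and> a < b \<and> b \<le> length ds \<and> \<sigma> b < \<sigma> a} = pairs (length ds) \<inter> {(a, b). \<sigma> b < \<sigma> a}"
  by (auto simp: pairs_def)
 then show ?thesis
  unfolding koszul_def by (auto simp: prod.inter_restrict case_prod_beta intro!: prod.cong)
qed

lemma prod_pairs_permute:
 assumes \<rho>: "\<rho> permutes {1..n}" and sym: "\<And>p q. g p q = g q p"
 shows "(\<Prod>(p, q)\<in>pairs n. g p q) = (\<Prod>(a, b)\<in>pairs n. g (\<rho> a) (\<rho> b))"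
proof -
 let ?h = "\<lambda>\<tau> (a, b). (min (\<tau> a) (\<tau> b), max (\<tau> a) (\<tau> b) :: nat)"
 have h: "?h \<tau> x \<in> pairs n" if \<tau>: "\<tau> permutes {1..n}" and xP: "x \<in> pairs n" for \<tau> x
 proof -
  obtain a b where x: "x = (a, b)" "1 \<le> a" "a < b" "b \<le> n" using xP by (auto simp: pairs_def)
  then have "\<tau> a \<in> {1..n}" "\<tau> b \<in> {1..n}" using permutes_in_image[OF \<tau>] by auto
  moreover have "\<tau> a \<noteq> \<tau> b" using permutes_inj[OF \<tau>] x by (auto dest: injD)
  ultimately show ?thesis using x by (auto simp: pairs_def min_def max_def)
 qed
 have inv: "?h \<tau> (?h \<upsilon> x) = x" if "\<And>y. \<tau> (\<upsilon> y) = y" "x \<in> pairs n" for \<tau> \<upsilon> x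
  using that by (auto simp: pairs_def min_def max_def)
 show ?thesis
 proof (rule prod.reindex_bij_witness[of _ "?h \<rho>" "?h (inv \<rho>)"])
  fix x assume x: "x \<in> pairs n"
  show "?h \<rho> (?h (inv \<rho>) x) = x" "?h (inv \<rho>) (?h \<rho> x) = x"
   using permutes_inverses[OF \<rho>] by (auto intro!: inv x)
  show "?h (inv \<rho>) x \<in> pairs n" "?h \<rho> x \<in> pairs n"
   by (rule h[OF permutes_inv[OF \<rho>] x], rule h[OF \<rho> x])
  obtain p q where pq: "x = (p, q)" by force
  show "(case ?h (inv \<rho>) x of (a, b) => g (\<rho> a) (\<rho> b)) = (case x of (p, q) => g p q)"
   unfolding pq using permutes_inverses[OF \<rho>] sym by (auto simp: min_def max_def)
 qed
qed

text \<open>Compare both sides as products over pairs of positions: a pair is inverted by $\alpha\circ\rho$ iff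
 it is inverted by exactly one of the two steps, and a pair inverted twice contributes a square.\<close>

lemma koszul_comp:
 assumes \<alpha>: "\<alpha> permutes {1..length ds}" and \<rho>: "\<rho> permutes {1..length ds}"
 shows "koszul ds (\<alpha> \<circ> \<rho>) = koszul ds \<alpha> * (koszul (pm ds \<alpha>) \<rho> :: 'k::field)"
proof -
 let ?n = "length ds"
 let ?c = "\<lambda>x y. (-1 :: 'k) powi (ds ! (x - 1) * ds ! (y - 1))"
 let ?g = "\<lambda>p q. if (p < q \<and> \<alpha> q < \<alpha> p) \<or> (q < p \<and> \<alpha> p < \<alpha> q) then ?c (\<alpha> p) (\<alpha> q) else 1"
 have cc: "?c x y * ?c x y = 1" for x y by (simp add: powi_minus_one_parity)
 have 1: "koszul ds \<alpha> = (\<Prod>(p, q)\<in>pairs ?n. ?g p q)"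
  unfolding koszul_pairs by (rule prod.cong) (auto simp: pairs_def)
 also have "\<dots> = (\<Prod>(a, b)\<in>pairs ?n. ?g (\<rho> a) (\<rho> b))"
  by (rule prod_pairs_permute[OF \<rho>]) (auto simp: mult.commute)
 finally have A: "koszul ds \<alpha> = (\<Prod>(a, b)\<in>pairs ?n. ?g (\<rho> a) (\<rho> b))" .
 have R: "koszul (pm ds \<alpha>) \<rho> = (\<Prod>(a, b)\<in>pairs ?n. if \<rho> b < \<rho> a then ?c (\<alpha> (\<rho> a)) (\<alpha> (\<rho> b)) else 1)"
  unfolding koszul_pairs length_pm
 proof (rule prod.cong[OF refl])
  fix x assume "x \<in> pairs ?n"
  then obtain a b where x: "x = (a, b)" "1 \<le> a" "a < b" "b \<le> ?n" by (auto simp: pairs_def)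
  then have "\<rho> a \<in> {1..?n}" "\<rho> b \<in> {1..?n}" using permutes_in_image[OF \<rho>] by auto
  then have "pm ds \<alpha> ! (\<rho> a - 1) = ds ! (\<alpha> (\<rho> a) - 1)" "pm ds \<alpha> ! (\<rho> b - 1) = ds ! (\<alpha> (\<rho> b) - 1)"
   by (auto simp: nth_pm)
  then show "(case x of (a, b) => if \<rho> b < \<rho> a then (-1 :: 'k) powi (pm ds \<alpha> ! (\<rho> a - 1) * pm ds \<alpha> ! (\<rho> b - 1)) else 1) =
   (case x of (a, b) => if \<rho> b < \<rho> a then ?c (\<alpha> (\<rho> a)) (\<alpha> (\<rho> b)) else 1)"
   by (simp add: x(1))
 qed
 have "koszul ds (\<alpha> \<circ> \<rho>) = (\<Prod>(a, b)\<in>pairs ?n. ?g (\<rho> a) (\<rho> b) * (if \<rho> b < \<rho> a then ?c (\<alpha> (\<rho> a)) (\<alpha> (\<rho> b)) else 1))"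
  unfolding koszul_pairs
 proof (rule prod.cong[OF refl])
  fix x assume "x \<in> pairs ?n"
  then obtain a b where x: "x = (a, b)" "a < b" by (auto simp: pairs_def)
  have "\<rho> a \<noteq> \<rho> b" "\<alpha> (\<rho> a) \<noteq> \<alpha> (\<rho> b)"
   using x permutes_inj[OF \<alpha>] permutes_inj[OF \<rho>] by (auto dest: injD)
  then show "(case x of (a, b) => if (\<alpha> \<circ> \<rho>) b < (\<alpha> \<circ> \<rho>) a then (-1 :: 'k) powi (ds ! ((\<alpha> \<circ> \<rho>) a - 1) * ds ! ((\<alpha> \<circ> \<rho>) b - 1)) else 1) =
   (case x of (a, b) => ?g (\<rho> a) (\<rho> b) * (if \<rho> b < \<rho> a then ?c (\<alpha> (\<rho> a)) (\<alpha> (\<rho> b)) else 1))"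
   unfolding x(1) prod.case o_apply
   by (cases "\<rho> a < \<rho> b"; cases "\<alpha> (\<rho> a) < \<alpha> (\<rho> b)") (simp_all add: cc)
 qed
 also have "\<dots> = koszul ds \<alpha> * koszul (pm ds \<alpha>) \<rho>"
  unfolding A R prod.distrib[symmetric] by (rule prod.cong) auto
 finally show ?thesis .
qed

lemma pm_comp: "\<alpha> permutes {1..length vs} ==> \<rho> permutes {1..length vs} ==> pm vs (\<alpha> \<circ> \<rho>) = pm (pm vs \<alpha>) \<rho>"
proof (rule nth_equalityI)
 fix i assume \<rho>: "\<rho> permutes {1..length vs}" and "i < length (pm vs (\<alpha> \<circ> \<rho>))"
 then have i: "i < length vs" by simp
 have "\<rho> (Suc i) \<in> {1..length vs}" using permutes_in_image[OF \<rho>, of "Suc i"] i by simp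
 then have "\<rho> (Suc i) - 1 < length vs" "Suc (\<rho> (Suc i) - 1) = \<rho> (Suc i)" by auto
 then show "pm vs (\<alpha> \<circ> \<rho>) ! i = pm (pm vs \<alpha>) \<rho> ! i" using i by (simp only: nth_pm length_pm o_apply)
qed simp

lemma koszul_take:
 assumes \<rho>: "\<rho> permutes {1..k}" and k: "k \<le> length ds"
 shows "koszul (take k ds) \<rho> = koszul ds \<rho>"
proof -
 have eq: "{(a, b). 1 \<le> a \<and> a < b \<and> b \<le> length ds \<and> \<rho> b < \<rho> a} = {(a, b). 1 \<le> a \<and> a < b \<and> b \<le> length (take k ds) \<and> \<rho> b < \<rho> a}"
 proof -
  have "b \<le> k" if "1 \<le> a" "a < b" "\<rho> b < \<rho> a" for a b
  proof (rule ccontr)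
   assume "\<not> b \<le> k"
   then have "\<rho> b = b" using permutes_not_in[OF \<rho>] by simp
   moreover have "\<rho> a \<le> max a k" using permutes_in_image[OF \<rho>, of a] permutes_not_in[OF \<rho>, of a] by (cases "a \<in> {1..k}") auto
   ultimately show False using that \<open>\<not> b \<le> k\<close> by auto
  qed
  then have "(1 \<le> a \<and> a < b \<and> b \<le> length ds \<and> \<rho> b < \<rho> a) = (1 \<le> a \<and> a < b \<and> b \<le> length (take k ds) \<and> \<rho> b < \<rho> a)" for a b
   using k by (auto intro: order_trans)
  then show ?thesis by simp
 qed
 show ?thesis unfolding koszul_def eq
 proof (rule prod.cong[OF refl])
  fix x assume "x \<in> {(a, b). 1 \<le> a \<and> a < b \<and> b \<le> length (take k ds) \<and> \<rho> b < \<rho> a}"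
  then obtain a b where x: "x = (a, b)" "a \<in> {1..k}" "b \<in> {1..k}" by auto
  then have "\<rho> a \<in> {1..k}" "\<rho> b \<in> {1..k}" using permutes_in_image[OF \<rho>] by blast+
  then show "(case x of (a, b) => (-1) powi (take k ds ! (\<rho> a - 1) * take k ds ! (\<rho> b - 1))) =
   (case x of (a, b) => (-1) powi (ds ! (\<rho> a - 1) * ds ! (\<rho> b - 1)))"
   unfolding x(1) prod.case by (subst (1 2) nth_take) auto
 qed
qed

subsection \<open>Suspension and Koszul signs\<close>

text \<open>Sorting by adjacent swaps.\<close>

lemma adjacent_transpositions_induct [consumes 1, case_names id comp adjacent]:
 assumes \<sigma>: "\<sigma> permutes {1..n::nat}" and id: "Q id"
  and comp: "\<And>\<alpha> \<rho>. \<alpha> permutes {1..n} ==> \<rho> permutes {1..n} ==> Q \<alpha> ==> Q \<rho> ==> Q (\<alpha> \<circ> \<rho>)"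
  and adj: "\<And>a. 1 \<le> a ==> a < n ==> Q (transpose a (Suc a))"
 shows "Q \<sigma>"
proof -
 have tr: "Q (transpose a (Suc (a + m)))" if "1 \<le> a" "a + m < n" for a m
  using that
 proof (induct m)
  case 0 then show ?case using adj by simp
 next
  case (Suc m)
  let ?b = "Suc (a + m)"
  have p: "transpose ?b (Suc ?b) permutes {1..n}" "transpose a ?b permutes {1..n}"
   using Suc by (auto intro!: permutes_swap_id)
  have "transpose a (Suc ?b) = transpose ?b (Suc ?b) \<circ> (transpose a ?b \<circ> transpose ?b (Suc ?b))"
   by (auto simp: fun_eq_iff transpose_def)
  moreover have b: "Q (transpose ?b (Suc ?b))" using adj Suc by simp
  moreover have "Q (transpose a ?b)" using Suc by simp
  ultimately show ?case
   using comp[OF p(1) permutes_compose[OF p(1,2)] b comp[OF p(2,1) _ b]] by (simp only: add_Suc_right)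
 qed
 have tr': "Q (transpose a b)" if "a \<in> {1..n}" "b \<in> {1..n}" "a < b" for a b
  using tr[of a "b - Suc a"] that by simp
 have tr'': "Q (transpose a b)" if "a \<in> {1..n}" "b \<in> {1..n}" "a \<noteq> b" for a b
  using tr'[of a b] tr'[of b a] that by (cases "a < b") (auto simp: transpose_commute)
 have "\<sigma> permutes {1..n} \<and> Q \<sigma>"
  using \<sigma> finite_atLeastAtMost[of 1 n]
 proof (induct rule: permutes_induct)
  case id show ?case by (intro conjI permutes_id \<open>Q id\<close>)
 next
  case (swap a b p)
  have t: "transpose a b permutes {1..n}" by (rule permutes_swap_id[OF swap(1,2)])
  have p: "p permutes {1..n}" "Q p" using swap(4) by auto
  show ?case by (intro conjI permutes_compose[OF p(1) t] comp[OF t p(1) tr''[OF swap(1,2,3)] p(2)])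
 qed
 then show ?thesis by simp
qed

lemma susp_sign_square [simp]: "susp_sign ds * susp_sign ds = (1 :: 'k::field)"
 "susp_sign ds * (susp_sign ds * x) = (x :: 'k::field)"
 by (simp_all add: susp_sign_def powi_minus_one_parity)

lemma powi_minus_one_add: "(-1 :: 'k::field) powi (a + b) = (-1) powi a * (-1) powi b"
 by (rule power_int_add) simp

lemma susp_sign_append:
 "susp_sign (xs @ ys) = susp_sign xs * (-1 :: 'k::field) powi (int (length ys) * sum_list xs) * susp_sign ys"
proof -
 let ?n = "length xs" and ?m = "length ys"
 have split: "(\<Sum>r=1..?n + ?m. g r) = (\<Sum>r=1..?n. g r) + (\<Sum>r=1..?m. g (?n + r))" for g :: "nat => int"
 proof -
  have "(\<Sum>r=1..?n + ?m. g r) = (\<Sum>r=1..?n. g r) + (\<Sum>r=?n + 1..?n + ?m. g r)"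
   by (rule sum.ub_add_nat) simp
  also have "(\<Sum>r=?n + 1..?n + ?m. g r) = (\<Sum>r=1..?m. g (?n + r))"
   using sum.shift_bounds_cl_nat_ivl[of g 1 ?n ?m] by (simp add: add.commute)
  finally show ?thesis .
 qed
 have sl: "sum_list xs = (\<Sum>r=1..?n. xs ! (r - 1))"
  unfolding sum_list_sum_nth by (rule sum.reindex_bij_witness[of _ "\<lambda>i. i - 1" Suc]) auto
 have "(\<Sum>r=1..length (xs @ ys). int (length (xs @ ys) - r) * (xs @ ys) ! (r - 1))
  = (\<Sum>r=1..?n. int (?n + ?m - r) * (xs @ ys) ! (r - 1)) + (\<Sum>r=1..?m. int (?n + ?m - (?n + r)) * (xs @ ys) ! (?n + r - 1))"
  unfolding length_append by (rule split)
 also have "(\<Sum>r=1..?n. int (?n + ?m - r) * (xs @ ys) ! (r - 1)) =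
  (\<Sum>r=1..?n. int (?n - r) * xs ! (r - 1) + int ?m * xs ! (r - 1))"
  by (rule sum.cong) (auto simp: nth_append of_nat_diff algebra_simps)
 also have "\<dots> = (\<Sum>r=1..?n. int (?n - r) * xs ! (r - 1)) + int ?m * sum_list xs"
  by (simp add: sum.distrib sl sum_distrib_left)
 also have "(\<Sum>r=1..?m. int (?n + ?m - (?n + r)) * (xs @ ys) ! (?n + r - 1)) = (\<Sum>r=1..?m. int (?m - r) * ys ! (r - 1))"
  by (rule sum.cong) (auto simp: nth_append)
 finally show ?thesis unfolding susp_sign_def by (simp only: powi_minus_one_add)
qed

lemma susp_sign_Nil [simp]: "susp_sign [] = 1" "susp_sign [d] = 1"
 by (simp_all add: susp_sign_def)

lemma koszul_adjacent:
 assumes "1 \<le> a" "a < length ds"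
 shows "koszul ds (transpose a (Suc a)) = (-1 :: 'k::field) powi (ds ! a * ds ! (a - 1))"
proof -
 have "{(x, y). 1 \<le> x \<and> x < y \<and> y \<le> length ds \<and> transpose a (Suc a) y < transpose a (Suc a) x} = {(a, Suc a)}"
  using assms by (auto simp: transpose_def split: if_splits)
 then show ?thesis unfolding koszul_def by (simp add: mult.commute)
qed

text \<open>Both sides are multiplicative along $\alpha\circ\rho$ by \<open>koszul_comp\<close>, so it suffices to treat an
 adjacent transposition; there the degrees \<open>a\<close> and \<open>b\<close> contribute $(a+1)(b+1) - ab = a + b + 1$, where 1 is
 the signature and $a + b$ is the change of the sign of $s^{\otimes n}$.\<close>

lemma koszul_susp:
 assumes "\<sigma> permutes {1..length ds}"
 shows "koszul (map (\<lambda>d. d + 1) ds) \<sigma> =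
  koszul ds \<sigma> * of_int (sign \<sigma>) * susp_sign ds * (susp_sign (pm ds \<sigma>) :: 'k::field)"
proof -
 define n where "n = length ds"
 have "\<sigma> permutes {1..n}" using assms by (simp add: n_def)
 then have "\<forall>ds. length ds = n \<longrightarrow> koszul (map (\<lambda>d. d + 1) ds) \<sigma> =
  koszul ds \<sigma> * of_int (sign \<sigma>) * susp_sign ds * (susp_sign (pm ds \<sigma>) :: 'k)"
 proof (induct rule: adjacent_transpositions_induct)
  case id show ?case unfolding koszul_id pm_id sign_id by simp
 next
  case (comp \<alpha> \<rho>)
  show ?case
  proof (intro allI impI)
   fix ds :: "int list" assume n: "length ds = n"
   have perm: "permutation \<alpha>" "permutation \<rho>" using comp(1,2) by (auto simp: permutation_permutes)
   have p: "\<alpha> permutes {1..length ds}" "\<rho> permutes {1..length ds}" using comp n by auto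
   have pm: "pm (map (\<lambda>d. d + 1) ds) \<alpha> = map (\<lambda>d. d + 1) (pm ds \<alpha>)"
    using permutes_range[OF p(1)] by (intro nth_equalityI) (simp_all add: nth_pm)
   have "koszul (map (\<lambda>d. d + 1) ds) (\<alpha> \<circ> \<rho>) = koszul (map (\<lambda>d. d + 1) ds) \<alpha> * (koszul (map (\<lambda>d. d + 1) (pm ds \<alpha>)) \<rho> :: 'k)"
    using koszul_comp[of \<alpha> "map (\<lambda>d. d + 1) ds" \<rho>] p by (simp add: pm)
   also have "\<dots> = (koszul ds \<alpha> * of_int (sign \<alpha>) * susp_sign ds * susp_sign (pm ds \<alpha>)) *
    (koszul (pm ds \<alpha>) \<rho> * of_int (sign \<rho>) * susp_sign (pm ds \<alpha>) * susp_sign (pm (pm ds \<alpha>) \<rho>))"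
    using comp(3,4) n by simp
   also have "\<dots> = (koszul ds \<alpha> * koszul (pm ds \<alpha>) \<rho>) * (of_int (sign \<alpha>) * of_int (sign \<rho>)) * susp_sign ds *
    (susp_sign (pm ds \<alpha>) * susp_sign (pm ds \<alpha>)) * susp_sign (pm (pm ds \<alpha>) \<rho>)"
    by (simp only: ac_simps)
   also have "\<dots> = koszul ds (\<alpha> \<circ> \<rho>) * of_int (sign (\<alpha> \<circ> \<rho>)) * susp_sign ds * susp_sign (pm ds (\<alpha> \<circ> \<rho>))"
    by (simp only: koszul_comp[OF p] pm_comp[OF p] sign_compose[OF perm] susp_sign_square mult_1_right of_int_mult)
   finally show "koszul (map (\<lambda>d. d + 1) ds) (\<alpha> \<circ> \<rho>) = koszul ds (\<alpha> \<circ> \<rho>) * of_int (sign (\<alpha> \<circ> \<rho>)) * susp_sign ds *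
     (susp_sign (pm ds (\<alpha> \<circ> \<rho>)) :: 'k)" .
  qed
 next
  case (adjacent a)
  show ?case
  proof (intro allI impI)
   fix ds :: "int list" assume n: "length ds = n"
   have a: "1 \<le> a" "a < length ds" using adjacent n by auto
   let ?t = "transpose a (Suc a)"
   define xs ys where "xs = take (a - 1) ds" and "ys = drop (Suc a) ds"
   define x y where "x = ds ! (a - 1)" and "y = ds ! a"
   have "drop (a - 1) ds = x # drop a ds" "drop a ds = y # ys"
    using Cons_nth_drop_Suc[of "a - 1" ds] Cons_nth_drop_Suc[of a ds] a by (simp_all add: x_def y_def ys_def)
   then have ds: "ds = xs @ [x, y] @ ys" using append_take_drop_id[of "a - 1" ds] by (simp add: xs_def)
   have lx: "length xs = a - 1" using a by (simp add: xs_def)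
   have pt: "pm ds ?t = xs @ [y, x] @ ys"
   proof (rule nth_equalityI)
    fix i assume "i < length (pm ds ?t)"
    then have i: "i < length ds" by simp
    show "pm ds ?t ! i = (xs @ [y, x] @ ys) ! i"
    proof (cases "i = a - 1 \<or> i = a")
     case True
     then show ?thesis using i a lx by (auto simp: nth_pm x_def y_def nth_append nth_Cons')
    next
     case False
     then have "?t (Suc i) = Suc i" using a by (auto simp: transpose_def)
     then have "pm ds ?t ! i = ds ! i" using i by (simp add: nth_pm)
     also have "\<dots> = (xs @ [y, x] @ ys) ! i" using False a lx by (subst ds) (auto simp: nth_append nth_Cons')
     finally show ?thesis .
    qed
   qed (subst ds, simp)
   have S: "susp_sign ds * susp_sign (pm ds ?t) = (-1 :: 'k) powi (x + y)"
   proof -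
    have sq: "z powi m * z powi m = (1 :: 'k)" if "z = -1" for z :: 'k and m :: int
     using that by (simp add: powi_minus_one_parity)
    define a u c b where "a = (susp_sign xs :: 'k)" and "u = (-1 :: 'k) powi (int (2 + length ys) * sum_list xs)"
     and "c = (-1 :: 'k) powi (int (length ys) * (x + y))" and "b = (susp_sign ys :: 'k)"
    have two: "susp_sign [x', y'] = (-1 :: 'k) powi x'" for x' y'
     using susp_sign_append[of "[x']" "[y']"] by simp
    have "susp_sign ([x', y'] @ ys) = (-1) powi x' * c * b" if "x' + y' = x + y" for x' y'
     unfolding susp_sign_append[of "[x', y']" ys] two using that by (simp add: c_def b_def)
    from this[of x y] this[of y x]
    have "susp_sign ds = a * u * ((-1) powi x * c * b)" "susp_sign (pm ds ?t) = a * u * ((-1) powi y * c * b)"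
     unfolding pt by (subst ds, simp_all only: susp_sign_append[of xs] a_def u_def length_append length_Cons list.size)
      (simp_all add: add.commute)
    then have "susp_sign ds * susp_sign (pm ds ?t) = (a * a) * (u * u) * (c * c) * (b * b) * ((-1) powi x * (-1) powi y)"
     by (simp only: ac_simps)
    then show ?thesis by (simp add: powi_minus_one_add sq a_def b_def c_def u_def)
   qed
   have kos: "koszul ds ?t = (-1 :: 'k) powi (ds ! a * ds ! (a - 1))" by (rule koszul_adjacent[OF a])
   have "koszul (map (\<lambda>d. d + 1) ds) ?t = (-1 :: 'k) powi ((y + 1) * (x + 1))"
    using koszul_adjacent[of a "map (\<lambda>d. d + 1) ds"] a by (simp add: x_def y_def)
   also have "(y + 1) * (x + 1) = y * x + (1 + (x + y))" by (simp add: algebra_simps)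
   also have "(-1 :: 'k) powi \<dots> = koszul ds ?t * of_int (sign ?t) * ((-1) powi (x + y))"
    unfolding kos by (simp add: powi_minus_one_add sign_swap_id x_def y_def)
   finally show "koszul (map (\<lambda>d. d + 1) ds) ?t = koszul ds ?t * of_int (sign ?t) * susp_sign ds * (susp_sign (pm ds ?t) :: 'k)"
    unfolding S[symmetric] by (simp only: mult.assoc)
  qed
 qed
 then show ?thesis by (simp add: n_def)
qed

subsection \<open>Half-shuffles, block by block\<close>

lemma psum_append: "psum (ks @ ks') r = (if r \<le> length ks then psum ks r else sum_list ks + psum ks' (r - length ks))"
 by (simp add: psum_def)

lemma psum_le: "psum ks r \<le> sum_list ks"
 unfolding psum_def by (metis append_take_drop_id le_add1 sum_list_append)

lemma psum_Suc: "r < length ks ==> psum ks (Suc r) = psum ks r + ks ! r"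
 by (simp add: psum_def take_Suc_conv_app_nth)

lemma psum_length: "length ks \<le> r ==> psum ks r = sum_list ks"
 by (simp add: psum_def)

lemma psum_pos:
 assumes "\<forall>k\<in>set ks. 1 \<le> k" "1 \<le> r" "r \<le> length ks" shows "1 \<le> psum ks r"
proof -
 obtain q where r: "r = Suc q" using assms by (cases r) auto
 then have "1 \<le> ks ! q" using assms by (intro bspec[OF assms(1)]) simp
 moreover have "psum ks r = psum ks q + ks ! q" using psum_Suc[of q ks] assms(3) r by simp
 ultimately show ?thesis by linarith
qed

lemma psum_block:
 assumes "1 \<le> j" "j \<le> sum_list ks"
 obtains r where "r < length ks" "psum ks r < j" "j \<le> psum ks (Suc r)"
proof -
 define r where "r = (LEAST r. j \<le> psum ks r)"
 have ex: "j \<le> psum ks (length ks)" using assms by (simp add: psum_length)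
 have r: "j \<le> psum ks r" unfolding r_def by (rule LeastI[of _ "length ks"]) (rule ex)
 have rl: "r \<le> length ks" unfolding r_def by (rule Least_le) (rule ex)
 obtain q where q: "r = Suc q" using r assms by (cases r) (auto simp: psum_def)
 have "\<not> j \<le> psum ks q" using not_less_Least[of q "\<lambda>r. j \<le> psum ks r"] q r_def by simp
 then show ?thesis using that[of q] r rl q by simp
qed

lemma half_ShD:
 assumes "\<sigma> \<in> half_Sh ks"
 shows "\<sigma> permutes {1..sum_list ks}" "\<And>r. r < length ks ==> strict_mono_on {psum ks r + 1..psum ks (r + 1)} \<sigma>"
  "strict_mono_on {1..length ks} (\<lambda>r. \<sigma> (psum ks r))"
 using assms by (auto simp: half_Sh_def Sh_def)

lemma Sh_twoD:
 assumes "\<alpha> \<in> Sh [N, m]"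
 shows "\<alpha> permutes {1..N + m}" "strict_mono_on {1..N} \<alpha>" "strict_mono_on {N + 1..N + m} \<alpha>"
proof -
 have *: "\<And>r. r < length [N, m] ==> strict_mono_on {psum [N, m] r + 1..psum [N, m] (r + 1)} \<alpha>"
  and "\<alpha> permutes {1..sum_list [N, m]}" using assms unfolding Sh_def by blast+
 then show "\<alpha> permutes {1..N + m}" by simp
 show "strict_mono_on {1..N} \<alpha>" "strict_mono_on {N + 1..N + m} \<alpha>"
  using *[of 0] *[of 1] by (simp_all add: psum_def numeral_2_eq_2)
qed

lemma half_Sh_last:
 assumes \<sigma>: "\<sigma> \<in> half_Sh ks" and pos: "\<forall>k\<in>set ks. 1 \<le> k" and ne: "ks \<noteq> []"
 shows "\<sigma> (sum_list ks) = sum_list ks"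
proof -
 let ?n = "sum_list ks"
 have n: "1 \<le> ?n" using psum_pos[OF pos, of "length ks"] ne by (simp add: psum_length Suc_le_eq)
 note p = half_ShD(1)[OF \<sigma>]
 define j where "j = inv \<sigma> ?n"
 have j: "1 \<le> j" "j \<le> ?n" "\<sigma> j = ?n"
  using permutes_in_image[OF permutes_inv[OF p], of ?n] n permutes_inverses[OF p] by (auto simp: j_def)
 from psum_block[OF j(1,2)] obtain r where r: "r < length ks" "psum ks r < j" "j \<le> psum ks (Suc r)" by blast
 have "\<sigma> j \<le> \<sigma> (psum ks (Suc r))"
 proof (cases "j = psum ks (Suc r)")
  case False
  then have "\<sigma> j < \<sigma> (psum ks (Suc r))" using r by (intro strict_mono_onD[OF half_ShD(2)[OF \<sigma> r(1)]]) auto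
  then show ?thesis by simp
 qed simp
 also have "\<dots> \<le> \<sigma> (psum ks (length ks))"
 proof (cases "Suc r = length ks")
  case False
  then have "\<sigma> (psum ks (Suc r)) < \<sigma> (psum ks (length ks))"
   using r by (intro strict_mono_onD[OF half_ShD(3)[OF \<sigma>]]) auto
  then show ?thesis by simp
 qed simp
 finally have "?n \<le> \<sigma> ?n" using j(3) by (simp add: psum_length)
 moreover have "\<sigma> ?n \<le> ?n" using permutes_in_image[OF p, of ?n] n by simp
 ultimately show ?thesis by simp
qed

text \<open>In a half-shuffle the last letter of the last block is the last letter of the word.  So removing the
 last block leaves a half-shuffle of the rest, preceded by an ordinary shuffle that separates the two;
 this is the combinatorial form of the recursion for coalgebra morphisms.\<close>

lemma bij_half_Sh_snoc:
 assumes pos: "\<forall>k\<in>set ks. 1 \<le> k" and k: "1 \<le> k" and N: "N = sum_list ks"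
 shows "bij_betw (\<lambda>(\<alpha>, \<rho>). \<alpha> \<circ> \<rho>) (Sh [N, k - 1] \<times> half_Sh ks) (half_Sh (ks @ [k]))"
proof -
 let ?n = "N + k" and ?L = "length ks"
 have pos': "\<forall>k\<in>set (ks @ [k]). 1 \<le> k" using pos k by simp
 have ps: "psum (ks @ [k]) r = psum ks r" if "r \<le> ?L" for r using that by (simp add: psum_append)
 have psN: "psum ks ?L = N" "psum (ks @ [k]) (Suc ?L) = ?n" by (simp_all add: psum_def N)
 have sum: "sum_list (ks @ [k]) = ?n" by (simp add: N)
 have perm: "\<alpha> permutes {1..?n - 1}" "\<alpha> permutes {1..?n}" "\<alpha> ?n = ?n" if "\<alpha> \<in> Sh [N, k - 1]" for \<alpha>
 proof -
  show 1: "\<alpha> permutes {1..?n - 1}" using Sh_twoD(1)[OF that] k by simp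
  show "\<alpha> permutes {1..?n}" by (rule permutes_subset[OF 1]) auto
  show "\<alpha> ?n = ?n" by (rule permutes_not_in[OF 1]) (use k in auto)
 qed
 have perm\<rho>: "\<rho> permutes {1..N}" "\<rho> permutes {1..?n}" if "\<rho> \<in> half_Sh ks" for \<rho>
  using half_ShD(1)[OF that] permutes_subset[OF half_ShD(1)[OF that], of "{1..?n}"] N by auto
 show ?thesis
 proof (rule bij_betwI')
  fix x y assume x: "x \<in> Sh [N, k - 1] \<times> half_Sh ks" and y: "y \<in> Sh [N, k - 1] \<times> half_Sh ks"
  obtain \<alpha> \<rho> \<alpha>' \<rho>' where xy: "x = (\<alpha>, \<rho>)" "y = (\<alpha>', \<rho>')" by force
  have m: "\<alpha> \<in> Sh [N, k - 1]" "\<alpha>' \<in> Sh [N, k - 1]" "\<rho> \<in> half_Sh ks" "\<rho>' \<in> half_Sh ks" using x y xy by auto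
  have "x = y" if eq: "\<alpha> \<circ> \<rho> = \<alpha>' \<circ> \<rho>'"
  proof -
   define \<tau> where "\<tau> = inv \<alpha>' \<circ> \<alpha>"
   have \<tau>\<rho>: "\<tau> \<circ> \<rho> = \<rho>'"
    unfolding \<tau>_def using eq permutes_inverses[OF perm(2)[OF m(2)]] by (auto simp: fun_eq_iff)
   have "\<tau> x = (\<rho>' \<circ> inv \<rho>) x" for x
    using fun_cong[OF \<tau>\<rho>, of "inv \<rho> x"] permutes_inverses(1)[OF perm\<rho>(1)[OF m(3)], of x] by simp
   then have "\<tau> = \<rho>' \<circ> inv \<rho>" by (rule ext)
   then have \<tau>: "\<tau> permutes {1..N}"
    using permutes_compose[OF permutes_inv[OF perm\<rho>(1)[OF m(3)]] perm\<rho>(1)[OF m(4)]] by simp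
   have \<alpha>: "\<alpha> = \<alpha>' \<circ> \<tau>"
    unfolding \<tau>_def using permutes_inverses[OF perm(2)[OF m(2)]] by (auto simp: fun_eq_iff)
   have "strict_mono_on {1..N} \<tau>"
   proof (rule strict_mono_onI)
    fix r s assume rs: "r \<in> {1..N}" "s \<in> {1..N}" "r < s"
    have "\<alpha>' (\<tau> r) < \<alpha>' (\<tau> s)" using strict_mono_onD[OF Sh_twoD(2)[OF m(1)] rs] \<alpha> by simp
    moreover have "\<tau> r \<in> {1..N}" "\<tau> s \<in> {1..N}" using permutes_in_image[OF \<tau>] rs by blast+
    ultimately show "\<tau> r < \<tau> s"
     using strict_mono_onD[OF Sh_twoD(2)[OF m(2)], of "\<tau> s" "\<tau> r"] by (cases "\<tau> r" "\<tau> s" rule: linorder_cases) auto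
   qed
   then have "\<tau> = id" by (rule strict_mono_permutes_id[OF \<tau>])
   then show ?thesis using \<alpha> \<tau>\<rho> xy by simp
  qed
  then show "((case x of (\<alpha>, \<rho>) => \<alpha> \<circ> \<rho>) = (case y of (\<alpha>, \<rho>) => \<alpha> \<circ> \<rho>)) = (x = y)"
   using xy by auto
 next
  fix x assume "x \<in> Sh [N, k - 1] \<times> half_Sh ks"
  then obtain \<alpha> \<rho> where x: "x = (\<alpha>, \<rho>)" and \<alpha>: "\<alpha> \<in> Sh [N, k - 1]" and \<rho>: "\<rho> \<in> half_Sh ks" by auto
  have \<rho>in: "\<rho> j \<in> {1..N}" if "j \<in> {1..N}" for j using permutes_in_image[OF perm\<rho>(1)[OF \<rho>]] that by blast
  have \<rho>out: "\<rho> j = j" if "j > N" for j using permutes_not_in[OF perm\<rho>(1)[OF \<rho>]] that by simp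
  have mono: "strict_mono_on {psum (ks @ [k]) r + 1..psum (ks @ [k]) (r + 1)} (\<alpha> \<circ> \<rho>)" if "r < length (ks @ [k])" for r
  proof (rule strict_mono_onI)
   fix a b assume ab: "a \<in> {psum (ks @ [k]) r + 1..psum (ks @ [k]) (r + 1)}" "b \<in> {psum (ks @ [k]) r + 1..psum (ks @ [k]) (r + 1)}" "a < b"
   show "(\<alpha> \<circ> \<rho>) a < (\<alpha> \<circ> \<rho>) b"
   proof (cases "r < ?L")
    case True
    then have ab': "a \<in> {psum ks r + 1..psum ks (r + 1)}" "b \<in> {psum ks r + 1..psum ks (r + 1)}" using ab ps by auto
    then have "a \<in> {1..N}" "b \<in> {1..N}" using psum_le[of ks "r + 1"] N by auto
    moreover have "\<rho> a < \<rho> b" using strict_mono_onD[OF half_ShD(2)[OF \<rho> True] ab'] ab by simp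
    ultimately show ?thesis using strict_mono_onD[OF Sh_twoD(2)[OF \<alpha>]] \<rho>in by simp
   next
    case False
    then have r: "r = ?L" using that by simp
    then have ab': "N < a" "N < b" "b \<le> ?n" using ab ps[of ?L] psN by auto
    then have "\<alpha> a < \<alpha> b"
    proof (cases "b = ?n")
     case True
     then have "a \<in> {1..?n - 1}" using ab' ab by auto
     then have "\<alpha> a \<in> {1..?n - 1}" using permutes_in_image[OF perm(1)[OF \<alpha>]] by blast
     then show ?thesis using True perm(3)[OF \<alpha>] by auto
    next
     case False
     then show ?thesis using ab' ab by (intro strict_mono_onD[OF Sh_twoD(3)[OF \<alpha>]]) auto
    qed
    then show ?thesis using \<rho>out ab' by simp
   qed
  qed
  have ends: "strict_mono_on {1..length (ks @ [k])} (\<lambda>r. (\<alpha> \<circ> \<rho>) (psum (ks @ [k]) r))"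
  proof (rule strict_mono_onI)
   fix r s assume rs: "r \<in> {1..length (ks @ [k])}" "s \<in> {1..length (ks @ [k])}" "r < s"
   have r: "psum (ks @ [k]) r = psum ks r" "psum ks r \<in> {1..N}"
    using rs ps psum_pos[OF pos, of r] psum_le[of ks r] N by auto
   show "(\<alpha> \<circ> \<rho>) (psum (ks @ [k]) r) < (\<alpha> \<circ> \<rho>) (psum (ks @ [k]) s)"
   proof (cases "s = Suc ?L")
    case True
    have "\<rho> (psum ks r) \<in> {1..?n - 1}" using \<rho>in[OF r(2)] k by auto
    then have "\<alpha> (\<rho> (psum ks r)) \<in> {1..?n - 1}" using permutes_in_image[OF perm(1)[OF \<alpha>]] by blast
    then have "\<alpha> (\<rho> (psum ks r)) < ?n" using k by auto
    moreover have "\<rho> ?n = ?n" using \<rho>out k by simp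
    ultimately show ?thesis using True r psN perm(3)[OF \<alpha>] by simp
   next
    case False
    then have s: "psum (ks @ [k]) s = psum ks s" "psum ks s \<in> {1..N}"
     using rs ps psum_pos[OF pos, of s] psum_le[of ks s] N by auto
    have "\<rho> (psum ks r) < \<rho> (psum ks s)" using strict_mono_onD[OF half_ShD(3)[OF \<rho>], of r s] rs False by auto
    then show ?thesis using r s strict_mono_onD[OF Sh_twoD(2)[OF \<alpha>]] \<rho>in by simp
   qed
  qed
  show "(case x of (\<alpha>, \<rho>) => \<alpha> \<circ> \<rho>) \<in> half_Sh (ks @ [k])"
   unfolding half_Sh_def Sh_def x prod.case mem_Collect_eq sum
   using permutes_compose[OF perm\<rho>(2)[OF \<rho>] perm(2)[OF \<alpha>]] mono ends by blast
 next
  fix \<sigma> assume \<sigma>: "\<sigma> \<in> half_Sh (ks @ [k])"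
  have p: "\<sigma> permutes {1..?n}" using half_ShD(1)[OF \<sigma>] sum by simp
  have \<sigma>n: "\<sigma> ?n = ?n" using half_Sh_last[OF \<sigma> pos'] sum by simp
  have inj: "inj_on \<sigma> A" for A using permutes_inj[OF p] by (rule inj_on_subset) simp
  define A where "A = \<sigma> ` {1..N}"
  have cA: "finite A" "card A = N" unfolding A_def by (auto simp: card_image[OF inj])
  obtain h where h: "bij_betw h {0..<N} A" "strict_mono_on {0..<N} h"
   using ex_bij_betw_strict_mono_card[OF cA(1)] unfolding cA(2) atLeast0LessThan by blast
  define \<alpha> where "\<alpha> x = (if x \<in> {1..N} then h (x - 1) else \<sigma> x)" for x
  have bh: "bij_betw (\<lambda>x. h (x - 1)) {1..N} A"
  proof -
   have "bij_betw (\<lambda>x::nat. x - 1) {1..N} {0..<N}"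
    by (rule bij_betw_byWitness[where f' = Suc]) auto
   from bij_betw_trans[OF this h(1)] show ?thesis by (simp add: o_def)
  qed
  have "bij_betw \<alpha> ({1..N} \<union> {N + 1..?n}) (A \<union> \<sigma> ` {N + 1..?n})"
  proof (rule bij_betw_combine)
   show "bij_betw \<alpha> {1..N} A" using bh by (rule bij_betw_cong[THEN iffD1, rotated]) (simp add: \<alpha>_def)
   have "bij_betw \<sigma> {N + 1..?n} (\<sigma> ` {N + 1..?n})" using inj by (rule inj_on_imp_bij_betw)
   then show "bij_betw \<alpha> {N + 1..?n} (\<sigma> ` {N + 1..?n})"
    by (rule bij_betw_cong[THEN iffD1, rotated]) (simp add: \<alpha>_def)
   have "{1..N} \<inter> {N + 1..?n} = {}" by auto
   then show "A \<inter> \<sigma> ` {N + 1..?n} = {}"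
    unfolding A_def image_Int[OF permutes_inj[OF p], symmetric] by (simp only: image_empty)
  qed
  moreover have "{1..N} \<union> {N + 1..?n} = {1..?n}" by auto
  moreover have "A \<union> \<sigma> ` {N + 1..?n} = {1..?n}"
   unfolding A_def image_Un[symmetric] calculation(2) by (rule permutes_image[OF p])
  ultimately have "bij_betw \<alpha> {1..?n} {1..?n}" by simp
  moreover have "\<alpha> x = x" if "x \<notin> {1..?n}" for x
   using that permutes_not_in[OF p that] by (auto simp: \<alpha>_def)
  ultimately have \<alpha>p: "\<alpha> permutes {1..?n}" by (rule bij_imp_permutes)
  have \<alpha>N: "\<alpha> x = \<sigma> x" if "x \<notin> {1..N}" for x using that by (simp only: \<alpha>_def if_False)
  have \<alpha>n: "\<alpha> ?n = ?n" using \<alpha>N[of ?n] \<sigma>n k by simp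
  have \<alpha>p': "\<alpha> permutes {1..?n - 1}"
  proof (rule permutes_superset[OF \<alpha>p])
   fix x assume "x \<in> {1..?n} - {1..?n - 1}"
   then have "x = ?n" by auto
   then show "\<alpha> x = x" using \<alpha>n by simp
  qed
  have \<alpha>mono: "strict_mono_on {1..N} \<alpha>"
  proof (rule strict_mono_onI)
   fix r s assume rs: "r \<in> {1..N}" "s \<in> {1..N}" "r < s"
   then have "h (r - 1) < h (s - 1)" by (intro strict_mono_onD[OF h(2)]) auto
   then show "\<alpha> r < \<alpha> s" using rs by (simp add: \<alpha>_def)
  qed
  have \<alpha>mono2: "strict_mono_on {N + 1..?n - 1} \<alpha>"
  proof (rule strict_mono_onI)
   fix r s assume rs: "r \<in> {N + 1..?n - 1}" "s \<in> {N + 1..?n - 1}" "r < s"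
   have "strict_mono_on {psum (ks @ [k]) ?L + 1..psum (ks @ [k]) (?L + 1)} \<sigma>" by (rule half_ShD(2)[OF \<sigma>]) simp
   then have "strict_mono_on {N + 1..?n} \<sigma>" using ps[of ?L] psN by simp
   then have "\<sigma> r < \<sigma> s" using rs by (elim strict_mono_onD) auto
   then show "\<alpha> r < \<alpha> s" using \<alpha>N[of r] \<alpha>N[of s] rs by simp
  qed
  have "\<alpha> \<in> Sh [N, k - 1]"
   unfolding Sh_def using \<alpha>p' \<alpha>mono \<alpha>mono2 k by (auto simp: psum_def All_less_Suc numeral_2_eq_2)
  define \<rho> where "\<rho> = inv \<alpha> \<circ> \<sigma>"
  have \<alpha>\<rho>: "\<alpha> (\<rho> x) = \<sigma> x" for x unfolding \<rho>_def by (simp add: permutes_inverses[OF \<alpha>p])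
  have \<rho>p: "\<rho> permutes {1..N}"
  proof (rule permutes_superset)
   show "\<rho> permutes {1..?n}" unfolding \<rho>_def by (rule permutes_compose[OF p permutes_inv[OF \<alpha>p]])
   fix x assume "x \<in> {1..?n} - {1..N}"
   then have "\<sigma> x = \<alpha> x" using \<alpha>N by simp
   then show "\<rho> x = x" unfolding \<rho>_def by (simp add: permutes_inverses[OF \<alpha>p])
  qed
  have less: "\<rho> a < \<rho> b" if "a \<in> {1..N}" "b \<in> {1..N}" "\<sigma> a < \<sigma> b" for a b
  proof -
   have "\<rho> a \<in> {1..N}" "\<rho> b \<in> {1..N}" using permutes_in_image[OF \<rho>p] that by blast+
   then show ?thesis using that(3) \<alpha>\<rho>[of a] \<alpha>\<rho>[of b] strict_mono_onD[OF \<alpha>mono, of "\<rho> b" "\<rho> a"]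
    by (cases "\<rho> a" "\<rho> b" rule: linorder_cases) auto
  qed
  have "\<rho> \<in> half_Sh ks"
   unfolding half_Sh_def Sh_def mem_Collect_eq
  proof (intro conjI allI impI)
   show "\<rho> permutes {1..sum_list ks}" using \<rho>p N by simp
   show "strict_mono_on {psum ks r + 1..psum ks (r + 1)} \<rho>" if r: "r < ?L" for r
   proof (rule strict_mono_onI)
    fix a b assume ab: "a \<in> {psum ks r + 1..psum ks (r + 1)}" "b \<in> {psum ks r + 1..psum ks (r + 1)}" "a < b"
    have "strict_mono_on {psum (ks @ [k]) r + 1..psum (ks @ [k]) (r + 1)} \<sigma>" by (rule half_ShD(2)[OF \<sigma>]) (use r in simp)
    then have "\<sigma> a < \<sigma> b" using ab ps[of r] ps[of "r + 1"] r by (elim strict_mono_onD) auto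
    then show "\<rho> a < \<rho> b" using ab psum_le[of ks "r + 1"] N by (intro less) auto
   qed
   show "strict_mono_on {1..?L} (\<lambda>r. \<rho> (psum ks r))"
   proof (rule strict_mono_onI)
    fix r s assume rs: "r \<in> {1..?L}" "s \<in> {1..?L}" "r < s"
    have "\<sigma> (psum ks r) < \<sigma> (psum ks s)" using strict_mono_onD[OF half_ShD(3)[OF \<sigma>], of r s] rs ps by simp
    moreover have "psum ks r \<in> {1..N}" "psum ks s \<in> {1..N}"
     using rs psum_pos[OF pos, of r] psum_pos[OF pos, of s] psum_le[of ks] N by auto
    ultimately show "\<rho> (psum ks r) < \<rho> (psum ks s)" by (intro less)
   qed
  qed
  moreover have "\<sigma> = \<alpha> \<circ> \<rho>" using \<alpha>\<rho> by (auto simp: fun_eq_iff)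
  ultimately show "\<exists>x\<in>Sh [N, k - 1] \<times> half_Sh ks. \<sigma> = (case x of (\<alpha>, \<rho>) => \<alpha> \<circ> \<rho>)"
   using \<open>\<alpha> \<in> Sh [N, k - 1]\<close> by auto
 qed
qed

section \<open>Morphisms and coderivations on words\<close>

definition compositions :: "nat => nat list set" where
 "compositions n = {ks. (\<forall>k\<in>set ks. 1 \<le> k) \<and> sum_list ks = n}"

lemma finite_compositions: "finite (compositions n)"
proof (rule finite_subset)
 have "length ks \<le> sum_list ks" if "\<forall>k\<in>set ks. 1 \<le> k" for ks :: "nat list"
  using that by (induct ks) auto
 then show "compositions n \<subseteq> {ks. set ks \<subseteq> {..n} \<and> length ks \<le> n}"
  by (auto simp: compositions_def intro: member_le_sum_list)
 show "finite {ks. set ks \<subseteq> {..n} \<and> length ks \<le> n}" by (rule finite_lists_length_le) simp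
qed

lemma sum_compositions:
 assumes n: "1 \<le> n"
 shows "(\<Sum>ks\<in>compositions n. g ks) = g [n] + (\<Sum>k=1..n - 1. \<Sum>ks\<in>compositions k. g (ks @ [n - k]))"
proof -
 let ?h = "\<lambda>(k, ks). ks @ [n - k :: nat]"
 let ?S = "Sigma {1..n - 1} compositions"
 have inj: "inj_on ?h ?S" by (auto simp: inj_on_def compositions_def)
 have img: "compositions n - {[n]} = ?h ` ?S"
 proof
  show "?h ` ?S \<subseteq> compositions n - {[n]}" by (auto simp: compositions_def)
  show "compositions n - {[n]} \<subseteq> ?h ` ?S"
  proof
   fix ks assume ks: "ks \<in> compositions n - {[n]}"
   then have "ks \<noteq> []" using n by (auto simp: compositions_def)
   then obtain ks' m where eq: "ks = ks' @ [m]" by (cases ks rule: rev_cases) auto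
   then have m: "1 \<le> m" "\<forall>k\<in>set ks'. 1 \<le> k" "sum_list ks' + m = n" using ks by (auto simp: compositions_def)
   have "ks' \<noteq> []" using ks eq m by auto
   then have "1 \<le> sum_list ks'" using m(2) by (cases ks') auto
   then have "(sum_list ks', ks') \<in> ?S" using m by (auto simp: compositions_def)
   moreover have "ks = ?h (sum_list ks', ks')" using eq m by auto
   ultimately show "ks \<in> ?h ` ?S" by (rule rev_image_eqI)
  qed
 qed
 have "[n] \<in> compositions n" using n by (simp add: compositions_def)
 then have "(\<Sum>ks\<in>compositions n. g ks) = g [n] + (\<Sum>ks\<in>compositions n - {[n]}. g ks)"
  by (rule sum.remove[OF finite_compositions])
 also have "(\<Sum>ks\<in>compositions n - {[n]}. g ks) = (\<Sum>x\<in>?S. g (?h x))"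
  unfolding img using sum.reindex[OF inj, of g] by (simp add: o_def)
 also have "\<dots> = (\<Sum>k=1..n - 1. \<Sum>ks\<in>compositions k. g (ks @ [n - k]))"
  by (subst sum.Sigma) (auto simp: finite_compositions case_prod_beta)
 finally show ?thesis .
qed

lemma finite_half_Sh [simp]: "finite (half_Sh ks)"
 by (rule finite_subset[OF _ finite_Sh[of ks]]) (auto simp: half_Sh_def)

lemma half_Sh_single: "half_Sh [n] = {id}"
 unfolding half_Sh_def Sh_trivial by (auto simp: strict_mono_on_def)

lemma slice_take:
 assumes "\<sigma> permutes {1..k}" "1 \<le> a" "b \<le> k" "k \<le> length vs"
 shows "slice (take k vs) \<sigma> a b = slice vs \<sigma> a b"
proof (rule nth_equalityI)
 fix i assume i: "i < length (slice (take k vs) \<sigma> a b)"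
 then have "\<sigma> (a + i) \<in> {1..k}" using permutes_in_image[OF assms(1), of "a + i"] assms by auto
 then have "\<sigma> (a + i) - 1 < k" by auto
 then show "slice (take k vs) \<sigma> a b ! i = slice vs \<sigma> a b ! i" using i by (simp add: nth_slice)
qed simp

lemma slice_comp:
 assumes "\<rho> permutes {1..length vs}" "1 \<le> a" "b \<le> length vs"
 shows "slice vs (\<alpha> \<circ> \<rho>) a b = slice (pm vs \<alpha>) \<rho> a b"
proof (rule nth_equalityI)
 fix i assume i: "i < length (slice vs (\<alpha> \<circ> \<rho>) a b)"
 then have "\<rho> (a + i) \<in> {1..length vs}" using permutes_in_image[OF assms(1), of "a + i"] assms by auto
 then have "\<rho> (a + i) - 1 < length vs" "Suc (\<rho> (a + i) - 1) = \<rho> (a + i)" by auto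
 then show "slice vs (\<alpha> \<circ> \<rho>) a b ! i = slice (pm vs \<alpha>) \<rho> a b ! i" using i by (simp add: nth_slice nth_pm)
qed simp

text \<open>Induction on the length with \<open>coalgebra_map_rec\<close>: the last block is the argument of $\pi F$ in the second
 factor, and \<open>bij_half_Sh_snoc\<close> merges the outer shuffle with the half-shuffle of the first factor.\<close>

lemma (in cofree_pair) coalgebra_map_words:
 assumes F: "coalgebra_map F"
 shows "homogeneous U ds us ==> multilinear U' ground \<beta> ==> F (pure U us) \<beta> =
  (\<Sum>ks\<in>compositions (length us). \<Sum>\<sigma>\<in>half_Sh ks.
   koszul ds \<sigma> * \<beta> (map (\<lambda>r. R.\<pi> (F (pure U (slice us \<sigma> (psum ks (r - 1) + 1) (psum ks r))))) [1..<length ks + 1]))"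
proof (induct "length us" arbitrary: us ds \<beta> rule: less_induct)
 case less
 note h = less(2) and \<beta> = less(3)
 let ?n = "length us"
 let ?f = "\<lambda>vs. R.\<pi> (F (pure U vs))"
 let ?B = "\<lambda>us ks \<sigma>. map (\<lambda>r. ?f (slice us \<sigma> (psum ks (r - 1) + 1) (psum ks r))) [1..<length ks + 1]"
 have n: "1 \<le> ?n" and len: "length ds = ?n" using h by (auto simp: homogeneous_nth Suc_le_eq)
 have fin: "?f vs \<in> elems U'" if "homogeneous U cs vs" for cs vs
  by (rule lm_in[OF R.lm_\<pi> lm_in[OF coalgebra_map_lm[OF F] S.pure_T[OF that]]])
 have bil: "bilinear_form S.T S.T (\<lambda>a b. F a (\<lambda>ws. \<beta> (ws @ [R.\<pi> (F b)])))"
  by (rule bf_comp[OF R.bf_conc[OF \<beta>] coalgebra_map_lm[OF F] lm_comp[OF coalgebra_map_lm[OF F] R.lm_\<pi>]])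
 have one: "?B us [?n] id = [?f us]"
  using slice_eq_drop[of us id 0] by (simp add: psum_def)
 have step: "(\<Sum>\<alpha>\<in>Sh [k, ?n - k - 1]. koszul ds \<alpha> * F (pure U (take k (pm us \<alpha>))) (\<lambda>ws. \<beta> (ws @ [?f (drop k (pm us \<alpha>))])))
   = (\<Sum>ks\<in>compositions k. \<Sum>\<sigma>\<in>half_Sh (ks @ [?n - k]). koszul ds \<sigma> * \<beta> (?B us (ks @ [?n - k]) \<sigma>))"
  if k: "k \<in> {1..?n - 1}" for k
 proof -
  have k': "0 < k" "k < ?n" "1 \<le> ?n - k" using k by auto
  have per: "\<alpha> permutes {1..?n}" if "\<alpha> \<in> Sh [k, ?n - k - 1]" for \<alpha> by (rule Sh_two_permutes(2)[OF that k'(2)])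
  have "koszul ds \<alpha> * F (pure U (take k (pm us \<alpha>))) (\<lambda>ws. \<beta> (ws @ [?f (drop k (pm us \<alpha>))]))
   = (\<Sum>ks\<in>compositions k. \<Sum>\<rho>\<in>half_Sh ks. koszul ds (\<alpha> \<circ> \<rho>) * \<beta> (?B us (ks @ [?n - k]) (\<alpha> \<circ> \<rho>)))"
   if \<alpha>: "\<alpha> \<in> Sh [k, ?n - k - 1]" for \<alpha>
  proof -
   have h': "homogeneous U (pm ds \<alpha>) (pm us \<alpha>)" by (rule homogeneous_pm[OF h per[OF \<alpha>]])
   have ht: "homogeneous U (take k (pm ds \<alpha>)) (take k (pm us \<alpha>))" by (rule homogeneous_take[OF h' k'(1)])
   have fd: "?f (drop k (pm us \<alpha>)) \<in> elems U'" using fin[OF homogeneous_drop[OF h', of k]] k' by simp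
   have \<beta>': "multilinear U' ground (\<lambda>ws. \<beta> (ws @ [?f (drop k (pm us \<alpha>))]))"
    by (rule ml_append_right[OF \<beta>]) (use fd in simp)
   have IH: "F (pure U (take k (pm us \<alpha>))) (\<lambda>ws. \<beta> (ws @ [?f (drop k (pm us \<alpha>))])) =
    (\<Sum>ks\<in>compositions k. \<Sum>\<rho>\<in>half_Sh ks. koszul (take k (pm ds \<alpha>)) \<rho> *
     \<beta> (?B (take k (pm us \<alpha>)) ks \<rho> @ [?f (drop k (pm us \<alpha>))]))"
    using less(1)[OF _ ht \<beta>'] k' by simp
   have "koszul ds \<alpha> * (koszul (take k (pm ds \<alpha>)) \<rho> * \<beta> (?B (take k (pm us \<alpha>)) ks \<rho> @ [?f (drop k (pm us \<alpha>))]))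
    = koszul ds (\<alpha> \<circ> \<rho>) * \<beta> (?B us (ks @ [?n - k]) (\<alpha> \<circ> \<rho>))"
    if ks: "ks \<in> compositions k" and \<rho>: "\<rho> \<in> half_Sh ks" for ks \<rho>
   proof -
    have sk: "sum_list ks = k" using ks by (simp add: compositions_def)
    have \<rho>k: "\<rho> permutes {1..k}" using half_ShD(1)[OF \<rho>] sk by simp
    have \<rho>n: "\<rho> permutes {1..?n}" by (rule permutes_subset[OF \<rho>k]) (use k' in auto)
    have "koszul (take k (pm ds \<alpha>)) \<rho> = (koszul (pm ds \<alpha>) \<rho> :: 'k)"
     using koszul_take[OF \<rho>k, of "pm ds \<alpha>"] k' len by simp
    then have kos: "koszul ds \<alpha> * koszul (take k (pm ds \<alpha>)) \<rho> = (koszul ds (\<alpha> \<circ> \<rho>) :: 'k)"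
     by (simp add: koszul_comp[of \<alpha> ds \<rho>] per[OF \<alpha>, unfolded One_nat_def] \<rho>n[unfolded One_nat_def] len)
    have sl: "slice us (\<alpha> \<circ> \<rho>) (psum ks (r - 1) + 1) (psum ks r) = slice (take k (pm us \<alpha>)) \<rho> (psum ks (r - 1) + 1) (psum ks r)" for r
    proof -
     have "psum ks r \<le> k" using psum_le[of ks r] sk by simp
     then show ?thesis using slice_comp[OF \<rho>n] slice_take[OF \<rho>k, of _ _ "pm us \<alpha>"] k' by simp
    qed
    have last: "slice us (\<alpha> \<circ> \<rho>) (Suc k) ?n = drop k (pm us \<alpha>)"
    proof -
     have "drop k (pm (pm us \<alpha>) \<rho>) = drop k (pm us \<alpha>)"
     proof (rule nth_equalityI)
      fix i assume "i < length (drop k (pm (pm us \<alpha>) \<rho>))"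
      then have i: "k + i < ?n" by simp
      then have "\<rho> (Suc (k + i)) = Suc (k + i)" using permutes_not_in[OF \<rho>k, of "Suc (k + i)"] by simp
      then show "drop k (pm (pm us \<alpha>) \<rho>) ! i = drop k (pm us \<alpha>) ! i" using i by (simp add: nth_pm[of _ "pm us \<alpha>"])
     qed simp
     then show ?thesis using slice_eq_drop[of us "\<alpha> \<circ> \<rho>" k] pm_comp[OF per[OF \<alpha>] \<rho>n] by simp
    qed
    have "?B us (ks @ [?n - k]) (\<alpha> \<circ> \<rho>) = ?B (take k (pm us \<alpha>)) ks \<rho> @ [?f (drop k (pm us \<alpha>))]"
    proof -
     have "[1..<length (ks @ [?n - k]) + 1] = [1..<length ks + 1] @ [length ks + 1]" by simp
     moreover have "psum (ks @ [?n - k]) r = psum ks r" if "r \<le> length ks" for r using that by (simp add: psum_append)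
     moreover have "psum (ks @ [?n - k]) (length ks + 1) = ?n" using sk k' by (simp add: psum_def)
     moreover have "psum ks (length ks) = k" using sk by (simp add: psum_def)
     ultimately show ?thesis using sl last by auto
    qed
    then show ?thesis by (simp only: kos[symmetric] mult.assoc)
   qed
   then show ?thesis unfolding IH sum_distrib_left by (intro sum.cong refl)
  qed
  then have "(\<Sum>\<alpha>\<in>Sh [k, ?n - k - 1]. koszul ds \<alpha> * F (pure U (take k (pm us \<alpha>))) (\<lambda>ws. \<beta> (ws @ [?f (drop k (pm us \<alpha>))])))
   = (\<Sum>\<alpha>\<in>Sh [k, ?n - k - 1]. \<Sum>ks\<in>compositions k. \<Sum>\<rho>\<in>half_Sh ks. koszul ds (\<alpha> \<circ> \<rho>) * \<beta> (?B us (ks @ [?n - k]) (\<alpha> \<circ> \<rho>)))"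
   by (intro sum.cong refl)
  also have "\<dots> = (\<Sum>ks\<in>compositions k. \<Sum>\<alpha>\<in>Sh [k, ?n - k - 1]. \<Sum>\<rho>\<in>half_Sh ks. koszul ds (\<alpha> \<circ> \<rho>) * \<beta> (?B us (ks @ [?n - k]) (\<alpha> \<circ> \<rho>)))"
   by (rule sum.swap)
  also have "\<dots> = (\<Sum>ks\<in>compositions k. \<Sum>\<sigma>\<in>half_Sh (ks @ [?n - k]). koszul ds \<sigma> * \<beta> (?B us (ks @ [?n - k]) \<sigma>))"
  proof (rule sum.cong[OF refl])
   fix ks assume ks: "ks \<in> compositions k"
   then have "bij_betw (\<lambda>(\<alpha>, \<rho>). \<alpha> \<circ> \<rho>) (Sh [k, ?n - k - 1] \<times> half_Sh ks) (half_Sh (ks @ [?n - k]))"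
    using k'(3) by (intro bij_half_Sh_snoc) (auto simp: compositions_def)
   from sum.reindex_bij_betw[OF this, of "\<lambda>\<sigma>. koszul ds \<sigma> * \<beta> (?B us (ks @ [?n - k]) \<sigma>)"]
   show "(\<Sum>\<alpha>\<in>Sh [k, ?n - k - 1]. \<Sum>\<rho>\<in>half_Sh ks. koszul ds (\<alpha> \<circ> \<rho>) * \<beta> (?B us (ks @ [?n - k]) (\<alpha> \<circ> \<rho>))) =
    (\<Sum>\<sigma>\<in>half_Sh (ks @ [?n - k]). koszul ds \<sigma> * \<beta> (?B us (ks @ [?n - k]) \<sigma>))"
    unfolding sum.cartesian_product by (rule trans[rotated]) (rule sum.cong, auto)
  qed
  finally show ?thesis .
 qed
 have "F (pure U us) \<beta> = \<beta> [?f us] + S.\<Delta> (pure U us) (\<lambda>a b. F a (\<lambda>ws. \<beta> (ws @ [R.\<pi> (F b)])))"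
  by (rule coalgebra_map_rec[OF F S.pure_T[OF h] \<beta>])
 also have "S.\<Delta> (pure U us) (\<lambda>a b. F a (\<lambda>ws. \<beta> (ws @ [R.\<pi> (F b)]))) =
  (\<Sum>k=1..?n - 1. \<Sum>\<alpha>\<in>Sh [k, ?n - k - 1]. koszul ds \<alpha> * F (pure U (take k (pm us \<alpha>))) (\<lambda>ws. \<beta> (ws @ [?f (drop k (pm us \<alpha>))])))"
  by (rule zin_coproduct_pure[OF S.graded h bil])
 also have "\<dots> = (\<Sum>k=1..?n - 1. \<Sum>ks\<in>compositions k. \<Sum>\<sigma>\<in>half_Sh (ks @ [?n - k]). koszul ds \<sigma> * \<beta> (?B us (ks @ [?n - k]) \<sigma>))"
  by (rule sum.cong[OF refl step])
 also have "\<beta> [?f us] = (\<Sum>\<sigma>\<in>half_Sh [?n]. koszul ds \<sigma> * \<beta> (?B us [?n] \<sigma>))"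
  unfolding half_Sh_single using one by simp
 finally show ?case unfolding sum_compositions[OF n] .
qed

text \<open>Induction on the length with \<open>coderivation_rec\<close>: either $\pi D$ is applied to the second factor,
 which ends in the last letter, or \<open>D\<close> acts in the word in front of the last letter.\<close>

lemma (in cofree_zinbiel) coderivation_words:
 assumes D: "coderivation D"
 shows "homogeneous U ds us ==> multilinear U ground \<beta> ==> D (pure U us) \<beta> =
  (\<Sum>k=1..length us. \<Sum>j=1..k. \<Sum>\<sigma>\<in>Sh [k - j, j - 1].
   koszul ds \<sigma> * (-1) powi (sum_list (slice ds \<sigma> 1 (k - j))) *
    \<beta> (slice us \<sigma> 1 (k - j) @ [\<pi> (D (pure U (slice us \<sigma> (k - j + 1) (k - 1) @ [us ! (k - 1)])))] @ drop k us))"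
proof (induct "length us" arbitrary: us ds \<beta> rule: less_induct)
 case less
 note h = less(2) and \<beta> = less(3)
 let ?n = "length us"
 let ?d = "\<lambda>vs. \<pi> (D (pure U vs))"
 let ?t = "\<lambda>us ds \<beta> k j \<sigma>. koszul ds \<sigma> * (-1) powi (sum_list (slice ds \<sigma> 1 (k - j))) *
    \<beta> (slice us \<sigma> 1 (k - j) @ [?d (slice us \<sigma> (k - j + 1) (k - 1) @ [us ! (k - 1)])] @ drop k us) :: 'k"
 have n: "1 \<le> ?n" and len: "length ds = ?n" and ne: "us \<noteq> []" using h by (auto simp: homogeneous_nth Suc_le_eq)
 have last: "last us = us ! (?n - 1)" by (rule last_conv_nth[OF ne])
 note lD = coderivation_lm[OF D]
 have bil: "bilinear_form T T (\<lambda>a b. par T a (\<lambda>ws. \<beta> (ws @ [\<pi> (D b)])))"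
  by (rule bf_comp[OF bf_conc[OF \<beta>] lm_par[OF gT] lm_comp[OF lD lm_\<pi>]])
 have dlin: "?d vs \<in> elems U" if "homogeneous U cs vs" for cs vs
  by (rule lm_in[OF lm_\<pi> lm_in[OF lD pure_T[OF that]]])
 have full: "\<beta> [?d us] = (\<Sum>\<sigma>\<in>Sh [?n - ?n, ?n - 1]. ?t us ds \<beta> ?n ?n \<sigma>)"
 proof -
  have "slice us id 1 (?n - 1) @ [us ! (?n - 1)] = us" using slice_snoc[of id us 0] n ne last by simp
  moreover have "slice us id 1 0 = []" "slice ds id 1 0 = []" by (simp_all add: slice_def)
  ultimately show ?thesis by (simp add: Sh_trivial)
 qed
 have third: "\<Delta> (pure U us) (\<lambda>a b. par T a (\<lambda>ws. \<beta> (ws @ [\<pi> (D b)]))) =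
  (\<Sum>j=1..?n - 1. \<Sum>\<sigma>\<in>Sh [?n - j, j - 1]. ?t us ds \<beta> ?n j \<sigma>)"
 proof -
  have "\<Delta> (pure U us) (\<lambda>a b. par T a (\<lambda>ws. \<beta> (ws @ [\<pi> (D b)]))) =
   (\<Sum>k=1..?n - 1. \<Sum>\<sigma>\<in>Sh [k, ?n - k - 1]. koszul ds \<sigma> * par T (pure U (take k (pm us \<sigma>))) (\<lambda>ws. \<beta> (ws @ [?d (drop k (pm us \<sigma>))])))"
   by (rule zin_coproduct_pure[OF graded h bil])
  also have "\<dots> = (\<Sum>k=1..?n - 1. \<Sum>\<sigma>\<in>Sh [k, ?n - k - 1]. ?t us ds \<beta> ?n (?n - k) \<sigma>)"
  proof (intro sum.cong refl)
   fix k \<sigma> assume k: "k \<in> {1..?n - 1}" and \<sigma>: "\<sigma> \<in> Sh [k, ?n - k - 1]"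
   have k': "0 < k" "k < ?n" "?n - (?n - k) = k" using k by auto
   have h': "homogeneous U (pm ds \<sigma>) (pm us \<sigma>)" by (rule homogeneous_pm[OF h Sh_two_permutes(2)[OF \<sigma> k'(2)]])
   have ht: "homogeneous U (take k (pm ds \<sigma>)) (take k (pm us \<sigma>))" by (rule homogeneous_take[OF h' k'(1)])
   have fd: "?d (drop k (pm us \<sigma>)) \<in> elems U" using dlin[OF homogeneous_drop[OF h', of k]] k' by simp
   have \<beta>': "multilinear U ground (\<lambda>ws. \<beta> (ws @ [?d (drop k (pm us \<sigma>))]))"
    by (rule ml_append_right[OF \<beta>]) (use fd in simp)
   have sl: "slice us \<sigma> 1 k = take k (pm us \<sigma>)" "slice ds \<sigma> 1 k = take k (pm ds \<sigma>)"
    using slice_eq_take[of k us \<sigma>] slice_eq_take[of k ds \<sigma>] k' len by auto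
   have sd: "slice us \<sigma> (k + 1) (?n - 1) @ [us ! (?n - 1)] = drop k (pm us \<sigma>)"
    using slice_snoc[of \<sigma> us k] Sh_two_last[OF \<sigma> k'(2)] k' last by simp
   show "koszul ds \<sigma> * par T (pure U (take k (pm us \<sigma>))) (\<lambda>ws. \<beta> (ws @ [?d (drop k (pm us \<sigma>))])) = ?t us ds \<beta> ?n (?n - k) \<sigma>"
    unfolding k'(3) sl sd par_hcomp[OF gT hcomp_pure[OF ht]] using \<beta>' by simp
  qed
  also have "\<dots> = (\<Sum>j=1..?n - 1. \<Sum>\<sigma>\<in>Sh [?n - j, j - 1]. ?t us ds \<beta> ?n j \<sigma>)"
   by (rule sum.reindex_bij_witness[of _ "\<lambda>j. ?n - j" "\<lambda>j. ?n - j"]) auto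
  finally show ?thesis .
 qed
 have second: "\<Delta> (pure U us) (\<lambda>a b. D a (\<lambda>ws. \<beta> (ws @ [\<pi> b]))) = (\<Sum>k=1..?n - 1. \<Sum>j=1..k. \<Sum>\<sigma>\<in>Sh [k - j, j - 1]. ?t us ds \<beta> k j \<sigma>)"
 proof -
  have bil: "bilinear_form T U (\<lambda>a u. D a (\<lambda>ws. \<beta> (ws @ [u])))"
   by (rule bf_comp[OF bf_conc[OF \<beta>] lD lm_id(1)])
  show ?thesis
  proof (cases "?n = 1")
   case True then show ?thesis using coproduct_proj1[OF h bil] by simp
  next
   case False
   let ?m = "?n - 1"
   have m: "0 < ?m" "?m < ?n" using False n by auto
   let ?us = "take ?m us" and ?ds = "take ?m ds" and ?\<beta> = "\<lambda>ws. \<beta> (ws @ [last us])"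
   have ht: "homogeneous U ?ds ?us" by (rule homogeneous_take[OF h m(1)])
   have "last us \<in> elems U" using homogeneous_words[OF vU h] ne by (auto simp: words_def)
   then have \<beta>': "multilinear U ground ?\<beta>" by (intro ml_append_right[OF \<beta>]) simp
   have "\<Delta> (pure U us) (\<lambda>a b. D a (\<lambda>ws. \<beta> (ws @ [\<pi> b]))) = D (pure U ?us) ?\<beta>"
    using coproduct_proj1[OF h bil] False by (simp add: butlast_conv_take)
   also have "\<dots> = (\<Sum>k=1..?m. \<Sum>j=1..k. \<Sum>\<sigma>\<in>Sh [k - j, j - 1]. ?t ?us ?ds ?\<beta> k j \<sigma>)"
    using less(1)[OF _ ht \<beta>'] m by simp
   also have "\<dots> = (\<Sum>k=1..?m. \<Sum>j=1..k. \<Sum>\<sigma>\<in>Sh [k - j, j - 1]. ?t us ds \<beta> k j \<sigma>)"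
   proof (intro sum.cong refl)
    fix k j \<sigma> assume k: "k \<in> {1..?m}" and j: "j \<in> {1..k}" and \<sigma>: "\<sigma> \<in> Sh [k - j, j - 1]"
    have kj: "1 \<le> j" "j \<le> k" "k \<le> ?m" "1 \<le> k" using k j by auto
    have \<sigma>m: "\<sigma> permutes {1..?m}"
     by (rule permutes_subset[OF Sh_permutes[OF \<sigma>]]) (use kj in auto)
    have kos: "koszul ?ds \<sigma> = (koszul ds \<sigma> :: 'k)" by (rule koszul_take[OF \<sigma>m]) (use len in simp)
    have sl: "slice ?us \<sigma> 1 (k - j) = slice us \<sigma> 1 (k - j)" "slice ?ds \<sigma> 1 (k - j) = slice ds \<sigma> 1 (k - j)"
     "slice ?us \<sigma> (k - j + 1) (k - 1) = slice us \<sigma> (k - j + 1) (k - 1)"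
     by (rule slice_take[OF \<sigma>m]; use kj len in simp)+
    have nth: "?us ! (k - 1) = us ! (k - 1)" using kj by simp
    have dr: "drop k ?us @ [last us] = drop k us"
    proof -
     have "drop k (?us @ [last us]) = drop k ?us @ [last us]" using kj by simp
     moreover have "?us @ [last us] = us" using append_butlast_last_id[OF ne] by (simp add: butlast_conv_take)
     ultimately show ?thesis by (simp only:)
    qed
    show "?t ?us ?ds ?\<beta> k j \<sigma> = ?t us ds \<beta> k j \<sigma>"
     unfolding kos sl nth dr[symmetric] append_assoc ..
   qed
   finally show ?thesis .
  qed
 qed
 have "D (pure U us) \<beta> = \<beta> [?d us] + \<Delta> (pure U us) (\<lambda>a b. D a (\<lambda>ws. \<beta> (ws @ [\<pi> b])))
  + \<Delta> (pure U us) (\<lambda>a b. par T a (\<lambda>ws. \<beta> (ws @ [\<pi> (D b)])))"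
  by (rule coderivation_rec[OF D pure_T[OF h] \<beta>])
 also have "\<dots> = (\<Sum>k=1..?n - 1. \<Sum>j=1..k. \<Sum>\<sigma>\<in>Sh [k - j, j - 1]. ?t us ds \<beta> k j \<sigma>) +
  ((\<Sum>j=1..?n - 1. \<Sum>\<sigma>\<in>Sh [?n - j, j - 1]. ?t us ds \<beta> ?n j \<sigma>) + (\<Sum>\<sigma>\<in>Sh [?n - ?n, ?n - 1]. ?t us ds \<beta> ?n ?n \<sigma>))"
  unfolding full second third by (simp only: ac_simps)
 also have "\<dots> = (\<Sum>k=1..?n. \<Sum>j=1..k. \<Sum>\<sigma>\<in>Sh [k - j, j - 1]. ?t us ds \<beta> k j \<sigma>)"
 proof -
  have top: "(\<Sum>k=1..?n. g k) = (\<Sum>k=1..?n - 1. g k) + g ?n" for g :: "nat => 'k"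
  proof -
   obtain m where "?n = Suc m" using n by (cases ?n) auto
   then show ?thesis by simp
  qed
  show ?thesis unfolding top[of "\<lambda>k. \<Sum>j=1..k. \<Sum>\<sigma>\<in>Sh [k - j, j - 1]. ?t us ds \<beta> k j \<sigma>"]
   top[of "\<lambda>j. \<Sum>\<sigma>\<in>Sh [?n - j, j - 1]. ?t us ds \<beta> ?n j \<sigma>"] ..
 qed
 finally show ?case .
qed

section \<open>Corestrictions and Leibniz infinity morphisms\<close>

subsection \<open>Signs of desuspended operations\<close>

lemma powi_minus_one_even: "even (a - b) ==> (-1 :: 'k::field) powi a = (-1) powi b"
 by (rule sign_parity_cong) presburger

lemma minus_one_power_powi: "(-1 :: 'k::field) ^ m = (-1) powi int m"
 by simp

text \<open>After expanding all \<open>susp_sign\<close> over the concatenations, the exponents of both sides agree modulo 2.\<close>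

lemma insertion_sign:
 assumes "length X = k - j" "length P = j" "length Z = n - k" "1 \<le> j" "j \<le> k" "k \<le> n"
 shows "(-1 :: 'k::field) ^ (k + (n - k + 1) * j) * (-1) powi (int j * sum_list X) *
   susp_sign (X @ [sum_list P + int j - 2] @ Z) * susp_sign P
  = susp_sign (X @ P @ Z) * (-1) powi (sum_list (map (\<lambda>d. d + 1) X))"
proof -
 define a z where "a = k - j" and "z = n - k"
 have k: "k = j + a" and n: "n = j + a + z" using assms by (auto simp: a_def z_def)
 have sX: "sum_list (map (\<lambda>d. d + 1) X) = sum_list X + int a" using assms(1)
  unfolding a_def[symmetric] by (induct X arbitrary: a) (auto simp: sum_list_addf)
 let ?p = "sum_list P" and ?x = "sum_list X"
 let ?e1 = "int (k + (n - k + 1) * j) + int j * ?x + int (1 + z) * ?x + int z * (?p + int j - 2)"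
 let ?e2 = "int (j + z) * ?x + int z * ?p + (?x + int a)"
 have "susp_sign (X @ [?p + int j - 2] @ Z) = susp_sign X * (-1 :: 'k) powi (int (1 + z) * ?x) * ((-1) powi (int z * (?p + int j - 2)) * susp_sign Z)"
  using assms(3) by (simp add: susp_sign_append[of X] susp_sign_append[of "[_]" Z, simplified] z_def)
 moreover have "susp_sign (X @ P @ Z) = susp_sign X * (-1 :: 'k) powi (int (j + z) * ?x) * (susp_sign P * (-1) powi (int z * ?p) * susp_sign Z)"
  using assms(2,3) by (simp add: susp_sign_append[of X] susp_sign_append[of P] z_def)
 moreover have "even (?e1 - ?e2)" unfolding n k by (simp add: algebra_simps)
 then have "(-1 :: 'k) powi ?e1 = (-1) powi ?e2" by (rule powi_minus_one_even)
 then have "(-1 :: 'k) powi int (k + (n - k + 1) * j) * (-1) powi (int j * ?x) * (-1) powi (int (1 + z) * ?x) * (-1) powi (int z * (?p + int j - 2))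
  = (-1) powi (int (j + z) * ?x) * (-1) powi (int z * ?p) * (-1) powi (?x + int a)"
  by (simp only: powi_minus_one_add)
 ultimately show ?thesis
  unfolding sX minus_one_power_powi by (simp only: ac_simps)
qed

text \<open>Induction on the number of blocks; a new last block multiplies both sides by the same sign.\<close>

lemma block_sign:
 fixes Bs :: "int list list"
 defines "ks \<equiv> map length Bs" and "i \<equiv> length Bs"
 shows "(-1 :: 'k::field) ^ ((\<Sum>r=1..i - 1. (i - r) * ks ! (r - 1)) + i * (i - 1) div 2) *
  (-1) powi (\<Sum>r=2..i. (int (ks ! (r - 1)) - 1) * sum_list (concat (take (r - 1) Bs))) *
  (\<Prod>B\<leftarrow>Bs. susp_sign B) * susp_sign (map (\<lambda>B. sum_list B + int (length B) - 1) Bs)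
  = susp_sign (concat Bs)"
 unfolding ks_def i_def
proof (induct Bs rule: rev_induct)
 case Nil then show ?case by simp
next
 case (snoc B Bs)
 let ?i = "length Bs" and ?ks = "map length Bs" and ?k = "length B"
 let ?C = "sum_list (concat Bs)"
 let ?A = "(\<Sum>r=1..?i - 1. (?i - r) * ?ks ! (r - 1)) + ?i * (?i - 1) div 2"
 let ?A' = "(\<Sum>r=1..length (Bs @ [B]) - 1. (length (Bs @ [B]) - r) * map length (Bs @ [B]) ! (r - 1)) +
  length (Bs @ [B]) * (length (Bs @ [B]) - 1) div 2"
 let ?S = "\<Sum>r=2..?i. (int (?ks ! (r - 1)) - 1) * sum_list (concat (take (r - 1) Bs))"
 let ?S' = "\<Sum>r=2..length (Bs @ [B]). (int (map length (Bs @ [B]) ! (r - 1)) - 1) * sum_list (concat (take (r - 1) (Bs @ [B])))"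
 let ?q = "\<lambda>B. sum_list B + int (length B) - 1"
 have sk: "sum_list ?ks = (\<Sum>r=1..?i. ?ks ! (r - 1))"
  unfolding sum_list_sum_nth by (rule sum.reindex_bij_witness[of _ "\<lambda>i. i - 1" Suc]) auto
 have A: "?A' = ?A + sum_list ?ks + ?i"
 proof -
  have "(\<Sum>r=1..?i. (Suc ?i - r) * map length (Bs @ [B]) ! (r - 1)) = (\<Sum>r=1..?i. (?i - r) * ?ks ! (r - 1) + ?ks ! (r - 1))"
   by (rule sum.cong) (auto simp: nth_append Suc_diff_le)
  also have "\<dots> = (\<Sum>r=1..?i. (?i - r) * ?ks ! (r - 1)) + sum_list ?ks" by (simp add: sum.distrib sk)
  also have "(\<Sum>r=1..?i. (?i - r) * ?ks ! (r - 1)) = (\<Sum>r=1..?i - 1. (?i - r) * ?ks ! (r - 1))"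
   by (cases ?i) auto
  finally have "(\<Sum>r=1..?i. (Suc ?i - r) * map length (Bs @ [B]) ! (r - 1)) = (\<Sum>r=1..?i - 1. (?i - r) * ?ks ! (r - 1)) + sum_list ?ks" .
  moreover have "Suc ?i * ?i div 2 = ?i * (?i - 1) div 2 + ?i"
  proof (cases ?i)
   case (Suc m)
   have "Suc (Suc m) * Suc m = Suc m * m + 2 * Suc m" by simp
   then show ?thesis unfolding Suc diff_Suc_1 using div_mult_self2[of 2 "Suc m * m" "Suc m"] by (simp only: add.commute)
  qed simp
  ultimately show ?thesis by simp
 qed
 have S: "?S' = ?S + (if ?i = 0 then 0 else (int ?k - 1) * ?C)"
 proof (cases "?i = 0")
  case False
  then have "?S' = (\<Sum>r=2..?i. (int (map length (Bs @ [B]) ! (r - 1)) - 1) * sum_list (concat (take (r - 1) (Bs @ [B])))) +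
   (int ?k - 1) * ?C" by (simp add: nth_append)
  also have "(\<Sum>r=2..?i. (int (map length (Bs @ [B]) ! (r - 1)) - 1) * sum_list (concat (take (r - 1) (Bs @ [B])))) = ?S"
   by (rule sum.cong) (auto simp: nth_append)
  finally show ?thesis using False by simp
 qed simp
 have C0: "(if ?i = 0 then 0 else (int ?k - 1) * ?C) = (int ?k - 1) * ?C" by simp
 have q: "sum_list (map ?q Bs) = ?C + int (sum_list ?ks) - int ?i"
  by (induct Bs) auto
 let ?P = "(\<Prod>B\<leftarrow>Bs. susp_sign B) :: 'k" and ?Q = "susp_sign (map ?q Bs) :: 'k"
 have "(-1 :: 'k) ^ ?A' * (-1) powi ?S' * (\<Prod>B\<leftarrow>Bs @ [B]. susp_sign B) * susp_sign (map ?q (Bs @ [B]))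
  = ((-1) ^ ?A * (-1) powi ?S * ?P * ?Q) *
   ((-1) powi (int (sum_list ?ks + ?i)) * (-1) powi ((int ?k - 1) * ?C) * (-1) powi (?C + int (sum_list ?ks) - int ?i)) * susp_sign B"
  unfolding A S C0 by (simp add: susp_sign_append q powi_minus_one_add power_add)
 also have "(-1 :: 'k) powi (int (sum_list ?ks + ?i)) * (-1) powi ((int ?k - 1) * ?C) * (-1) powi (?C + int (sum_list ?ks) - int ?i)
  = (-1) powi (int ?k * ?C)"
  unfolding powi_minus_one_add[symmetric] by (rule powi_minus_one_even) (simp add: algebra_simps)
 finally show ?case unfolding snoc by (simp add: susp_sign_append)
qed

lemma slice_append: "a \<le> Suc b ==> b \<le> c ==> slice vs \<sigma> a b @ slice vs \<sigma> (Suc b) c = slice vs \<sigma> a c"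
proof -
 assume "a \<le> Suc b" "b \<le> c"
 then have "[a..<Suc c] = [a..<Suc b] @ [Suc b..<Suc c]"
  using upt_add_eq_append[of a "Suc b" "c - b"] by simp
 then show ?thesis unfolding slice_def by (simp only: map_append)
qed

lemma psum_mono: "r \<le> s ==> psum ks r \<le> psum ks s"
 unfolding psum_def by (metis le_add1 le_add_diff_inverse sum_list_append take_add)

lemma concat_blocks:
 "concat (map (\<lambda>r. slice vs \<sigma> (psum ks (r - 1) + 1) (psum ks r)) [1..<q + 1]) = slice vs \<sigma> 1 (psum ks q)"
proof (induct q)
 case 0 then show ?case by (simp add: psum_def slice_def)
next
 case (Suc q)
 then show ?case using slice_append[of 1 "psum ks q" "psum ks (Suc q)" vs \<sigma>] psum_mono[of q "Suc q" ks] by simp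
qed

subsection \<open>Scalars in multilinear maps\<close>

lemma multilinear_scale:
 assumes V: "vecsp V" and W: "vecsp W" and h: "multilinear V W h" and "length cs = length vs" "set vs \<subseteq> elems V" "vs \<noteq> []"
 shows "h (map2 (smult V) cs vs) = smult W (prod_list cs) (h vs)"
proof -
 interpret W: vector_space "smult W" by fact
 have "h (us @ map2 (smult V) cs vs) = smult W (prod_list cs) (h (us @ vs))"
  if "length cs = length vs" "set vs \<subseteq> elems V" "set us \<subseteq> elems V" "us @ vs \<noteq> []" for us cs vs
  using that
 proof (induct vs arbitrary: us cs)
  case Nil then show ?case by simp
 next
  case (Cons v vs)
  then obtain c cs' where cs: "cs = c # cs'" "length cs' = length vs" by (cases cs) auto
  have v: "v \<in> elems V" "smult V c v \<in> elems V" using Cons(3) elems_smult[OF V] by auto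
  have "h (us @ map2 (smult V) cs (v # vs)) = h ((us @ [smult V c v]) @ map2 (smult V) cs' vs)" by (simp add: cs)
  also have "\<dots> = smult W (prod_list cs') (h ((us @ [smult V c v]) @ vs))"
   by (rule Cons(1)) (use cs Cons v in auto)
  also have "h ((us @ [smult V c v]) @ vs) = smult W c (h (us @ v # vs))"
  proof -
   have "linear_map V W (\<lambda>v. h (us @ v # vs))" using h Cons unfolding multilinear_def by simp
   from lm_smult[OF this v(1), of c] show ?thesis by simp
  qed
  finally show ?case by (simp add: cs mult.commute)
 qed
 from this[of cs vs "[]"] show ?thesis using assms by simp
qed

lemma graded_susp: "graded_vector_space V ==> graded_vector_space (susp V)"
 unfolding graded_vector_space_def
proof (intro conjI allI impI)
 assume V: "vecsp V \<and> (\<forall>n. module.subspace (smult V) (hcomp V n)) \<and>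
  (\<forall>N x. finite N \<and> (\<forall>n\<in>N. x n \<in> hcomp V n) \<and> sum x N = 0 \<longrightarrow> (\<forall>n\<in>N. x n = 0))"
 then show "vecsp (susp V)" "module.subspace (smult (susp V)) (hcomp (susp V) n)" for n by simp_all
 fix N x assume N: "finite N \<and> (\<forall>n\<in>N. x n \<in> hcomp (susp V) n) \<and> sum x N = 0"
 have shifted: "(\<Sum>n\<in>(\<lambda>n. n - 1) ` N. x (n + 1)) = sum x N"
  by (subst sum.reindex) (auto simp: inj_on_def)
 have direct: "\<forall>n\<in>N. x n = 0" if "finite N" "\<forall>n\<in>N. x n \<in> hcomp V n" "sum x N = 0" for N x
  using V that by blast
 have "\<forall>n\<in>(\<lambda>n. n - 1) ` N. x (n + 1) = 0"
  using direct[of "(\<lambda>n. n - 1) ` N" "\<lambda>n. x (n + 1)"] N shifted by auto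
 then show "\<forall>n\<in>N. x n = 0" by auto
qed

lemma linear_map_susp [simp]: "linear_map V (susp W) = linear_map V W" "linear_map (susp V) W = linear_map V W"
 by (auto simp: linear_map_def fun_eq_iff)

lemma susp_sign_nonzero [simp]: "susp_sign ds \<noteq> (0 :: 'k::field)"
 by (simp add: susp_sign_def)

lemma desusp_corestrictions_homogeneous:
 assumes V: "graded_vector_space V" and W: "vecsp W" and F: "linear_map (tensor_module (susp V)) (tensor_module (susp W)) F"
  and h: "homogeneous V ds vs"
 shows "desusp_corestrictions V W F vs = smult W (susp_sign ds) (proj1 (susp W) (F (pure (susp V) vs)))"
proof -
 have v: "vecsp V" using V by (rule graded_vs)
 have w: "vs \<in> words V" by (rule homogeneous_words[OF v h])
 have p: "pure (susp V) vs \<in> elems (tensor_module (susp V))" using pure_in[of "susp V" vs] v w by simp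
 have "linear_map (tensor_module (susp V)) (susp W) (\<lambda>x. proj1 (susp W) (F x))"
  using lm_comp[OF F lm_proj1] W by simp
 from lm_smult[OF this p, of "susp_sign ds"] show ?thesis
  using w susp_tensor_pure[OF V h] by (simp add: desusp_corestrictions_def)
qed

lemma multilinear_desusp_corestrictions:
 assumes V: "graded_vector_space V" and W: "vecsp W" and F: "linear_map (tensor_module (susp V)) (tensor_module (susp W)) F"
 shows "multilinear V W (desusp_corestrictions V W F)"
proof -
 have v: "vecsp V" using V by (rule graded_vs)
 have "linear_map (tensor_module (susp V)) W (\<lambda>x. proj1 (susp W) (F x))"
  using lm_comp[OF F lm_proj1[of "susp W"]] W by simp
 from ml_comp[OF ml_pure[OF v] lm_comp[OF lm_susp_tensor[OF V] this]]
 show ?thesis by (subst ml_cong[OF v]) (auto simp: desusp_corestrictions_def words_def)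
qed

lemma graded_proj1:
 assumes U: "graded_vector_space U"
 shows "graded_map (tensor_module U) U 0 (proj1 U)"
proof (rule graded_map_from_words[OF U U])
 have v: "vecsp U" using U by (rule graded_vs)
 show "linear_map (tensor_module U) U (proj1 U)" by (rule lm_proj1[OF v])
 fix ds vs assume h: "homogeneous U ds vs"
 note w = homogeneous_words[OF v h]
 show "proj1 U (pure U vs) \<in> hcomp U (sum_list ds + 0)"
 proof (cases "length vs = 1")
  case True
  then obtain u where "vs = [u]" by (auto simp: length_Suc_conv)
  then show ?thesis using h proj1_pure[OF v w] by (auto simp: homogeneous_nth length_Suc_conv)
 qed (simp add: proj1_pure[OF v w] hcomp_0[OF U])
qed

lemma graded_desusp_corestrictions:
 assumes V: "graded_vector_space V" and W: "graded_vector_space W"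
  and F: "graded_map (tensor_module (susp V)) (tensor_module (susp W)) q F"
 shows "graded_multilinear V W (\<lambda>i. int i - 1 + q) (desusp_corestrictions V W F)"
 unfolding graded_multilinear_def
proof (intro conjI allI impI)
 have lF: "linear_map (tensor_module (susp V)) (tensor_module (susp W)) F" using F by (simp add: graded_map_def)
 show "multilinear V W (desusp_corestrictions V W F)"
  by (rule multilinear_desusp_corestrictions[OF V graded_vs[OF W] lF])
 fix ds vs assume h: "homogeneous V ds vs"
 have "sum_list (map (\<lambda>d. d + 1) ds) = sum_list ds + int (length vs)"
  using homogeneous_length[OF h] by (simp add: sum_list_addf sum_list_triv)
 then have "F (pure (susp V) vs) \<in> hcomp (tensor_module (susp W)) (sum_list ds + int (length vs) + q)"
  using hcomp_pure[OF h[folded homogeneous_susp[of V]]] F by (auto simp: graded_map_def)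
 then have "proj1 (susp W) (F (pure (susp V) vs)) \<in> hcomp (susp W) (sum_list ds + int (length vs) + q + 0)"
  using graded_proj1[OF graded_susp[OF W]] by (simp only: graded_map_def)
 then show "desusp_corestrictions V W F vs \<in> hcomp W (sum_list ds + (int (length vs) - 1 + q))"
  unfolding desusp_corestrictions_homogeneous[OF V graded_vs[OF W] lF h]
  by (intro hcomp_smult[OF W]) (simp add: algebra_simps)
qed

subsection \<open>The morphism equation\<close>

lemma (in cofree_zinbiel) coderivation_pure:
 assumes D: "coderivation D" and h: "homogeneous U ds us"
 shows "D (pure U us) =
  (\<Sum>k=1..length us. \<Sum>j=1..k. \<Sum>\<sigma>\<in>Sh [k - j, j - 1].
   smult T (koszul ds \<sigma> * (-1) powi (sum_list (slice ds \<sigma> 1 (k - j))))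
    (pure U (slice us \<sigma> 1 (k - j) @ [\<pi> (D (pure U (slice us \<sigma> (k - j + 1) (k - 1) @ [us ! (k - 1)])))] @ drop k us)))"
  (is "_ = ?R")
proof
 fix \<beta>
 show "D (pure U us) \<beta> = ?R \<beta>"
 proof (cases "multilinear U ground \<beta>")
  case True then show ?thesis by (simp add: coderivation_words[OF D h] sum_fun_apply)
 next
  case False
  then show ?thesis using tmod_nonmultilinear[OF vU lm_in[OF coderivation_lm[OF D] pure_T[OF h]]]
   by (simp add: sum_fun_apply pure_nonmultilinear)
 qed
qed

lemma (in cofree_pair) coalgebra_map_pure:
 assumes F: "coalgebra_map F" and h: "homogeneous U ds us"
 shows "F (pure U us) = (\<Sum>ks\<in>compositions (length us). \<Sum>\<sigma>\<in>half_Sh ks.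
  smult R.T (koszul ds \<sigma>)
   (pure U' (map (\<lambda>r. R.\<pi> (F (pure U (slice us \<sigma> (psum ks (r - 1) + 1) (psum ks r))))) [1..<length ks + 1])))"
  (is "_ = ?R")
proof
 fix \<beta>
 show "F (pure U us) \<beta> = ?R \<beta>"
 proof (cases "multilinear U' ground \<beta>")
  case True then show ?thesis by (simp add: coalgebra_map_words[OF F h] sum_fun_apply)
 next
  case False
  then show ?thesis using tmod_nonmultilinear[OF R.vU lm_in[OF coalgebra_map_lm[OF F] S.pure_T[OF h]]]
   by (simp add: sum_fun_apply pure_nonmultilinear)
 qed
qed

lemma homogeneous_slice:
 assumes h: "homogeneous V ds vs" and \<sigma>: "\<sigma> permutes {1..length vs}" and ab: "1 \<le> a" "b \<le> length vs"
 shows "list_all2 (\<lambda>d v. v \<in> hcomp V d) (slice ds \<sigma> a b) (slice vs \<sigma> a b)"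
 unfolding list_all2_conv_all_nth
proof (intro conjI allI impI)
 fix i assume "i < length (slice ds \<sigma> a b)"
 then have i: "i < Suc b - a" by simp
 have "\<sigma> (a + i) \<in> {1..length vs}" using permutes_in_image[OF \<sigma>, of "a + i"] ab i by auto
 then have "\<sigma> (a + i) - 1 < length vs" by auto
 then show "slice vs \<sigma> a b ! i \<in> hcomp V (slice ds \<sigma> a b ! i)"
  using h by (simp only: nth_slice[OF i] homogeneous_nth)
qed simp

lemma sum_triangle: "(\<Sum>j=1..n. \<Sum>k=j..n. g j k) = (\<Sum>k=1..n. \<Sum>j=1..k. g j (k :: nat))"
 by (subst (1 2) sum.Sigma, simp_all) (rule sum.reindex_bij_witness[of _ prod.swap prod.swap], auto)

text \<open>The common shape of the two sign comparisons: \<open>S\<close> is the sign of $s^{\otimes n}$ on the whole word, whose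
 square is 1, while \<open>K\<close> and \<open>g\<close> stand for the Koszul sign and the signature.\<close>

lemma sign_cancel:
 fixes S :: "'k::field"
 assumes "a * b * s * t = r * e" "S * S = 1"
 shows "a * b * K * g * (s * t) = S * (K * g * S * r * e)"
proof -
 have "S * (K * g * S * r * e) = (S * S) * (K * g * (r * e))" by (simp only: ac_simps)
 also have "\<dots> = K * g * (a * b * s * t)" using assms by simp
 finally show ?thesis by (simp only: ac_simps)
qed

text \<open>The right side of the morphism equation; it is used with $f = \pi F$.\<close>

lemma insertion_sum:
 fixes V :: "('k::field, 'v::ab_group_add) graded_space" and W :: "('k, 'w::ab_group_add) graded_space"
 assumes V: "graded_vector_space V" and W: "graded_vector_space W"
  and cV: "cofree_zinbiel (susp V)" and D: "cofree_zinbiel.coderivation (susp V) D"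
  and gD: "graded_map (tensor_module (susp V)) (tensor_module (susp V)) (-1) D"
  and l: "\<And>vs. vs \<in> words V ==> l vs = desusp_corestrictions V V D vs"
  and f: "linear_map (tensor_module (susp V)) W f"
  and \<phi>: "\<And>ds vs. homogeneous V ds vs ==> \<phi> vs = smult W (susp_sign ds) (f (pure (susp V) vs))"
  and h: "homogeneous V ds vs"
 shows "(\<Sum>j=1..length vs. \<Sum>k=j..length vs. \<Sum>\<sigma>\<in>Sh [k - j, j - 1].
      smult W
       ((-1) ^ (k + (length vs - k + 1) * j) *
       (-1) powi (int j * sum_list (slice ds \<sigma> 1 (k - j))) *
       koszul ds \<sigma> * of_int (sign \<sigma>))
       (\<phi> (slice vs \<sigma> 1 (k - j) @ [l (slice vs \<sigma> (k - j + 1) (k - 1) @ [vs ! (k - 1)])] @ drop k vs)))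
  = smult W (susp_sign ds) (f (D (pure (susp V) vs)))"
proof -
 interpret S: cofree_zinbiel "susp V" by (rule cV)
 have vV: "vecsp V" and vW: "vecsp W" using V W graded_vs by auto
 interpret W: vector_space "smult W" by (rule vW)
 let ?n = "length vs" and ?es = "map (\<lambda>d. d + 1) ds"
 have len: "length ds = ?n" by (rule homogeneous_length[OF h])
 have hs: "homogeneous (susp V) ?es vs" using h homogeneous_susp[of V ds vs] by simp
 have lD: "linear_map S.T S.T D" using gD by (simp add: graded_map_def)
 let ?X = "\<lambda>j k \<sigma>. slice vs \<sigma> 1 (k - j)" and ?P = "\<lambda>j k \<sigma>. slice vs \<sigma> (k - j + 1) (k - 1) @ [vs ! (k - 1)]"
 let ?dX = "\<lambda>j k \<sigma>. slice ds \<sigma> 1 (k - j)" and ?dP = "\<lambda>j k \<sigma>. slice ds \<sigma> (k - j + 1) (k - 1) @ [ds ! (k - 1)]"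
 let ?w = "\<lambda>j k \<sigma>. S.\<pi> (D (pure (susp V) (?P j k \<sigma>)))"
 let ?c = "\<lambda>j k \<sigma>. koszul ?es \<sigma> * (-1) powi (sum_list (slice ?es \<sigma> 1 (k - j))) :: 'k"
 let ?u = "\<lambda>j k \<sigma>. pure (susp V) (?X j k \<sigma> @ [?w j k \<sigma>] @ drop k vs)"
 have facts: "smult W ((-1) ^ (k + (?n - k + 1) * j) * (-1) powi (int j * sum_list (?dX j k \<sigma>)) * koszul ds \<sigma> * of_int (sign \<sigma>))
   (\<phi> (?X j k \<sigma> @ [l (?P j k \<sigma>)] @ drop k vs)) = smult W (susp_sign ds) (smult W (?c j k \<sigma>) (f (?u j k \<sigma>)))
   \<and> ?u j k \<sigma> \<in> elems S.T"
  if k: "k \<in> {1..?n}" and j: "j \<in> {1..k}" and \<sigma>: "\<sigma> \<in> Sh [k - j, j - 1]" for j k \<sigma>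
 proof -
  have kj: "1 \<le> j" "j \<le> k" "1 \<le> k" "k \<le> ?n" using k j by auto
  have \<sigma>k: "\<sigma> permutes {1..k - 1}" using Sh_permutes[OF \<sigma>] kj by simp
  have \<sigma>n: "\<sigma> permutes {1..?n}" by (rule permutes_subset[OF \<sigma>k]) (use kj in auto)
  let ?Z = "drop k vs" and ?dZ = "drop k ds"
  have X: "list_all2 (\<lambda>d v. v \<in> hcomp V d) (?dX j k \<sigma>) (?X j k \<sigma>)"
   by (rule homogeneous_slice[OF h \<sigma>n]) (use kj in auto)
  have Y: "list_all2 (\<lambda>d v. v \<in> hcomp V d) (slice ds \<sigma> (k - j + 1) (k - 1)) (slice vs \<sigma> (k - j + 1) (k - 1))"
   by (rule homogeneous_slice[OF h \<sigma>n]) (use kj in auto)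
  have P: "homogeneous V (?dP j k \<sigma>) (?P j k \<sigma>)"
   unfolding homogeneous_def using Y h kj by (auto intro!: list_all2_appendI simp: homogeneous_nth)
  have Z: "list_all2 (\<lambda>d v. v \<in> hcomp V d) ?dZ ?Z"
   using h by (simp add: homogeneous_def list_all2_dropI)
  have lenP: "length (?P j k \<sigma>) = j" "length (?dP j k \<sigma>) = j" using kj by auto
  have lP: "l (?P j k \<sigma>) = smult V (susp_sign (?dP j k \<sigma>)) (?w j k \<sigma>)"
   using l[OF homogeneous_words[OF vV P]] desusp_corestrictions_homogeneous[OF V vV lD P] by simp
  have "l (?P j k \<sigma>) \<in> hcomp V (sum_list (?dP j k \<sigma>) + (int j - 1 + - 1))"
   using graded_desusp_corestrictions[OF V V gD] l[OF homogeneous_words[OF vV P]] P lenP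
   unfolding graded_multilinear_def by metis
  then have lPh: "l (?P j k \<sigma>) \<in> hcomp V (sum_list (?dP j k \<sigma>) + int j - 2)" by (simp add: algebra_simps)
  have arg: "homogeneous V (?dX j k \<sigma> @ [sum_list (?dP j k \<sigma>) + int j - 2] @ ?dZ) (?X j k \<sigma> @ [l (?P j k \<sigma>)] @ ?Z)"
   unfolding homogeneous_def using X Z lPh by (auto intro!: list_all2_appendI)
  have w: "?w j k \<sigma> \<in> elems V"
   using lm_in[OF S.lm_\<pi> lm_in[OF lD pure_in[of "susp V" "?P j k \<sigma>"]]] homogeneous_words[OF vV P] vV by simp
  have sX: "set (?X j k \<sigma>) \<subseteq> elems V" "set ?Z \<subseteq> elems V"
   using homogeneous_words[OF vV arg] by (auto simp: words_def)
  have u: "?u j k \<sigma> \<in> elems S.T"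
   by (rule pure_in) (use vV w sX in \<open>auto simp: words_def\<close>)
  have lin: "linear_map V S.T (\<lambda>v. pure (susp V) (?X j k \<sigma> @ v # ?Z))"
   using ml_pure[of "susp V"] vV sX by (simp add: multilinear_def)
  have "\<phi> (?X j k \<sigma> @ [l (?P j k \<sigma>)] @ ?Z) =
   smult W (susp_sign (?dX j k \<sigma> @ [sum_list (?dP j k \<sigma>) + int j - 2] @ ?dZ)) (smult W (susp_sign (?dP j k \<sigma>)) (f (?u j k \<sigma>)))"
  proof -
   have "f (pure (susp V) (?X j k \<sigma> @ [l (?P j k \<sigma>)] @ ?Z)) = smult W (susp_sign (?dP j k \<sigma>)) (f (?u j k \<sigma>))"
    unfolding lP using lm_smult[OF lm_comp[OF lin f] w] by simp
   with \<phi>[OF arg] show ?thesis by (simp only:)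
  qed
  note phi = this
  have pm: "pm ds \<sigma> = ?dX j k \<sigma> @ ?dP j k \<sigma> @ ?dZ"
  proof -
   have "\<sigma> k = k" by (rule permutes_not_in[OF \<sigma>k]) (use kj in auto)
   then have "slice ds \<sigma> k k = [ds ! (k - 1)]" by (simp add: slice_def)
   moreover have "slice ds \<sigma> (Suc k) ?n = drop k (pm ds \<sigma>)" using slice_eq_drop[of ds \<sigma> k] len by simp
   moreover have "drop k (pm ds \<sigma>) = ?dZ"
   proof (rule nth_equalityI)
    fix i assume "i < length (drop k (pm ds \<sigma>))"
    then have i: "k + i < length ds" by simp
    have "\<sigma> (Suc (k + i)) = Suc (k + i)" by (rule permutes_not_in[OF \<sigma>k]) (use kj in auto)
    then show "drop k (pm ds \<sigma>) ! i = ?dZ ! i" using i by (simp add: nth_pm)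
   qed simp
   moreover have "slice ds \<sigma> 1 (k - j) @ slice ds \<sigma> (Suc (k - j)) (k - 1) = slice ds \<sigma> 1 (k - 1)"
    using kj by (intro slice_append) auto
   moreover have "slice ds \<sigma> 1 (k - 1) @ slice ds \<sigma> k k = slice ds \<sigma> 1 k"
    using slice_append[of 1 "k - 1" k ds \<sigma>] kj by simp
   moreover have "slice ds \<sigma> 1 k @ slice ds \<sigma> (Suc k) ?n = pm ds \<sigma>"
    using slice_append[of 1 k ?n ds \<sigma>] kj len by (simp add: pm_def)
   ultimately show ?thesis by (metis Suc_eq_plus1 append.assoc)
  qed
  have es: "slice ?es \<sigma> 1 (k - j) = map (\<lambda>d. d + 1) (?dX j k \<sigma>)"
  proof (rule nth_equalityI)
   fix i assume "i < length (slice ?es \<sigma> 1 (k - j))"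
   then have i: "i < k - j" by simp
   have "\<sigma> (1 + i) \<in> {1..?n}" using permutes_in_image[OF \<sigma>n, of "1 + i"] i kj by auto
   then have "\<sigma> (1 + i) - 1 < length ds" using len by auto
   then show "slice ?es \<sigma> 1 (k - j) ! i = map (\<lambda>d. d + 1) (?dX j k \<sigma>) ! i" using i by (simp add: nth_slice)
  qed simp
  have K: "koszul ?es \<sigma> = koszul ds \<sigma> * of_int (sign \<sigma>) * susp_sign ds * (susp_sign (pm ds \<sigma>) :: 'k)"
   by (rule koszul_susp) (use \<sigma>n len in simp)
  have "(-1 :: 'k) ^ (k + (?n - k + 1) * j) * (-1) powi (int j * sum_list (?dX j k \<sigma>)) *
   susp_sign (?dX j k \<sigma> @ [sum_list (?dP j k \<sigma>) + int j - 2] @ ?dZ) * susp_sign (?dP j k \<sigma>)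
   = susp_sign (?dX j k \<sigma> @ ?dP j k \<sigma> @ ?dZ) * (-1) powi (sum_list (map (\<lambda>d. d + 1) (?dX j k \<sigma>)))" (is "?a * ?b * ?s * ?t = ?r * ?e")
   by (rule insertion_sign) (use kj len lenP in auto)
  from sign_cancel[OF this susp_sign_square(1), of "koszul ds \<sigma>" "of_int (sign \<sigma>)" ds]
  have "?a * ?b * koszul ds \<sigma> * of_int (sign \<sigma>) * (?s * ?t) = susp_sign ds * ?c j k \<sigma>"
   unfolding K es pm .
  then show ?thesis using u unfolding phi W.scale_scale by (simp only: simp_thms)
 qed
 have "f (D (pure (susp V) vs)) = (\<Sum>k=1..?n. \<Sum>j=1..k. \<Sum>\<sigma>\<in>Sh [k - j, j - 1]. smult W (?c j k \<sigma>) (f (?u j k \<sigma>)))"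
 proof -
  have in1: "smult S.T (?c j k \<sigma>) (?u j k \<sigma>) \<in> elems S.T" if "k \<in> {1..?n}" "j \<in> {1..k}" "\<sigma> \<in> Sh [k - j, j - 1]" for j k \<sigma>
   using facts[OF that] by (intro elems_smult vs_simps) blast
  have "f (D (pure (susp V) vs)) = f (\<Sum>k=1..?n. \<Sum>j=1..k. \<Sum>\<sigma>\<in>Sh [k - j, j - 1]. smult S.T (?c j k \<sigma>) (?u j k \<sigma>))"
   by (simp only: S.coderivation_pure[OF D hs])
  also have "\<dots> = (\<Sum>k=1..?n. f (\<Sum>j=1..k. \<Sum>\<sigma>\<in>Sh [k - j, j - 1]. smult S.T (?c j k \<sigma>) (?u j k \<sigma>)))"
   by (intro lm_sum[OF vs_simps(2) f] elems_sum[OF vs_simps(2)] in1)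
  also have "\<dots> = (\<Sum>k=1..?n. \<Sum>j=1..k. f (\<Sum>\<sigma>\<in>Sh [k - j, j - 1]. smult S.T (?c j k \<sigma>) (?u j k \<sigma>)))"
   by (intro sum.cong refl lm_sum[OF vs_simps(2) f] elems_sum[OF vs_simps(2)] in1)
  also have "\<dots> = (\<Sum>k=1..?n. \<Sum>j=1..k. \<Sum>\<sigma>\<in>Sh [k - j, j - 1]. f (smult S.T (?c j k \<sigma>) (?u j k \<sigma>)))"
   by (intro sum.cong refl lm_sum[OF vs_simps(2) f] in1)
  also have "\<dots> = (\<Sum>k=1..?n. \<Sum>j=1..k. \<Sum>\<sigma>\<in>Sh [k - j, j - 1]. smult W (?c j k \<sigma>) (f (?u j k \<sigma>)))"
   by (intro sum.cong refl lm_smult[OF f]) (use facts in blast)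
  finally show ?thesis .
 qed
 then have "smult W (susp_sign ds) (f (D (pure (susp V) vs))) =
  (\<Sum>k=1..?n. \<Sum>j=1..k. \<Sum>\<sigma>\<in>Sh [k - j, j - 1]. smult W (susp_sign ds) (smult W (?c j k \<sigma>) (f (?u j k \<sigma>))))"
  by (simp only: W.scale_sum_right)
 also have "\<dots> = (\<Sum>k=1..?n. \<Sum>j=1..k. \<Sum>\<sigma>\<in>Sh [k - j, j - 1].
   smult W ((-1) ^ (k + (?n - k + 1) * j) * (-1) powi (int j * sum_list (?dX j k \<sigma>)) * koszul ds \<sigma> * of_int (sign \<sigma>))
   (\<phi> (?X j k \<sigma> @ [l (?P j k \<sigma>)] @ drop k vs)))"
  by (rule sum.cong[OF refl], rule sum.cong[OF refl], rule sum.cong[OF refl], rule sym, rule conjunct1[OF facts])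
 finally show ?thesis unfolding sum_triangle ..
qed

text \<open>The left side of the morphism equation.\<close>

lemma block_sum:
 fixes V :: "('k::field, 'v::ab_group_add) graded_space" and W :: "('k, 'w::ab_group_add) graded_space"
 assumes V: "graded_vector_space V" and W: "graded_vector_space W"
  and P: "cofree_pair (susp V) (susp W)" and F: "cofree_pair.coalgebra_map (susp V) (susp W) F"
  and gF: "graded_map (tensor_module (susp V)) (tensor_module (susp W)) 0 F"
  and lE: "linear_map (tensor_module (susp W)) (tensor_module (susp W)) E"
  and m: "\<And>ws. ws \<in> words W ==> m ws = desusp_corestrictions W W E ws"
  and \<phi>: "\<And>vs. vs \<in> words V ==> \<phi> vs = desusp_corestrictions V W F vs"
  and h: "homogeneous V ds vs"
 shows "(\<Sum>ks\<in>compositions (length vs). \<Sum>\<sigma>\<in>half_Sh ks.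
      smult W
       ((-1) ^ ((\<Sum>r=1..length ks-1. (length ks - r) * ks ! (r - 1)) + length ks * (length ks - 1) div 2) *
       (-1) powi (\<Sum>r=2..length ks. (int (ks ! (r - 1)) - 1) * sum_list (slice ds \<sigma> 1 (psum ks (r - 1)))) *
       koszul ds \<sigma> * of_int (sign \<sigma>))
       (m (map (\<lambda>r. \<phi> (slice vs \<sigma> (psum ks (r - 1) + 1) (psum ks r))) [1..<length ks+1])))
  = smult W (susp_sign ds) (proj1 (susp W) (E (F (pure (susp V) vs))))"
proof -
 interpret P: cofree_pair "susp V" "susp W" by (rule P)
 have vV: "vecsp V" and vW: "vecsp W" using V W graded_vs by auto
 interpret W: vector_space "smult W" by (rule vW)
 let ?n = "length vs" and ?es = "map (\<lambda>d. d + 1) ds"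
 have len: "length ds = ?n" by (rule homogeneous_length[OF h])
 have n: "1 \<le> ?n" using h by (auto simp: homogeneous_nth Suc_le_eq)
 have hs: "homogeneous (susp V) ?es vs" using h homogeneous_susp[of V ds vs] by simp
 have lF: "linear_map P.S.T P.R.T F" by (rule P.coalgebra_map_lm[OF F])
 let ?e = "\<lambda>x. P.R.\<pi> (E x)" and ?f = "\<lambda>vs. P.R.\<pi> (F (pure (susp V) vs))"
 have e: "linear_map P.R.T W ?e" using lm_comp[OF lE P.R.lm_\<pi>] by simp
 let ?B = "\<lambda>ks \<sigma> r. slice vs \<sigma> (psum ks (r - 1) + 1) (psum ks r)"
 let ?dB = "\<lambda>ks \<sigma> r. slice ds \<sigma> (psum ks (r - 1) + 1) (psum ks r)"
 let ?u = "\<lambda>ks \<sigma>. pure (susp W) (map (\<lambda>r. ?f (?B ks \<sigma> r)) [1..<length ks+1])"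
 have facts: "smult W
   ((-1) ^ ((\<Sum>r=1..length ks-1. (length ks - r) * ks ! (r - 1)) + length ks * (length ks - 1) div 2) *
    (-1) powi (\<Sum>r=2..length ks. (int (ks ! (r - 1)) - 1) * sum_list (slice ds \<sigma> 1 (psum ks (r - 1)))) *
    koszul ds \<sigma> * of_int (sign \<sigma>))
   (m (map (\<lambda>r. \<phi> (?B ks \<sigma> r)) [1..<length ks+1]))
  = smult W (susp_sign ds) (smult W (koszul ?es \<sigma>) (?e (?u ks \<sigma>))) \<and> ?u ks \<sigma> \<in> elems P.R.T"
  if ks: "ks \<in> compositions ?n" and \<sigma>: "\<sigma> \<in> half_Sh ks" for ks \<sigma>
 proof -
  let ?i = "length ks" and ?r = "[1..<length ks + 1]"
  have pos: "\<forall>k\<in>set ks. 1 \<le> k" and sum: "sum_list ks = ?n" using ks by (auto simp: compositions_def)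
  have i: "ks \<noteq> []" using sum n by auto
  have \<sigma>n: "\<sigma> permutes {1..?n}" using half_ShD(1)[OF \<sigma>] sum by simp
  have diff: "psum ks r - psum ks (r - 1) = ks ! (r - 1)" "psum ks (r - 1) < psum ks r" if "r \<in> set ?r" for r
  proof -
   from that have "r = Suc (r - 1)" "r - 1 < ?i" by (auto simp del: upt_Suc)
   then obtain q where q: "r = Suc q" "q < ?i" by blast
   then have "1 \<le> ks ! q" using pos by simp
   then show "psum ks r - psum ks (r - 1) = ks ! (r - 1)" "psum ks (r - 1) < psum ks r" using q psum_Suc[of q ks] by auto
  qed
  define Bs where "Bs = map (?dB ks \<sigma>) ?r"
  have Bh: "homogeneous V (?dB ks \<sigma> r) (?B ks \<sigma> r)" if "r \<in> set ?r" for r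
  proof -
   have "psum ks r \<le> ?n" using psum_le[of ks r] sum by simp
   then have "list_all2 (\<lambda>d v. v \<in> hcomp V d) (?dB ks \<sigma> r) (?B ks \<sigma> r)" by (intro homogeneous_slice[OF h \<sigma>n]) auto
   moreover have "0 < length (?B ks \<sigma> r)" using diff(2)[OF that] by (simp del: length_greater_0_conv)
   then have "?B ks \<sigma> r \<noteq> []" by (simp only: length_greater_0_conv simp_thms)
   ultimately show ?thesis by (simp only: homogeneous_def simp_thms)
  qed
  have lenB: "length (?dB ks \<sigma> r) = ks ! (r - 1)" "length (?B ks \<sigma> r) = ks ! (r - 1)" if "r \<in> set ?r" for r
   using diff[OF that] by simp_all
  have mapl: "map length Bs = ks"
  proof (rule nth_equalityI)
   fix i assume "i < length (map length Bs)"
   then have "i < ?i" by (simp add: Bs_def del: upt_Suc)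
   then show "map length Bs ! i = ks ! i" using lenB(1)[of "Suc i"] by (simp add: Bs_def del: upt_Suc length_slice)
  qed (simp only: Bs_def length_map length_upt add_diff_cancel_right')
  have lBs: "length Bs = ?i" by (simp only: Bs_def length_map length_upt add_diff_cancel_right')
  have take: "concat (take (r - 1) Bs) = slice ds \<sigma> 1 (psum ks (r - 1))" if "r \<in> {2..?i}" for r
  proof -
   have "take (r - 1) ?r = [1..<(r - 1) + 1]" using that by (auto simp: take_upt simp del: upt_Suc)
   then have "take (r - 1) Bs = map (?dB ks \<sigma>) [1..<(r - 1) + 1]" by (simp only: Bs_def take_map)
   then show ?thesis by (simp only: concat_blocks)
  qed
  have conc: "concat Bs = pm ds \<sigma>"
   using concat_blocks[of ds \<sigma> ks ?i] sum len by (simp add: Bs_def pm_def psum_length del: upt_Suc)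
  let ?q = "map (\<lambda>B. sum_list B + int (length B) - 1) Bs"
  have \<phi>h: "\<phi> (?B ks \<sigma> r) \<in> hcomp W (sum_list (?dB ks \<sigma> r) + int (length (?dB ks \<sigma> r)) - 1)"
   "\<phi> (?B ks \<sigma> r) = smult W (susp_sign (?dB ks \<sigma> r)) (?f (?B ks \<sigma> r))" if "r \<in> set ?r" for r
  proof -
   note b = Bh[OF that]
   have p: "\<phi> (?B ks \<sigma> r) = desusp_corestrictions V W F (?B ks \<sigma> r)" by (rule \<phi>[OF homogeneous_words[OF vV b]])
   have "desusp_corestrictions V W F (?B ks \<sigma> r) \<in> hcomp W (sum_list (?dB ks \<sigma> r) + (int (length (?B ks \<sigma> r)) - 1 + 0))"
    using graded_desusp_corestrictions[OF V W gF] b unfolding graded_multilinear_def by blast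
   then show "\<phi> (?B ks \<sigma> r) \<in> hcomp W (sum_list (?dB ks \<sigma> r) + int (length (?dB ks \<sigma> r)) - 1)"
    unfolding p by (simp add: algebra_simps)
   show "\<phi> (?B ks \<sigma> r) = smult W (susp_sign (?dB ks \<sigma> r)) (?f (?B ks \<sigma> r))"
    unfolding p by (rule desusp_corestrictions_homogeneous[OF V vW lF b])
  qed
  have arg: "homogeneous W ?q (map (\<lambda>r. \<phi> (?B ks \<sigma> r)) ?r)"
   unfolding homogeneous_def list_all2_conv_all_nth
  proof (intro conjI allI impI)
   fix q assume "q < length ?q"
   then have "q < ?i" by (simp add: lBs)
   then show "map (\<lambda>r. \<phi> (?B ks \<sigma> r)) ?r ! q \<in> hcomp W (?q ! q)"
    using \<phi>h(1)[of "Suc q"] by (simp add: Bs_def del: upt_Suc length_slice)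
  qed (use i in \<open>auto simp: lBs simp del: upt_Suc\<close>)
  have fin: "?f (?B ks \<sigma> r) \<in> elems W" if "r \<in> set ?r" for r
   using lm_in[OF P.R.lm_\<pi> lm_in[OF lF pure_in[of "susp V"]]] homogeneous_words[OF vV Bh[OF that]] vV by simp
  have setf: "set (map (\<lambda>r. ?f (?B ks \<sigma> r)) ?r) \<subseteq> elems W" using fin by auto
  have u: "?u ks \<sigma> \<in> elems P.R.T"
   by (rule pure_in) (use vW setf i in \<open>auto simp: words_def Suc_le_eq\<close>)
  have mle: "multilinear W W (\<lambda>ws. ?e (pure (susp W) ws))"
   using ml_comp[OF ml_pure[of "susp W"] e] vW by simp
  have mp: "map (\<lambda>r. \<phi> (?B ks \<sigma> r)) ?r = map2 (smult W) (map susp_sign Bs) (map (\<lambda>r. ?f (?B ks \<sigma> r)) ?r)"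
  proof (rule nth_equalityI)
   fix q assume "q < length (map (\<lambda>r. \<phi> (?B ks \<sigma> r)) ?r)"
   then have "q < ?i" by (simp del: upt_Suc)
   then show "map (\<lambda>r. \<phi> (?B ks \<sigma> r)) ?r ! q =
     map2 (smult W) (map susp_sign Bs) (map (\<lambda>r. ?f (?B ks \<sigma> r)) ?r) ! q"
    using \<phi>h(2)[of "Suc q"] by (simp add: Bs_def del: upt_Suc)
  qed (simp add: lBs del: upt_Suc)
  have "m (map (\<lambda>r. \<phi> (?B ks \<sigma> r)) ?r) = smult W (susp_sign ?q) (?e (pure (susp W) (map (\<lambda>r. \<phi> (?B ks \<sigma> r)) ?r)))"
   using m[OF homogeneous_words[OF vW arg]] desusp_corestrictions_homogeneous[OF W vW lE arg] by simp
  also have "?e (pure (susp W) (map (\<lambda>r. \<phi> (?B ks \<sigma> r)) ?r)) = smult W (prod_list (map susp_sign Bs)) (?e (?u ks \<sigma>))"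
   unfolding mp by (rule multilinear_scale[OF vW vW mle _ setf]) (use i in \<open>auto simp: lBs simp del: upt_Suc\<close>)
  finally have M: "m (map (\<lambda>r. \<phi> (?B ks \<sigma> r)) ?r) = smult W (susp_sign ?q) (smult W (prod_list (map susp_sign Bs)) (?e (?u ks \<sigma>)))" .
  have K: "koszul ?es \<sigma> = koszul ds \<sigma> * of_int (sign \<sigma>) * susp_sign ds * (susp_sign (pm ds \<sigma>) :: 'k)"
   by (rule koszul_susp) (use \<sigma>n len in simp)
  let ?a = "(-1 :: 'k) ^ ((\<Sum>r=1..length ks-1. (length ks - r) * ks ! (r - 1)) + length ks * (length ks - 1) div 2)"
  let ?b = "(-1 :: 'k) powi (\<Sum>r=2..length ks. (int (ks ! (r - 1)) - 1) * sum_list (slice ds \<sigma> 1 (psum ks (r - 1))))"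
  have "(\<Sum>r=2..length ks. (int (ks ! (r - 1)) - 1) * sum_list (slice ds \<sigma> 1 (psum ks (r - 1)))) =
   (\<Sum>r=2..length ks. (int (ks ! (r - 1)) - 1) * sum_list (concat (take (r - 1) Bs)))"
   by (rule sum.cong[OF refl]) (simp only: take)
  then have "?a * ?b * prod_list (map susp_sign Bs) * susp_sign ?q = susp_sign (pm ds \<sigma>) * 1"
   using block_sign[of Bs, where 'k = 'k] unfolding mapl lBs conc by (simp only: mult_1_right)
  from sign_cancel[OF this susp_sign_square(1), of "koszul ds \<sigma>" "of_int (sign \<sigma>)" ds]
  have "?a * ?b * koszul ds \<sigma> * of_int (sign \<sigma>) * (susp_sign ?q * prod_list (map susp_sign Bs)) = susp_sign ds * koszul ?es \<sigma>"
   unfolding K by (simp only: mult_1_right mult.commute[of "prod_list (map susp_sign Bs)"])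
  then show ?thesis using u unfolding M W.scale_scale by (simp only: simp_thms)
 qed
 have "?e (F (pure (susp V) vs)) = (\<Sum>ks\<in>compositions ?n. \<Sum>\<sigma>\<in>half_Sh ks. smult W (koszul ?es \<sigma>) (?e (?u ks \<sigma>)))"
 proof -
  have in1: "smult P.R.T (koszul ?es \<sigma>) (?u ks \<sigma>) \<in> elems P.R.T" if "ks \<in> compositions ?n" "\<sigma> \<in> half_Sh ks" for ks \<sigma>
   using facts[OF that] by (intro elems_smult vs_simps) blast
  have "?e (F (pure (susp V) vs)) = ?e (\<Sum>ks\<in>compositions ?n. \<Sum>\<sigma>\<in>half_Sh ks. smult P.R.T (koszul ?es \<sigma>) (?u ks \<sigma>))"
   by (simp only: P.coalgebra_map_pure[OF F hs])
  also have "\<dots> = (\<Sum>ks\<in>compositions ?n. ?e (\<Sum>\<sigma>\<in>half_Sh ks. smult P.R.T (koszul ?es \<sigma>) (?u ks \<sigma>)))"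
   by (intro lm_sum[OF vs_simps(2) e] elems_sum[OF vs_simps(2)] in1)
  also have "\<dots> = (\<Sum>ks\<in>compositions ?n. \<Sum>\<sigma>\<in>half_Sh ks. ?e (smult P.R.T (koszul ?es \<sigma>) (?u ks \<sigma>)))"
   by (intro sum.cong refl lm_sum[OF vs_simps(2) e] in1)
  also have "\<dots> = (\<Sum>ks\<in>compositions ?n. \<Sum>\<sigma>\<in>half_Sh ks. smult W (koszul ?es \<sigma>) (?e (?u ks \<sigma>)))"
   by (intro sum.cong refl lm_smult[OF e]) (use facts in blast)
  finally show ?thesis .
 qed
 then have "smult W (susp_sign ds) (?e (F (pure (susp V) vs))) =
  (\<Sum>ks\<in>compositions ?n. \<Sum>\<sigma>\<in>half_Sh ks. smult W (susp_sign ds) (smult W (koszul ?es \<sigma>) (?e (?u ks \<sigma>))))"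
  by (simp only: W.scale_sum_right)
 also have "\<dots> = (\<Sum>ks\<in>compositions ?n. \<Sum>\<sigma>\<in>half_Sh ks. smult W
   ((-1) ^ ((\<Sum>r=1..length ks-1. (length ks - r) * ks ! (r - 1)) + length ks * (length ks - 1) div 2) *
    (-1) powi (\<Sum>r=2..length ks. (int (ks ! (r - 1)) - 1) * sum_list (slice ds \<sigma> 1 (psum ks (r - 1)))) *
    koszul ds \<sigma> * of_int (sign \<sigma>))
   (m (map (\<lambda>r. \<phi> (?B ks \<sigma> r)) [1..<length ks+1])))"
  by (rule sum.cong[OF refl], rule sum.cong[OF refl], rule sym, rule conjunct1[OF facts])
 finally show ?thesis ..
qed

subsection \<open>The coalgebra correspondence\<close>

text \<open>The two sums differ from the composites by the same invertible sign, so the equation says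
 $\pi F D = \pi E F$ on words; \<open>coderivation_commute\<close> removes the $\pi$.\<close>

lemma dg_morphism_iff_leibniz:
 fixes V :: "('k::field, 'v::ab_group_add) graded_space" and W :: "('k, 'w::ab_group_add) graded_space"
 assumes V: "graded_vector_space V" and W: "graded_vector_space W"
  and D: "encoding_codifferential V l D" and E: "encoding_codifferential W m E"
  and P: "cofree_pair (susp V) (susp W)" and F: "cofree_pair.coalgebra_map (susp V) (susp W) F"
  and gF: "graded_map (tensor_module (susp V)) (tensor_module (susp W)) 0 F"
  and \<phi>: "\<phi> = desusp_corestrictions V W F"
 shows "\<phi> \<in> leibniz_inf_morphisms V l W m \<longleftrightarrow> (\<forall>x\<in>elems (tensor_module (susp V)). F (D x) = E (F x))"
proof -
 interpret P: cofree_pair "susp V" "susp W" by (rule P)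
 have vV: "vecsp V" and vW: "vecsp W" using V W graded_vs by auto
 interpret W: vector_space "smult W" by (rule vW)
 have dg: "dg_zinbiel_coalgebra P.S.T P.S.\<Delta> D" "dg_zinbiel_coalgebra P.R.T P.R.\<Delta> E"
  and l: "\<And>vs. vs \<in> words V ==> l vs = desusp_corestrictions V V D vs"
  and m: "\<And>ws. ws \<in> words W ==> m ws = desusp_corestrictions W W E ws"
  using D E by (auto simp: encoding_codifferential_def)
 have cD: "P.S.coderivation D" and cE: "P.R.coderivation E"
  using dg P.S.dg_coderivation P.R.dg_coderivation by blast+
 have gD: "graded_map P.S.T P.S.T (-1) D" using dg(1) by (simp add: dg_zinbiel_coalgebra_def)
 have lF: "linear_map P.S.T P.R.T F" and lD: "linear_map P.S.T P.S.T D" and lE: "linear_map P.R.T P.R.T E"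
  using P.coalgebra_map_lm[OF F] P.S.coderivation_lm[OF cD] P.R.coderivation_lm[OF cE] by auto
 have \<phi>h: "\<phi> vs = smult W (susp_sign ds) (P.R.\<pi> (F (pure (susp V) vs)))" if "homogeneous V ds vs" for ds vs
  unfolding \<phi> by (rule desusp_corestrictions_homogeneous[OF V vW lF that])
 have lf: "linear_map P.S.T W (\<lambda>x. P.R.\<pi> (F x))" using lm_comp[OF lF P.R.lm_\<pi>] by simp
 have gm: "graded_multilinear V W (\<lambda>i. int i - 1) \<phi>"
  using graded_desusp_corestrictions[OF V W gF] unfolding \<phi> by simp
 have ext: "\<phi> \<in> extensional (words V)" unfolding \<phi> desusp_corestrictions_def by simp
 have eq: "\<phi> \<in> leibniz_inf_morphisms V l W m \<longleftrightarrow>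
   (\<forall>ds vs. homogeneous V ds vs \<longrightarrow>
    smult W (susp_sign ds) (P.R.\<pi> (E (F (pure (susp V) vs)))) = smult W (susp_sign ds) (P.R.\<pi> (F (D (pure (susp V) vs)))))"
  unfolding leibniz_inf_morphisms_def mem_Collect_eq Let_def compositions_def[symmetric]
  using ext gm
  by (simp only: simp_thms block_sum[OF V W P F gF lE m fun_cong[OF \<phi>]]
    insertion_sum[OF V W P.S.cofree_zinbiel_axioms cD gD l lf \<phi>h] cong: imp_cong)
 also have "\<dots> \<longleftrightarrow> (\<forall>ds vs. homogeneous V ds vs \<longrightarrow> P.R.\<pi> (F (D (pure (susp V) vs))) = P.R.\<pi> (E (F (pure (susp V) vs))))"
  by (auto simp: W.scale_left_imp_eq W.scale_cancel_left)
 also have "\<dots> \<longleftrightarrow> (\<forall>x\<in>elems P.S.T. P.R.\<pi> (F (D x)) = P.R.\<pi> (E (F x)))"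
 proof (intro iffI ballI allI impI)
  fix x assume "\<forall>ds vs. homogeneous V ds vs \<longrightarrow> P.R.\<pi> (F (D (pure (susp V) vs))) = P.R.\<pi> (E (F (pure (susp V) vs)))"
   and x: "x \<in> elems P.S.T"
  then have w: "P.R.\<pi> (F (D (pure (susp V) vs))) = P.R.\<pi> (E (F (pure (susp V) vs)))" if "homogeneous V ds vs" for ds vs
   using that by blast
  show "P.R.\<pi> (F (D x)) = P.R.\<pi> (E (F x))"
  proof (rule tmod_eq[OF P.S.vU lm_comp[OF lm_comp[OF lD lF] P.R.lm_\<pi>] lm_comp[OF lm_comp[OF lF lE] P.R.lm_\<pi>] _ x])
   fix es vs assume "homogeneous (susp V) es vs"
   moreover have "es = map (\<lambda>d. d + 1) (map (\<lambda>d. d - 1) es)" by (simp add: map_idI)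
   ultimately have "homogeneous V (map (\<lambda>d. d - 1) es) vs" using homogeneous_susp[of V "map (\<lambda>d. d - 1) es" vs] by simp
   then show "P.R.\<pi> (F (D (pure (susp V) vs))) = P.R.\<pi> (E (F (pure (susp V) vs)))" by (rule w)
  qed
 next
  fix ds vs assume *: "\<forall>x\<in>elems P.S.T. P.R.\<pi> (F (D x)) = P.R.\<pi> (E (F x))" and h: "homogeneous V ds vs"
  have "pure (susp V) vs \<in> elems P.S.T" using pure_in[of "susp V" vs] homogeneous_words[OF vV h] vV by simp
  then show "P.R.\<pi> (F (D (pure (susp V) vs))) = P.R.\<pi> (E (F (pure (susp V) vs)))" using * by blast
 qed
 also have "\<dots> \<longleftrightarrow> (\<forall>x\<in>elems P.S.T. F (D x) = E (F x))"
  using P.coderivation_commute[OF F graded_map_parity(2)[OF P.S.gT P.R.gT gF] cD cE] by (metis (no_types, lifting))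
 finally show ?thesis .
qed

text \<open>Injectivity is \<open>coalgebra_map_unique\<close>.  For surjectivity the components of a morphism, multiplied by
 the sign of $s^{\otimes i}$, assemble to a linear map on words, whose lift is the coalgebra morphism.\<close>

lemma coalgebra_correspondence:
 fixes V :: "('k::field, 'v::ab_group_add) graded_space" and W :: "('k, 'w::ab_group_add) graded_space"
 assumes V: "graded_vector_space V" and W: "graded_vector_space W"
  and D: "encoding_codifferential V l D" and E: "encoding_codifferential W m E"
 shows "bij_betw (desusp_corestrictions V W)
     (dg_coalgebra_morphisms
      (tensor_module (susp V)) (zin_coproduct (susp V)) D
      (tensor_module (susp W)) (zin_coproduct (susp W)) E)
     (leibniz_inf_morphisms V l W m)"
proof -
 have vV: "vecsp V" and vW: "vecsp W" using V W graded_vs by auto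
 have P: "cofree_pair (susp V) (susp W)"
  using D E graded_susp[OF V] graded_susp[OF W]
  by (simp add: cofree_pair_def cofree_zinbiel_def encoding_codifferential_def dg_zinbiel_coalgebra_def)
 interpret P: cofree_pair "susp V" "susp W" by (rule P)
 interpret W: vector_space "smult W" by (rule vW)
 let ?M = "dg_coalgebra_morphisms P.S.T P.S.\<Delta> D P.R.T P.R.\<Delta> E"
 have M: "F \<in> ?M \<longleftrightarrow> F \<in> extensional (elems P.S.T) \<and> graded_map P.S.T P.R.T 0 F \<and> P.coalgebra_map F \<and>
   (\<forall>x\<in>elems P.S.T. F (D x) = E (F x))" for F
  unfolding dg_coalgebra_morphisms_def using P.coalgebra_map_iff[of F] by (auto simp: graded_map_def)
 have into: "desusp_corestrictions V W F \<in> leibniz_inf_morphisms V l W m" if "F \<in> ?M" for F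
  using that dg_morphism_iff_leibniz[OF V W D E P _ _ refl] unfolding M by blast
 have inj: "F = G" if F: "F \<in> ?M" and G: "G \<in> ?M" and eq: "desusp_corestrictions V W F = desusp_corestrictions V W G" for F G
 proof (rule extensionalityI)
  show "F \<in> extensional (elems P.S.T)" "G \<in> extensional (elems P.S.T)" using F G M by auto
  have cF: "P.coalgebra_map F" and cG: "P.coalgebra_map G" using F G M by auto
  have lF: "linear_map P.S.T P.R.T F" and lG: "linear_map P.S.T P.R.T G"
   using P.coalgebra_map_lm[OF cF] P.coalgebra_map_lm[OF cG] by auto
  have "P.R.\<pi> (F x) = P.R.\<pi> (G x)" if x: "x \<in> elems P.S.T" for x
  proof (rule tmod_eq[OF P.S.vU lm_comp[OF lF P.R.lm_\<pi>] lm_comp[OF lG P.R.lm_\<pi>] _ x])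
   fix es vs assume "homogeneous (susp V) es vs"
   moreover have "es = map (\<lambda>d. d + 1) (map (\<lambda>d. d - 1) es)" by (simp add: map_idI)
   ultimately have h: "homogeneous V (map (\<lambda>d. d - 1) es) vs" using homogeneous_susp[of V "map (\<lambda>d. d - 1) es" vs] by simp
   from eq have "smult W (susp_sign (map (\<lambda>d. d - 1) es)) (P.R.\<pi> (F (pure (susp V) vs))) =
     smult W (susp_sign (map (\<lambda>d. d - 1) es)) (P.R.\<pi> (G (pure (susp V) vs)))"
    using desusp_corestrictions_homogeneous[OF V vW lF h] desusp_corestrictions_homogeneous[OF V vW lG h] by simp
   then show "P.R.\<pi> (F (pure (susp V) vs)) = P.R.\<pi> (G (pure (susp V) vs))" by simp
  qed
  then show "F x = G x" if "x \<in> elems P.S.T" for x using P.coalgebra_map_unique[OF cF cG _ that] by blast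
 qed
 have onto: "\<exists>F\<in>?M. \<phi> = desusp_corestrictions V W F" if \<phi>: "\<phi> \<in> leibniz_inf_morphisms V l W m" for \<phi>
 proof -
  have ext: "\<phi> \<in> extensional (words V)" and gm: "graded_multilinear V W (\<lambda>i. int i - 1) \<phi>"
   using \<phi> by (auto simp: leibniz_inf_morphisms_def)
  have ml: "multilinear V W \<phi>" using gm by (simp add: graded_multilinear_def)
  let ?h = "twist V W susp_sign \<phi>"
  have "multilinear (susp V) W ?h" using ml_twist[OF V vW ml] by simp
  then obtain g where g: "linear_map P.S.T W g" "\<And>vs. vs \<in> words (susp V) ==> g (pure (susp V) vs) = ?h vs"
   using lift_multilinear[OF P.S.vU vW] by blast
  have gp: "g (pure (susp V) vs) = smult W (susp_sign ds) (\<phi> vs)" if h: "homogeneous V ds vs" for ds vs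
  proof -
   have "g (pure (susp V) vs) = ?h vs" using g(2) homogeneous_words[OF vV h] by simp
   then show ?thesis using twist_homogeneous[OF V vW ml h, of susp_sign] by (simp add: susp_sign_parity)
  qed
  have gg: "graded_map P.S.T (susp W) 0 g"
  proof (rule graded_map_from_words[OF P.S.graded P.R.graded])
   show "linear_map P.S.T (susp W) g" using g(1) by simp
   fix es vs assume he: "homogeneous (susp V) es vs"
   have es: "es = map (\<lambda>d. d + 1) (map (\<lambda>d. d - 1) es)" by (simp add: map_idI)
   with he have h: "homogeneous V (map (\<lambda>d. d - 1) es) vs" using homogeneous_susp[of V "map (\<lambda>d. d - 1) es" vs] by simp
   have "sum_list es = sum_list (map (\<lambda>d. d - 1) es) + int (length vs)"
    using homogeneous_length[OF h] by (subst es) (simp only: sum_list_addf sum_list_triv length_map, simp)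
   then have "\<phi> vs \<in> hcomp W (sum_list es - 1)"
    using gm h unfolding graded_multilinear_def by (metis add_diff_eq)
   then show "g (pure (susp V) vs) \<in> hcomp (susp W) (sum_list es + 0)"
    unfolding gp[OF h] using hcomp_smult[OF W] by simp
  qed
  let ?F = "\<lambda>x\<in>elems P.S.T. cofree_lift (susp V) (susp W) g x"
  have lin: "linear_map P.S.T P.R.T ?F"
   by (subst lm_cong[OF vs_simps(2), where g = "cofree_lift (susp V) (susp W) g"]) (use P.lm_lift[OF gg] in auto)
  have gr: "graded_map P.S.T P.R.T 0 ?F"
   using lin P.graded_lift[OF gg] hcomp_elems[OF vs_simps(2)] unfolding graded_map_def by (auto simp: restrict_def)
  have co: "P.coalgebra_map ?F"
   unfolding P.coalgebra_map_def
  proof (intro conjI ballI allI impI)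
   show "linear_map P.S.T P.R.T ?F" by (rule lin)
   fix x \<beta> assume x: "x \<in> elems P.S.T" and \<beta>: "bilinear_form P.R.T P.R.T \<beta>"
   show "P.R.\<Delta> (?F x) \<beta> = P.S.\<Delta> x (\<lambda>a b. \<beta> (?F a) (?F b))"
   proof -
    have "P.R.\<Delta> (?F x) \<beta> = P.S.\<Delta> x (\<lambda>a b. \<beta> (P.lift g a) (P.lift g b))"
     using P.coalgebra_mapD[OF P.coalgebra_map_lift[OF gg] x \<beta>] x by simp
    also have "\<dots> = P.S.\<Delta> x (\<lambda>a b. \<beta> (?F a) (?F b))"
     by (rule tens_cong[OF vs_simps(2,2) P.S.\<Delta>_in[OF x]]) simp
    finally show ?thesis .
   qed
  qed
  have dc: "desusp_corestrictions V W ?F = \<phi>"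
  proof (rule extensionalityI[OF _ ext])
   show "desusp_corestrictions V W ?F \<in> extensional (words V)" by (simp add: desusp_corestrictions_def)
   fix vs assume w: "vs \<in> words V"
   show "desusp_corestrictions V W ?F vs = \<phi> vs"
   proof (rule ml_eq[OF vV multilinear_desusp_corestrictions[OF V vW lin] ml _ w])
    fix ds vs assume h: "homogeneous V ds vs"
    have p: "pure (susp V) vs \<in> elems P.S.T" using pure_in[of "susp V" vs] homogeneous_words[OF vV h] vV by simp
    show "desusp_corestrictions V W ?F vs = \<phi> vs"
     unfolding desusp_corestrictions_homogeneous[OF V vW lin h] using p
     by (simp add: P.proj1_lift[OF gg p] gp[OF h] susp_sign_square)
   qed
  qed
  have "?F \<in> ?M"
   unfolding M using gr co dg_morphism_iff_leibniz[OF V W D E P co gr dc[symmetric]] \<phi> by auto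
  then show ?thesis using dc by metis
 qed
 show ?thesis unfolding bij_betw_def
  by (intro conjI inj_onI equalityI subsetI) (use inj into onto in blast)+
qed

section \<open>Duality in finite dimensions\<close>

subsection \<open>Graded spaces in duality\<close>

lemma lform_iff: "lform A f \<longleftrightarrow> (\<forall>x\<in>elems A. \<forall>y\<in>elems A. f (x + y) = f x + f y) \<and> (\<forall>c. \<forall>x\<in>elems A. f (smult A c x) = c * f x)"
 by (simp add: linear_map_def)

lemma bf_times: "lform A f ==> lform B g ==> bilinear_form A B (\<lambda>a b. f a * g b)"
 unfolding bilinear_form_def lform_iff by (simp add: algebra_simps)

text \<open>A pairing with dual homogeneous bases indexed by a possibly infinite set.  The roles of the two spaces
 are interchangeable (\<open>swapped\<close>), so everything is proved for one of them only.\<close>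

locale dual_bases =
 fixes B :: "('k::field, 'b::ab_group_add) graded_space" and C :: "('k, 'c::ab_group_add) graded_space"
  and p :: "'b => 'c => 'k" and J :: "'j set" and e' :: "'j => 'b" and e :: "'j => 'c" and dg :: "'j => int"
 assumes gB: "graded_vector_space B" and gC: "graded_vector_space C"
  and left: "\<And>x. x \<in> elems C ==> lform B (\<lambda>\<omega>. p \<omega> x)" and right: "\<And>\<omega>. \<omega> \<in> elems B ==> lform C (p \<omega>)"
  and e': "\<And>j. j \<in> J ==> e' j \<in> hcomp B (- dg j)" and e: "\<And>j. j \<in> J ==> e j \<in> hcomp C (dg j)"
  and dual: "\<And>i j. i \<in> J ==> j \<in> J ==> p (e' i) (e j) = (if i = j then 1 else 0)"
  and span_B: "elems B \<subseteq> module.span (smult B) (e' ` J)" and span_C: "elems C \<subseteq> module.span (smult C) (e ` J)"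
  and orth: "\<And>\<omega> x m n. \<omega> \<in> hcomp B m ==> x \<in> hcomp C n ==> m \<noteq> - n ==> p \<omega> x = 0"
begin

lemma swapped: "dual_bases C B (\<lambda>x \<omega>. p \<omega> x) J e e' (\<lambda>j. - dg j)"
proof
 show "p \<omega> x = 0" if "x \<in> hcomp C m" "\<omega> \<in> hcomp B n" "m \<noteq> - n" for x \<omega> m n
  by (rule orth[OF that(2,1)]) (use that(3) in auto)
 show "p (e' j) (e i) = (if i = j then 1 else 0)" if "i \<in> J" "j \<in> J" for i j
  using dual[OF that(2,1)] by auto
qed (use gB gC left right e e' span_B span_C in auto)

lemma vB: "vecsp B" and vC: "vecsp C"
 using gB gC graded_vs by auto

lemma e_in: "j \<in> J ==> e j \<in> elems C" "j \<in> J ==> e' j \<in> elems B"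
 using hcomp_elems[OF vC e] hcomp_elems[OF vB e'] by auto

text \<open>Stated for all large enough finite index sets, so that expansions of several elements can be taken
 over a common one.\<close>

lemma expand:
 assumes "x \<in> elems C"
 obtains S where "finite S" "S \<subseteq> J"
  "\<And>S'. finite S' ==> S \<subseteq> S' ==> S' \<subseteq> J ==> (\<Sum>j\<in>S'. smult C (p (e' j) x) (e j)) = x"
proof -
 interpret C: vector_space "smult C" by (rule vC)
 have "x \<in> C.span (e ` J)" using span_C assms by auto
 then have "x \<in> elems C \<and> (\<exists>S. finite S \<and> S \<subseteq> J \<and>
   (\<forall>S'. finite S' \<and> S \<subseteq> S' \<and> S' \<subseteq> J \<longrightarrow> (\<Sum>j\<in>S'. smult C (p (e' j) x) (e j)) = x))"
 proof (induct rule: C.span_induct_alt)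
  case base
  have "(\<Sum>j\<in>S'. smult C (p (e' j) 0) (e j)) = 0" if "S' \<subseteq> J" for S'
   using that lm_0[OF vC right[OF e_in(2)]] by (intro sum.neutral) auto
  then show ?case using elems_0[OF vC] by (intro conjI exI[of _ "{}"]) auto
 next
  case (step c y x)
  then obtain i where i: "i \<in> J" "y = e i" by auto
  have x: "x \<in> elems C" using step(2) by (rule conjunct1)
  from conjunct2[OF step(2)] obtain S where S: "finite S" "S \<subseteq> J"
   and eq: "\<forall>S'. finite S' \<and> S \<subseteq> S' \<and> S' \<subseteq> J \<longrightarrow> (\<Sum>j\<in>S'. smult C (p (e' j) x) (e j)) = x" by (elim exE conjE)
  have "(\<Sum>j\<in>S'. smult C (p (e' j) (smult C c y + x)) (e j)) = smult C c y + x"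
   if S': "finite S'" "insert i S \<subseteq> S'" "S' \<subseteq> J" for S'
  proof -
   have "(\<Sum>j\<in>S'. smult C (p (e' j) (smult C c y + x)) (e j)) =
     (\<Sum>j\<in>S'. (if j = i then smult C c (e i) else 0) + smult C (p (e' j) x) (e j))"
   proof (rule sum.cong[OF refl])
    fix j assume "j \<in> S'"
    then have j: "j \<in> J" using S' by auto
    have "p (e' j) (smult C c y + x) = c * p (e' j) (e i) + p (e' j) x"
     using lm_add[OF right[OF e_in(2)[OF j]] elems_smult[OF vC e_in(1)[OF i(1)], of c] x]
      lm_smult[OF right[OF e_in(2)[OF j]] e_in(1)[OF i(1)], of c] i(2) by (simp add: ground_def)
    then show "smult C (p (e' j) (smult C c y + x)) (e j) =
      (if j = i then smult C c (e i) else 0) + smult C (p (e' j) x) (e j)"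
     using dual[OF j i(1)] by (auto simp: C.scale_left_distrib)
   qed
   also have "\<dots> = smult C c (e i) + (\<Sum>j\<in>S'. smult C (p (e' j) x) (e j))"
    using S' by (simp add: sum.distrib sum.delta)
   finally show ?thesis using eq S' i(2) by simp
  qed
  moreover have "smult C c y + x \<in> elems C" using elems_add[OF vC elems_smult[OF vC e_in(1)[OF i(1)]] x] i(2) by simp
  ultimately show ?case using S i by (intro conjI exI[of _ "insert i S"]) auto
 qed
 from conjunct2[OF this] obtain S where "finite S" "S \<subseteq> J"
  "\<forall>S'. finite S' \<and> S \<subseteq> S' \<and> S' \<subseteq> J \<longrightarrow> (\<Sum>j\<in>S'. smult C (p (e' j) x) (e j)) = x" by (elim exE conjE)
 then show thesis by (intro that[of S]) simp_all
qed

lemma nondegenerate: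
 assumes x: "x \<in> elems C" and y: "y \<in> elems C" and eq: "\<And>\<omega>. \<omega> \<in> elems B ==> p \<omega> x = p \<omega> y"
 shows "x = y"
proof -
 obtain S where S: "finite S" "S \<subseteq> J"
  "\<And>S'. finite S' ==> S \<subseteq> S' ==> S' \<subseteq> J ==> (\<Sum>j\<in>S'. smult C (p (e' j) x) (e j)) = x" using expand[OF x] by blast
 obtain R where R: "finite R" "R \<subseteq> J"
  "\<And>S'. finite S' ==> R \<subseteq> S' ==> S' \<subseteq> J ==> (\<Sum>j\<in>S'. smult C (p (e' j) y) (e j)) = y" using expand[OF y] by blast
 have "x = (\<Sum>j\<in>S \<union> R. smult C (p (e' j) x) (e j))" by (rule S(3)[symmetric]) (use S(1,2) R(1,2) in auto)
 also have "\<dots> = (\<Sum>j\<in>S \<union> R. smult C (p (e' j) y) (e j))"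
  using S(2) R(2) eq[OF e_in(2)] by (intro sum.cong refl) auto
 also have "\<dots> = y" by (rule R(3)) (use S(1,2) R(1,2) in auto)
 finally show ?thesis .
qed

text \<open>Finite support is the only obstruction: the space has finite sums of basis vectors only.\<close>

lemma represent:
 assumes L: "lform B L" and fin: "finite {j \<in> J. L (e' j) \<noteq> 0}"
 shows "\<exists>x. x \<in> elems C \<and> (\<forall>\<omega>\<in>elems B. p \<omega> x = L \<omega>)"
proof (intro exI conjI ballI)
 let ?S = "{j \<in> J. L (e' j) \<noteq> 0}" and ?x = "\<Sum>j | j \<in> J \<and> L (e' j) \<noteq> 0. smult C (L (e' j)) (e j)"
 show x: "?x \<in> elems C" by (intro elems_sum[OF vC] elems_smult[OF vC] e_in) auto
 show "p \<omega> ?x = L \<omega>" if \<omega>: "\<omega> \<in> elems B" for \<omega>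
 proof (rule lm_eq_span[OF vB left[OF x] L _ span_B _ \<omega>])
  show "e' ` J \<subseteq> elems B" using e_in by auto
  fix \<omega> assume "\<omega> \<in> e' ` J"
  then obtain i where i: "i \<in> J" "\<omega> = e' i" by auto
  have "p (e' i) ?x = (\<Sum>j\<in>?S. p (e' i) (smult C (L (e' j)) (e j)))"
   by (rule lm_sum[OF vC right[OF e_in(2)[OF i(1)]] elems_smult[OF vC e_in(1)]]) auto
  also have "\<dots> = (\<Sum>j\<in>?S. if j = i then L (e' i) else 0)"
   using lm_smult[OF right[OF e_in(2)[OF i(1)]] e_in(1)] dual[OF i(1)] by (intro sum.cong) (auto simp: ground_def)
  also have "\<dots> = L (e' i)" using fin i by simp
  finally show "p \<omega> ?x = L \<omega>" using i by simp
 qed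
qed

lemma hcomp_by_pairing:
 assumes x: "x \<in> elems C" and "\<And>j. j \<in> J ==> dg j \<noteq> n ==> p (e' j) x = 0"
 shows "x \<in> hcomp C n"
proof -
 interpret C: vector_space "smult C" by (rule vC)
 obtain S where S: "finite S" "S \<subseteq> J" "(\<Sum>j\<in>S. smult C (p (e' j) x) (e j)) = x"
  using expand[OF x] by (metis subset_refl)
 have "smult C (p (e' j) x) (e j) \<in> hcomp C n" if "j \<in> S" for j
  using that S(2) e[of j] assms(2)[of j] hcomp_0[OF gC] hcomp_smult[OF gC] by (cases "dg j = n") auto
 then show ?thesis by (subst S(3)[symmetric]) (rule hcomp_sum[OF gC])
qed

lemma tensor_expand:
 assumes "t \<in> elems (tensor_space C C)"
 obtains S where "finite S" "S \<subseteq> J"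
  "\<forall>S' \<beta>. finite S' \<and> S \<subseteq> S' \<and> S' \<subseteq> J \<and> bilinear_form C C \<beta> \<longrightarrow>
   t \<beta> = (\<Sum>i\<in>S'. \<Sum>j\<in>S'. \<beta> (e i) (e j) * t (\<lambda>a b. p (e' i) a * p (e' j) b))"
proof -
 have bf: "bilinear_form C C (\<lambda>a b. p (e' i) a * p (e' j) b)" if "i \<in> J" "j \<in> J" for i j
  by (rule bf_times[OF right[OF e_in(2)[OF that(1)]] right[OF e_in(2)[OF that(2)]]])
 from vC vC assms have "\<exists>S. finite S \<and> S \<subseteq> J \<and> (\<forall>S' \<beta>. finite S' \<and> S \<subseteq> S' \<and> S' \<subseteq> J \<and> bilinear_form C C \<beta> \<longrightarrow>
   t \<beta> = (\<Sum>i\<in>S'. \<Sum>j\<in>S'. \<beta> (e i) (e j) * t (\<lambda>a b. p (e' i) a * p (e' j) b)))"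
 proof (induct rule: tens_induct)
  case zero then show ?case by (intro exI[of _ "{}"]) simp
 next
  case (step c a b _ _ t)
  have a: "a \<in> elems C" and b: "b \<in> elems C" using step hcomp_elems[OF vC] by auto
  obtain R where R: "finite R" "R \<subseteq> J"
   "\<And>S'. finite S' ==> R \<subseteq> S' ==> S' \<subseteq> J ==> (\<Sum>j\<in>S'. smult C (p (e' j) a) (e j)) = a" using expand[OF a] by blast
  obtain Q where Q: "finite Q" "Q \<subseteq> J"
   "\<And>S'. finite S' ==> Q \<subseteq> S' ==> S' \<subseteq> J ==> (\<Sum>j\<in>S'. smult C (p (e' j) b) (e j)) = b" using expand[OF b] by blast
  from step(4) obtain S where S: "finite S" "S \<subseteq> J"
   "\<forall>S' \<beta>. finite S' \<and> S \<subseteq> S' \<and> S' \<subseteq> J \<and> bilinear_form C C \<beta> \<longrightarrow>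
    t \<beta> = (\<Sum>i\<in>S'. \<Sum>j\<in>S'. \<beta> (e i) (e j) * t (\<lambda>a b. p (e' i) a * p (e' j) b))" by (elim exE conjE)
  have main: "c * tensor C C a b \<beta> + t \<beta> =
    (\<Sum>i\<in>S'. \<Sum>j\<in>S'. \<beta> (e i) (e j) * (c * tensor C C a b (\<lambda>a b. p (e' i) a * p (e' j) b) + t (\<lambda>a b. p (e' i) a * p (e' j) b)))"
   if S': "finite S'" "S \<union> R \<union> Q \<subseteq> S'" "S' \<subseteq> J" and \<beta>: "bilinear_form C C \<beta>" for S' \<beta>
  proof -
   have eS: "e j \<in> elems C" if "j \<in> S'" for j using that S' e_in by auto
   have "\<beta> a b = \<beta> (\<Sum>i\<in>S'. smult C (p (e' i) a) (e i)) b" using R(3)[of S'] S' by auto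
   also have "\<dots> = (\<Sum>i\<in>S'. \<beta> (smult C (p (e' i) a) (e i)) b)"
    by (rule lm_sum[OF vC bf_left[OF \<beta> b] elems_smult[OF vC eS]])
   also have "\<dots> = (\<Sum>i\<in>S'. p (e' i) a * \<beta> (e i) b)"
    using lm_smult[OF bf_left[OF \<beta> b] eS] by (intro sum.cong refl) (simp add: ground_def)
   also have "\<dots> = (\<Sum>i\<in>S'. p (e' i) a * (\<Sum>j\<in>S'. p (e' j) b * \<beta> (e i) (e j)))"
   proof (intro sum.cong refl arg_cong2[of _ _ _ _ "(*)"])
    fix i assume i: "i \<in> S'"
    have "\<beta> (e i) b = \<beta> (e i) (\<Sum>j\<in>S'. smult C (p (e' j) b) (e j))" using Q(3)[of S'] S' by auto
    also have "\<dots> = (\<Sum>j\<in>S'. \<beta> (e i) (smult C (p (e' j) b) (e j)))"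
     by (rule lm_sum[OF vC bf_right[OF \<beta> eS[OF i]] elems_smult[OF vC eS]])
    also have "\<dots> = (\<Sum>j\<in>S'. p (e' j) b * \<beta> (e i) (e j))"
     using lm_smult[OF bf_right[OF \<beta> eS[OF i]] eS] by (intro sum.cong refl) (simp add: ground_def)
    finally show "\<beta> (e i) b = (\<Sum>j\<in>S'. p (e' j) b * \<beta> (e i) (e j))" .
   qed
   also have "\<dots> = (\<Sum>i\<in>S'. \<Sum>j\<in>S'. \<beta> (e i) (e j) * tensor C C a b (\<lambda>a b. p (e' i) a * p (e' j) b))"
    unfolding sum_distrib_left by (intro sum.cong refl) (use S' in \<open>auto simp: tensor_eval[OF bf] subset_iff\<close>)
   finally have ab: "\<beta> a b = (\<Sum>i\<in>S'. \<Sum>j\<in>S'. \<beta> (e i) (e j) * tensor C C a b (\<lambda>a b. p (e' i) a * p (e' j) b))" .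
   have "t \<beta> = (\<Sum>i\<in>S'. \<Sum>j\<in>S'. \<beta> (e i) (e j) * t (\<lambda>a b. p (e' i) a * p (e' j) b))"
    by (rule S(3)[rule_format]) (use S' \<beta> in auto)
   then show ?thesis
    by (simp add: tensor_eval[OF \<beta>] distrib_left sum.distrib mult.left_commute[of _ c] ab flip: sum_distrib_left)
  qed
  show ?case
  proof (intro exI[of _ "S \<union> R \<union> Q"] conjI allI impI)
   show "finite (S \<union> R \<union> Q)" "S \<union> R \<union> Q \<subseteq> J" using R(1,2) S(1,2) Q(1,2) by simp_all
  qed (elim conjE, rule main)
 qed
 then obtain S where "finite S" "S \<subseteq> J"
  "\<forall>S' \<beta>. finite S' \<and> S \<subseteq> S' \<and> S' \<subseteq> J \<and> bilinear_form C C \<beta> \<longrightarrow>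
    t \<beta> = (\<Sum>i\<in>S'. \<Sum>j\<in>S'. \<beta> (e i) (e j) * t (\<lambda>a b. p (e' i) a * p (e' j) b))" by (elim exE conjE)
 then show thesis by (rule that)
qed

lemma tensor_nondegenerate:
 assumes t: "t \<in> elems (tensor_space C C)" and t': "t' \<in> elems (tensor_space C C)"
  and eq: "\<And>\<omega> \<omega>'. \<omega> \<in> elems B ==> \<omega>' \<in> elems B ==> t (\<lambda>a b. p \<omega> a * p \<omega>' b) = t' (\<lambda>a b. p \<omega> a * p \<omega>' b)"
 shows "t = t'"
proof (rule tens_eqI[OF vC vC t t'])
 fix \<beta> assume \<beta>: "bilinear_form C C \<beta>"
 obtain S where S: "finite S" "S \<subseteq> J" "\<forall>S' \<beta>. finite S' \<and> S \<subseteq> S' \<and> S' \<subseteq> J \<and> bilinear_form C C \<beta> \<longrightarrow>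
   t \<beta> = (\<Sum>i\<in>S'. \<Sum>j\<in>S'. \<beta> (e i) (e j) * t (\<lambda>a b. p (e' i) a * p (e' j) b))" by (rule tensor_expand[OF t]) (rule that; assumption)
 obtain R where R: "finite R" "R \<subseteq> J" "\<forall>S' \<beta>. finite S' \<and> R \<subseteq> S' \<and> S' \<subseteq> J \<and> bilinear_form C C \<beta> \<longrightarrow>
   t' \<beta> = (\<Sum>i\<in>S'. \<Sum>j\<in>S'. \<beta> (e i) (e j) * t' (\<lambda>a b. p (e' i) a * p (e' j) b))" by (rule tensor_expand[OF t']) (rule that; assumption)
 have "t \<beta> = (\<Sum>i\<in>S \<union> R. \<Sum>j\<in>S \<union> R. \<beta> (e i) (e j) * t (\<lambda>a b. p (e' i) a * p (e' j) b))"
  by (rule S(3)[rule_format]) (use S(1,2) R(1,2) \<beta> in auto)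
 also have "\<dots> = (\<Sum>i\<in>S \<union> R. \<Sum>j\<in>S \<union> R. \<beta> (e i) (e j) * t' (\<lambda>a b. p (e' i) a * p (e' j) b))"
  using S(2) R(2) by (intro sum.cong refl arg_cong2[of _ _ _ _ "(*)"] eq e_in) auto
 also have "\<dots> = t' \<beta>" by (rule R(3)[rule_format, symmetric]) (use S(1,2) R(1,2) \<beta> in auto)
 finally show "t \<beta> = t' \<beta>" .
qed

end

text \<open>Gradedness of the adjoint comes from orthogonality of components whose degrees do not add up to 0.\<close>

lemma adjoint:
 assumes S: "dual_bases B C p J e' e dg" and R: "dual_bases B' C' p' J' u' u dg'"
  and f: "graded_map B' B 0 f" and fin: "\<And>x. x \<in> elems C ==> finite {j \<in> J'. p (f (u' j)) x \<noteq> 0}"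
 shows "\<exists>F. graded_map C C' 0 F \<and> (\<forall>x\<in>elems C. \<forall>\<omega>\<in>elems B'. p' \<omega> (F x) = p (f \<omega>) x)"
proof -
 interpret S: dual_bases B C p J e' e dg by (rule S)
 interpret R: dual_bases B' C' p' J' u' u dg' by (rule R)
 have lf: "linear_map B' B f" using f by (simp add: graded_map_def)
 have "\<exists>y. y \<in> elems C' \<and> (\<forall>\<omega>\<in>elems B'. p' \<omega> y = p (f \<omega>) x)" if x: "x \<in> elems C" for x
  by (rule R.represent[OF lm_comp[OF lf S.left[OF x]] fin[OF x]])
 then have "\<forall>x\<in>elems C. \<exists>y. y \<in> elems C' \<and> (\<forall>\<omega>\<in>elems B'. p' \<omega> y = p (f \<omega>) x)" by (rule ballI)
 from bchoice[OF this] obtain F where F': "\<forall>x\<in>elems C. F x \<in> elems C' \<and> (\<forall>\<omega>\<in>elems B'. p' \<omega> (F x) = p (f \<omega>) x)" ..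
 then have F: "\<And>x. x \<in> elems C ==> F x \<in> elems C'"
  "\<And>x \<omega>. x \<in> elems C ==> \<omega> \<in> elems B' ==> p' \<omega> (F x) = p (f \<omega>) x" by simp_all
 have "graded_map C C' 0 F"
  unfolding graded_map_def
 proof (intro conjI allI ballI)
  show "linear_map C C' F"
   unfolding linear_map_def
  proof (intro conjI ballI allI)
   fix x y c assume x: "x \<in> elems C" and y: "y \<in> elems C"
   show "F x \<in> elems C'" by (rule F(1)[OF x])
   show "F (x + y) = F x + F y"
    by (rule R.nondegenerate)
     (use x y F in \<open>simp_all add: elems_add[OF S.vC] elems_add[OF R.vC] lm_add[OF R.right] lm_add[OF S.right] lm_in[OF lf]\<close>)
   show "F (smult C c x) = smult C' c (F x)"
    by (rule R.nondegenerate)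
     (use x F in \<open>simp_all add: elems_smult[OF S.vC] elems_smult[OF R.vC] lm_smult[OF R.right] lm_smult[OF S.right] lm_in[OF lf]\<close>)
  qed
  fix n x assume x: "x \<in> hcomp C n"
  have x': "x \<in> elems C" by (rule hcomp_elems[OF S.vC x])
  have "F x \<in> hcomp C' n"
  proof (rule R.hcomp_by_pairing[OF F(1)[OF x']])
   fix j assume j: "j \<in> J'" "dg' j \<noteq> n"
   have "f (u' j) \<in> hcomp B (- dg' j + 0)" using f R.e'[OF j(1)] by (simp only: graded_map_def)
   then show "p' (u' j) (F x) = 0"
    unfolding F(2)[OF x' R.e_in(2)[OF j(1)]] by (rule S.orth[OF _ x]) (use j in auto)
  qed
  then show "F x \<in> hcomp C' (n + 0)" by simp
 qed
 then show ?thesis by (intro exI[of _ F] conjI ballI F(2))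
qed

subsection \<open>The dual of a graded space\<close>

lemma graded_desusp: "graded_vector_space V ==> graded_vector_space (desusp V)"
 unfolding graded_vector_space_def
proof (intro conjI allI impI)
 assume V: "vecsp V \<and> (\<forall>n. module.subspace (smult V) (hcomp V n)) \<and>
  (\<forall>N x. finite N \<and> (\<forall>n\<in>N. x n \<in> hcomp V n) \<and> sum x N = 0 \<longrightarrow> (\<forall>n\<in>N. x n = 0))"
 then show "vecsp (desusp V)" "module.subspace (smult (desusp V)) (hcomp (desusp V) n)" for n by simp_all
 fix N x assume N: "finite N \<and> (\<forall>n\<in>N. x n \<in> hcomp (desusp V) n) \<and> sum x N = 0"
 have shifted: "(\<Sum>n\<in>(\<lambda>n. n + 1) ` N. x (n - 1)) = sum x N"
  by (subst sum.reindex) (auto simp: inj_on_def)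
 have direct: "\<forall>n\<in>N. x n = 0" if "finite N" "\<forall>n\<in>N. x n \<in> hcomp V n" "sum x N = 0" for N x
  using V that by blast
 have "\<forall>n\<in>(\<lambda>n. n + 1) ` N. x (n - 1) = 0"
  using direct[of "(\<lambda>n. n + 1) ` N" "\<lambda>n. x (n - 1)"] N shifted by auto
 then show "\<forall>n\<in>N. x n = 0" by auto
qed

lemma multilinear_desusp [simp]:
 "multilinear (desusp V) W h \<longleftrightarrow> multilinear V W h" "words (desusp V) = words V" "linear_map (desusp V) W f = linear_map V W f"
 by (simp_all add: multilinear_def linear_map_def words_def)

lemma graded_ground: "graded_vector_space (ground :: ('k::field, 'k) graded_space)"
proof -
 interpret vector_space "(*) :: 'k => 'k => 'k" by (rule vector_space_mult)
 have "(\<Sum>n\<in>N. x n) = (if 0 \<in> N then x 0 else 0)"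
  if "finite N" "\<forall>n\<in>N. x n \<in> (if n = 0 then UNIV else {0})" for N and x :: "int => 'k"
 proof -
  have "(\<Sum>n\<in>N. x n) = (\<Sum>n\<in>N. if n = 0 then x 0 else 0)" using that by (intro sum.cong) auto
  then show ?thesis using that by simp
 qed
 then have "x n = 0" if "finite N" "\<forall>n\<in>N. x n \<in> (if n = 0 then UNIV else {0})" "(\<Sum>n\<in>N. x n) = 0" "n \<in> N" for N n and x :: "int => 'k"
  using that by (cases "n = 0") auto
 moreover have "subspace (if n = 0 then UNIV else {0})" for n :: int by (simp add: subspace_single_0)
 ultimately show ?thesis unfolding graded_vector_space_def ground_def by (auto simp: vector_space_axioms)
qed

lemma elems_dual:
 assumes V: "vecsp V" and f: "f \<in> elems (dual V)"
 shows "lform V f" and "v \<notin> elems V ==> f v = 0"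
proof -
 have "lform V f \<and> (\<forall>v. v \<notin> elems V \<longrightarrow> f v = 0)"
  using vs_simps(4) f
 proof (induct rule: elems_induct)
  case zero then show ?case using lm_zeroI[OF V, of ground] by (simp add: zero_fun_def)
 next
  case (step c n h y)
  then have "lform V h" "\<forall>v. v \<notin> elems V \<longrightarrow> h v = 0" by (auto simp: dual_def)
  then show ?case using step by (auto simp: lform_iff dual_def algebra_simps)
 qed
 then show "lform V f" "v \<notin> elems V ==> f v = 0" by auto
qed

text \<open>A sum of functionals of different degrees that vanishes can be evaluated on one component of the
 space at a time, where only one summand survives.\<close>

lemma graded_dual:
 fixes V :: "('k::field, 'v::ab_group_add) graded_space"
 assumes V: "graded_vector_space V" shows "graded_vector_space (dual V)"
proof -
 have v: "vecsp V" by (rule graded_vs[OF V])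
 interpret vector_space "\<lambda>c (f :: 'v => 'k) v. c * f v" using vs_simps(4)[of V] by (simp add: dual_def)
 have sub: "subspace (hcomp (dual V) n)" for n
  unfolding subspace_def using lm_zeroI[OF v, of ground] by (auto simp: dual_def lform_iff algebra_simps)
 have "\<forall>n\<in>N. x n = 0" if N: "finite N" "\<forall>n\<in>N. x n \<in> hcomp (dual V) n" "(\<Sum>n\<in>N. x n) = 0" for N x
 proof
  fix n assume n: "n \<in> N"
  have l: "lform V (x n)" and out: "\<forall>v. v \<notin> elems V \<longrightarrow> x n v = 0" and z: "\<forall>p. p \<noteq> - n \<longrightarrow> (\<forall>v\<in>hcomp V p. x n v = 0)"
   using N(2) n by (auto simp: dual_def)
  have "x n v = 0" if h: "v \<in> hcomp V p" for v p
  proof (cases "p = - n")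
   case True
   have "0 = (\<Sum>m\<in>N. x m v)" using fun_cong[OF N(3), of v] by (simp add: sum_fun_apply)
   also have "\<dots> = (\<Sum>m\<in>N. if m = n then x n v else 0)"
   proof (rule sum.cong[OF refl])
    fix m assume m: "m \<in> N"
    then have "\<forall>p. p \<noteq> - m \<longrightarrow> (\<forall>v\<in>hcomp V p. x m v = 0)" using N(2) by (auto simp: dual_def)
    moreover have "- n \<noteq> - m" if "m \<noteq> n" using that by simp
    ultimately show "x m v = (if m = n then x n v else 0)" using h True by (cases "m = n") (simp, metis)
   qed
   also have "\<dots> = x n v" using N(1) n by simp
   finally show ?thesis by simp
  qed (use z h in blast)
  then have "x n v = 0" if "v \<in> elems V" for v
   using lm_eq[OF v l lm_zeroI[OF v vs_simps(3)] _ that] by blast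
  then show "x n = 0" using out by (intro ext) (metis zero_fun_apply)
 qed
 note direct = this
 show ?thesis unfolding graded_vector_space_def
 proof (intro conjI allI impI)
  show "vecsp (dual V)" by (rule vs_simps(4))
  show "module.subspace (smult (dual V)) (hcomp (dual V) n)" for n using sub by (simp add: dual_def)
  show "\<forall>n\<in>N. x n = 0" if "finite N \<and> (\<forall>n\<in>N. x n \<in> hcomp (dual V) n) \<and> (\<Sum>n\<in>N. x n) = 0" for N x
   by (rule direct[OF conjunct1[OF that] conjunct1[OF conjunct2[OF that]] conjunct2[OF conjunct2[OF that]]])
 qed
qed

lemma homogeneous_evaluation:
 "f \<in> hcomp (desusp (dual V)) c ==> v \<in> hcomp (susp V) d ==> f v \<noteq> 0 ==> c = - d"
 by (auto simp: dual_def) (metis add.commute diff_add_cancel minus_add_cancel add.inverse_inverse minus_diff_eq)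

subsection \<open>The pairing\<close>

definition word_pairing :: "('v => 'k::field) list => 'v list => 'k" where
 "word_pairing fs vs = (if length fs = length vs then \<Prod>i<length vs. (fs ! i) (vs ! i) else 0)"

lemma pairing_word_pairing: "pairing \<omega> x = \<omega> (\<lambda>fs. x (word_pairing fs))"
 by (simp add: pairing_def word_pairing_def[abs_def])

lemma prod_update:
 fixes n :: nat shows "i < n ==> (\<Prod>j<n. g j) = g i * (\<Prod>j\<in>{..<n} - {i}. g j :: 'k::field)"
 by (rule prod.remove) auto

lemma ml_word_pairing:
 assumes V: "vecsp V"
 shows ml_word_pairing_right: "set fs \<subseteq> elems (dual V) ==> multilinear (susp V) ground (word_pairing fs)"
  and ml_word_pairing_left: "multilinear (desusp (dual V)) ground (\<lambda>fs. word_pairing fs vs)"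
proof -
 have "lform V (\<lambda>v. word_pairing fs (vs[i := v]))" if fs: "set fs \<subseteq> elems (dual V)" and i: "i < length vs" for fs vs i
 proof (cases "length fs = length vs")
  case True
  then have "fs ! i \<in> elems (dual V)" using fs i by auto
  from elems_dual(1)[OF V this] have "lform V (\<lambda>v. (fs ! i) v * c)" for c
   by (simp add: lform_iff algebra_simps)
  moreover have "word_pairing fs (vs[i := v]) = (fs ! i) v * (\<Prod>j\<in>{..<length vs} - {i}. (fs ! j) (vs ! j))" for v
   using True i by (simp add: word_pairing_def prod_update[OF i])
  ultimately show ?thesis by simp
 qed (simp add: word_pairing_def lm_zeroI V)
 then show "multilinear (susp V) ground (word_pairing fs)" if "set fs \<subseteq> elems (dual V)"
  using that V by (intro mlI) simp_all
 have "lform (dual V) (\<lambda>f. word_pairing (fs[i := f]) vs)" if i: "i < length fs" for fs i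
 proof (cases "length fs = length vs")
  case True
  then have "word_pairing (fs[i := f]) vs = f (vs ! i) * (\<Prod>j\<in>{..<length vs} - {i}. (fs ! j) (vs ! j))" for f
   using i prod_update[of i "length vs" "\<lambda>j. (fs[i := f] ! j) (vs ! j)"] by (simp add: word_pairing_def)
  then show ?thesis by (simp add: lform_iff dual_def algebra_simps)
 qed (simp add: word_pairing_def lm_zeroI)
 then show "multilinear (desusp (dual V)) ground (\<lambda>fs. word_pairing fs vs)" by (intro mlI) simp_all
qed

lemma pairing_pure:
 assumes V: "vecsp V" and fs: "fs \<in> words (dual V)"
 shows "pairing (pure (desusp (dual V)) fs) (pure (susp V) vs) = word_pairing fs vs"
proof -
 have "pairing (pure (desusp (dual V)) fs) (pure (susp V) vs) = pure (desusp (dual V)) fs (\<lambda>fs. word_pairing fs vs)"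
  unfolding pairing_word_pairing
  by (rule tmod_cong[of "desusp (dual V)"]) (use fs ml_word_pairing_right[OF V] in \<open>auto intro!: pure_in simp: words_def\<close>)
 then show ?thesis using ml_word_pairing_left[OF V] by simp
qed

lemma lform_pairing:
 assumes V: "vecsp V"
 shows lform_pairing_left: "lform (tensor_module (desusp (dual V))) (\<lambda>\<omega>. pairing \<omega> x)"
  and lform_pairing_right: "\<omega> \<in> elems (tensor_module (desusp (dual V))) ==> lform (tensor_module (susp V)) (pairing \<omega>)"
proof -
 show "lform (tensor_module (desusp (dual V))) (\<lambda>\<omega>. pairing \<omega> x)"
  unfolding pairing_word_pairing by (rule lform_eval(2))
 assume \<omega>: "\<omega> \<in> elems (tensor_module (desusp (dual V)))"
 have vD: "vecsp (desusp (dual V))" and vS: "vecsp (susp V)" using V by simp_all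
 show "lform (tensor_module (susp V)) (pairing \<omega>)"
  unfolding pairing_word_pairing
 proof (rule tmod_param[OF vD vs_simps(2) \<omega>])
  fix x assume x: "x \<in> elems (tensor_module (susp V))"
  show "multilinear (desusp (dual V)) ground (\<lambda>fs. x (word_pairing fs))"
  proof (rule mlI[OF vD])
   fix fs i assume fs: "set fs \<subseteq> elems (desusp (dual V))" "i < length fs"
   show "lform (desusp (dual V)) (\<lambda>f. x (word_pairing (fs[i := f])))"
   proof (rule tmod_param[OF vS vD x])
    show "multilinear (susp V) ground (word_pairing (fs[i := f]))" if "f \<in> elems (desusp (dual V))" for f
     using fs that set_update_subset_insert[of fs i f] by (intro ml_word_pairing_right[OF V]) auto
    show "lform (desusp (dual V)) (\<lambda>f. word_pairing (fs[i := f]) vs)" for vs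
     by (rule ml_upd[OF ml_word_pairing_left[OF V] fs])
   qed
  qed
 qed (rule lform_eval(2))
qed

lemma word_pairing_homogeneous:
 assumes "homogeneous (desusp (dual V)) cs fs" "homogeneous (susp V) ds vs" "word_pairing fs vs \<noteq> 0"
 shows "cs = map uminus ds"
proof (rule nth_equalityI)
 have len: "length fs = length vs" "\<And>i. i < length vs ==> (fs ! i) (vs ! i) \<noteq> 0"
  using assms(3) by (auto simp: word_pairing_def split: if_splits)
 then show "length cs = length (map uminus ds)" using homogeneous_length[OF assms(1)] homogeneous_length[OF assms(2)] by simp
 fix i assume "i < length cs"
 then have i: "i < length vs" using assms(1) len homogeneous_length by metis
 have "cs ! i = - (ds ! i)"
  using assms(1,2) i len by (intro homogeneous_evaluation[of "fs ! i" V _ "vs ! i"]) (auto simp: homogeneous_nth simp del: hcomp_simps)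
 then show "cs ! i = map uminus ds ! i" using i homogeneous_length[OF assms(2)] by simp
qed

text \<open>On words this is \<open>word_pairing_homogeneous\<close>; it extends to the components by linearity in each
 argument, read as a graded map into the ground field.\<close>

lemma pairing_orthogonal:
 fixes V :: "('k::field, 'v::ab_group_add) graded_space"
 assumes V: "graded_vector_space V" and \<omega>: "\<omega> \<in> hcomp (tensor_module (desusp (dual V))) m"
  and x: "x \<in> hcomp (tensor_module (susp V)) n" and mn: "m \<noteq> - n"
 shows "pairing \<omega> x = 0"
proof -
 have v: "vecsp V" by (rule graded_vs[OF V])
 have gD: "graded_vector_space (desusp (dual V))" by (rule graded_desusp[OF graded_dual[OF V]])
 have "graded_map (tensor_module (desusp (dual V))) ground n (\<lambda>\<omega>. pairing \<omega> x)"
 proof (rule graded_map_from_words[OF gD graded_ground lform_pairing_left[OF v]])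
  fix cs fs assume f: "homogeneous (desusp (dual V)) cs fs"
  have fw: "fs \<in> words (dual V)" using homogeneous_words[OF _ f] by simp
  have "graded_map (tensor_module (susp V)) ground (sum_list cs) (pairing (pure (desusp (dual V)) fs))"
  proof (rule graded_map_from_words[OF graded_susp[OF V] graded_ground lform_pairing_right[OF v]])
   show "pure (desusp (dual V)) fs \<in> elems (tensor_module (desusp (dual V)))" by (rule pure_in) (use fw in simp_all)
   fix ds vs assume h: "homogeneous (susp V) ds vs"
   show "pairing (pure (desusp (dual V)) fs) (pure (susp V) vs) \<in> hcomp ground (sum_list ds + sum_list cs)"
   proof (cases "word_pairing fs vs = 0")
    case False
    then have "cs = map uminus ds" by (rule word_pairing_homogeneous[OF f h])
    moreover have "sum_list ds + sum_list (map uminus ds) = 0" by (induct ds) simp_all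
    ultimately have "sum_list ds + sum_list cs = 0" by simp
    then show ?thesis by (simp add: ground_def)
   qed (simp add: pairing_pure[OF v fw] ground_def)
  qed
  then show "pairing (pure (desusp (dual V)) fs) x \<in> hcomp ground (sum_list cs + n)"
   using x unfolding graded_map_def by (simp add: add.commute)
 qed
 then have "pairing \<omega> x \<in> hcomp ground (m + n)" using \<omega> by (simp add: graded_map_def)
 then show ?thesis using mn by (auto simp: ground_def split: if_splits)
qed

lemma tensor_module_span:
 fixes U :: "('k::field, 'a::ab_group_add) graded_space"
 assumes U: "vecsp U" and Bs: "Bs \<subseteq> elems U" "elems U \<subseteq> module.span (smult U) Bs"
 shows "elems (tensor_module U) \<subseteq> module.span fscale (pure U ` {bs. bs \<noteq> [] \<and> set bs \<subseteq> Bs})"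
proof -
 interpret U: vector_space "smult U" by (rule U)
 interpret F: vector_space "fscale :: _ => (('a list => 'k) => 'k) => _" by (rule vector_space_fscale)
 let ?S = "F.span (pure U ` {bs. bs \<noteq> [] \<and> set bs \<subseteq> Bs})"
 have "pure U (us @ vs) \<in> ?S" if "set us \<subseteq> Bs" "set vs \<subseteq> elems U" "us @ vs \<noteq> []" for us vs
  using that
 proof (induct vs arbitrary: us)
  case Nil then show ?case by (intro F.span_base) auto
 next
  case (Cons v vs)
  have lin: "linear_map U (tensor_module U) (\<lambda>v. pure U (us @ v # vs))"
   using ml_pure[OF U] Cons(2,3) Bs(1) unfolding multilinear_def by simp
  have "v \<in> U.span Bs" using Cons(3) Bs(2) by auto
  then have "v \<in> elems U \<and> pure U (us @ v # vs) \<in> ?S"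
  proof (induct rule: U.span_induct_alt)
   case base
   have "(\<lambda>_. 0) \<in> ?S" using F.span_zero by (simp add: zero_fun_def)
   then show ?case using lm_0[OF U lin] elems_0[OF U] by (simp add: zero_fun_def)
  next
   case (step c b y)
   have b: "b \<in> elems U" using step(1) Bs(1) by auto
   have "pure U ((us @ [b]) @ vs) \<in> ?S" by (rule Cons(1)) (use Cons(2,3) step(1) in auto)
   then have bS: "pure U (us @ b # vs) \<in> ?S" by simp
   have eq: "pure U (us @ (smult U c b + y) # vs) = fscale c (pure U (us @ b # vs)) + pure U (us @ y # vs)"
    using lm_add[OF lin elems_smult[OF U b, of c]] lm_smult[OF lin b, of c] step(2) by simp
   show ?case
    unfolding eq using elems_add[OF U elems_smult[OF U b] conjunct1[OF step(2)]]
     F.span_add[OF F.span_scale[OF bS] conjunct2[OF step(2)]] by (rule conjI)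
  qed
  then show ?case by simp
 qed
 from this[of "[]"] have "pure U vs \<in> ?S" if "homogeneous U ds vs" for ds vs
  using homogeneous_words[OF U that] by (simp add: words_def)
 then show ?thesis unfolding elems_tensor_module by (intro F.span_minimal) auto
qed

text \<open>A finite homogeneous basis.  Gradedness of the two tensor modules belongs to the given differential
 graded structures and is taken from there.\<close>

locale finite_dual =
 fixes V :: "('k::field, 'v::ab_group_add) graded_space" and Bs :: "'v set" and deg :: "'v => int"
 assumes graded: "graded_vector_space V" and finite_Bs: "finite Bs"
  and independent: "\<not> module.dependent (smult V) Bs" and span_Bs: "module.span (smult V) Bs = elems V"
  and Bs_hcomp: "\<And>b. b \<in> Bs ==> b \<in> hcomp V (deg b)"
  and hcomp_span: "\<And>p x. x \<in> hcomp V p ==> x \<in> module.span (smult V) {b \<in> Bs. deg b = p}"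
  and graded_B: "graded_vector_space (tensor_module (desusp (dual V)))"
  and graded_C: "graded_vector_space (tensor_module (susp V))"

lemma finite_dual_exists:
 assumes V: "graded_vector_space V" and fin: "finite_dimensional V"
  and B: "graded_vector_space (tensor_module (desusp (dual V)))" and C: "graded_vector_space (tensor_module (susp V))"
 obtains Bs deg where "finite_dual V Bs deg"
proof -
 interpret vector_space "smult V" by (rule graded_vs[OF V])
 obtain Bs deg where Bs: "independent Bs" "span Bs = elems V" "\<And>b. b \<in> Bs ==> b \<in> hcomp V (deg b)"
  "\<And>p x. x \<in> hcomp V p ==> x \<in> span {b \<in> Bs. deg b = p}"
  by (rule homogeneous_basis[OF V]) (rule that; assumption)
 obtain S where S: "finite S" "elems V = span S" using fin by (auto simp: finite_dimensional_def)
 have "Bs \<subseteq> span S" using Bs(2) S(2) span_superset[of Bs] by simp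
 then have "finite Bs" using independent_span_bound[OF S(1) Bs(1)] by simp
 then have "finite_dual V Bs deg" using V Bs B C by (simp add: finite_dual_def)
 then show thesis by (rule that)
qed

context finite_dual
begin

abbreviation "B \<equiv> tensor_module (desusp (dual V))"
abbreviation "C \<equiv> tensor_module (susp V)"

lemma vV: "vecsp V" by (rule graded_vs[OF graded])

lemma gD: "graded_vector_space (desusp (dual V))"
 by (rule graded_desusp[OF graded_dual[OF graded]])

lemma Bs_elems: "Bs \<subseteq> elems V"
 using hcomp_elems[OF vV Bs_hcomp] by auto

text \<open>The dual basis, normalised to vanish outside the space as \<open>dual\<close> demands.\<close>

definition star :: "'v => 'v => 'k" where
 "star b v = (if v \<in> elems V then module.representation (smult V) Bs v b else 0)"

lemma star_basis: "b \<in> Bs ==> b' \<in> Bs ==> star b b' = (if b = b' then 1 else 0)"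
proof -
 interpret vector_space "smult V" by (rule vV)
 assume "b \<in> Bs" "b' \<in> Bs"
 then show ?thesis using Bs_elems representation_basis[OF independent, of b'] by (auto simp: star_def)
qed

lemma star_hcomp: "star b \<in> hcomp (dual V) (- deg b)" if b: "b \<in> Bs"
proof -
 interpret vector_space "smult V" by (rule vV)
 have sp: "v \<in> elems V \<longleftrightarrow> v \<in> span Bs" for v using span_Bs by simp
 have "lform V (star b)"
  unfolding lform_iff
  using elems_add[OF vV] elems_smult[OF vV] representation_add[OF independent] representation_scale[OF independent]
  by (simp add: star_def sp span_add span_scale)
 moreover have "star b v = 0" if "p \<noteq> deg b" "v \<in> hcomp V p" for p v
 proof -
  have v: "v \<in> span {b \<in> Bs. deg b = p}" by (rule hcomp_span[OF that(2)])
  have "representation Bs v = representation {b \<in> Bs. deg b = p} v"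
   by (rule representation_extend[OF independent v]) auto
  moreover have "representation {b \<in> Bs. deg b = p} v b = 0"
   using representation_ne_zero[of "{b \<in> Bs. deg b = p}" v b] that(1) by auto
  ultimately show ?thesis by (simp add: star_def)
 qed
 ultimately show ?thesis by (auto simp: dual_def star_def)
qed

lemma star_elems: "b \<in> Bs ==> star b \<in> elems (dual V)"
 by (rule hcomp_elems[OF vs_simps(4) star_hcomp])

lemma basis_expansion: "v \<in> elems V ==> (\<Sum>b\<in>Bs. smult V (star b v) b) = v"
proof -
 interpret vector_space "smult V" by (rule vV)
 assume v: "v \<in> elems V"
 have "(\<Sum>b\<in>Bs. smult V (representation Bs v b) b) = v"
  by (rule sum_representation_eq[OF independent _ finite_Bs]) (use v span_Bs in auto)
 then show ?thesis using v by (simp add: star_def)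
qed

lemma dual_span: "elems (dual V) \<subseteq> module.span (smult (dual V)) (star ` Bs)"
proof
 fix f assume f: "f \<in> elems (dual V)"
 interpret D: vector_space "smult (dual V)" by (rule vs_simps(4))
 have "f = (\<Sum>b\<in>Bs. smult (dual V) (f b) (star b))"
 proof
  fix v
  show "f v = (\<Sum>b\<in>Bs. smult (dual V) (f b) (star b)) v"
  proof (cases "v \<in> elems V")
   case True
   have bV: "b \<in> elems V" if "b \<in> Bs" for b using that Bs_elems by auto
   have "f v = f (\<Sum>b\<in>Bs. smult V (star b v) b)" by (simp only: basis_expansion[OF True])
   also have "\<dots> = (\<Sum>b\<in>Bs. f (smult V (star b v) b))"
    by (rule lm_sum[OF vV elems_dual(1)[OF vV f] elems_smult[OF vV bV]])
   also have "\<dots> = (\<Sum>b\<in>Bs. smult (dual V) (f b) (star b) v)"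
    using elems_dual(1)[OF vV f] bV by (intro sum.cong) (simp_all add: lform_iff dual_def)
   finally show ?thesis by (simp only: sum_fun_apply)
  next
   case False
   then show ?thesis using elems_dual(2)[OF vV f] by (simp add: sum_fun_apply dual_def star_def)
  qed
 qed
 then show "f \<in> D.span (star ` Bs)"
  by (metis (no_types, lifting) D.span_sum D.span_scale D.span_base imageI)
qed

lemma basis_word_homogeneous:
 assumes "bs \<noteq> [] \<and> set bs \<subseteq> Bs"
 shows "homogeneous (susp V) (map (\<lambda>b. deg b + 1) bs) bs"
  and "homogeneous (desusp (dual V)) (map (\<lambda>b. - (deg b + 1)) bs) (map star bs)"
proof -
 have i: "bs ! i \<in> Bs" if "i < length bs" for i using assms that by auto
 show "homogeneous (susp V) (map (\<lambda>b. deg b + 1) bs) bs"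
  using Bs_hcomp[OF i] assms by (simp add: homogeneous_nth)
 show "homogeneous (desusp (dual V)) (map (\<lambda>b. - (deg b + 1)) bs) (map star bs)"
  using star_hcomp[OF i] assms by (simp add: homogeneous_nth)
qed

lemma word_pairing_star:
 assumes "set as \<subseteq> Bs" "set bs \<subseteq> Bs"
 shows "word_pairing (map star as) bs = (if as = bs then 1 else 0)"
proof (cases "as = bs")
 case True
 have "star (bs ! i) (bs ! i) = 1" if "i < length bs" for i
  using star_basis[of "bs ! i" "bs ! i"] subsetD[OF assms(2) nth_mem[OF that]] by simp
 then show ?thesis unfolding True by (simp add: word_pairing_def)
next
 case False
 show ?thesis
 proof (cases "length as = length bs")
  case True
  then obtain i where i: "i < length bs" "as ! i \<noteq> bs ! i" using False by (auto simp: list_eq_iff_nth_eq)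
  then have "star (as ! i) (bs ! i) = 0"
   using star_basis[OF subsetD[OF assms(1) nth_mem[of i]] subsetD[OF assms(2) nth_mem[of i]]] True by simp
  then have "\<exists>i\<in>{..<length bs}. (map star as ! i) (bs ! i) = 0" using i True by (intro bexI[of _ i]) auto
  then show ?thesis using False True by (simp add: word_pairing_def)
 qed (use False in \<open>auto simp: word_pairing_def\<close>)
qed

sublocale dual_bases B C pairing "{bs. bs \<noteq> [] \<and> set bs \<subseteq> Bs}" "\<lambda>bs. pure (desusp (dual V)) (map star bs)" "pure (susp V)"
 "\<lambda>bs. sum_list (map (\<lambda>b. deg b + 1) bs)"
proof
 interpret F: vector_space "fscale :: _ => ((('v => 'k) list => 'k) => 'k) => _" by (rule vector_space_fscale)
 let ?J = "{bs. bs \<noteq> [] \<and> set bs \<subseteq> Bs}"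
 have vS: "vecsp (susp V)" using vV by simp
 show "graded_vector_space B" "graded_vector_space C"
  by (rule graded_B graded_C)+
 show "lform B (\<lambda>\<omega>. pairing \<omega> x)" for x by (rule lform_pairing_left[OF vV])
 show "lform C (pairing \<omega>)" if "\<omega> \<in> elems B" for \<omega> by (rule lform_pairing_right[OF vV that])
 show "pure (desusp (dual V)) (map star bs) \<in> hcomp B (- sum_list (map (\<lambda>b. deg b + 1) bs))" if "bs \<in> ?J" for bs
 proof -
  have "- sum_list (map (\<lambda>b. deg b + 1) bs) = sum_list (map (\<lambda>b. - (deg b + 1)) bs)" by (induct bs) simp_all
  then show ?thesis using hcomp_pure[OF basis_word_homogeneous(2)] that by simp
 qed
 show "pure (susp V) bs \<in> hcomp C (sum_list (map (\<lambda>b. deg b + 1) bs))" if "bs \<in> ?J" for bs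
  using hcomp_pure[OF basis_word_homogeneous(1)] that by blast
 show "pairing (pure (desusp (dual V)) (map star as)) (pure (susp V) bs) = (if as = bs then 1 else 0)"
  if "as \<in> ?J" "bs \<in> ?J" for as bs
 proof -
  have "map star as \<in> words (dual V)" using that star_elems by (auto simp: words_def)
  from pairing_pure[OF vV this] show ?thesis using word_pairing_star that by simp
 qed
 show "elems C \<subseteq> module.span (smult C) (pure (susp V) ` ?J)"
  using tensor_module_span[OF vS, of Bs] Bs_elems span_Bs by simp
 have mono: "pure (desusp (dual V)) ` {fs. fs \<noteq> [] \<and> set fs \<subseteq> star ` Bs} \<subseteq> (\<lambda>bs. pure (desusp (dual V)) (map star bs)) ` ?J"
 proof
  fix t assume "t \<in> pure (desusp (dual V)) ` {fs. fs \<noteq> [] \<and> set fs \<subseteq> star ` Bs}"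
  then obtain fs where fs: "fs \<noteq> []" "set fs \<subseteq> star ` Bs" "t = pure (desusp (dual V)) fs" by auto
  then have "fs \<in> lists (star ` Bs)" by auto
  then obtain bs where "fs = map star bs" "set bs \<subseteq> Bs" by (auto simp: lists_image)
  then show "t \<in> (\<lambda>bs. pure (desusp (dual V)) (map star bs)) ` ?J" using fs by auto
 qed
 have span: "elems B \<subseteq> module.span fscale (pure (desusp (dual V)) ` {fs. fs \<noteq> [] \<and> set fs \<subseteq> star ` Bs})"
  by (rule tensor_module_span) (use star_elems dual_span in auto)
 show "elems B \<subseteq> module.span (smult B) ((\<lambda>bs. pure (desusp (dual V)) (map star bs)) ` ?J)"
  unfolding smult_simps by (rule subset_trans[OF span F.span_mono[OF mono]])
 show "pairing \<omega> x = 0" if "\<omega> \<in> hcomp B m" "x \<in> hcomp C n" "m \<noteq> - n" for \<omega> x m n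
  by (rule pairing_orthogonal[OF graded that])
qed

end

subsection \<open>Product and coproduct are dual\<close>

lemma word_pairing_Cons: "word_pairing (f # fs) (v # vs) = f v * word_pairing fs vs"
 by (simp add: word_pairing_def prod.lessThan_Suc_shift del: prod.lessThan_Suc)

lemma word_pairing_append:
 "length fs = length us ==> word_pairing (fs @ gs) (us @ ws) = word_pairing fs us * word_pairing gs ws"
proof (induct fs us rule: list_induct2)
 case Nil then show ?case by (simp add: word_pairing_def)
qed (simp add: word_pairing_Cons)

lemma word_pairing_pm:
 assumes \<sigma>: "\<sigma> permutes {1..length vs}" and len: "length fs = length vs"
 shows "word_pairing fs (pm vs \<sigma>) = word_pairing (pm fs (inv \<sigma>)) vs"
proof -
 let ?n = "length vs"
 have \<iota>: "inv \<sigma> permutes {1..?n}" by (rule permutes_inv[OF \<sigma>])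
 have pos: "\<sigma> (Suc i) \<noteq> 0" "inv \<sigma> (Suc i) \<noteq> 0" if "i < ?n" for i
  using permutes_in_image[OF \<sigma>, of "Suc i"] permutes_in_image[OF \<iota>, of "Suc i"] that by auto
 have "(\<Prod>i<?n. (fs ! i) (vs ! (\<sigma> (Suc i) - 1))) = (\<Prod>j<?n. (fs ! (inv \<sigma> (Suc j) - 1)) (vs ! j))"
 proof (rule prod.reindex_bij_witness[of _ "\<lambda>j. inv \<sigma> (Suc j) - 1" "\<lambda>i. \<sigma> (Suc i) - 1"])
  fix i assume "i \<in> {..<?n}"
  then have i: "i < ?n" by simp
  show "\<sigma> (Suc i) - 1 \<in> {..<?n}" "inv \<sigma> (Suc i) - 1 \<in> {..<?n}"
   using permutes_range[OF \<sigma> i] permutes_range[OF \<iota> i] by auto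
  show 1: "inv \<sigma> (Suc (\<sigma> (Suc i) - 1)) - 1 = i" using pos[OF i] permutes_inverses(2)[OF \<sigma>] by simp
  show "\<sigma> (Suc (inv \<sigma> (Suc i) - 1)) - 1 = i" using pos[OF i] permutes_inverses(1)[OF \<sigma>] by simp
  show "(fs ! (inv \<sigma> (Suc (\<sigma> (Suc i) - 1)) - 1)) (vs ! (\<sigma> (Suc i) - 1)) = (fs ! i) (vs ! (\<sigma> (Suc i) - 1))"
   unfolding 1 ..
 qed
 then show ?thesis using len by (simp add: word_pairing_def nth_pm)
qed

lemma koszul_square: "koszul ds \<sigma> * koszul ds \<sigma> = (1 :: 'k::field)"
 unfolding koszul_def prod.distrib[symmetric]
 by (rule prod.neutral) (auto simp: powi_minus_one_parity)

lemma koszul_uminus: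
 assumes "\<sigma> permutes {1..length ds}" shows "koszul (map uminus ds) \<sigma> = (koszul ds \<sigma> :: 'k::field)"
proof -
 have "(- d) mod 2 = d mod 2" for d :: int by presburger
 then have "map (\<lambda>d. d mod 2) (map uminus ds) = map (\<lambda>d. d mod (2 :: int)) ds" by simp
 then have "koszul (map (\<lambda>d. d mod 2) (map uminus ds)) \<sigma> = (koszul (map (\<lambda>d. d mod 2) ds) \<sigma> :: 'k)" by (rule arg_cong)
 then show ?thesis
  using koszul_parity[of \<sigma> "map uminus ds", where 'k = 'k] koszul_parity[of \<sigma> ds, where 'k = 'k] assms by simp
qed

text \<open>Undoing a permutation costs the same sign, by the cocycle property.\<close>

lemma koszul_inv:
 assumes \<sigma>: "\<sigma> permutes {1..length ds}"
 shows "koszul (pm ds \<sigma>) (inv \<sigma>) = (koszul ds \<sigma> :: 'k::field)"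
proof -
 have "koszul ds \<sigma> * koszul (pm ds \<sigma>) (inv \<sigma>) = (koszul ds (\<sigma> \<circ> inv \<sigma>) :: 'k)"
  by (rule koszul_comp[OF \<sigma> permutes_inv[OF \<sigma>], symmetric])
 also have "\<dots> = koszul ds \<sigma> * koszul ds \<sigma>" by (simp add: permutes_inv_o[OF \<sigma>] koszul_square)
 finally show ?thesis using koszul_square[of ds \<sigma>, where 'k = 'k] by (metis mult_cancel_left mult_zero_left zero_neq_one)
qed

text \<open>Only deconcatenations of matching lengths pair nontrivially, and then product and coproduct run over
 the same shuffles, with the letters of one word permuted instead of those of the other.  The Koszul
 signs agree because paired letters have opposite degrees.\<close>

lemma product_coproduct_pure:
 fixes V :: "('k::field, 'v::ab_group_add) graded_space"
 assumes V: "graded_vector_space V"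
  and f: "homogeneous (desusp (dual V)) cs fs" and g: "homogeneous (desusp (dual V)) es gs" and h: "homogeneous (susp V) ds vs"
 shows "pairing (zin_product (desusp (dual V)) (tensor (tensor_module (desusp (dual V))) (tensor_module (desusp (dual V)))
     (pure (desusp (dual V)) fs) (pure (desusp (dual V)) gs))) (pure (susp V) vs)
   = zin_coproduct (susp V) (pure (susp V) vs)
     (\<lambda>a b. pairing (pure (desusp (dual V)) fs) a * pairing (pure (desusp (dual V)) gs) b)"
  (is "pairing ?m _ = _")
proof -
 let ?D = "desusp (dual V)" and ?U = "susp V" and ?p = "length fs" and ?q = "length gs" and ?n = "length vs"
 have v: "vecsp V" by (rule graded_vs[OF V])
 have gD: "graded_vector_space ?D" by (rule graded_desusp[OF graded_dual[OF V]])
 have gU: "graded_vector_space ?U" by (rule graded_susp[OF V])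
 have vD: "vecsp ?D" and vU: "vecsp ?U" using v by simp_all
 have fw: "fs \<in> words (dual V)" "gs \<in> words (dual V)" using homogeneous_words[OF vD f] homogeneous_words[OF vD g] by simp_all
 have pq: "1 \<le> ?p" "1 \<le> ?q" using fw by (auto simp: words_def Suc_le_eq)
 have pin: "pure ?D fs \<in> elems (tensor_module ?D)" "pure ?D gs \<in> elems (tensor_module ?D)"
  by (rule pure_in[OF vD], simp add: fw)+
 have min: "?m \<in> elems (tensor_module ?D)"
  by (rule lm_in[OF lm_zin_product[OF gD] tensor_in[OF vs_simps(2,2) pin]])
 have "pairing ?m (pure ?U vs) = ?m (\<lambda>hs. word_pairing hs vs)"
  unfolding pairing_word_pairing
  by (rule tmod_cong[OF vD min]) (simp add: pure_eval[OF ml_word_pairing_right[OF v]] words_def)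
 also have "\<dots> = (\<Sum>\<sigma>\<in>Sh [?p, ?q - 1]. koszul (cs @ es) (inv \<sigma>) * word_pairing (pm (fs @ gs) (inv \<sigma>)) vs)"
  by (rule zin_product_pure[OF gD f g ml_word_pairing_left[OF v]])
 also have "\<dots> = (\<Sum>k=1..?n - 1. \<Sum>\<sigma>\<in>Sh [k, ?n - k - 1]. koszul ds \<sigma> *
   (word_pairing fs (take k (pm vs \<sigma>)) * word_pairing gs (drop k (pm vs \<sigma>))))"
 proof (cases "?n = ?p + ?q")
  case True
  have z: "(\<Sum>\<sigma>\<in>Sh [k, ?n - k - 1]. koszul ds \<sigma> *
    (word_pairing fs (take k (pm vs \<sigma>)) * word_pairing gs (drop k (pm vs \<sigma>)))) = 0"
   if k: "k \<in> {1..?n - 1} - {?p}" for k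
  proof (rule sum.neutral, rule ballI)
   fix \<sigma>
   have "length (take k (pm vs \<sigma>)) \<noteq> ?p" using k by auto
   then have "word_pairing fs (take k (pm vs \<sigma>)) = 0" unfolding word_pairing_def by (metis (full_types))
   then show "koszul ds \<sigma> * (word_pairing fs (take k (pm vs \<sigma>)) * word_pairing gs (drop k (pm vs \<sigma>))) = 0" by simp
  qed
  have p: "?p \<in> {1..?n - 1}" using True pq by auto
  have "(\<Sum>\<sigma>\<in>Sh [?p, ?q - 1]. koszul (cs @ es) (inv \<sigma>) * word_pairing (pm (fs @ gs) (inv \<sigma>)) vs) =
   (\<Sum>\<sigma>\<in>Sh [?p, ?n - ?p - 1]. koszul ds \<sigma> * (word_pairing fs (take ?p (pm vs \<sigma>)) * word_pairing gs (drop ?p (pm vs \<sigma>))))"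
  proof (rule sum.cong)
   show "Sh [?p, ?q - 1] = Sh [?p, ?n - ?p - 1]" using True by simp
   fix \<sigma> assume s: "\<sigma> \<in> Sh [?p, ?n - ?p - 1]"
   have "?p < ?n" using True pq by linarith
   then have \<sigma>: "\<sigma> permutes {1..?n}" by (rule Sh_two_permutes(2)[OF s])
   have ld: "length ds = ?n" by (rule homogeneous_length[OF h])
   have "word_pairing fs (take ?p (pm vs \<sigma>)) * word_pairing gs (drop ?p (pm vs \<sigma>)) = word_pairing (fs @ gs) (pm vs \<sigma>)"
    using word_pairing_append[of fs "take ?p (pm vs \<sigma>)" gs "drop ?p (pm vs \<sigma>)"] True by simp
   moreover have "word_pairing (fs @ gs) (pm vs \<sigma>) = word_pairing (pm (fs @ gs) (inv \<sigma>)) vs"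
    by (rule word_pairing_pm[OF \<sigma>]) (simp add: True)
   moreover have "koszul (cs @ es) (inv \<sigma>) = (koszul ds \<sigma> :: 'k)" if "word_pairing (fs @ gs) (pm vs \<sigma>) \<noteq> 0"
   proof -
    have "cs @ es = map uminus (pm ds \<sigma>)"
     by (rule word_pairing_homogeneous[OF homogeneous_append[OF f g] homogeneous_pm[OF h \<sigma>] that])
    then show ?thesis using koszul_uminus[of "inv \<sigma>" "pm ds \<sigma>", where 'k = 'k] koszul_inv[of \<sigma> ds, where 'k = 'k] permutes_inv[OF \<sigma>] \<sigma> ld
     by simp
   qed
   ultimately show "koszul (cs @ es) (inv \<sigma>) * word_pairing (pm (fs @ gs) (inv \<sigma>)) vs =
     koszul ds \<sigma> * (word_pairing fs (take ?p (pm vs \<sigma>)) * word_pairing gs (drop ?p (pm vs \<sigma>)))"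
    by (cases "word_pairing (fs @ gs) (pm vs \<sigma>) = 0") simp_all
  qed
  also have "\<dots> = (\<Sum>k=1..?n - 1. \<Sum>\<sigma>\<in>Sh [k, ?n - k - 1]. koszul ds \<sigma> *
   (word_pairing fs (take k (pm vs \<sigma>)) * word_pairing gs (drop k (pm vs \<sigma>))))"
   by (subst sum.remove[OF finite_atLeastAtMost p]) (simp only: sum.neutral[OF ballI, OF z] add_0_right)
  finally show ?thesis .
 next
  case False
  have z: "word_pairing (pm (fs @ gs) (inv \<sigma>)) vs = 0" for \<sigma> using False by (simp add: word_pairing_def)
  have z': "word_pairing fs (take k (pm vs \<sigma>)) * word_pairing gs (drop k (pm vs \<sigma>)) = 0" if "k \<in> {1..?n - 1}" for k \<sigma>
   using False that by (auto simp: word_pairing_def)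
  have "(\<Sum>k=1..?n - 1. \<Sum>\<sigma>\<in>Sh [k, ?n - k - 1]. koszul ds \<sigma> *
    (word_pairing fs (take k (pm vs \<sigma>)) * word_pairing gs (drop k (pm vs \<sigma>)))) = 0"
   by (rule sum.neutral, rule ballI, rule sum.neutral, rule ballI) (simp only: z' mult_zero_right)
  then show ?thesis by (simp only: z mult_zero_right sum.neutral_const)
 qed
 also have "\<dots> = zin_coproduct ?U (pure ?U vs) (\<lambda>a b. pairing (pure ?D fs) a * pairing (pure ?D gs) b)"
  unfolding zin_coproduct_pure[OF gU h bf_times[OF lform_pairing_right[OF v pin(1)] lform_pairing_right[OF v pin(2)]]]
  by (simp add: pairing_pure[OF v fw(1)] pairing_pure[OF v fw(2)])
 finally show ?thesis .
qed

lemma lform_times: "lform A f ==> lform A (\<lambda>x. f x * c)" "lform A f ==> lform A (\<lambda>x. c * f x)"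
 by (simp_all add: lform_iff algebra_simps)

lemma product_coproduct:
 fixes V :: "('k::field, 'v::ab_group_add) graded_space"
 assumes V: "graded_vector_space V" and \<omega>: "\<omega> \<in> elems (tensor_module (desusp (dual V)))" and \<omega>': "\<omega>' \<in> elems (tensor_module (desusp (dual V)))" and x: "x \<in> elems (tensor_module (susp V))"
 shows "pairing (zin_product (desusp (dual V)) (tensor (tensor_module (desusp (dual V))) (tensor_module (desusp (dual V))) \<omega> \<omega>')) x =
  zin_coproduct (susp V) x (\<lambda>a b. pairing \<omega> a * pairing \<omega>' b)"
proof -
 let ?B = "tensor_module (desusp (dual V))" and ?C = "tensor_module (susp V)"
 have v: "vecsp V" by (rule graded_vs[OF V])
 have gD: "graded_vector_space (desusp (dual V))" by (rule graded_desusp[OF graded_dual[OF V]])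
 have gU: "graded_vector_space (susp V)" by (rule graded_susp[OF V])
 have vD: "vecsp (desusp (dual V))" and vU: "vecsp (susp V)" and vB: "vecsp ?B" and vC: "vecsp ?C"
  using v by simp_all
 have lL: "lform ?B (\<lambda>\<omega>. pairing \<omega> x)" and lR: "\<omega> \<in> elems ?B ==> lform ?C (pairing \<omega>)" for x \<omega>
  using lform_pairing_left[OF v] lform_pairing_right[OF v] by blast+
 have lm: "linear_map (tensor_space ?B ?B) ?B (zin_product (desusp (dual V)))"
  by (rule lm_zin_product[OF gD])
 have lc: "linear_map ?C (tensor_space ?C ?C) (zin_coproduct (susp V))"
  by (rule lm_zin_coproduct[OF gU])
 have bt: "bilinear_map ?B ?B (tensor_space ?B ?B) (tensor ?B ?B)" by (rule bm_tensor[OF vB vB])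
 have L1: "lform ?B (\<lambda>\<omega>. pairing (zin_product (desusp (dual V)) (tensor ?B ?B \<omega> \<omega>')) x)" if "\<omega>' \<in> elems ?B" for \<omega>' x
  by (rule lm_comp[OF lm_comp[OF bm_left[OF bt that] lm] lL])
 have L2: "lform ?B (\<lambda>\<omega>'. pairing (zin_product (desusp (dual V)) (tensor ?B ?B \<omega> \<omega>')) x)" if "\<omega> \<in> elems ?B" for \<omega> x
  by (rule lm_comp[OF lm_comp[OF bm_right[OF bt that] lm] lL])
 have L3: "lform ?C (pairing (zin_product (desusp (dual V)) (tensor ?B ?B \<omega> \<omega>')))" if "\<omega> \<in> elems ?B" "\<omega>' \<in> elems ?B" for \<omega> \<omega>'
  by (rule lR[OF lm_in[OF lm tensor_in[OF vB vB that]]])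
 have R1: "lform ?B (\<lambda>\<omega>. zin_coproduct (susp V) x (\<lambda>a b. pairing \<omega> a * pairing \<omega>' b))" if "\<omega>' \<in> elems ?B" "x \<in> elems ?C" for \<omega>' x
  by (rule tens_param[OF vC vC vB lm_in[OF lc that(2)] bf_times[OF lR lR[OF that(1)]] lform_times(1)[OF lL]])
 have R2: "lform ?B (\<lambda>\<omega>'. zin_coproduct (susp V) x (\<lambda>a b. pairing \<omega> a * pairing \<omega>' b))" if "\<omega> \<in> elems ?B" "x \<in> elems ?C" for \<omega> x
  by (rule tens_param[OF vC vC vB lm_in[OF lc that(2)] bf_times[OF lR[OF that(1)] lR] lform_times(2)[OF lL]])
 have R3: "lform ?C (\<lambda>x. zin_coproduct (susp V) x (\<lambda>a b. pairing \<omega> a * pairing \<omega>' b))" for \<omega> \<omega>'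
  by (rule lm_comp[OF lc lform_eval(1)])
 show ?thesis
 proof (rule tmod_eq[OF vU L3[OF \<omega> \<omega>'] R3 _ x])
  fix ds vs assume h: "homogeneous (susp V) ds vs"
  have px: "pure (susp V) vs \<in> elems ?C" by (rule pure_in[OF vU homogeneous_words[OF vU h]])
  show "pairing (zin_product (desusp (dual V)) (tensor ?B ?B \<omega> \<omega>')) (pure (susp V) vs) =
    zin_coproduct (susp V) (pure (susp V) vs) (\<lambda>a b. pairing \<omega> a * pairing \<omega>' b)"
  proof (rule tmod_eq[OF vD L1[OF \<omega>'] R1[OF \<omega>' px] _ \<omega>])
   fix cs fs assume f: "homogeneous (desusp (dual V)) cs fs"
   have pf: "pure (desusp (dual V)) fs \<in> elems ?B" by (rule pure_in[OF vD homogeneous_words[OF vD f]])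
   show "pairing (zin_product (desusp (dual V)) (tensor ?B ?B (pure (desusp (dual V)) fs) \<omega>')) (pure (susp V) vs) =
     zin_coproduct (susp V) (pure (susp V) vs) (\<lambda>a b. pairing (pure (desusp (dual V)) fs) a * pairing \<omega>' b)"
    by (rule tmod_eq[OF vD L2[OF pf] R2[OF pf px] _ \<omega>'])
     (use product_coproduct_pure[OF V f _ h] in blast)
  qed
 qed
qed

text \<open>Every word is built from letters by right multiplication; this makes induction along the product
 possible.\<close>

lemma zin_product_snoc:
 assumes U: "graded_vector_space U" and f: "homogeneous U cs fs" and g: "homogeneous U [c] [g]"
 shows "zin_product U (tensor (tensor_module U) (tensor_module U) (pure U fs) (pure U [g])) = pure U (fs @ [g])"
proof (rule tmod_eqI)
 show v: "vecsp U" by (rule graded_vs[OF U])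
 note fg = homogeneous_words[OF v f] homogeneous_words[OF v g] homogeneous_words[OF v homogeneous_append[OF f g]]
 show "zin_product U (tensor (tensor_module U) (tensor_module U) (pure U fs) (pure U [g])) \<in> elems (tensor_module U)"
  by (rule lm_in[OF lm_zin_product[OF U] tensor_in[OF vs_simps(2,2) pure_in[OF v fg(1)] pure_in[OF v fg(2)]]])
 show "pure U (fs @ [g]) \<in> elems (tensor_module U)" by (rule pure_in[OF v fg(3)])
 fix \<beta> assume \<beta>: "multilinear U ground \<beta>"
 show "zin_product U (tensor (tensor_module U) (tensor_module U) (pure U fs) (pure U [g])) \<beta> = pure U (fs @ [g]) \<beta>"
  by (simp add: zin_product_pure[OF U f g \<beta>] Sh_trivial pure_eval[OF \<beta>])
qed

lemma pairing_letter:
 assumes V: "vecsp V" and g: "g \<in> elems (dual V)" and y: "y \<in> elems (tensor_module (susp V))"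
 shows "pairing (pure (desusp (dual V)) [g]) y = g (proj1 (susp V) y)"
proof -
 have vS: "vecsp (susp V)" using V by simp
 have gw: "[g] \<in> words (dual V)" using g by (simp add: words_def)
 have "pure (desusp (dual V)) [g] \<in> elems (tensor_module (desusp (dual V)))" by (rule pure_in) (use gw in simp_all)
 note l = lform_pairing_right[OF V this]
 have r: "lform (tensor_module (susp V)) (\<lambda>y. g (proj1 (susp V) y))"
  by (rule lm_comp[OF lm_proj1[OF vS]]) (use elems_dual(1)[OF V g] in simp)
 show ?thesis
 proof (rule tmod_eq[OF vS l r _ y])
  fix ds vs assume h: "homogeneous (susp V) ds vs"
  note w = homogeneous_words[OF vS h]
  show "pairing (pure (desusp (dual V)) [g]) (pure (susp V) vs) = g (proj1 (susp V) (pure (susp V) vs))"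
   unfolding pairing_pure[OF V gw] proj1_pure[OF vS w]
  proof (cases vs)
   case (Cons a as)
   then show "word_pairing [g] vs = g (if length vs = 1 then hd vs else 0)"
    using lm_0[OF V elems_dual(1)[OF V g]] by (simp add: word_pairing_def)
  qed (use w in \<open>simp add: words_def\<close>)
 qed
qed

text \<open>A multilinear map truncated to long words is still multilinear, and homogeneous words suffice.\<close>

lemma long_words_vanish:
 assumes V: "vecsp V" and W: "vecsp W" and ml: "multilinear V W \<phi>"
  and zero: "\<And>ds vs. homogeneous V ds vs ==> N < length vs ==> \<phi> vs = 0"
 shows "finitely_many_components V \<phi>"
 unfolding finitely_many_components_def
proof (intro exI ballI impI)
 fix vs assume w: "vs \<in> words V" and n: "N < length vs"
 have "multilinear V W (\<lambda>vs. if N < n then \<phi> vs else 0)" for n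
  using ml ml_zeroI[OF V W] by (cases "N < n") simp_all
 from ml_length[OF this] have "multilinear V W (\<lambda>vs. if N < length vs then \<phi> vs else 0)" .
 from ml_eq[OF V this ml_zeroI[OF V W] _ w] have "(if N < length vs then \<phi> vs else 0) = 0" using zero by simp
 then show "\<phi> vs = 0" using n by simp
qed

lemma finitely_many_iff:
 fixes V :: "('k::field, 'v::ab_group_add) graded_space" and W :: "('k, 'w::ab_group_add) graded_space"
 assumes V: "graded_vector_space V" and W: "graded_vector_space W"
  and F: "linear_map (tensor_module (susp V)) (tensor_module (susp W)) F"
 shows "finitely_many_components V (desusp_corestrictions V W F) \<longleftrightarrow>
  (\<exists>N. \<forall>ds vs. homogeneous (susp V) ds vs \<longrightarrow> N < length vs \<longrightarrow> proj1 (susp W) (F (pure (susp V) vs)) = 0)"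
proof
 have vV: "vecsp V" and vW: "vecsp W" using V W graded_vs by auto
 interpret W: vector_space "smult W" by (rule vW)
 let ?dc = "desusp_corestrictions V W F"
 have ml: "multilinear V W ?dc" by (rule multilinear_desusp_corestrictions[OF V vW F])
 {
  assume "finitely_many_components V ?dc"
  then obtain N where N: "\<And>vs. vs \<in> words V ==> N < length vs ==> ?dc vs = 0"
   unfolding finitely_many_components_def by blast
  have "proj1 (susp W) (F (pure (susp V) vs)) = 0" if h: "homogeneous (susp V) ds vs" and n: "N < length vs" for ds vs
  proof -
   have "ds = map (\<lambda>d. d + 1) (map (\<lambda>d. d - 1) ds)" by (simp add: map_idI)
   with h have h': "homogeneous V (map (\<lambda>d. d - 1) ds) vs" using homogeneous_susp[of V "map (\<lambda>d. d - 1) ds" vs] by simp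
   have "smult W (susp_sign (map (\<lambda>d. d - 1) ds)) (proj1 (susp W) (F (pure (susp V) vs))) = 0"
    using N[OF homogeneous_words[OF vV h'] n] desusp_corestrictions_homogeneous[OF V vW F h'] by simp
   then show ?thesis by simp
  qed
  then show "\<exists>N. \<forall>ds vs. homogeneous (susp V) ds vs \<longrightarrow> N < length vs \<longrightarrow> proj1 (susp W) (F (pure (susp V) vs)) = 0"
   by blast
 }
 assume "\<exists>N. \<forall>ds vs. homogeneous (susp V) ds vs \<longrightarrow> N < length vs \<longrightarrow> proj1 (susp W) (F (pure (susp V) vs)) = 0"
 then obtain N where N: "\<And>ds vs. homogeneous (susp V) ds vs ==> N < length vs ==> proj1 (susp W) (F (pure (susp V) vs)) = 0" by blast
 have "?dc vs = 0" if h: "homogeneous V ds vs" "N < length vs" for ds vs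
  using desusp_corestrictions_homogeneous[OF V vW F h(1)] N[of "map (\<lambda>d. d + 1) ds" vs] h homogeneous_susp[of V ds vs] by simp
 then show "finitely_many_components V ?dc" by (rule long_words_vanish[OF vV vW ml])
qed

subsection \<open>Transposition\<close>

text \<open>The differentials on the two sides correspond to each other through the pairing.\<close>

locale transpose_setting = X: finite_dual V Bs deg + Y: finite_dual W Bs' deg' + P: cofree_pair "susp V" "susp W"
 for V :: "('k::field, 'v::ab_group_add) graded_space" and Bs deg
  and W :: "('k, 'w::ab_group_add) graded_space" and Bs' deg' +
 fixes D E d e
 assumes D_in: "x \<in> elems X.C ==> D x \<in> elems X.C" and E_in: "y \<in> elems Y.C ==> E y \<in> elems Y.C"
  and d_in: "\<omega> \<in> elems X.B ==> d \<omega> \<in> elems X.B" and e_in: "\<omega>' \<in> elems Y.B ==> e \<omega>' \<in> elems Y.B"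
  and dual_d: "\<omega> \<in> elems X.B ==> x \<in> elems X.C ==> pairing \<omega> (D x) = pairing (d \<omega>) x"
  and dual_e: "\<omega>' \<in> elems Y.B ==> y \<in> elems Y.C ==> pairing \<omega>' (E y) = pairing (e \<omega>') y"
begin

abbreviation "mV \<equiv> zin_product (desusp (dual V))"
abbreviation "mW \<equiv> zin_product (desusp (dual W))"
abbreviation "algebra_morphisms \<equiv> dg_algebra_morphisms Y.B mW e X.B mV d"
abbreviation "coalgebra_morphisms \<equiv> dg_coalgebra_morphisms X.C P.S.\<Delta> D Y.C P.R.\<Delta> E"

definition algebra_map :: "(((('w => 'k) list => 'k) => 'k) => (('v => 'k) list => 'k) => 'k) => bool" where
 "algebra_map f \<longleftrightarrow> (\<forall>\<omega>\<in>elems Y.B. \<forall>\<omega>'\<in>elems Y.B. f (mW (tensor Y.B Y.B \<omega> \<omega>')) = mV (tensor X.B X.B (f \<omega>) (f \<omega>')))"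

lemma lm_mV: "linear_map (tensor_space X.B X.B) X.B mV" and lm_mW: "linear_map (tensor_space Y.B Y.B) Y.B mW"
 by (rule lm_zin_product[OF X.gD], rule lm_zin_product[OF Y.gD])

lemma algebra_map_iff:
 assumes f: "linear_map Y.B X.B f"
 shows "(\<forall>t\<in>elems (tensor_space Y.B Y.B). f (mW t) = mV (tensor_map Y.B Y.B X.B X.B f 0 f t)) \<longleftrightarrow> algebra_map f"
proof -
 have tm: "tensor_map Y.B Y.B X.B X.B f 0 f (tensor Y.B Y.B \<omega> \<omega>') = tensor X.B X.B (f \<omega>) (f \<omega>')"
  if "\<omega> \<in> elems Y.B" "\<omega>' \<in> elems Y.B" for \<omega> \<omega>'
 proof (rule tens_eqI[OF X.vB X.vB])
  note t = tensor_in[OF Y.vB Y.vB that]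
  show "tensor_map Y.B Y.B X.B X.B f 0 f (tensor Y.B Y.B \<omega> \<omega>') \<in> elems (tensor_space X.B X.B)"
   by (rule lm_in[OF lm_tensor_map_0[OF Y.vB Y.vB X.vB X.vB f f] t])
  show "tensor X.B X.B (f \<omega>) (f \<omega>') \<in> elems (tensor_space X.B X.B)"
   by (rule tensor_in[OF X.vB X.vB lm_in[OF f that(1)] lm_in[OF f that(2)]])
  fix \<beta> assume \<beta>: "bilinear_form X.B X.B \<beta>"
  show "tensor_map Y.B Y.B X.B X.B f 0 f (tensor Y.B Y.B \<omega> \<omega>') \<beta> = tensor X.B X.B (f \<omega>) (f \<omega>') \<beta>"
   unfolding tensor_map_0_apply[OF Y.vB Y.vB X.vB X.vB f f t \<beta>] tensor_eval[OF \<beta>] by (rule tensor_eval[OF bf_comp[OF \<beta> f f]])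
 qed
 show ?thesis
 proof
  assume all: "\<forall>t\<in>elems (tensor_space Y.B Y.B). f (mW t) = mV (tensor_map Y.B Y.B X.B X.B f 0 f t)"
  show "algebra_map f"
   unfolding algebra_map_def
  proof (intro ballI)
   fix \<omega> \<omega>' assume w: "\<omega> \<in> elems Y.B" "\<omega>' \<in> elems Y.B"
   show "f (mW (tensor Y.B Y.B \<omega> \<omega>')) = mV (tensor X.B X.B (f \<omega>) (f \<omega>'))"
    using bspec[OF all tensor_in[OF Y.vB Y.vB w]] unfolding tm[OF w] .
  qed
 next
  assume a: "algebra_map f"
  show "\<forall>t\<in>elems (tensor_space Y.B Y.B). f (mW t) = mV (tensor_map Y.B Y.B X.B X.B f 0 f t)"
  proof
   fix t assume t: "t \<in> elems (tensor_space Y.B Y.B)"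
   let ?S = "{tensor Y.B Y.B a b | a b p q. a \<in> hcomp Y.B p \<and> b \<in> hcomp Y.B q}"
   show "f (mW t) = mV (tensor_map Y.B Y.B X.B X.B f 0 f t)"
   proof (rule lm_eq_span[OF vs_simps(1) lm_comp[OF lm_mW f]
      lm_comp[OF lm_tensor_map_0[OF Y.vB Y.vB X.vB X.vB f f] lm_mV] _ _ _ t])
    show "?S \<subseteq> elems (tensor_space Y.B Y.B)"
     using tensor_in[OF Y.vB Y.vB hcomp_elems[OF Y.vB] hcomp_elems[OF Y.vB]] by blast
    show "elems (tensor_space Y.B Y.B) \<subseteq> module.span (smult (tensor_space Y.B Y.B)) ?S"
     unfolding elems_tensor[OF Y.vB Y.vB] by simp
    fix s assume "s \<in> ?S"
    then obtain a b p q where s: "s = tensor Y.B Y.B a b" and h: "a \<in> hcomp Y.B p" "b \<in> hcomp Y.B q" by blast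
    note ab = hcomp_elems[OF Y.vB h(1)] hcomp_elems[OF Y.vB h(2)]
    show "f (mW s) = mV (tensor_map Y.B Y.B X.B X.B f 0 f s)"
     unfolding s tm[OF ab] by (rule bspec[OF bspec[OF a[unfolded algebra_map_def] ab(1)] ab(2)])
   qed
  qed
 qed
qed

lemma algebra_morphism_iff:
 "f \<in> algebra_morphisms \<longleftrightarrow>
  f \<in> extensional (elems Y.B) \<and> graded_map Y.B X.B 0 f \<and> algebra_map f \<and> (\<forall>\<omega>\<in>elems Y.B. f (e \<omega>) = d (f \<omega>))"
 unfolding dg_algebra_morphisms_def mem_Collect_eq
 using algebra_map_iff[of f] by (auto simp: graded_map_def)

lemma coalgebra_morphism_iff:
 "F \<in> coalgebra_morphisms \<longleftrightarrow>
  F \<in> extensional (elems X.C) \<and> graded_map X.C Y.C 0 F \<and> P.coalgebra_map F \<and> (\<forall>x\<in>elems X.C. F (D x) = E (F x))"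
 unfolding dg_coalgebra_morphisms_def mem_Collect_eq
 using P.coalgebra_map_iff[of F] by (auto simp: graded_map_def)

definition adjoints where
 "adjoints f F \<longleftrightarrow> graded_map Y.B X.B 0 f \<and> graded_map X.C Y.C 0 F \<and>
  (\<forall>x\<in>elems X.C. \<forall>\<omega>\<in>elems Y.B. pairing \<omega> (F x) = pairing (f \<omega>) x)"

lemma adjointsD:
 assumes "adjoints f F"
 shows "linear_map Y.B X.B f" "linear_map X.C Y.C F"
  "x \<in> elems X.C ==> \<omega> \<in> elems Y.B ==> pairing \<omega> (F x) = pairing (f \<omega>) x"
 using assms by (auto simp: adjoints_def graded_map_def)

text \<open>All four identities become identities of scalars after pairing with arbitrary elements, which loses
 nothing because the pairings are nondegenerate, also on the tensor square.\<close>

lemma algebra_coalgebra_adjoint: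
 assumes "adjoints f F"
 shows "algebra_map f \<longleftrightarrow> P.coalgebra_map F"
  and "(\<forall>\<omega>\<in>elems Y.B. f (e \<omega>) = d (f \<omega>)) \<longleftrightarrow> (\<forall>x\<in>elems X.C. F (D x) = E (F x))"
proof -
 note f = adjointsD(1)[OF assms] and F = adjointsD(2)[OF assms] and adj = adjointsD(3)[OF assms]
 have L: "pairing (f (mW (tensor Y.B Y.B \<omega> \<omega>'))) x = P.R.\<Delta> (F x) (\<lambda>a b. pairing \<omega> a * pairing \<omega>' b)"
  if "\<omega> \<in> elems Y.B" "\<omega>' \<in> elems Y.B" "x \<in> elems X.C" for \<omega> \<omega>' x
  using product_coproduct[OF Y.graded that(1,2) lm_in[OF F that(3)]]
   adj[OF that(3) lm_in[OF lm_mW tensor_in[OF Y.vB Y.vB that(1,2)]]] by (rule trans[OF sym, rotated])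
 have R: "pairing (mV (tensor X.B X.B (f \<omega>) (f \<omega>'))) x = P.S.\<Delta> x (\<lambda>a b. pairing \<omega> (F a) * pairing \<omega>' (F b))"
  if "\<omega> \<in> elems Y.B" "\<omega>' \<in> elems Y.B" "x \<in> elems X.C" for \<omega> \<omega>' x
 proof -
  have "pairing (mV (tensor X.B X.B (f \<omega>) (f \<omega>'))) x = P.S.\<Delta> x (\<lambda>a b. pairing (f \<omega>) a * pairing (f \<omega>') b)"
   by (rule product_coproduct[OF X.graded lm_in[OF f that(1)] lm_in[OF f that(2)] that(3)])
  also have "\<dots> = P.S.\<Delta> x (\<lambda>a b. pairing \<omega> (F a) * pairing \<omega>' (F b))"
   by (rule tens_cong[OF X.vC X.vC P.S.\<Delta>_in[OF that(3)]]) (simp only: adj that)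
  finally show ?thesis .
 qed
 have bf: "bilinear_form Y.C Y.C (\<lambda>a b. pairing \<omega> a * pairing \<omega>' b)" if "\<omega> \<in> elems Y.B" "\<omega>' \<in> elems Y.B" for \<omega> \<omega>'
  by (rule bf_times[OF Y.right[OF that(1)] Y.right[OF that(2)]])
 show "algebra_map f \<longleftrightarrow> P.coalgebra_map F"
 proof
  assume a: "algebra_map f"
  show "P.coalgebra_map F"
   unfolding P.coalgebra_map_iff[OF F]
  proof
   fix x assume x: "x \<in> elems X.C"
   show "P.R.\<Delta> (F x) = tensor_map X.C X.C Y.C Y.C F 0 F (P.S.\<Delta> x)"
   proof (rule Y.tensor_nondegenerate)
    show "P.R.\<Delta> (F x) \<in> elems (tensor_space Y.C Y.C)" by (rule P.R.\<Delta>_in[OF lm_in[OF F x]])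
    show "tensor_map X.C X.C Y.C Y.C F 0 F (P.S.\<Delta> x) \<in> elems (tensor_space Y.C Y.C)"
     by (rule lm_in[OF lm_tensor_map_0[OF X.vC X.vC Y.vC Y.vC F F] P.S.\<Delta>_in[OF x]])
    fix \<omega> \<omega>' assume w: "\<omega> \<in> elems Y.B" "\<omega>' \<in> elems Y.B"
    have "f (mW (tensor Y.B Y.B \<omega> \<omega>')) = mV (tensor X.B X.B (f \<omega>) (f \<omega>'))" using a w unfolding algebra_map_def by simp
    then show "P.R.\<Delta> (F x) (\<lambda>a b. pairing \<omega> a * pairing \<omega>' b) =
      tensor_map X.C X.C Y.C Y.C F 0 F (P.S.\<Delta> x) (\<lambda>a b. pairing \<omega> a * pairing \<omega>' b)"
     unfolding tensor_map_0_apply[OF X.vC X.vC Y.vC Y.vC F F P.S.\<Delta>_in[OF x] bf[OF w]] L[OF w x, symmetric] R[OF w x, symmetric]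
     by simp
   qed
  qed
 next
  assume c: "P.coalgebra_map F"
  show "algebra_map f"
   unfolding algebra_map_def
  proof (intro ballI)
   fix \<omega> \<omega>' assume w: "\<omega> \<in> elems Y.B" "\<omega>' \<in> elems Y.B"
   show "f (mW (tensor Y.B Y.B \<omega> \<omega>')) = mV (tensor X.B X.B (f \<omega>) (f \<omega>'))"
   proof (rule dual_bases.nondegenerate[OF X.swapped])
    show "f (mW (tensor Y.B Y.B \<omega> \<omega>')) \<in> elems X.B"
     by (rule lm_in[OF f lm_in[OF lm_mW tensor_in[OF Y.vB Y.vB w]]])
    show "mV (tensor X.B X.B (f \<omega>) (f \<omega>')) \<in> elems X.B"
     by (rule lm_in[OF lm_mV tensor_in[OF X.vB X.vB lm_in[OF f w(1)] lm_in[OF f w(2)]]])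
    show "pairing (f (mW (tensor Y.B Y.B \<omega> \<omega>'))) x = pairing (mV (tensor X.B X.B (f \<omega>) (f \<omega>'))) x" if "x \<in> elems X.C" for x
     unfolding L[OF w that] R[OF w that] by (rule P.coalgebra_mapD[OF c that bf[OF w]])
   qed
  qed
 qed
 have eq: "pairing (f (e \<omega>)) x = pairing \<omega> (E (F x))" "pairing (d (f \<omega>)) x = pairing \<omega> (F (D x))"
  if "\<omega> \<in> elems Y.B" "x \<in> elems X.C" for \<omega> x
  using adj[OF that(2) e_in[OF that(1)]] dual_e[OF that(1) lm_in[OF F that(2)]]
   adj[OF D_in[OF that(2)] that(1)] dual_d[OF lm_in[OF f that(1)] that(2)] by simp_all
 show "(\<forall>\<omega>\<in>elems Y.B. f (e \<omega>) = d (f \<omega>)) \<longleftrightarrow> (\<forall>x\<in>elems X.C. F (D x) = E (F x))"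
 proof (intro iffI ballI)
  fix x assume a: "\<forall>\<omega>\<in>elems Y.B. f (e \<omega>) = d (f \<omega>)" and x: "x \<in> elems X.C"
  show "F (D x) = E (F x)"
   by (rule Y.nondegenerate[OF lm_in[OF F D_in[OF x]] E_in[OF lm_in[OF F x]]])
    (use eq[OF _ x] a in simp)
 next
  fix \<omega> assume a: "\<forall>x\<in>elems X.C. F (D x) = E (F x)" and w: "\<omega> \<in> elems Y.B"
  show "f (e \<omega>) = d (f \<omega>)"
   by (rule dual_bases.nondegenerate[OF X.swapped lm_in[OF f e_in[OF w]] d_in[OF lm_in[OF f w]]])
    (use eq[OF w] a in simp)
 qed
qed

lemma transpose_adjoint:
 assumes a: "adjoints f F" and x: "x \<in> elems X.C"
 shows "transpose_map V W f x = F x"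
proof -
 note F = adjointsD(2)[OF a] and adj = adjointsD(3)[OF a]
 have "(THE y. y \<in> elems Y.C \<and> (\<forall>\<omega>\<in>elems Y.B. pairing \<omega> y = pairing (f \<omega>) x)) = F x"
 proof (rule the_equality)
  show "F x \<in> elems Y.C \<and> (\<forall>\<omega>\<in>elems Y.B. pairing \<omega> (F x) = pairing (f \<omega>) x)" using lm_in[OF F x] adj[OF x] by simp
  fix y assume "y \<in> elems Y.C \<and> (\<forall>\<omega>\<in>elems Y.B. pairing \<omega> y = pairing (f \<omega>) x)"
  then show "y = F x" using Y.nondegenerate[of y "F x"] lm_in[OF F x] adj[OF x] by simp
 qed
 then show ?thesis using x by (simp add: transpose_map_def)
qed

text \<open>Peel off the last letter of \<open>fs\<close>: the product becomes a coproduct of \<open>vs\<close> whose first factor is too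
 short for the induction hypothesis to leave anything.\<close>

lemma algebra_map_short:
 assumes f: "linear_map Y.B X.B f" and a: "algebra_map f"
  and "homogeneous (desusp (dual W)) cs fs" "homogeneous (susp V) ds vs" "length vs < length fs"
 shows "pairing (f (pure (desusp (dual W)) fs)) (pure (susp V) vs) = 0"
 using assms(3-5)
proof (induct fs arbitrary: cs ds vs rule: rev_induct)
 case Nil then show ?case by simp
next
 case (snoc g fs)
 let ?D = "desusp (dual W)" and ?U = "susp V"
 have vD: "vecsp ?D" by simp
 note h = snoc(3)
 show ?case
 proof (cases "fs = []")
  case True then show ?thesis using snoc(4) h by (simp add: homogeneous_def)
 next
  case False
  from snoc(2) have l: "length cs = Suc (length fs)" using homogeneous_length by fastforce
  have h1: "homogeneous ?D (take (length fs) cs) fs" using homogeneous_take[OF snoc(2), of "length fs"] False by simp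
  have h2: "homogeneous ?D [cs ! length fs] [g]"
   using snoc(2) l by (auto simp: homogeneous_nth simp del: hcomp_simps)
  have p1: "pure ?D fs \<in> elems Y.B" and p2: "pure ?D [g] \<in> elems Y.B"
   by (rule pure_in[OF vD homogeneous_words[OF vD h1]], rule pure_in[OF vD homogeneous_words[OF vD h2]])
  note f1 = X.right[OF lm_in[OF f p1]] and f2 = X.right[OF lm_in[OF f p2]]
  have px: "pure ?U vs \<in> elems X.C" by (rule P.S.pure_T[OF h])
  have "f (pure ?D (fs @ [g])) = mV (tensor X.B X.B (f (pure ?D fs)) (f (pure ?D [g])))"
   using a p1 p2 unfolding algebra_map_def by (simp add: zin_product_snoc[OF Y.gD h1 h2, symmetric])
  then have "pairing (f (pure ?D (fs @ [g]))) (pure ?U vs) =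
    P.S.\<Delta> (pure ?U vs) (\<lambda>a b. pairing (f (pure ?D fs)) a * pairing (f (pure ?D [g])) b)"
   using product_coproduct[OF X.graded lm_in[OF f p1] lm_in[OF f p2] px] by simp
  also have "\<dots> = P.S.\<Delta> (pure ?U vs) (\<lambda>a b. 0)"
  proof (rule P.S.coproduct_cong[OF h bf_times[OF f1 f2]])
   show "bilinear_form X.C X.C (\<lambda>a b. 0)" by (simp add: bilinear_form_def lform_iff)
   fix cs' us es' ws assume u: "homogeneous ?U cs' us" "homogeneous ?U es' ws" and len: "length us + length ws = length vs"
   have "0 < length ws" using u(2) by (simp add: homogeneous_def)
   moreover have "length vs < length fs + 1" using snoc(4) by simp
   ultimately have "length us < length fs" using len by linarith
   from snoc(1)[OF h1 u(1) this]
   show "pairing (f (pure ?D fs)) (pure ?U us) * pairing (f (pure ?D [g])) (pure ?U ws) = 0" by simp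
  qed
  also have "\<dots> = 0" using zin_coproduct_pure[OF P.S.graded h, of "\<lambda>a b. 0"] by (simp add: bilinear_form_def lform_iff)
  finally show ?thesis .
 qed
qed

text \<open>As before, but now a letter of \<open>fs\<close> can absorb up to \<open>N\<close> letters of \<open>vs\<close>.\<close>

lemma coalgebra_map_short:
 assumes F: "P.coalgebra_map F"
  and N: "\<And>ds vs. homogeneous (susp V) ds vs ==> N < length vs ==> P.R.\<pi> (F (pure (susp V) vs)) = 0"
  and "homogeneous (desusp (dual W)) cs fs" "homogeneous (susp V) ds vs" "N * length fs < length vs"
 shows "pairing (pure (desusp (dual W)) fs) (F (pure (susp V) vs)) = 0"
 using assms(3-5)
proof (induct fs arbitrary: cs ds vs rule: rev_induct)
 case Nil then show ?case by (simp add: homogeneous_def)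
next
 case (snoc g fs)
 let ?D = "desusp (dual W)" and ?U = "susp V"
 note lF = P.coalgebra_map_lm[OF F]
 have vD: "vecsp ?D" by simp
 note h = snoc(3)
 have px: "pure ?U vs \<in> elems X.C" by (rule P.S.pure_T[OF h])
 from snoc(2) have l: "length cs = Suc (length fs)" using homogeneous_length by fastforce
 have h2: "homogeneous ?D [cs ! length fs] [g]"
  using snoc(2) l by (auto simp: homogeneous_nth simp del: hcomp_simps)
 have g: "g \<in> elems (dual W)" using homogeneous_words[OF vD h2] by (simp add: words_def)
 have letter: "pairing (pure ?D [g]) (F (pure ?U ws)) = 0" if "homogeneous ?U es ws" "N < length ws" for es ws
  using pairing_letter[OF Y.vV g lm_in[OF lF P.S.pure_T[OF that(1)]]] N[OF that] lm_0[OF Y.vV elems_dual(1)[OF Y.vV g]] by simp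
 show ?case
 proof (cases "fs = []")
  case True then show ?thesis using letter[OF h] snoc(4) by simp
 next
  case False
  have h1: "homogeneous ?D (take (length fs) cs) fs" using homogeneous_take[OF snoc(2), of "length fs"] False by simp
  have p1: "pure ?D fs \<in> elems Y.B" and p2: "pure ?D [g] \<in> elems Y.B"
   by (rule pure_in[OF vD homogeneous_words[OF vD h1]], rule pure_in[OF vD homogeneous_words[OF vD h2]])
  note bf = bf_times[OF Y.right[OF p1] Y.right[OF p2]]
  have "pairing (pure ?D (fs @ [g])) (F (pure ?U vs)) =
    P.R.\<Delta> (F (pure ?U vs)) (\<lambda>a b. pairing (pure ?D fs) a * pairing (pure ?D [g]) b)"
   unfolding zin_product_snoc[OF Y.gD h1 h2, symmetric] by (rule product_coproduct[OF Y.graded p1 p2 lm_in[OF lF px]])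
  also have "\<dots> = P.S.\<Delta> (pure ?U vs) (\<lambda>a b. pairing (pure ?D fs) (F a) * pairing (pure ?D [g]) (F b))"
   by (rule P.coalgebra_mapD[OF F px bf])
  also have "\<dots> = P.S.\<Delta> (pure ?U vs) (\<lambda>a b. 0)"
  proof (rule P.S.coproduct_cong[OF h bf_comp[OF bf lF lF]])
   show "bilinear_form X.C X.C (\<lambda>a b. 0)" by (simp add: bilinear_form_def lform_iff)
   fix cs' us es' ws assume u: "homogeneous ?U cs' us" "homogeneous ?U es' ws" and len: "length us + length ws = length vs"
   have "N * length fs < length us \<or> N < length ws" using len snoc(4) by (simp add: algebra_simps) linarith
   then show "pairing (pure ?D fs) (F (pure ?U us)) * pairing (pure ?D [g]) (F (pure ?U ws)) = 0"
    using snoc(1)[OF h1 u(1)] letter[OF u(2)] by auto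
  qed
  also have "\<dots> = 0" using zin_coproduct_pure[OF P.S.graded h, of "\<lambda>a b. 0"] by (simp add: bilinear_form_def lform_iff)
  finally show ?thesis .
 qed
qed

lemma finite_short_words: "finite S ==> finite {bs \<in> {bs. bs \<noteq> [] \<and> set bs \<subseteq> S}. length bs \<le> K}"
 by (rule finite_subset[OF _ finite_lists_length_le[of S K]]) auto

text \<open>The transpose of \<open>f\<close> exists by \<open>algebra_map_short\<close>; it has finitely many components because each of the
 finitely many dual basis vectors has an image of bounded length.  Conversely \<open>coalgebra_map_short\<close>
 provides the adjoint of a coalgebra morphism with finitely many components.\<close>

theorem transpose_bijection:
 "bij_betw (transpose_map V W) algebra_morphisms
  {F \<in> coalgebra_morphisms. \<exists>N. \<forall>ds vs. homogeneous (susp V) ds vs \<longrightarrow> N < length vs \<longrightarrow> P.R.\<pi> (F (pure (susp V) vs)) = 0}"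
  (is "bij_betw _ _ {F \<in> _. ?short F}")
proof -
 let ?D = "desusp (dual W)" and ?U = "susp V"
 have vD: "vecsp ?D" "vecsp (desusp (dual V))" and vU: "vecsp ?U" using X.vV by simp_all
 have ex: "adjoints f (transpose_map V W f) \<and> ?short (transpose_map V W f)" if f: "f \<in> algebra_morphisms" for f
 proof -
  have gf: "graded_map Y.B X.B 0 f" and am: "algebra_map f" using f by (simp_all add: algebra_morphism_iff)
  have lf: "linear_map Y.B X.B f" using gf by (simp add: graded_map_def)
  have fin: "finite {bs \<in> {bs. bs \<noteq> [] \<and> set bs \<subseteq> Bs'}. pairing (f (pure ?D (map Y.star bs))) x \<noteq> 0}" if x: "x \<in> elems X.C" for x
  proof -
   from vU x have "\<exists>K. \<forall>cs fs. homogeneous ?D cs fs \<longrightarrow> K < length fs \<longrightarrow> pairing (f (pure ?D fs)) x = 0"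
   proof (induct rule: tmod_induct)
    case zero
    have "pairing (f (pure ?D fs)) (\<lambda>_. 0) = 0" if "homogeneous ?D cs fs" for cs fs
     by (rule lm_zero_fun[OF vs_simps(2) X.right[OF lm_in[OF lf pure_in[OF vD(1) homogeneous_words[OF vD(1) that]]]]])
    then show ?case by blast
   next
    case (step c ds vs x)
    then obtain K where K: "\<And>cs fs. homogeneous ?D cs fs ==> K < length fs ==> pairing (f (pure ?D fs)) x = 0" by blast
    have "pairing (f (pure ?D fs)) (\<lambda>\<beta>. c * pure ?U vs \<beta> + x \<beta>) = 0"
     if hf: "homogeneous ?D cs fs" and len: "max K (length vs) < length fs" for cs fs
    proof -
     note r = X.right[OF lm_in[OF lf pure_in[OF vD(1) homogeneous_words[OF vD(1) hf]]]]
     note pv = P.S.pure_T[OF step(1)]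
     have eq: "(\<lambda>\<beta>. c * pure ?U vs \<beta> + x \<beta>) = smult X.C c (pure ?U vs) + x" by (simp add: plus_fun_def)
     show ?thesis
      unfolding eq lm_add[OF r elems_smult[OF vs_simps(2) pv] step(2)] lm_smult[OF r pv]
      using K[OF hf] algebra_map_short[OF lf am hf step(1)] len by simp
    qed
    then show ?case by blast
   qed
   then obtain K where K: "\<And>cs fs. homogeneous ?D cs fs ==> K < length fs ==> pairing (f (pure ?D fs)) x = 0" by blast
   show ?thesis
   proof (rule finite_subset[OF _ finite_short_words[OF Y.finite_Bs, of K]], rule subsetI)
    fix bs assume b: "bs \<in> {bs \<in> {bs. bs \<noteq> [] \<and> set bs \<subseteq> Bs'}. pairing (f (pure ?D (map Y.star bs))) x \<noteq> 0}"
    then have "\<not> K < length bs" using K[OF Y.basis_word_homogeneous(2), of bs] by auto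
    then show "bs \<in> {bs \<in> {bs. bs \<noteq> [] \<and> set bs \<subseteq> Bs'}. length bs \<le> K}" using b by simp
   qed
  qed
  have "\<exists>F0. graded_map X.C Y.C 0 F0 \<and> (\<forall>x\<in>elems X.C. \<forall>\<omega>\<in>elems Y.B. pairing \<omega> (F0 x) = pairing (f \<omega>) x)"
   by (rule adjoint[OF X.dual_bases_axioms Y.dual_bases_axioms gf]) (rule fin)
  then obtain F0 where F0: "graded_map X.C Y.C 0 F0" "\<forall>x\<in>elems X.C. \<forall>\<omega>\<in>elems Y.B. pairing \<omega> (F0 x) = pairing (f \<omega>) x"
   by (elim exE conjE)
  have a0: "adjoints f F0" using gf F0 by (simp add: adjoints_def)
  let ?F = "transpose_map V W f"
  have t: "?F x = F0 x" if "x \<in> elems X.C" for x by (rule transpose_adjoint[OF a0 that])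
  have gF: "graded_map X.C Y.C 0 ?F"
   using F0(1) lm_cong[OF X.vC t] t[OF hcomp_elems[OF X.vC]] by (simp add: graded_map_def)
  have a: "adjoints f ?F" using gf gF F0(2) t by (simp add: adjoints_def)
  note lF = adjointsD(2)[OF a]
  have "\<exists>M. \<forall>ds vs. homogeneous ?U ds vs \<longrightarrow> M < length vs \<longrightarrow> pairing \<omega> (pure ?U vs) = 0" if "\<omega> \<in> elems X.B" for \<omega>
   using vD(2) that
  proof (induct rule: tmod_induct)
   case zero show ?case by (simp add: pairing_def)
  next
   case (step c cs fs \<omega>)
   then obtain K where K: "\<And>ds vs. homogeneous ?U ds vs ==> K < length vs ==> pairing \<omega> (pure ?U vs) = 0" by blast
   have fw: "fs \<in> words (dual V)" using homogeneous_words[OF vD(2) step(1)] by simp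
   have "pairing (\<lambda>\<beta>. c * pure (desusp (dual V)) fs \<beta> + \<omega> \<beta>) (pure ?U vs) = 0"
    if "homogeneous ?U ds vs" "max K (length fs) < length vs" for ds vs
   proof -
    have "pairing (\<lambda>\<beta>. c * pure (desusp (dual V)) fs \<beta> + \<omega> \<beta>) (pure ?U vs) = c * word_pairing fs vs + pairing \<omega> (pure ?U vs)"
     using pairing_pure[OF X.vV fw, of vs] by (simp add: pairing_def)
    then show ?thesis using K[OF that(1)] that(2) by (simp add: word_pairing_def)
   qed
   then show ?case by blast
  qed
  then have "\<forall>b\<in>Bs'. \<exists>M. \<forall>ds vs. homogeneous ?U ds vs \<longrightarrow> M < length vs \<longrightarrow> pairing (f (pure ?D [Y.star b])) (pure ?U vs) = 0"
   using lm_in[OF lf pure_in[OF vD(1)]] Y.star_elems by (simp add: words_def)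
  from bchoice[OF this] obtain M where M: "\<forall>b\<in>Bs'. \<forall>ds vs. homogeneous ?U ds vs \<longrightarrow> M b < length vs \<longrightarrow>
    pairing (f (pure ?D [Y.star b])) (pure ?U vs) = 0" ..
  have "P.R.\<pi> (?F (pure ?U vs)) = 0" if h: "homogeneous ?U ds vs" and len: "Max (insert 0 (M ` Bs')) < length vs" for ds vs
  proof -
   interpret W: vector_space "smult W" by (rule Y.vV)
   note pv = P.S.pure_T[OF h]
   let ?y = "P.R.\<pi> (?F (pure ?U vs))"
   have y: "?y \<in> elems W" using lm_in[OF P.R.lm_\<pi> lm_in[OF lF pv]] by simp
   have "Y.star b ?y = 0" if b: "b \<in> Bs'" for b
   proof -
    have "M b \<le> Max (insert 0 (M ` Bs'))" by (rule Max_ge) (use b Y.finite_Bs in auto)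
    then have "pairing (f (pure ?D [Y.star b])) (pure ?U vs) = 0" using M b h len by (meson le_less_trans)
    moreover have "pure ?D [Y.star b] \<in> elems Y.B" by (rule pure_in[OF vD(1)]) (use Y.star_elems[OF b] in \<open>simp add: words_def\<close>)
    ultimately have "pairing (pure ?D [Y.star b]) (?F (pure ?U vs)) = 0" using adjointsD(3)[OF a pv] by simp
    then show ?thesis using pairing_letter[OF Y.vV Y.star_elems[OF b] lm_in[OF lF pv]] by simp
   qed
   then have "(\<Sum>b\<in>Bs'. smult W (Y.star b ?y) b) = 0" by simp
   then show ?thesis using Y.basis_expansion[OF y] by simp
  qed
  then show ?thesis using a by blast
 qed
 have into: "transpose_map V W f \<in> coalgebra_morphisms \<and> ?short (transpose_map V W f)" if f: "f \<in> algebra_morphisms" for f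
  using ex[OF f] f algebra_coalgebra_adjoint[OF conjunct1[OF ex[OF f]]] unfolding algebra_morphism_iff coalgebra_morphism_iff
  by (simp add: adjoints_def transpose_map_def)
 have inj: "f = g" if f: "f \<in> algebra_morphisms" and g: "g \<in> algebra_morphisms" and eq: "transpose_map V W f = transpose_map V W g" for f g
 proof (rule extensionalityI)
  show "f \<in> extensional (elems Y.B)" "g \<in> extensional (elems Y.B)" using f g by (simp_all add: algebra_morphism_iff)
  note af = conjunct1[OF ex[OF f]] and ag = conjunct1[OF ex[OF g]]
  fix \<omega> assume w: "\<omega> \<in> elems Y.B"
  show "f \<omega> = g \<omega>"
  proof (rule dual_bases.nondegenerate[OF X.swapped lm_in[OF adjointsD(1)[OF af] w] lm_in[OF adjointsD(1)[OF ag] w]])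
   show "pairing (f \<omega>) x = pairing (g \<omega>) x" if "x \<in> elems X.C" for x
    using adjointsD(3)[OF af that w] adjointsD(3)[OF ag that w] eq by simp
  qed
 qed
 have onto: "\<exists>f\<in>algebra_morphisms. F = transpose_map V W f" if F: "F \<in> coalgebra_morphisms" and short: "?short F" for F
 proof -
  have gF: "graded_map X.C Y.C 0 F" and cF: "P.coalgebra_map F" and eF: "F \<in> extensional (elems X.C)"
   using F by (simp_all add: coalgebra_morphism_iff)
  have lF: "linear_map X.C Y.C F" using gF by (simp add: graded_map_def)
  from short obtain N where N: "\<And>ds vs. homogeneous ?U ds vs ==> N < length vs ==> P.R.\<pi> (F (pure ?U vs)) = 0" by blast
  have fin: "finite {bs \<in> {bs. bs \<noteq> [] \<and> set bs \<subseteq> Bs}. pairing \<omega> (F (pure ?U bs)) \<noteq> 0}" if w: "\<omega> \<in> elems Y.B" for \<omega>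
  proof -
   from vD(1) w have "\<exists>K. \<forall>ds vs. homogeneous ?U ds vs \<longrightarrow> K < length vs \<longrightarrow> pairing \<omega> (F (pure ?U vs)) = 0"
   proof (induct rule: tmod_induct)
    case zero show ?case by (simp add: pairing_def)
   next
    case (step c cs fs \<omega>)
    then obtain K where K: "\<And>ds vs. homogeneous ?U ds vs ==> K < length vs ==> pairing \<omega> (F (pure ?U vs)) = 0" by blast
    have "pairing (\<lambda>\<beta>. c * pure ?D fs \<beta> + \<omega> \<beta>) (F (pure ?U vs)) = 0"
     if h: "homogeneous ?U ds vs" and len: "max K (N * length fs) < length vs" for ds vs
    proof -
     have "pairing (\<lambda>\<beta>. c * pure ?D fs \<beta> + \<omega> \<beta>) (F (pure ?U vs)) =
       c * pairing (pure ?D fs) (F (pure ?U vs)) + pairing \<omega> (F (pure ?U vs))" by (simp add: pairing_def)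
     then show ?thesis using K[OF h] coalgebra_map_short[OF cF N step(1) h] len by simp
    qed
    then show ?case by blast
   qed
   then obtain K where K: "\<And>ds vs. homogeneous ?U ds vs ==> K < length vs ==> pairing \<omega> (F (pure ?U vs)) = 0" by blast
   show ?thesis
   proof (rule finite_subset[OF _ finite_short_words[OF X.finite_Bs, of K]], rule subsetI)
    fix bs assume b: "bs \<in> {bs \<in> {bs. bs \<noteq> [] \<and> set bs \<subseteq> Bs}. pairing \<omega> (F (pure ?U bs)) \<noteq> 0}"
    then have "\<not> K < length bs" using K[OF X.basis_word_homogeneous(1), of bs] by auto
    then show "bs \<in> {bs \<in> {bs. bs \<noteq> [] \<and> set bs \<subseteq> Bs}. length bs \<le> K}" using b by simp
   qed
  qed
  have "\<exists>f0. graded_map Y.B X.B 0 f0 \<and> (\<forall>\<omega>\<in>elems Y.B. \<forall>x\<in>elems X.C. pairing (f0 \<omega>) x = pairing \<omega> (F x))"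
   by (rule adjoint[OF Y.swapped X.swapped gF]) (rule fin)
  then obtain f0 where f0: "graded_map Y.B X.B 0 f0" "\<forall>\<omega>\<in>elems Y.B. \<forall>x\<in>elems X.C. pairing (f0 \<omega>) x = pairing \<omega> (F x)"
   by (elim exE conjE)
  let ?f = "\<lambda>\<omega>\<in>elems Y.B. f0 \<omega>"
  have lf: "linear_map Y.B X.B ?f"
   by (subst lm_cong[OF Y.vB, where g = f0]) (use f0(1) in \<open>auto simp: graded_map_def\<close>)
  have gf: "graded_map Y.B X.B 0 ?f"
   using lf f0(1) hcomp_elems[OF Y.vB] unfolding graded_map_def by (auto simp: restrict_def)
  have a: "adjoints ?f F" using gf gF f0(2) by (simp add: adjoints_def)
  have m: "?f \<in> algebra_morphisms"
   using F gf algebra_coalgebra_adjoint[OF a] unfolding algebra_morphism_iff coalgebra_morphism_iff by simp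
  have "F = transpose_map V W ?f"
  proof (rule extensionalityI[OF eF])
   show "transpose_map V W ?f \<in> extensional (elems X.C)" by (simp add: transpose_map_def)
  qed (rule transpose_adjoint[OF a, symmetric])
  then show ?thesis using m by blast
 qed
 show ?thesis unfolding bij_betw_def
  by (intro conjI inj_onI equalityI subsetI) (use inj into onto in blast)+
qed

end

subsection \<open>The correspondences\<close>

lemma bij_betw_restrict: "bij_betw f A B ==> bij_betw f {x \<in> A. Q (f x)} {y \<in> B. Q y}"
 unfolding bij_betw_def inj_on_def by auto

lemma Collect_all: "(\<And>x. x \<in> A ==> Q x) ==> {x \<in> A. Q x} = A"
 by auto

text \<open>The \<open>i\<close>-th component raises degrees by $i - 1$, so on a nonnegatively graded space it lands above the
 top degree of the finite-dimensional target once \<open>i\<close> is large.\<close>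

lemma nonneg_finitely_many:
 assumes V: "graded_vector_space V" "nonneg_graded V" and W: "finite_dual W Bs' deg'"
  and \<phi>: "graded_multilinear V W (\<lambda>i. int i - 1) \<phi>"
 shows "finitely_many_components V \<phi>"
proof -
 interpret Y: finite_dual W Bs' deg' by (rule W)
 interpret W: vector_space "smult W" by (rule Y.vV)
 have vV: "vecsp V" by (rule graded_vs[OF V(1)])
 have ml: "multilinear V W \<phi>" using \<phi> by (simp add: graded_multilinear_def)
 let ?K = "Max (insert 0 (deg' ` Bs'))"
 have big: "x = 0" if "x \<in> hcomp W n" "?K < n" for x n
 proof -
  have "deg' b \<le> ?K" if "b \<in> Bs'" for b by (rule Max_ge) (use that Y.finite_Bs in auto)
  then have none: "{b \<in> Bs'. deg' b = n} = {}" using that(2) by force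
  show ?thesis using Y.hcomp_span[OF that(1)] unfolding none by simp
 qed
 show ?thesis
 proof (rule long_words_vanish[OF vV Y.vV ml])
  fix ds vs assume h: "homogeneous V ds vs" and len: "nat (?K + 1) < length vs"
  show "\<phi> vs = 0"
  proof (cases "\<exists>i<length vs. ds ! i < 0")
   case True
   then obtain i where i: "i < length vs" "ds ! i < 0" by blast
   then have "vs ! i \<in> hcomp V (ds ! i)" using h by (simp add: homogeneous_nth)
   then have "vs ! i = 0" using V(2) i(2) by (simp add: nonneg_graded_def)
   then show ?thesis using ml_0[OF vV ml _ i(1)] homogeneous_words[OF vV h] by (simp add: words_def)
  next
   case False
   have "0 \<le> d" if "d \<in> set ds" for d using that False homogeneous_length[OF h] by (metis in_set_conv_nth not_less)
   then have "0 \<le> sum_list ds" by (rule sum_list_nonneg)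
   then have "?K < sum_list ds + (int (length vs) - 1)" using len by linarith
   moreover have "\<phi> vs \<in> hcomp W (sum_list ds + (int (length vs) - 1))" using \<phi> h unfolding graded_multilinear_def by blast
   ultimately show ?thesis using big by blast
  qed
 qed
qed

lemma algebra_correspondence:
 fixes V :: "('k::field, 'v::ab_group_add) graded_space" and W :: "('k, 'w::ab_group_add) graded_space"
 assumes V: "graded_vector_space V" and W: "graded_vector_space W"
  and fin: "finite_dimensional V" "finite_dimensional W"
  and d: "encoding_differential V l d" and e: "encoding_differential W m e"
 shows "bij_betw (\<lambda>f. desusp_corestrictions V W (transpose_map V W f))
   (dg_algebra_morphisms
    (tensor_module (desusp (dual W))) (zin_product (desusp (dual W))) e
    (tensor_module (desusp (dual V))) (zin_product (desusp (dual V))) d)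
   {\<phi> \<in> leibniz_inf_morphisms V l W m. finitely_many_components V \<phi>}"
  and "nonneg_graded V ==> {\<phi> \<in> leibniz_inf_morphisms V l W m. finitely_many_components V \<phi>} = leibniz_inf_morphisms V l W m"
proof -
 obtain D where D: "encoding_codifferential V l D" and dD: "\<forall>\<omega>\<in>elems (tensor_module (desusp (dual V))).
   \<forall>x\<in>elems (tensor_module (susp V)). pairing \<omega> (D x) = pairing (d \<omega>) x"
  using d unfolding encoding_differential_def by blast
 obtain E where E: "encoding_codifferential W m E" and eE: "\<forall>\<omega>\<in>elems (tensor_module (desusp (dual W))).
   \<forall>x\<in>elems (tensor_module (susp W)). pairing \<omega> (E x) = pairing (e \<omega>) x"
  using e unfolding encoding_differential_def by blast
 have dgD: "dg_zinbiel_coalgebra (tensor_module (susp V)) (zin_coproduct (susp V)) D"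
  and dgE: "dg_zinbiel_coalgebra (tensor_module (susp W)) (zin_coproduct (susp W)) E"
  using D E by (simp_all add: encoding_codifferential_def)
 have dgd: "dg_zinbiel_algebra (tensor_module (desusp (dual V))) (zin_product (desusp (dual V))) d"
  and dge: "dg_zinbiel_algebra (tensor_module (desusp (dual W))) (zin_product (desusp (dual W))) e"
  using d e by (simp_all add: encoding_differential_def)
 have gr: "graded_vector_space (tensor_module (susp V))" "graded_vector_space (tensor_module (susp W))"
  "graded_vector_space (tensor_module (desusp (dual V)))" "graded_vector_space (tensor_module (desusp (dual W)))"
  using dgD dgE dgd dge
  by (simp_all add: dg_zinbiel_coalgebra_def zinbiel_coalgebra_def dg_zinbiel_algebra_def zinbiel_algebra_def)
 obtain Bs deg where FV: "finite_dual V Bs deg" by (rule finite_dual_exists[OF V fin(1) gr(3,1)])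
 obtain Bs' deg' where FW: "finite_dual W Bs' deg'" by (rule finite_dual_exists[OF W fin(2) gr(4,2)])
 have P: "cofree_pair (susp V) (susp W)"
  using dgD dgE graded_susp[OF V] graded_susp[OF W]
  by (simp add: cofree_pair_def cofree_zinbiel_def dg_zinbiel_coalgebra_def)
 interpret T: transpose_setting V Bs deg W Bs' deg' D E d e
 proof (intro transpose_setting.intro FV FW P transpose_setting_axioms.intro)
  show "D x \<in> elems (tensor_module (susp V))" if "x \<in> elems (tensor_module (susp V))" for x
   by (rule lm_in[OF _ that]) (use dgD in \<open>simp add: dg_zinbiel_coalgebra_def graded_map_def\<close>)
  show "E x \<in> elems (tensor_module (susp W))" if "x \<in> elems (tensor_module (susp W))" for x
   by (rule lm_in[OF _ that]) (use dgE in \<open>simp add: dg_zinbiel_coalgebra_def graded_map_def\<close>)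
  show "d \<omega> \<in> elems (tensor_module (desusp (dual V)))" if "\<omega> \<in> elems (tensor_module (desusp (dual V)))" for \<omega>
   by (rule lm_in[OF _ that]) (use dgd in \<open>simp add: dg_zinbiel_algebra_def graded_map_def\<close>)
  show "e \<omega> \<in> elems (tensor_module (desusp (dual W)))" if "\<omega> \<in> elems (tensor_module (desusp (dual W)))" for \<omega>
   by (rule lm_in[OF _ that]) (use dge in \<open>simp add: dg_zinbiel_algebra_def graded_map_def\<close>)
 qed (use dD eE in blast)+
 have coalg: "bij_betw (desusp_corestrictions V W) T.coalgebra_morphisms (leibniz_inf_morphisms V l W m)"
  by (rule coalgebra_correspondence[OF V W D E])
 have "{F \<in> T.coalgebra_morphisms. \<exists>N. \<forall>ds vs. homogeneous (susp V) ds vs \<longrightarrow> N < length vs \<longrightarrow> proj1 (susp W) (F (pure (susp V) vs)) = 0}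
   = {F \<in> T.coalgebra_morphisms. finitely_many_components V (desusp_corestrictions V W F)}"
 proof (rule Collect_cong, rule conj_cong[OF refl])
  fix F assume "F \<in> T.coalgebra_morphisms"
  then have "graded_map (tensor_module (susp V)) (tensor_module (susp W)) 0 F"
   by (simp only: T.coalgebra_morphism_iff)
  then have "linear_map (tensor_module (susp V)) (tensor_module (susp W)) F" by (simp only: graded_map_def)
  from finitely_many_iff[OF V W this]
  show "(\<exists>N. \<forall>ds vs. homogeneous (susp V) ds vs \<longrightarrow> N < length vs \<longrightarrow> proj1 (susp W) (F (pure (susp V) vs)) = 0) =
   finitely_many_components V (desusp_corestrictions V W F)" ..
 qed
 note short = this
 have tr: "bij_betw (transpose_map V W) T.algebra_morphisms
   {F \<in> T.coalgebra_morphisms. finitely_many_components V (desusp_corestrictions V W F)}"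
  using T.transpose_bijection unfolding short .
 have "bij_betw (desusp_corestrictions V W)
   {F \<in> T.coalgebra_morphisms. finitely_many_components V (desusp_corestrictions V W F)}
   {\<phi> \<in> leibniz_inf_morphisms V l W m. finitely_many_components V \<phi>}"
  by (rule bij_betw_restrict[OF coalg])
 from bij_betw_trans[OF tr this]
 show "bij_betw (\<lambda>f. desusp_corestrictions V W (transpose_map V W f)) T.algebra_morphisms
   {\<phi> \<in> leibniz_inf_morphisms V l W m. finitely_many_components V \<phi>}" by (simp only: comp_def)
 assume nonneg: "nonneg_graded V"
 show "{\<phi> \<in> leibniz_inf_morphisms V l W m. finitely_many_components V \<phi>} = leibniz_inf_morphisms V l W m"
 proof (rule Collect_all)
  show "finitely_many_components V \<phi>" if "\<phi> \<in> leibniz_inf_morphisms V l W m" for \<phi>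
   by (rule nonneg_finitely_many[OF V nonneg FW]) (use that in \<open>simp add: leibniz_inf_morphisms_def\<close>)
 qed
qed

theorem theorem5p2p9:
 fixes V :: "('k::field_char_0, 'v::ab_group_add) graded_space"
  and W :: "('k, 'w::ab_group_add) graded_space"
  and l :: "'v list => 'v" and m :: "'w list => 'w"
 assumes "leibniz_inf_algebra V l" and "leibniz_inf_algebra W m"
 shows
  "(\<forall>D E. encoding_codifferential V l D \<and> encoding_codifferential W m E \<longrightarrow>
    bij_betw (desusp_corestrictions V W)
     (dg_coalgebra_morphisms
      (tensor_module (susp V)) (zin_coproduct (susp V)) D
      (tensor_module (susp W)) (zin_coproduct (susp W)) E)
     (leibniz_inf_morphisms V l W m)) \<and>
  (\<forall>d e. finite_dimensional V \<and> finite_dimensional W \<and>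
    encoding_differential V l d \<and> encoding_differential W m e \<longrightarrow>
    bij_betw (\<lambda>f. desusp_corestrictions V W (transpose_map V W f))
     (dg_algebra_morphisms
      (tensor_module (desusp (dual W))) (zin_product (desusp (dual W))) e
      (tensor_module (desusp (dual V))) (zin_product (desusp (dual V))) d)
     {\<phi> \<in> leibniz_inf_morphisms V l W m. finitely_many_components V \<phi>} \<and>
    (nonneg_graded V \<longrightarrow>
    bij_betw (\<lambda>f. desusp_corestrictions V W (transpose_map V W f))
     (dg_algebra_morphisms
      (tensor_module (desusp (dual W))) (zin_product (desusp (dual W))) e
      (tensor_module (desusp (dual V))) (zin_product (desusp (dual V))) d)
     (leibniz_inf_morphisms V l W m)))"
proof (intro conjI allI impI; (elim conjE)?)
 have V: "graded_vector_space V" and W: "graded_vector_space W"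
  using assms by (simp_all add: leibniz_inf_algebra_def)
 note main = algebra_correspondence[OF V W]
 show "bij_betw (desusp_corestrictions V W)
   (dg_coalgebra_morphisms
    (tensor_module (susp V)) (zin_coproduct (susp V)) D
    (tensor_module (susp W)) (zin_coproduct (susp W)) E)
   (leibniz_inf_morphisms V l W m)"
  if "encoding_codifferential V l D" "encoding_codifferential W m E" for D E
  by (rule coalgebra_correspondence[OF V W that])
 fix d e
 assume a: "finite_dimensional V" "finite_dimensional W" "encoding_differential V l d" "encoding_differential W m e"
 show "bij_betw (\<lambda>f. desusp_corestrictions V W (transpose_map V W f))
   (dg_algebra_morphisms
    (tensor_module (desusp (dual W))) (zin_product (desusp (dual W))) e
    (tensor_module (desusp (dual V))) (zin_product (desusp (dual V))) d)
   {\<phi> \<in> leibniz_inf_morphisms V l W m. finitely_many_components V \<phi>}"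
  by (rule main(1)[OF a])
 assume "nonneg_graded V"
 then have all: "{\<phi> \<in> leibniz_inf_morphisms V l W m. finitely_many_components V \<phi>} = leibniz_inf_morphisms V l W m"
  by (rule main(2)[OF a])
 show "bij_betw (\<lambda>f. desusp_corestrictions V W (transpose_map V W f))
   (dg_algebra_morphisms
    (tensor_module (desusp (dual W))) (zin_product (desusp (dual W))) e
    (tensor_module (desusp (dual V))) (zin_product (desusp (dual V))) d)
   (leibniz_inf_morphisms V l W m)"
  using main(1)[OF a] unfolding all .
qed

end
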